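(* Let $X=\{X(t)\}$ be a supOU process with characteristic quadruple $(a,b,\mu_L,\pi)$, finite variance and zero mean, and let $X^*(t)=\int_0^t X(s)\,ds$, $t\ge 0$. Suppose that $\pi$ has a density $p$ satisfying $$p(x)\sim \alpha\,\ell(x^{-1})\,x^{\alpha-1}\quad\text{as } x\to 0,$$ for some $\alpha\in(0,1)$ and some function $\ell$ slowly varying at infinity. Suppose there exist $\beta>0$ and $c^+,c^-\ge 0$ with $c^++c^->0$ such that $$\mu_L([x,\infty))\sim c^+x^{-\beta}\quad\text{and}\quad \mu_L((-\infty,-x])\sim c^-x^{-\beta}\quad\text{as } x\to 0^+.$$ If $b=0$ and $1+\alpha<\beta<2$, then as $T\to\infty$ $$\left\{\frac{1}{T^{1-\alpha/\beta}\,\ell(T)^{1/\beta}}\,X^*(Tt)\right\}_{t\ge0}\longrightarrow\{Z_{\alpha,\beta}(t)\}_{t\ge0}$$ in the sense of convergence of all finite dimensional distributions, where $$Z_{\alpha,\beta}(t)=\int_{\mathbb{R}_+}\int_{\mathbb{R}}\left(\mathfrak{f}(\xi,t-s)-\mathfrak{f}(\xi,-s)\right)K(d\xi,ds),$$ $\mathfrak{f}(x,u)=1-e^{-xu}$ if $x>0$ and $u>0$, and $\mathfrak f(x,u)=0$ otherwise, and $K$ is a $\beta$-stable Lévy basis on $\mathbb{R}_+\times\mathbb{R}$ with control measure $k(d\xi,ds)=\alpha\,\xi^{\alpha-\beta}\,d\xi\,ds$ such that $$\log\mathbb{E}e^{i\zeta K(A)}=-|\zeta|^\beta\,\omega(\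zeta;\beta,c^+,c^-)\,k(A).$$
   Context: SupOU process: let $\pi$ be a probability measure on $\mathbb{R}_+=(0,\infty)$ and let $\kappa_L(\zeta)=\log \mathbb{E}e^{i\zeta L(1)}$ be the cumulant function of an infinitely divisible random variable $L(1)$ with Lévy–Khintchine triplet $(a,b,\mu_L)$: $\kappa_L(\zeta)=i\zeta a-\frac{\zeta^2}{2}b+\int_{\mathbb{R}}(e^{i\zeta x}-1-i\zeta x\mathbf{1}_{[-1,1]}(x))\mu_L(dx)$. Let $\Lambda$ be the homogeneous Lévy basis (independently scattered infinitely divisible random measure) on $\mathbb{R}_+\times\mathbb{R}$ with $\log\mathbb{E}e^{i\zeta\Lambda(A)}=(\pi\times \mathrm{Leb})(A)\,\kappa_L(\zeta)$ for Borel sets $A$ (of finite measure). The supOU process with characteristic quadruple $(a,b,\mu_L,\pi)$ is the strictly stationary process $$X(t)=\int_{\mathbb{R}_+}\int_{\mathbb{R}}e^{-\xi t+s}\mathbf{1}_{[0,\infty)}(\xi t-s)\,\Lambda(d\xi,ds),\quad t\in\mathbb{R},$$ where the stochastic integral is in the sense of Rajput–Rosiński: for $\Lambda$-integrable $f$, $\log\mathbb{E}\exp(i\zeta\int f\,d\Lambda)=\int\int\kappa_L(\zeta f(\xi,s))\,ds\,\pi(d\xi)$. Under zero mean and finite variance of $X$, $\int x^2\mu_L(dx)<\infty$, $\mathbb{E}L(1)=0$ and $\kappa_L(\zeta)=-\frac{\zeta^2}{2}b+\int_{\mathbb{R}}(e^{i\zeta x}-1-i\zeta x)\mu_L(dx)$.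 A relation $M(x)\sim c\,x^{-\beta}$ with $c=0$ is read as $x^{\beta}M(x)\to 0$. For $\gamma\in(0,2)$, $\gamma\ne1$, and $c_1,c_2\ge0$, $$\omega(\zeta;\gamma,c_1,c_2)=\frac{\Gamma(2-\gamma)}{1-\gamma}\left((c_1+c_2)\cos\left(\frac{\pi\gamma}{2}\right)-i(c_1-c_2)\,\mathrm{sign}(\zeta)\sin\left(\frac{\pi\gamma}{2}\right)\right).$$ Integrals with respect to $K$ are again in the Rajput–Rosiński sense, so the finite dimensional distributions of $Z_{\alpha,\beta}$ are determined by: with $G(\xi,s)=\sum_{j=1}^m\zeta_j(\mathfrak f(\xi,t_j-s)-\mathfrak f(\xi,-s))$, $$\log\mathbb{E}\exp\Big(i\sum_{j=1}^m\zeta_jZ_{\alpha,\beta}(t_j)\Big)=-\int_0^\infty\int_{-\infty}^\infty|G(\xi,s)|^\beta\,\omega(G(\xi,s);\beta,c^+,c^-)\,\alpha\,\xi^{\alpha-\beta}\,ds\,d\xi.$$ *)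

theory Defs
  imports "HOL-Probability.Probability" "HOL-Library.Landau_Symbols"
begin

section \<open>Asymptotics\<close>

definition slowly_varying :: "(real \<Rightarrow> real) \<Rightarrow> bool" where
  "slowly_varying l \<longleftrightarrow>
     (\<exists>x0. set_borel_measurable borel {x0..} l \<and> (\<forall>x\<ge>x0. l x > 0)) \<and>
     (\<forall>c>0. ((\<lambda>x. l (c * x) / l x) \<longlongrightarrow> 1) at_top)"

text \<open>\<open>M x \<sim> c x\<^sup>-\<^sup>\<beta>\<close> as \<open>x \<rightarrow> 0+\<close>, where for \<open>c = 0\<close> the relation means \<open>x\<^sup>\<beta> M x \<rightarrow> 0\<close>
  (the library relation would force \<open>M\<close> to vanish near \<open>0\<close>).\<close>

definition power_asymp_at_0 :: "(real \<Rightarrow> real) \<Rightarrow> real \<Rightarrow> real \<Rightarrow> bool" where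
  "power_asymp_at_0 M c \<beta> \<longleftrightarrow>
     (if c = 0 then ((\<lambda>x. x powr \<beta> * M x) \<longlongrightarrow> 0) (at_right 0)
      else M \<sim>[at_right 0] (\<lambda>x. c * x powr (- \<beta>)))"


section \<open>Modes of convergence\<close>

definition conv_in_prob :: "'w measure \<Rightarrow> (nat \<Rightarrow> 'w \<Rightarrow> real) \<Rightarrow> ('w \<Rightarrow> real) \<Rightarrow> bool" where
  "conv_in_prob M Y Z \<longleftrightarrow>
     (\<forall>\<epsilon>>0. (\<lambda>n. measure M {\<omega> \<in> space M. \<bar>Y n \<omega> - Z \<omega>\<bar> > \<epsilon>}) \<longlonglongrightarrow> 0)"

definition weak_conv_along :: "('i \<Rightarrow> 'a::topological_space measure) \<Rightarrow> 'a measure \<Rightarrow> 'i filter \<Rightarrow> bool" where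
  "weak_conv_along \<mu> \<nu> F \<longleftrightarrow>
     (\<forall>g :: 'a \<Rightarrow> real. continuous_on UNIV g \<longrightarrow> bounded (range g) \<longrightarrow>
        ((\<lambda>i. \<integral>x. g x \<partial>\<mu> i) \<longlongrightarrow> (\<integral>x. g x \<partial>\<nu>)) F)"


section \<open>Infinitely divisible laws\<close>

definition infinitely_divisible :: "real measure \<Rightarrow> bool" where
  "infinitely_divisible \<mu> \<longleftrightarrow> real_distribution \<mu> \<and>
     (\<forall>n::nat. n > 0 \<longrightarrow> (\<exists>\<nu>. real_distribution \<nu> \<and> (\<forall>\<zeta>. char \<mu> \<zeta> = char \<nu> \<zeta> ^ n)))"

definition levy_measure :: "real measure \<Rightarrow> bool" where
  "levy_measure \<mu> \<longleftrightarrow> sets \<mu> = sets borel \<and> emeasure \<mu> {0} = 0 \<and>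
     (\<integral>\<^sup>+x. ennreal (min 1 (x\<^sup>2)) \<partial>\<mu>) < \<infinity>"

definition levy_triplet :: "real \<Rightarrow> real \<Rightarrow> real measure \<Rightarrow> bool" where
  "levy_triplet a b \<mu> \<longleftrightarrow> b \<ge> 0 \<and> levy_measure \<mu>"

definition levy_cumulant :: "real \<Rightarrow> real \<Rightarrow> real measure \<Rightarrow> real \<Rightarrow> complex" where
  "levy_cumulant a b \<mu> \<zeta> =
     \<i> * of_real (\<zeta> * a) - of_real (\<zeta>\<^sup>2 / 2 * b) +
     (CLINT x|\<mu>. exp (\<i> * of_real (\<zeta> * x)) - 1
        - \<i> * of_real (\<zeta> * x * indicator {-1..1} x))"

definition stable_omega :: "real \<Rightarrow> real \<Rightarrow> real \<Rightarrow> real \<Rightarrow> complex" where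
  "stable_omega \<zeta> \<gamma> c1 c2 =
     of_real (Gamma (2 - \<gamma>) / (1 - \<gamma>)) *
     (of_real ((c1 + c2) * cos (pi * \<gamma> / 2)) -
      \<i> * of_real ((c1 - c2) * sgn \<zeta> * sin (pi * \<gamma> / 2)))"


section \<open>Levy bases\<close>

text \<open>The random measure is indexed by the \<open>\<delta>\<close>-ring of sets of finite \<open>m\<close>-measure; its values
  elsewhere are irrelevant.\<close>

definition independently_scattered ::
  "'w measure \<Rightarrow> 'a measure \<Rightarrow> ('a set \<Rightarrow> 'w \<Rightarrow> real) \<Rightarrow> bool" where
  "independently_scattered M m \<Lambda> \<longleftrightarrow>
     (\<forall>A\<in>fmeasurable m. \<Lambda> A \<in> borel_measurable M) \<and>
     (\<forall>A :: nat \<Rightarrow> 'a set. range A \<subseteq> fmeasurable m \<longrightarrow> disjoint_family A \<longrightarrow>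
        prob_space.indep_vars M (\<lambda>_. borel) (\<lambda>n. \<Lambda> (A n)) UNIV \<and>
        ((\<Union>n. A n) \<in> fmeasurable m \<longrightarrow>
           (AE \<omega> in M. (\<lambda>n. \<Lambda> (A n) \<omega>) sums \<Lambda> (\<Union>n. A n) \<omega>)))"

text \<open>The cumulant condition \<open>log E exp (i \<zeta> \<Lambda>(A)) = m(A) \<kappa>(\<zeta>)\<close> is stated with the exponential,
  so that no branch of the complex logarithm has to be chosen; for continuous \<open>\<kappa>\<close> with
  \<open>\<kappa> 0 = 0\<close> this determines the distinguished logarithm.\<close>

definition levy_basis ::
  "'w measure \<Rightarrow> 'a measure \<Rightarrow> (real \<Rightarrow> complex) \<Rightarrow> ('a set \<Rightarrow> 'w \<Rightarrow> real) \<Rightarrow> bool" where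
  "levy_basis M m \<kappa> \<Lambda> \<longleftrightarrow>
     prob_space M \<and> sigma_finite_measure m \<and> independently_scattered M m \<Lambda> \<and>
     (\<forall>A\<in>fmeasurable m.
        infinitely_divisible (distr M borel (\<Lambda> A)) \<and>
        (\<forall>\<zeta>. char (distr M borel (\<Lambda> A)) \<zeta> = exp (of_real (measure m A) * \<kappa> \<zeta>)))"


section \<open>The Rajput--Rosinski integral\<close>

definition rr_simple :: "'a measure \<Rightarrow> ('a \<Rightarrow> real) \<Rightarrow> bool" where
  "rr_simple m f \<longleftrightarrow> simple_function m f \<and> {x \<in> space m. f x \<noteq> 0} \<in> fmeasurable m"

text \<open>\<open>\<integral>\<^sub>A f d\<Lambda>\<close> for simple \<open>f\<close>, in the canonical representation of \<open>f\<close>.\<close>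

definition simple_integral_basis ::
  "'a measure \<Rightarrow> ('a set \<Rightarrow> 'w \<Rightarrow> real) \<Rightarrow> 'a set \<Rightarrow> ('a \<Rightarrow> real) \<Rightarrow> 'w \<Rightarrow> real" where
  "simple_integral_basis m \<Lambda> A f \<omega> =
     (\<Sum>y\<in>f ` space m - {0}. y * \<Lambda> (A \<inter> {x \<in> space m. f x = y}) \<omega>)"

text \<open>\<open>Y\<close> is a version of \<open>\<integral> f d\<Lambda>\<close>: simple functions \<open>h n\<close> converge to \<open>f\<close> almost everywhere, their
  integrals over every measurable set converge in probability, and \<open>Y\<close> is the limit over the
  whole space.\<close>

definition has_rr_integral ::
  "'w measure \<Rightarrow> 'a measure \<Rightarrow> ('a set \<Rightarrow> 'w \<Rightarrow> real) \<Rightarrow> ('a \<Rightarrow> real) \<Rightarrow> ('w \<Rightarrow> real) \<Rightarrow> bool" where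
  "has_rr_integral M m \<Lambda> f Y \<longleftrightarrow>
     f \<in> borel_measurable m \<and> Y \<in> borel_measurable M \<and>
     (\<exists>h :: nat \<Rightarrow> 'a \<Rightarrow> real.
        (\<forall>n. rr_simple m (h n)) \<and>
        (AE x in m. (\<lambda>n. h n x) \<longlonglongrightarrow> f x) \<and>
        (\<forall>A\<in>sets m. \<exists>V\<in>borel_measurable M.
           conv_in_prob M (\<lambda>n. simple_integral_basis m \<Lambda> A (h n)) V) \<and>
        conv_in_prob M (\<lambda>n. simple_integral_basis m \<Lambda> (space m) (h n)) Y)"

definition rr_integrable ::
  "'w measure \<Rightarrow> 'a measure \<Rightarrow> ('a set \<Rightarrow> 'w \<Rightarrow> real) \<Rightarrow> ('a \<Rightarrow> real) \<Rightarrow> bool" where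
  "rr_integrable M m \<Lambda> f \<longleftrightarrow> (\<exists>Y. has_rr_integral M m \<Lambda> f Y)"


section \<open>SupOU processes\<close>

abbreviation borel_pos :: "real measure" where
  "borel_pos \<equiv> restrict_space borel {0<..}"

abbreviation lborel_pos :: "real measure" where
  "lborel_pos \<equiv> restrict_space lborel {0<..}"

definition supOU_kernel :: "real \<Rightarrow> real \<times> real \<Rightarrow> real" where
  "supOU_kernel t = (\<lambda>(\<xi>, s). exp (- \<xi> * t + s) * indicator {0..} (\<xi> * t - s))"

definition supOU_process ::
  "'w measure \<Rightarrow> real \<Rightarrow> real \<Rightarrow> real measure \<Rightarrow> real measure \<Rightarrow> (real \<Rightarrow> 'w \<Rightarrow> real) \<Rightarrow> bool" where
  "supOU_process M a b \<mu> \<pi> X \<longleftrightarrow>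
     levy_triplet a b \<mu> \<and> prob_space \<pi> \<and> sets \<pi> = sets borel_pos \<and>
     (\<exists>\<Lambda>. levy_basis M (\<pi> \<Otimes>\<^sub>M lborel) (levy_cumulant a b \<mu>) \<Lambda> \<and>
          (\<forall>t. has_rr_integral M (\<pi> \<Otimes>\<^sub>M lborel) \<Lambda> (supOU_kernel t) (X t)))"

text \<open>The pathwise integral; used for jointly measurable \<open>X\<close> only.\<close>

definition integrated_process :: "(real \<Rightarrow> 'w \<Rightarrow> real) \<Rightarrow> real \<Rightarrow> 'w \<Rightarrow> real" where
  "integrated_process X t \<omega> = (LBINT s:{0..t}. X s \<omega>)"


section \<open>The limit process\<close>

definition frak_f :: "real \<Rightarrow> real \<Rightarrow> real" where
  "frak_f x u = (if x > 0 \<and> u > 0 then 1 - exp (- x * u) else 0)"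

definition Z_kernel :: "real \<Rightarrow> real \<times> real \<Rightarrow> real" where
  "Z_kernel t = (\<lambda>(\<xi>, s). frak_f \<xi> (t - s) - frak_f \<xi> (- s))"

definition Z_control :: "real \<Rightarrow> real \<Rightarrow> (real \<times> real) measure" where
  "Z_control \<alpha> \<beta> =
     density lborel_pos (\<lambda>\<xi>. ennreal (\<alpha> * \<xi> powr (\<alpha> - \<beta>))) \<Otimes>\<^sub>M lborel"

definition stable_cumulant :: "real \<Rightarrow> real \<Rightarrow> real \<Rightarrow> real \<Rightarrow> complex" where
  "stable_cumulant \<beta> c1 c2 \<zeta> = - (of_real (\<bar>\<zeta>\<bar> powr \<beta>) * stable_omega \<zeta> \<beta> c1 c2)"

end

theory Submission
  imports Defs "HOL-Real_Asymp.Real_Asymp"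
begin

text \<open>By Levy's continuity theorem it suffices to follow the joint characteristic functions. Approximating
  the pathwise integral by Riemann sums in mean square, one finds that a linear combination of the values
  \<open>X\<^sup>*(T t\<^sub>j) / A\<^sub>T\<close> has characteristic exponent \<open>\<integral> \<kappa>(F\<^sub>T / A\<^sub>T) d(\<pi> \<times> Leb)\<close>, where \<open>\<kappa>\<close> is the centered cumulant of the
  Levy measure and \<open>F\<^sub>T\<close> the integrated kernel. The substitution \<open>\<xi> = \<eta> / T\<close>, \<open>s = \<eta> \<sigma>\<close> turns \<open>F\<^sub>T\<close> into \<open>T / \<eta>\<close> times a
  linear combination of the limit kernels. Since \<open>T / A\<^sub>T \<rightarrow> \<infinity>\<close>, only the behaviour of \<open>\<kappa>\<close> at infinity matters, and the
  tails of \<open>\<mu>\<close> at \<open>0\<close> make \<open>\<kappa>\<close> asymptotically \<open>\<beta>\<close>-stable there. Dominated convergence, with Potter bounds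
  for \<open>l\<close>, then gives the exponent of \<open>Z\<close>.\<close>

text \<open>A Rajput-Rosinski integral is given only as a limit in probability of simple integrals,
  so its characteristic exponent has to be derived. Such convergence directly controls only the
  modulus of characteristic functions, that is the integral of
  \<open>\<psi> = - Re \<kappa>\<close>. The imaginary part follows if the cumulant stays in a
  sector, \<open>norm \<kappa> \<le> C * \<psi>\<close>. A drift can violate this near zero, where
  it is linear while \<psi> is quadratic once \<mu> has a finite second moment. Hence X is treated
  twice: the uncentered functional, through moduli alone, turns the finite variance of X into a
  finite second moment of \<mu>; the compensated functional then has a sector bound, and the zero
  mean shows that it represents the same X. Because \<beta> < 2, the quadratic bound near zero and
  the growth at infinity combine into one bound C |y|^\<beta> for all arguments. This bound
  dominates the rescaled integrand near \<xi> = 0 and makes the contribution of larger \<xi>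
  negligible.\<close>

section \<open>Slowly varying functions\<close>

text \<open>The measure-theoretic argument of Csiszar and Erdos: if the convergence were not uniform along
  \<open>x\<^sub>n\<close> and \<open>u\<^sub>n\<close>, then the increments from \<open>x\<^sub>n\<close> and from \<open>x\<^sub>n + u\<^sub>n\<close> would be small on sets of almost
  full measure, which have to overlap.\<close>

lemma uniform_increment_limit:
  fixes h :: "real \<Rightarrow> real"
  assumes meas: "set_borel_measurable borel {x0..} h"
    and lim: "\<And>u. ((\<lambda>x. h (x + u) - h x) \<longlongrightarrow> 0) at_top"
    and e: "0 < e"
  shows "\<exists>X. \<forall>x\<ge>X. \<forall>u\<in>{0..1}. \<bar>h (x + u) - h x\<bar> < e"
proof (rule ccontr)
  assume neg: "\<not> ?thesis"
  have "\<exists>x u. x \<ge> max x0 (real n) \<and> u \<in> {0..1} \<and> \<bar>h (x + u) - h x\<bar> \<ge> e" for n :: nat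
    using neg by (meson not_le)
  then obtain xs us where xs: "\<And>n. xs n \<ge> max x0 (real n)" and us: "\<And>n. us n \<in> {0..1}"
    and big: "\<And>n. \<bar>h (xs n + us n) - h (xs n)\<bar> \<ge> e" by metis
  \<comment> \<open>Measurability is given from \<open>x0\<close> on only, hence the cutoff; all
    arguments used below are at least \<open>x0\<close>.\<close>
  define h' where "h' x = indicator {x0..} x * h x" for x
  have [measurable]: "h' \<in> borel_measurable borel"
    using meas unfolding set_borel_measurable_def h'_def by simp
  have h'_eq: "h' x = h x" if "x \<ge> x0" for x using that by (simp add: h'_def)
  \<comment> \<open>The sets \<open>U n\<close> increase to {0..2}, of measure 2, so one of them
    exceeds 3/2. Two such sets, one of them shifted by at most 1, lie in {0..3} and cannot be
    disjoint, since 3/2 + 3/2 = 3.\<close>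
  have small: "\<exists>N. measure lborel {u\<in>{0..2}. \<forall>k\<ge>N. \<bar>h' (ys k + u) - h' (ys k)\<bar> < e / 2} > 3/2"
    if ys: "\<And>n. ys n \<ge> max x0 (real n)" for ys :: "nat \<Rightarrow> real"
  proof -
    define U where "U n = {u\<in>{0..2}. \<forall>k\<ge>n. \<bar>h' (ys k + u) - h' (ys k)\<bar> < e / 2}" for n :: nat
    have [measurable]: "U n \<in> sets borel" for n unfolding U_def by measurable
    have inc: "incseq U" unfolding U_def by (rule incseq_SucI) auto
    have un: "(\<Union>n. U n) = {0..2}"
    proof (intro equalityI subsetI)
      fix u :: real assume u: "u \<in> {0..2}"
      have "filterlim ys at_top sequentially"
        by (rule filterlim_at_top_mono[OF filterlim_real_sequentially]) (use ys in auto)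
      then have "((\<lambda>n. h (ys n + u) - h (ys n)) \<longlonglongrightarrow> 0)"
        using lim[of u] by (rule filterlim_compose[rotated])
      then have "\<forall>\<^sub>F n in sequentially. \<bar>h (ys n + u) - h (ys n)\<bar> < e / 2"
        using e by (auto dest!: tendstoD[where e="e/2"] simp: dist_real_def)
      then obtain N where "\<forall>n\<ge>N. \<bar>h (ys n + u) - h (ys n)\<bar> < e / 2"
        by (auto simp: eventually_sequentially)
      moreover have "h' (ys n + u) = h (ys n + u)" "h' (ys n) = h (ys n)" for n
        using ys[of n] u by (auto intro!: h'_eq)
      ultimately show "u \<in> (\<Union>n. U n)" using u by (auto simp: U_def)
    qed (auto simp: U_def)
    have "(\<lambda>n. measure lborel (U n)) \<longlonglongrightarrow> measure lborel (\<Union>n. U n)"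
    proof (rule Lim_measure_incseq)
      show "range U \<subseteq> sets lborel" by auto
      show "emeasure lborel (\<Union>n. U n) \<noteq> \<infinity>" by (simp add: un)
    qed (rule inc)
    then have "(\<lambda>n. measure lborel (U n)) \<longlonglongrightarrow> 2" by (simp add: un)
    then have "\<forall>\<^sub>F n in sequentially. measure lborel (U n) > 3/2"
      by (rule order_tendstoD) simp
    then show ?thesis unfolding U_def by (auto simp: eventually_sequentially)
  qed
  obtain N1 where N1: "measure lborel {u\<in>{0..2}. \<forall>k\<ge>N1. \<bar>h' (xs k + u) - h' (xs k)\<bar> < e / 2} > 3/2"
    using small[OF xs] by blast
  obtain N2 where N2: "measure lborel {u\<in>{0..2}. \<forall>k\<ge>N2. \<bar>h' (xs k + us k + u) - h' (xs k + us k)\<bar> < e / 2} > 3/2"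
  proof -
    have "xs n + us n \<ge> max x0 (real n)" for n using xs[of n] us[of n] by auto
    from small[OF this] show ?thesis using that by blast
  qed
  define n where "n = max N1 N2"
  define U where "U = {u\<in>{0..2}. \<bar>h' (xs n + u) - h' (xs n)\<bar> < e / 2}"
  define V where "V = {u\<in>{0..2}. \<bar>h' (xs n + us n + u) - h' (xs n + us n)\<bar> < e / 2}"
  have "U \<in> sets borel" unfolding U_def by measurable
  moreover have "V \<in> sets borel" unfolding V_def by measurable
  ultimately have UVm[measurable]: "U \<in> sets borel" "V \<in> sets borel" by auto
  have fm: "A \<in> fmeasurable lborel" if "A \<in> sets borel" "A \<subseteq> {0..2}" for A :: "real set"
    by (rule fmeasurableI2[OF _ that(2)]) (use that(1) in \<open>auto intro: fmeasurableI\<close>)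
  have "{u\<in>{0..2}. \<forall>k\<ge>N1. \<bar>h' (xs k + u) - h' (xs k)\<bar> < e / 2} \<in> sets borel" (is "?U \<in> _") by measurable
  then have "measure lborel ?U \<le> measure lborel U"
    by (intro measure_mono_fmeasurable) (use UVm(1) in \<open>auto simp: U_def n_def intro!: fm\<close>)
  with N1 have U: "measure lborel U > 3/2" by linarith
  have "{u\<in>{0..2}. \<forall>k\<ge>N2. \<bar>h' (xs k + us k + u) - h' (xs k + us k)\<bar> < e / 2} \<in> sets borel" (is "?V \<in> _") by measurable
  then have "measure lborel ?V \<le> measure lborel V"
    by (intro measure_mono_fmeasurable) (use UVm(2) in \<open>auto simp: V_def n_def intro!: fm\<close>)
  with N2 have V: "measure lborel V > 3/2" by linarith
  define V' where "V' = (\<lambda>v. us n + v) ` V"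
  have V'_eq: "V' = (\<lambda>v. - us n + v) -` V" 
    unfolding V'_def by (auto simp: image_iff intro!: bexI[of _ "_ - us n"])
  have V'm: "V' \<in> sets borel" unfolding V'_eq
    by (rule measurable_sets_borel[OF _ UVm(2)]) measurable
  have mV': "measure lborel V' = measure lborel V"
    unfolding V'_def measure_def
    using emeasure_lebesgue_affine[of 1 "us n" V] UVm V'm by (simp add: V'_def add.commute)
  \<comment> \<open>At a common point both increments end at the same value of \<open>h'\<close>, so
    together they bound the increment from \<open>xs n\<close> to \<open>xs n + us n\<close> by
    \<open>e\<close>, against \<open>big\<close>.\<close>
  have disj: "U \<inter> V' = {}"
  proof (rule ccontr)
    assume "U \<inter> V' \<noteq> {}"
    then obtain u v where uv: "u \<in> U" "v \<in> V" "u = us n + v" unfolding V'_def by auto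
    then have "\<bar>h' (xs n + u) - h' (xs n)\<bar> < e / 2" "\<bar>h' (xs n + u) - h' (xs n + us n)\<bar> < e / 2"
      by (auto simp: U_def V_def add.assoc)
    then have "\<bar>h' (xs n + us n) - h' (xs n)\<bar> < e" by linarith
    moreover have "h' (xs n + us n) = h (xs n + us n)" "h' (xs n) = h (xs n)"
      using xs[of n] us[of n] by (auto intro!: h'_eq)
    ultimately show False using big[of n] by simp
  qed
  have sub: "U \<union> V' \<subseteq> {0..3}" using us[of n] by (auto simp: U_def V'_def V_def)
  have f3: "A \<in> fmeasurable lborel" if "A \<in> sets borel" "A \<subseteq> {0..3}" for A :: "real set"
    by (rule fmeasurableI2[OF _ that(2)]) (use that(1) in \<open>auto intro: fmeasurableI\<close>)
  have "measure lborel U + measure lborel V' = measure lborel (U \<union> V')"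
  proof (rule measure_Un_AE[symmetric])
    show "AE x in lborel. x \<notin> U \<or> x \<notin> V'" using disj by (intro AE_I2) auto
  qed (use sub V'm in \<open>auto intro!: f3\<close>)
  also have "\<dots> \<le> measure lborel {0..3::real}"
    using sub V'm by (intro measure_mono_fmeasurable) (auto intro: fmeasurableI)
  finally show False using U V mV' by simp
qed

section \<open>Potter bounds for slowly varying functions\<close>

lemma slowly_varying_eventually_pos: "slowly_varying l \<Longrightarrow> \<forall>\<^sub>F x in at_top. l x > 0"
  unfolding slowly_varying_def by (auto simp: eventually_at_top_linorder)

text \<open>In logarithmic coordinates \<open>h = ln \<circ> l \<circ> exp\<close> slow variation
  says that increments vanish at infinity, uniformly over unit intervals by the previous lemma.
  Chaining unit steps of size below \<open>d\<close> gives \<open>d * (u + 1)\<close> for an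
  increment over length \<open>u\<close>; the incomplete last step is the source of the factor
  \<open>exp d\<close>.\<close>

lemma slowly_varying_quotient_bound:
  assumes sv: "slowly_varying l" and d: "0 < d"
  obtains X0 where "X0 > 0" "\<And>x. x \<ge> X0 \<Longrightarrow> l x > 0"
    "\<And>x y. X0 \<le> x \<Longrightarrow> x \<le> y \<Longrightarrow> l y \<le> exp d * (y / x) powr d * l x"
    "\<And>x y. X0 \<le> x \<Longrightarrow> x \<le> y \<Longrightarrow> l x \<le> exp d * (y / x) powr d * l y"
proof -
  obtain x0 where meas: "set_borel_measurable borel {x0..} l" and pos: "\<And>x. x \<ge> x0 \<Longrightarrow> l x > 0"
    and lim: "\<And>c. c > 0 \<Longrightarrow> ((\<lambda>x. l (c * x) / l x) \<longlongrightarrow> 1) at_top"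
    using sv unfolding slowly_varying_def by blast
  define h where "h x = ln (l (exp x))" for x
  have [measurable]: "(\<lambda>x. indicator {x0..} x * l x) \<in> borel_measurable borel"
    using meas by (simp add: set_borel_measurable_def)
  \<comment> \<open>\<open>exp\<close> maps {x1..} into {x0..}, where \<open>l\<close> is positive
    and measurable; the maximum with 1 keeps the argument of \<open>ln\<close> positive.\<close>
  define x1 where "x1 = ln (max 1 x0)"
  have ex1: "exp x \<ge> x0" if "x \<ge> x1" for x
  proof -
    have "exp x1 \<le> exp x" using that by simp
    then show ?thesis by (simp add: x1_def)
  qed
  have hm: "set_borel_measurable borel {x1..} h"
  proof -
    have "(\<lambda>x. indicator {x1..} x * ln (indicator {x0..} (exp x) * l (exp x))) \<in> borel_measurable borel"
      by measurable
    also have "(\<lambda>x. indicator {x1..} x * ln (indicator {x0..} (exp x) * l (exp x))) = (\<lambda>x. indicator {x1..} x *\<^sub>R h x)"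
      using ex1 by (auto simp: fun_eq_iff h_def indicator_def)
    finally show ?thesis by (simp add: set_borel_measurable_def)
  qed
  have hl: "((\<lambda>x. h (x + u) - h x) \<longlongrightarrow> 0) at_top" for u
  proof -
    have "((\<lambda>x. ln (l (exp u * exp x) / l (exp x))) \<longlongrightarrow> ln 1) at_top"
      by (intro tendsto_ln filterlim_compose[OF lim exp_at_top]) auto
    moreover have "\<forall>\<^sub>F x in at_top. ln (l (exp u * exp x) / l (exp x)) = h (x + u) - h x"
      using eventually_ge_at_top[of "max x1 (x1 - u)"]
    proof eventually_elim
      case (elim x)
      then have "l (exp (x + u)) > 0" "l (exp x) > 0" by (auto intro!: pos ex1)
      then show ?case by (simp add: h_def ln_div exp_add mult.commute)
    qed
    ultimately show ?thesis by (simp add: tendsto_cong)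
  qed
  obtain X where X: "\<And>x u. x \<ge> X \<Longrightarrow> u \<in> {0..1} \<Longrightarrow> \<bar>h (x + u) - h x\<bar> < d"
    using uniform_increment_limit[OF hm hl d] by blast
  have nat_step: "\<bar>h (x + real n) - h x\<bar> \<le> d * real n" if "x \<ge> X" for x n
  proof (induction n)
    case (Suc n)
    have "\<bar>h (x + real n + 1) - h (x + real n)\<bar> < d" using that by (intro X) auto
    with Suc show ?case by (simp add: algebra_simps)
  qed simp
  have step: "\<bar>h (x + u) - h x\<bar> \<le> d * (u + 1)" if "x \<ge> X" "u \<ge> 0" for x u
  proof -
    define n where "n = nat \<lfloor>u\<rfloor>"
    have n: "real n \<le> u" "u < real n + 1" using that by (auto simp: n_def)
    have "\<bar>h (x + real n + (u - real n)) - h (x + real n)\<bar> < d"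
      using n that by (intro X) auto
    with nat_step[OF that(1), of n] have "\<bar>h (x + u) - h x\<bar> \<le> d * real n + d" by simp
    also have "\<dots> \<le> d * (u + 1)" using n d by (simp add: algebra_simps)
    finally show ?thesis .
  qed
  define X0 where "X0 = exp (max X x1)"
  have X0pos: "0 < X0" by (simp add: X0_def)
  have key: "\<bar>ln (l y) - ln (l x)\<bar> \<le> d * (ln (y / x) + 1)" if "X0 \<le> x" "x \<le> y" for x y
  proof -
    have p: "x > 0" "y > 0" using less_le_trans[OF X0pos that(1)] that(2) by linarith+
    have "exp X \<le> x" using that(1) unfolding X0_def by (rule order_trans[rotated]) simp
    then have "ln x \<ge> X" using p by (simp add: ln_ge_iff)
    then have "\<bar>h (ln x + ln (y / x)) - h (ln x)\<bar> \<le> d * (ln (y / x) + 1)"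
      using p that by (intro step) auto
    then show ?thesis using p by (simp add: h_def ln_div)
  qed
  have pX0: "l x > 0" if "X0 \<le> x" for x
  proof -
    have "x \<ge> exp x1" using that unfolding X0_def by (rule order_trans[rotated]) simp
    then show ?thesis using ex1[of x1] by (intro pos) linarith
  qed
  show ?thesis
  proof (rule that[of X0])
    show "X0 > 0" by (simp add: X0_def)
    have *: "l a \<le> exp d * (y / x) powr d * l b"
      if "X0 \<le> x" "x \<le> y" "l a > 0" "l b > 0" "ln (l a) \<le> ln (l b) + d * (ln (y / x) + 1)" for a b x y
    proof -
      have p: "x > 0" "y > 0" using less_le_trans[OF X0pos that(1)] that(2) by linarith+
      have "l a = exp (ln (l a))" using that(3) by simp
      also have "\<dots> \<le> exp (ln (l b) + d * (ln (y / x) + 1))" using that(5) by simp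
      also have "\<dots> = exp d * (y / x) powr d * l b"
        using that(4) p by (simp add: exp_add powr_def distrib_left mult_ac)
      finally show ?thesis .
    qed
    show "l y \<le> exp d * (y / x) powr d * l x" "l x \<le> exp d * (y / x) powr d * l y"
      if "X0 \<le> x" "x \<le> y" for x y
    proof -
      have k: "\<bar>ln (l y) - ln (l x)\<bar> \<le> d * (ln (y / x) + 1)" by (rule key[OF that])
      have px: "0 < l x" "0 < l y" using pX0[OF that(1)] pX0[OF order_trans[OF that]] by -
      show "l y \<le> exp d * (y / x) powr d * l x" using k by (intro *[OF that px(2,1)]) linarith
      show "l x \<le> exp d * (y / x) powr d * l y" using k by (intro *[OF that px]) linarith
    qed
  qed (use pX0 in auto)
qed

section \<open>Gamma type integrals\<close>

lemma nn_integral_Gamma_scaled: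
  fixes s c :: real
  assumes "0 < s" "0 < c"
  shows "(\<integral>\<^sup>+t. ennreal (indicator {0<..} t * (t powr (s - 1) * exp (- (c * t)))) \<partial>lborel) = ennreal (Gamma s * c powr (- s))"
proof -
  let ?N = "\<integral>\<^sup>+t. ennreal (indicator {0<..} t * (t powr (s - 1) * exp (- (c * t)))) \<partial>lborel"
  have "ennreal (Gamma s) = ennreal \<bar>c\<bar> * (\<integral>\<^sup>+t. ennreal (indicator {0..} (0 + c * t) * (0 + c * t) powr (s - 1) / exp (0 + c * t)) \<partial>lborel)"
    unfolding Gamma_conv_nn_integral_real[OF assms(1)]
    by (rule nn_integral_real_affine) (use assms in auto)
  also have "(\<integral>\<^sup>+t. ennreal (indicator {0..} (0 + c * t) * (0 + c * t) powr (s - 1) / exp (0 + c * t)) \<partial>lborel)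
      = (\<integral>\<^sup>+t. ennreal (c powr (s - 1)) * ennreal (indicator {0<..} t * (t powr (s - 1) * exp (- (c * t)))) \<partial>lborel)"
    using assms by (intro nn_integral_cong)
      (auto simp: indicator_def powr_mult exp_minus field_simps zero_le_mult_iff simp flip: ennreal_mult)
  also have "\<dots> = ennreal (c powr (s - 1)) * ?N"
    by (rule nn_integral_cmult) auto
  finally have *: "ennreal (Gamma s) = ennreal (c powr s) * ?N"
    using assms by (simp add: mult.assoc[symmetric] powr_diff flip: ennreal_mult)
  have "ennreal (c powr (- s)) * ennreal (Gamma s) = ennreal (c powr (- s) * c powr s) * ?N"
    unfolding * by (simp add: mult.assoc ennreal_mult)
  also have "c powr (- s) * c powr s = 1" using assms by (simp flip: powr_add)
  finally show ?thesis using assms Gamma_real_pos[of s]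
    by (simp add: mult.commute flip: ennreal_mult)
qed

lemma has_bochner_integral_Gamma_scaled:
  fixes s c :: real
  assumes "0 < s" "0 < c"
  shows "has_bochner_integral lborel (\<lambda>t. indicator {0<..} t * (t powr (s - 1) * exp (- (c * t)))) (Gamma s * c powr (- s))"
  using assms Gamma_real_pos[of s]
  by (intro has_bochner_integral_nn_integral nn_integral_Gamma_scaled) auto

text \<open>The substitution \<open>v = sqrt x\<close> turns this into the Gamma integral with
  parameter \<open>a / 2\<close>.\<close>

lemma nn_integral_Gaussian_power:
  fixes a r :: real
  assumes a: "0 < a" and r: "0 < r"
  shows "(\<integral>\<^sup>+v. ennreal (indicator {0<..} v * (v powr (a - 1) * exp (- (r * v\<^sup>2)))) \<partial>lborel) = ennreal (Gamma (a / 2) * r powr (- (a / 2)) / 2)"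
proof -
  define f where "f v = v powr (a - 1) * exp (- (r * v\<^sup>2))" for v :: real
  have eq: "indicator {0<..} x * (f (sqrt x) * (1 / (2 * sqrt x))) = 1 / 2 * (indicator {0<..} x * (x powr (a / 2 - 1) * exp (- (r * x))))" for x :: real
  proof (cases "x > 0")
    case True
    have "sqrt x powr (a - 1) / sqrt x = sqrt x powr (a - 2)"
      using True by (simp add: powr_diff field_simps power2_eq_square)
    also have "\<dots> = x powr (a / 2 - 1)" using True by (simp add: powr_half_sqrt[symmetric] powr_powr field_simps)
    finally show ?thesis using True by (simp add: f_def field_simps)
  qed auto
  have ein: "einterval 0 \<infinity> = {0::real<..}" by (simp add: zero_ereal_def)
  have B: "has_bochner_integral lborel (\<lambda>x. indicator {0<..} x * (f (sqrt x) * (1 / (2 * sqrt x)))) (Gamma (a / 2) * r powr (- (a / 2)) / 2)"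
    unfolding eq using has_bochner_integral_mult_right[OF has_bochner_integral_Gamma_scaled[of "a/2" r], of "1/2"] a r by simp
  have int: "set_integrable lborel (einterval 0 \<infinity>) (\<lambda>x. f (sqrt x) * (1 / (2 * sqrt x)))"
    using B unfolding set_integrable_def ein by (auto simp: has_bochner_integral_iff)
  have lim0: "((ereal \<circ> sqrt \<circ> real_of_ereal) \<longlongrightarrow> 0) (at_right 0)"
    unfolding zero_ereal_def ereal_tendsto_simps by (auto intro!: tendsto_eq_intros)
  have lim1: "((ereal \<circ> sqrt \<circ> real_of_ereal) \<longlongrightarrow> \<infinity>) (at_left \<infinity>)"
    unfolding ereal_tendsto_simps by (rule sqrt_at_top)
  have D: "DERIV sqrt x :> 1 / (2 * sqrt x)" if "x > 0" for x
    using DERIV_real_sqrt[OF that] by (simp add: inverse_eq_divide mult.commute)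
  have cf: "isCont f (sqrt x)" if "x > 0" for x
    unfolding f_def using that by (intro continuous_intros) auto
  have cg: "isCont (\<lambda>x. 1 / (2 * sqrt x)) x" if "x > 0" for x
    using that by (intro continuous_intros) auto
  note sub = interval_integral_substitution_nonneg[where f=f and g=sqrt and g'="\<lambda>x. 1 / (2 * sqrt x)" and a=0 and b=\<infinity>, OF _ D cf cg _ _ lim0 lim1 int]
  have pos: "0 < x" if "0 < ereal x" for x using that by simp
  have nn: "0 \<le> 1 / (2 * sqrt x)" if "0 \<le> ereal x" for x using that by simp
  have fn: "0 \<le> f x" for x by (simp add: f_def)
  have s: "set_integrable lborel (einterval 0 \<infinity>) f" "(LBINT x=0..\<infinity>. f x) = (LBINT x=0..\<infinity>. f (sqrt x) * (1 / (2 * sqrt x)))"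
    by (rule sub; (rule pos nn fn | simp); assumption?)+
  have i: "integrable lborel (\<lambda>v. indicator {0<..} v * f v)"
    using s(1) by (simp add: set_integrable_def ein)
  have "(\<integral>v. indicator {0<..} v * f v \<partial>lborel) = (LBINT v=0..\<infinity>. f v)"
    unfolding zero_ereal_def interval_integral_to_infinity_eq set_lebesgue_integral_def by simp
  also have "\<dots> = (LBINT x=0..\<infinity>. f (sqrt x) * (1 / (2 * sqrt x)))" by (rule s(2))
  also have "\<dots> = (\<integral>x. indicator {0<..} x * (f (sqrt x) * (1 / (2 * sqrt x))) \<partial>lborel)"
    unfolding zero_ereal_def interval_integral_to_infinity_eq set_lebesgue_integral_def by simp
  also have "\<dots> = Gamma (a / 2) * r powr (- (a / 2)) / 2"
    using B by (simp only: has_bochner_integral_iff)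
  finally have v: "(\<integral>v. indicator {0<..} v * f v \<partial>lborel) = Gamma (a / 2) * r powr (- (a / 2)) / 2" .
  have "(\<integral>\<^sup>+v. ennreal (indicator {0<..} v * f v) \<partial>lborel) = ennreal (\<integral>v. indicator {0<..} v * f v \<partial>lborel)"
    by (rule nn_integral_eq_integral[OF i]) (simp add: f_def)
  then show ?thesis unfolding v unfolding f_def .
qed

lemma Gamma_reflection_real:
  fixes x :: real
  shows "Gamma x * Gamma (1 - x) = pi / sin (pi * x)"
proof -
  have "complex_of_real (Gamma x * Gamma (1 - x)) = Gamma (complex_of_real x) * Gamma (1 - complex_of_real x)"
    using Gamma_complex_of_real[of x] Gamma_complex_of_real[of "1 - x"] by simp
  also have "\<dots> = complex_of_real (pi / sin (pi * x))"
    unfolding Gamma_reflection_complex by (simp flip: sin_of_real)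
  finally have "complex_of_real (Gamma x * Gamma (1 - x)) = complex_of_real (pi / sin (pi * x))" .
  then show ?thesis using of_real_eq_iff by blast
qed

text \<open>Write \<open>1 / (1 + v\<^sup>2)\<close> as the integral of
  \<open>exp (- (1 + v\<^sup>2) * r)\<close> over \<open>r > 0\<close>. After the exchange the inner
  integral is Gaussian, and \<open>Gamma (a / 2) * Gamma (1 - a / 2) / 2\<close> remains, to which
  the reflection formula applies.\<close>

lemma nn_integral_power_over_1_plus_square:
  fixes a :: real
  assumes a: "0 < a" "a < 2"
  shows "(\<integral>\<^sup>+v. ennreal (indicator {0<..} v * (v powr (a - 1) / (1 + v\<^sup>2))) \<partial>lborel) = ennreal (pi / (2 * sin (pi * a / 2)))"
proof -
  let ?k = "\<lambda>v r :: real. ennreal (indicator {0<..} v * indicator {0<..} r * (v powr (a - 1) * exp (- ((1 + v\<^sup>2) * r))))"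
  have "(\<integral>\<^sup>+v. ennreal (indicator {0<..} v * (v powr (a - 1) / (1 + v\<^sup>2))) \<partial>lborel) = (\<integral>\<^sup>+v. \<integral>\<^sup>+r. ?k v r \<partial>lborel \<partial>lborel)"
  proof (rule nn_integral_cong)
    fix v :: real
    have p: "1 + v\<^sup>2 > 0" by (simp add: add_pos_nonneg)
    have "(\<integral>\<^sup>+r. ?k v r \<partial>lborel) = (\<integral>\<^sup>+r. ennreal (indicator {0<..} v * v powr (a - 1)) * ennreal (indicator {0<..} r * (r powr (1 - 1) * exp (- ((1 + v\<^sup>2) * r)))) \<partial>lborel)"
      by (intro nn_integral_cong) (auto simp: indicator_def simp flip: ennreal_mult)
    also have "\<dots> = ennreal (indicator {0<..} v * v powr (a - 1)) * ennreal (Gamma 1 * (1 + v\<^sup>2) powr (- 1))"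
      by (subst nn_integral_cmult, simp, subst nn_integral_Gamma_scaled) (use p in auto)
    also have "\<dots> = ennreal (indicator {0<..} v * (v powr (a - 1) / (1 + v\<^sup>2)))"
      using p by (simp add: powr_minus divide_inverse mult.assoc flip: ennreal_mult)
    finally show "ennreal (indicator {0<..} v * (v powr (a - 1) / (1 + v\<^sup>2))) = (\<integral>\<^sup>+r. ?k v r \<partial>lborel)" by simp
  qed
  also have "\<dots> = (\<integral>\<^sup>+r. \<integral>\<^sup>+v. ?k v r \<partial>lborel \<partial>lborel)"
    by (rule lborel_pair.Fubini'[symmetric]) measurable
  also have "\<dots> = (\<integral>\<^sup>+r. ennreal (Gamma (a / 2) / 2) * ennreal (indicator {0<..} r * (r powr ((1 - a / 2) - 1) * exp (- (1 * r)))) \<partial>lborel)"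
  proof (rule nn_integral_cong)
    fix r :: real
    show "(\<integral>\<^sup>+v. ?k v r \<partial>lborel) = ennreal (Gamma (a / 2) / 2) * ennreal (indicator {0<..} r * (r powr ((1 - a / 2) - 1) * exp (- (1 * r))))"
    proof (cases "r > 0")
      case True
      have "(\<integral>\<^sup>+v. ?k v r \<partial>lborel) = (\<integral>\<^sup>+v. ennreal (exp (- r)) * ennreal (indicator {0<..} v * (v powr (a - 1) * exp (- (r * v\<^sup>2)))) \<partial>lborel)"
        using True by (intro nn_integral_cong) (auto simp: indicator_def algebra_simps simp flip: ennreal_mult exp_add)
      also have "\<dots> = ennreal (exp (- r)) * ennreal (Gamma (a / 2) * r powr (- (a / 2)) / 2)"
        by (subst nn_integral_cmult, simp, subst nn_integral_Gaussian_power) (use a True in auto)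
      finally show ?thesis using True a by (simp add: ac_simps Gamma_real_pos less_imp_le flip: ennreal_mult)
    qed auto
  qed
  also have "\<dots> = ennreal (Gamma (a / 2) / 2) * ennreal (Gamma (1 - a / 2) * 1 powr (- (1 - a / 2)))"
    by (subst nn_integral_cmult, simp, subst nn_integral_Gamma_scaled) (use a in auto)
  also have "\<dots> = ennreal (Gamma (a / 2) * Gamma (1 - a / 2) / 2)"
    using a by (simp add: Gamma_real_pos less_imp_le flip: ennreal_mult)
  also have "Gamma (a / 2) * Gamma (1 - a / 2) / 2 = pi / (2 * sin (pi * a / 2))"
    by (simp add: Gamma_reflection_real)
  finally show ?thesis .
qed

lemma has_bochner_integral_power_over_1_plus_square:
  fixes a :: real
  assumes a: "0 < a" "a < 2"
  shows "has_bochner_integral lborel (\<lambda>v. indicator {0<..} v * (v powr (a - 1) / (1 + v\<^sup>2))) (pi / (2 * sin (pi * a / 2)))"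
proof -
  have "0 < sin (pi * a / 2)" using a by (intro sin_gt_zero) auto
  then show ?thesis
    by (intro has_bochner_integral_nn_integral nn_integral_power_over_1_plus_square a) auto
qed

section \<open>Compensated Fourier integrals of exponentials and powers\<close>

lemma has_bochner_integral_iexp_minus_1_exp:
  fixes v :: real
  assumes v: "0 < v"
  shows "has_bochner_integral lborel (\<lambda>u. indicator {0<..} u *\<^sub>R ((iexp u - 1) * exp (- (u * v)))) (1 / (v - \<i>) - 1 / v)"
proof -
  have nz: "complex_of_real v - \<i> \<noteq> 0" "\<i> - complex_of_real v \<noteq> 0" "complex_of_real v \<noteq> 0" using v by (auto simp: complex_eq_iff)
  define F where "F u = exp (u *\<^sub>R (\<i> - of_real v)) * (1 / (\<i> - of_real v)) - exp (u *\<^sub>R (- of_real v)) * (1 / - of_real v)" for u :: real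
  define f where "f u = (iexp u - 1) * exp (- (u * v))" for u :: real
  have ein: "einterval 0 \<infinity> = {0::real<..}" by (simp add: zero_ereal_def)
  have feq: "f u = exp (u *\<^sub>R (\<i> - of_real v)) - exp (u *\<^sub>R (- of_real v))" for u
    by (simp add: f_def algebra_simps scaleR_conv_of_real exp_of_real[symmetric] flip: exp_add)
  have D: "(F has_vector_derivative f u) (at u)" for u
  proof -
    have d: "((\<lambda>u. exp (u *\<^sub>R A) * (1 / A)) has_vector_derivative exp (u *\<^sub>R A)) (at u)" if "A \<noteq> 0" for A :: complex
      using has_vector_derivative_mult_left[OF exp_scaleR_has_vector_derivative_right[of A u UNIV], of "1 / A"] that by simp
    show ?thesis unfolding F_def feq
      by (intro has_vector_derivative_diff d) (use nz in auto)
  qed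
  have cont: "isCont f u" for u unfolding f_def by (intro continuous_intros)
  have int: "set_integrable lborel (einterval 0 \<infinity>) f"
    unfolding set_integrable_def ein
  proof (rule Bochner_Integration.integrable_bound)
    show "integrable lborel (\<lambda>t. 2 * (indicator {0<..} t * (t powr (1 - 1) * exp (- (v * t)))))"
      using has_bochner_integral_Gamma_scaled[of 1 v] v by (auto simp: has_bochner_integral_iff)
    show "(\<lambda>x. indicat_real {0<..} x *\<^sub>R f x) \<in> borel_measurable lborel" unfolding f_def by measurable
    have "norm (f t) \<le> 2 * exp (- (v * t))" for t
      using norm_triangle_ineq4[of "iexp t" 1] by (auto simp: f_def norm_mult mult.commute)
    then show "AE t in lborel. norm (indicator {0<..} t *\<^sub>R f t) \<le> norm (2 * (indicator {0<..} t * (t powr (1 - 1) * exp (- (v * t)))))"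
      by (intro AE_I2) (auto simp: indicator_def)
  qed
  have L0: "((F \<circ> real_of_ereal) \<longlongrightarrow> F 0) (at_right 0)"
    unfolding zero_ereal_def ereal_tendsto_simps
    using has_vector_derivative_continuous[OF D[of 0]] by (auto simp: continuous_within intro: filterlim_at_split[THEN iffD1, THEN conjunct2])
  have "(F \<longlongrightarrow> 0) at_top"
  proof (rule Lim_null_comparison)
    have "norm (exp (u *\<^sub>R (\<i> - of_real v))) = exp (- (u * v))" "norm (exp (u *\<^sub>R (- complex_of_real v))) = exp (- (u * v))" for u :: real
      by (simp_all add: norm_exp_eq_Re)
    then have "norm (F u) \<le> exp (- (u * v)) / norm (\<i> - of_real v) + exp (- (u * v)) / v" for u
      unfolding F_def using v by (intro order_trans[OF norm_triangle_ineq4]) (simp add: norm_divide norm_mult)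
    then show "\<forall>\<^sub>F u in at_top. norm (F u) \<le> exp (- (u * v)) / norm (\<i> - of_real v) + exp (- (u * v)) / v"
      by simp
    have "((\<lambda>u. exp (- (u * v))) \<longlongrightarrow> 0) at_top" using v by real_asymp
    then have "((\<lambda>u. exp (- (u * v)) / norm (\<i> - of_real v) + exp (- (u * v)) / v) \<longlongrightarrow> 0 / norm (\<i> - of_real v) + 0 / v) at_top"
      using nz v by (intro tendsto_intros) auto
    then show "((\<lambda>u. exp (- (u * v)) / norm (\<i> - of_real v) + exp (- (u * v)) / v) \<longlongrightarrow> 0) at_top" by simp
  qed
  then have L1: "((F \<circ> real_of_ereal) \<longlongrightarrow> 0) (at_left \<infinity>)"
    unfolding ereal_tendsto_simps .
  have "(LBINT u=0..\<infinity>. f u) = 0 - F 0"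
    by (rule interval_integral_FTC_integrable[OF _ D cont int L0 L1]) auto
  also have "0 - F 0 = 1 / (v - \<i>) - 1 / v"
    using nz by (simp add: F_def field_simps)
  finally have "(LBINT u=0..\<infinity>. f u) = 1 / (v - \<i>) - 1 / v" .
  then show ?thesis using int
    unfolding has_bochner_integral_iff set_integrable_def ein interval_lebesgue_integral_def set_lebesgue_integral_def f_def
    by simp
qed

lemma norm_iexp_minus_1_le: "norm (iexp u - 1) \<le> min \<bar>u\<bar> 2"
  using iexp_approx1[of u 0] iexp_approx2[of u 0] by simp

text \<open>A majorant of \<open>(iexp u - 1) * u powr - b\<close>: integrable at 0 because
  \<open>b < 2\<close> and at infinity because \<open>b > 1\<close>. The two comparison functions
  serve \<open>u \<le> 1\<close> and \<open>u > 1\<close>; for \<open>u > 1\<close> the factor 4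
  comes from \<open>min u 2 \<le> 2\<close> and
  \<open>u\<^sup>2 / (1 + u\<^sup>2) \<ge> 1 / 2\<close>.\<close>

lemma integrable_min_powr:
  fixes b :: real
  assumes b: "1 < b" "b < 2"
  shows "integrable lborel (\<lambda>u. indicator {0<..} u * (min u 2 * u powr (- b)))"
proof (rule Bochner_Integration.integrable_bound)
  let ?w = "\<lambda>a v. indicator {0<..} v * (v powr (a - 1) / (1 + v\<^sup>2)) :: real"
  show "integrable lborel (\<lambda>v. 4 * (?w (2 - b) v + ?w (3 - b) v))"
    using has_bochner_integral_power_over_1_plus_square[of "2 - b"] has_bochner_integral_power_over_1_plus_square[of "3 - b"] b
    by (intro integrable_mult_right Bochner_Integration.integrable_add) (auto simp: has_bochner_integral_iff)
  have "min u 2 * u powr (- b) \<le> 4 * (u powr (2 - b - 1) / (1 + u\<^sup>2) + u powr (3 - b - 1) / (1 + u\<^sup>2))" if u: "u > 0" for u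
  proof (cases "u \<le> 1")
    case True
    have "min u 2 * u powr (- b) = u powr (2 - b - 1)"
      using True u by (simp add: powr_diff powr_minus field_simps power2_eq_square)
    also have "\<dots> \<le> 4 * (u powr (2 - b - 1) / (1 + u\<^sup>2))"
    proof -
      have "u\<^sup>2 \<le> 1" using True u by (simp add: power_le_one)
      then have "u powr (2 - b - 1) * (1 + u\<^sup>2) \<le> u powr (2 - b - 1) * 4" by (intro mult_left_mono) auto
      then have "u powr (2 - b - 1) \<le> u powr (2 - b - 1) * 4 / (1 + u\<^sup>2)"
        by (subst pos_le_divide_eq) (auto intro: add_pos_nonneg)
      then show ?thesis by (simp add: mult.commute)
    qed
    also have "\<dots> \<le> 4 * (u powr (2 - b - 1) / (1 + u\<^sup>2) + u powr (3 - b - 1) / (1 + u\<^sup>2))"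
      by (intro mult_left_mono add_increasing2) auto
    finally show ?thesis .
  next
    case False
    then have "1 \<le> u\<^sup>2" by (simp add: one_le_power)
    have "min u 2 * u powr (- b) \<le> 2 * u powr (- b)" by (intro mult_right_mono) auto
    also have "\<dots> \<le> 4 * (u\<^sup>2 / (1 + u\<^sup>2)) * u powr (- b)"
      using \<open>1 \<le> u\<^sup>2\<close> by (intro mult_right_mono) (auto simp: field_simps)
    also have "\<dots> = 4 * (u powr (3 - b - 1) / (1 + u\<^sup>2))"
    proof -
      have "u powr (3 - b - 1) = u\<^sup>2 * u powr (- b)" using powr_add[of u 2 "- b"] u by simp
      then show ?thesis by simp
    qed
    also have "\<dots> \<le> 4 * (u powr (2 - b - 1) / (1 + u\<^sup>2) + u powr (3 - b - 1) / (1 + u\<^sup>2))"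
      by (intro mult_left_mono add_increasing) auto
    finally show ?thesis .
  qed
  then show "AE u in lborel. norm (indicator {0<..} u * (min u 2 * u powr (- b))) \<le> norm (4 * (?w (2 - b) u + ?w (3 - b) u))"
    by (intro AE_I2) (auto simp: indicator_def abs_mult)
qed simp

text \<open>Writing \<open>u\<^sup>-\<^sup>b\<close> as \<open>\<integral> v\<^sup>b\<^sup>-\<^sup>1 e\<^sup>-\<^sup>u\<^sup>v dv / \<Gamma>(b)\<close> and exchanging the integrals leaves rational functions of \<open>v\<close>
  against a power, so no contour rotation is needed.\<close>

lemma has_bochner_integral_iexp_minus_1_powr:
  fixes b :: real
  assumes b: "1 < b" "b < 2"
  shows "has_bochner_integral lborel (\<lambda>u. indicator {0<..} u *\<^sub>R ((iexp u - 1) * of_real (u powr (- b))))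
    (of_real (Gamma (2 - b) / (1 - b)) * (\<i> * cos (pi * b / 2) + sin (pi * b / 2)))"
proof -
  define g where "g u = indicator {0<..} u *\<^sub>R ((iexp u - 1) * of_real (u powr (- b)))" for u
  define k where "k u v = (indicator {0<..} u * indicator {0<..} v * (v powr (b - 1) * exp (- (u * v)))) *\<^sub>R (iexp u - 1)" for u v :: real
  have km: "case_prod k \<in> borel_measurable (lborel \<Otimes>\<^sub>M lborel)" unfolding k_def by measurable
  have G: "has_bochner_integral lborel (\<lambda>v. indicator {0<..} v * (v powr (b - 1) * exp (- (u * v)))) (Gamma b * u powr (- b))" if "u > 0" for u
    using has_bochner_integral_Gamma_scaled[of b u] b that by simp
  have gi: "integrable lborel g" unfolding g_def
  proof (rule Bochner_Integration.integrable_bound[OF integrable_min_powr[OF b]])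
    show "AE u in lborel. norm (indicator {0<..} u *\<^sub>R ((iexp u - 1) * of_real (u powr (- b)))) \<le> norm (indicator {0<..} u * (min u 2 * u powr (- b)))"
    proof (rule AE_I2)
      fix u :: real
      have "norm (iexp u - 1) * u powr (- b) \<le> min \<bar>u\<bar> 2 * u powr (- b)"
        by (rule mult_right_mono[OF norm_iexp_minus_1_le]) simp
      then show "norm (indicator {0<..} u *\<^sub>R ((iexp u - 1) * of_real (u powr (- b)))) \<le> norm (indicator {0<..} u * (min u 2 * u powr (- b)))"
        by (cases "u > 0") (simp_all add: norm_mult)
    qed
  qed simp
  have kint: "has_bochner_integral lborel (k u) (Gamma b *\<^sub>R g u)" for u
  proof (cases "u > 0")
    case True
    have "has_bochner_integral lborel (\<lambda>v. (indicator {0<..} v * (v powr (b - 1) * exp (- (u * v)))) *\<^sub>R (iexp u - 1)) ((Gamma b * u powr (- b)) *\<^sub>R (iexp u - 1))"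
      by (rule has_bochner_integral_scaleR_left[OF G[OF True]])
    then show ?thesis using True unfolding k_def g_def
      by (simp add: scaleR_conv_of_real mult_ac)
  next
    case False
    then have "k u = (\<lambda>_. 0)" "g u = 0" by (auto simp: k_def g_def)
    moreover have "has_bochner_integral lborel (\<lambda>_::real. 0::complex) 0" by (simp add: has_bochner_integral_iff)
    ultimately show ?thesis by simp
  qed
  have kn: "(\<integral>v. norm (k u v) \<partial>lborel) = Gamma b * norm (g u)" for u
  proof (cases "u > 0")
    case True
    have "(\<integral>v. norm (k u v) \<partial>lborel) = (\<integral>v. (indicator {0<..} v * (v powr (b - 1) * exp (- (u * v)))) * norm (iexp u - 1) \<partial>lborel)"
      using True by (intro Bochner_Integration.integral_cong) (auto simp: k_def abs_mult)
    also have "\<dots> = Gamma b * u powr (- b) * norm (iexp u - 1)"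
      using G[OF True] by (simp add: has_bochner_integral_iff)
    finally show ?thesis using True by (simp add: g_def norm_mult)
  qed (auto simp: k_def g_def)
  have kk: "integrable (lborel \<Otimes>\<^sub>M lborel) (case_prod k)"
  proof (rule lborel_pair.Fubini_integrable)
    show "integrable lborel (\<lambda>u. \<integral>v. norm (case (u, v) of (x, xa) \<Rightarrow> k x xa) \<partial>lborel)"
      using gi by (simp add: kn)
    show "AE u in lborel. integrable lborel (\<lambda>v. case (u, v) of (x, xa) \<Rightarrow> k x xa)"
      using kint by (auto simp: has_bochner_integral_iff)
  qed (use km in simp)
  have "(\<integral>v. (\<integral>u. k u v \<partial>lborel) \<partial>lborel) = (\<integral>u. (\<integral>v. k u v \<partial>lborel) \<partial>lborel)"
    by (rule lborel_pair.Fubini_integral[OF kk])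
  also have "\<dots> = Gamma b *\<^sub>R (\<integral>u. g u \<partial>lborel)"
    using kint by (simp add: has_bochner_integral_iff)
  finally have 1: "Gamma b *\<^sub>R (\<integral>u. g u \<partial>lborel) = (\<integral>v. (\<integral>u. k u v \<partial>lborel) \<partial>lborel)" by simp
  let ?w = "\<lambda>a v. indicator {0<..} v * (v powr (a - 1) / (1 + v\<^sup>2)) :: real"
  have "(\<integral>u. k u v \<partial>lborel) = \<i> * of_real (?w b v) - of_real (?w (b - 1) v)" for v
  proof (cases "v > 0")
    case True
    have nz: "complex_of_real v - \<i> \<noteq> 0" "complex_of_real v \<noteq> 0" "1 + complex_of_real v * complex_of_real v \<noteq> 0"
    proof -
      have "1 + v * v \<noteq> 0" using True by (simp add: add_pos_pos less_imp_neq[symmetric])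
      then show "1 + complex_of_real v * complex_of_real v \<noteq> 0"
        by (metis of_real_1 of_real_add of_real_eq_0_iff of_real_mult)
    qed (use True in \<open>auto simp: complex_eq_iff\<close>)
    have "(\<integral>u. k u v \<partial>lborel) = (\<integral>u. v powr (b - 1) *\<^sub>R (indicator {0<..} u *\<^sub>R ((iexp u - 1) * exp (- (u * v)))) \<partial>lborel)"
      using True by (intro Bochner_Integration.integral_cong) (auto simp: k_def indicator_def scaleR_conv_of_real mult_ac exp_of_real)
    also have "\<dots> = v powr (b - 1) *\<^sub>R (1 / (v - \<i>) - 1 / v)"
    proof -
      note B = has_bochner_integral_iexp_minus_1_exp[OF True, unfolded has_bochner_integral_iff]
      show ?thesis unfolding conjunct2[OF B, symmetric] by (rule integral_scaleR_right)
    qed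
    also have "1 / (complex_of_real v - \<i>) - 1 / v = \<i> / (1 + v * v) - 1 / (v * (1 + v * v))"
      using nz by (simp add: divide_simps) (simp add: algebra_simps)
    also have "v powr (b - 1) *\<^sub>R (\<i> / (1 + v * v) - 1 / (v * (1 + v * v))) = \<i> * of_real (?w b v) - of_real (?w (b - 1) v)"
    proof -
      have v: "v powr (b - 1 - 1) = v powr (b - 1) / v" using True powr_diff[of v "b - 1" 1] by simp
      have w: "v\<^sup>2 = v * v" by (rule power2_eq_square)
      show ?thesis using True unfolding v w by (simp add: scaleR_conv_of_real right_diff_distrib)
    qed
    finally show ?thesis .
  qed (simp add: k_def)
  then have "(\<integral>v. (\<integral>u. k u v \<partial>lborel) \<partial>lborel) = (\<integral>v. \<i> * of_real (?w b v) - of_real (?w (b - 1) v) \<partial>lborel)"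
    by simp
  also have "\<dots> = \<i> * of_real (pi / (2 * sin (pi * b / 2))) - of_real (pi / (2 * sin (pi * (b - 1) / 2)))"
  proof -
    have "has_bochner_integral lborel (\<lambda>v. \<i> * complex_of_real (?w b v) - complex_of_real (?w (b - 1) v))
        (\<i> * of_real (pi / (2 * sin (pi * b / 2))) - of_real (pi / (2 * sin (pi * (b - 1) / 2))))"
      using b by (intro has_bochner_integral_diff has_bochner_integral_mult_right has_bochner_integral_of_real
          has_bochner_integral_power_over_1_plus_square) auto
    then show ?thesis by (rule has_bochner_integral_integral_eq)
  qed
  finally have 2: "Gamma b *\<^sub>R (\<integral>u. g u \<partial>lborel) = \<dots>" using 1 by simp
  have sp: "sin (pi * b / 2) > 0" using b by (intro sin_gt_zero) auto
  have cn: "cos (pi * b / 2) < 0"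
  proof -
    have "cos (pi * b / 2) = - sin (pi * (b - 1) / 2)"
      by (simp add: right_diff_distrib diff_divide_distrib sin_diff)
    moreover have "sin (pi * (b - 1) / 2) > 0" using b by (intro sin_gt_zero) auto
    ultimately show ?thesis by simp
  qed
  have c: "sin (pi * (b - 1) / 2) = - cos (pi * b / 2)"
    by (simp add: right_diff_distrib diff_divide_distrib sin_diff)
  \<comment> \<open>The constant \<open>Gamma (2 - b) / (1 - b)\<close> is
    \<open>Gamma (1 - b)\<close>, since \<open>1 - b\<close> lies strictly between -1 and 0 and
    hence is no pole. Reflection and the double angle formula then give the right-hand side.\<close>
  have refl: "Gamma b * (Gamma (2 - b) / (1 - b)) = pi / (2 * sin (pi * b / 2) * cos (pi * b / 2))"
  proof -
    have "Gamma (1 - b + 1) = (1 - b) * Gamma (1 - b)" 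
    proof (rule Gamma_plus1, rule notI)
      assume "1 - b \<in> \<int>\<^sub>\<le>\<^sub>0"
      then obtain n where "1 - b = of_int n" by (auto elim!: nonpos_Ints_cases)
      then have "real_of_int (- 1) < of_int n" "of_int n < real_of_int 0" using b by auto
      then show False unfolding of_int_less_iff by linarith
    qed
    then have "Gamma (2 - b) / (1 - b) = Gamma (1 - b)" using b by (simp add: add.commute)
    then show ?thesis using Gamma_reflection_real[of b] sin_double[of "pi * b / 2"] by simp
  qed
  have "Gamma b *\<^sub>R (of_real (Gamma (2 - b) / (1 - b)) * (\<i> * cos (pi * b / 2) + sin (pi * b / 2)))
     = of_real (Gamma b * (Gamma (2 - b) / (1 - b))) * (\<i> * cos (pi * b / 2) + sin (pi * b / 2))"
    by (simp add: scaleR_conv_of_real)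
  also have "\<dots> = \<i> * of_real (pi / (2 * sin (pi * b / 2))) - of_real (pi / (2 * sin (pi * (b - 1) / 2)))"
    unfolding refl c using sp cn by (simp add: complex_eq_iff field_simps)
  finally have "Gamma b *\<^sub>R (\<integral>u. g u \<partial>lborel) = Gamma b *\<^sub>R (of_real (Gamma (2 - b) / (1 - b)) * (\<i> * cos (pi * b / 2) + sin (pi * b / 2)))"
    using 2 by simp
  then have "(\<integral>u. g u \<partial>lborel) = of_real (Gamma (2 - b) / (1 - b)) * (\<i> * cos (pi * b / 2) + sin (pi * b / 2))"
    using Gamma_real_pos[of b] b by (simp only: scaleR_cancel_left) (simp add: less_imp_neq[symmetric])
  then show ?thesis using gi unfolding has_bochner_integral_iff g_def by blast
qed

section \<open>Convergence in probability\<close>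

text \<open>The left-hand side is the characteristic function of the standard normal law, which is
  real.\<close>

lemma exp_neg_square_eq_normal_cos:
  fixes x :: real
  shows "exp (- (x\<^sup>2 / 2)) = (\<integral>z. cos (z * x) \<partial>std_normal_distribution)"
proof -
  interpret real_distribution std_normal_distribution by (rule real_dist_normal_dist)
  have "complex_of_real (exp (- (x\<^sup>2 / 2))) = (CLINT z|std_normal_distribution. iexp (x * z))"
    using fun_cong[OF char_std_normal_distribution, of x] by (simp add: char_def)
  then have "exp (- (x\<^sup>2 / 2)) = Re (CLINT z|std_normal_distribution. iexp (x * z))"
    by (metis Re_complex_of_real)
  also have "\<dots> = (\<integral>z. Re (iexp (x * z)) \<partial>std_normal_distribution)"
    by (intro integral_Re[symmetric] integrable_iexp) auto
  finally show ?thesis by (simp add: Re_exp mult.commute)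
qed

context prob_space
begin

lemma expectation_exp_neg_square:
  fixes Y :: "'a \<Rightarrow> real"
  assumes [measurable]: "Y \<in> borel_measurable M"
  shows "expectation (\<lambda>\<omega>. 1 - exp (- ((c * Y \<omega>)\<^sup>2 / 2))) = (\<integral>z. 1 - Re (CLINT \<omega>|M. iexp (z * c * Y \<omega>)) \<partial>std_normal_distribution)"
proof -
  interpret N: real_distribution std_normal_distribution by (rule real_dist_normal_dist)
  interpret NM: pair_prob_space std_normal_distribution M ..
  have i: "integrable M (\<lambda>\<omega>. cos (z * (c * Y \<omega>)))" for z by (rule integrable_const_bound[where B=1]) auto
  have i2: "integrable std_normal_distribution (\<lambda>z. cos (z * y))" for y by (rule N.integrable_const_bound[where B=1]) auto
  have [simp]: "N.prob UNIV = 1" using N.prob_space by simp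
  have c2: "norm (1 - cos x) \<le> 2" for x :: real
    using cos_le_one[of x] cos_ge_minus_one[of x] unfolding real_norm_def by linarith
  have re: "Re (CLINT \<omega>|M. iexp (z * c * Y \<omega>)) = expectation (\<lambda>\<omega>. cos (z * (c * Y \<omega>)))" for z
    by (subst integral_Re[symmetric]) (auto intro!: integrable_iexp simp: Re_exp mult.assoc)
  have "expectation (\<lambda>\<omega>. 1 - exp (- ((c * Y \<omega>)\<^sup>2 / 2))) = expectation (\<lambda>\<omega>. \<integral>z. 1 - cos (z * (c * Y \<omega>)) \<partial>std_normal_distribution)"
    using i2 by (simp add: exp_neg_square_eq_normal_cos)
  also have "\<dots> = (\<integral>z. expectation (\<lambda>\<omega>. 1 - cos (z * (c * Y \<omega>))) \<partial>std_normal_distribution)"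
    by (rule NM.Fubini_integral, rule NM.P.integrable_const_bound[where B=2])
       (use c2 in \<open>auto simp del: real_norm_def\<close>)
  also have "\<dots> = (\<integral>z. 1 - Re (CLINT \<omega>|M. iexp (z * c * Y \<omega>)) \<partial>std_normal_distribution)"
    unfolding re using i by (simp add: prob_space)
  finally show ?thesis .
qed

text \<open>Markov's inequality for \<open>1 - exp (- (Y / e)\<^sup>2 / 2)\<close>, which is at
  least \<open>1 - exp (- 1 / 2)\<close> where \<open>\<bar>Y\<bar> > e\<close>. It bounds a tail by
  an average of the characteristic function.\<close>

lemma prob_abs_gt_le:
  fixes Y :: "'a \<Rightarrow> real"
  assumes [measurable]: "Y \<in> borel_measurable M" and e: "0 < e"
  shows "prob {\<omega>\<in>space M. \<bar>Y \<omega>\<bar> > e} \<le> (\<integral>z. 1 - Re (CLINT \<omega>|M. iexp (z * (1 / e) * Y \<omega>)) \<partial>std_normal_distribution) / (1 - exp (- 1 / 2))"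
proof -
  have ie: "integrable M (\<lambda>\<omega>. 1 - exp (- (((1 / e) * Y \<omega>)\<^sup>2 / 2)))"
    by (rule integrable_const_bound[where B=1]) auto
  have "prob {\<omega>\<in>space M. \<bar>Y \<omega>\<bar> > e} * (1 - exp (- 1 / 2)) = expectation (\<lambda>\<omega>. indicator {\<omega>\<in>space M. \<bar>Y \<omega>\<bar> > e} \<omega> * (1 - exp (- 1 / 2)))"
    by simp
  also have "\<dots> \<le> expectation (\<lambda>\<omega>. 1 - exp (- (((1 / e) * Y \<omega>)\<^sup>2 / 2)))"
  proof (rule integral_mono[OF _ ie])
    fix \<omega>
    have "1 \<le> ((1 / e) * Y \<omega>)\<^sup>2" if "\<bar>Y \<omega>\<bar> > e"
      using that e abs_le_square_iff[of 1 "Y \<omega> / e"] by (simp add: abs_div_pos[symmetric])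
    then show "indicator {\<omega>\<in>space M. \<bar>Y \<omega>\<bar> > e} \<omega> * (1 - exp (- 1 / 2)) \<le> 1 - exp (- (((1 / e) * Y \<omega>)\<^sup>2 / 2))"
      by (auto simp: indicator_def)
  qed (intro integrable_mult_left integrable_const_bound[where B=1], auto)
  also have "\<dots> = (\<integral>z. 1 - Re (CLINT \<omega>|M. iexp (z * (1 / e) * Y \<omega>)) \<partial>std_normal_distribution)"
    by (rule expectation_exp_neg_square[OF assms(1)])
  finally show ?thesis by (subst pos_le_divide_eq) simp_all
qed

text \<open>Averaging \<open>1 - cos (z x)\<close> over a standard normal \<open>z\<close> gives \<open>1 - exp (- x\<^sup>2 / 2)\<close>, which is bounded below away
  from \<open>x = 0\<close>.\<close>

lemma char_tendsto_1_imp_prob_tendsto_0: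
  fixes Y :: "nat \<Rightarrow> 'a \<Rightarrow> real"
  assumes [measurable]: "\<And>n. Y n \<in> borel_measurable M"
    and lim: "\<And>z. (\<lambda>n. CLINT \<omega>|M. iexp (z * Y n \<omega>)) \<longlonglongrightarrow> 1" and e: "0 < e"
  shows "(\<lambda>n. prob {\<omega>\<in>space M. \<bar>Y n \<omega>\<bar> > e}) \<longlonglongrightarrow> 0"
proof -
  interpret N: real_distribution std_normal_distribution by (rule real_dist_normal_dist)
  let ?c = "\<lambda>n z. 1 - Re (CLINT \<omega>|M. iexp (z * (1 / e) * Y n \<omega>))"
  have n1: "norm (CLINT \<omega>|M. iexp (z * (1 / e) * Y n \<omega>)) \<le> 1" for n z
  proof -
    have "norm (CLINT \<omega>|M. iexp (z * (1 / e) * Y n \<omega>)) \<le> expectation (\<lambda>\<omega>. norm (iexp (z * (1 / e) * Y n \<omega>)))"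
      by (rule integral_norm_bound)
    also have "\<dots> = 1" using prob_space by simp
    finally show ?thesis .
  qed
  have [measurable]: "?c n \<in> borel_measurable borel" for n by measurable
  have "(\<lambda>n. \<integral>z. ?c n z \<partial>std_normal_distribution) \<longlonglongrightarrow> (\<integral>z. 0 \<partial>std_normal_distribution)"
  proof (rule integral_dominated_convergence[where w="\<lambda>_. 2"])
    have "(\<lambda>n. ?c n z) \<longlonglongrightarrow> 1 - Re 1" for z by (intro tendsto_intros lim)
    then show "AE z in std_normal_distribution. (\<lambda>n. ?c n z) \<longlonglongrightarrow> 0" by simp
    show "AE z in std_normal_distribution. norm (?c n z) \<le> 2" for n
    proof (rule AE_I2)
      fix z
      have "\<bar>Re (CLINT \<omega>|M. iexp (z * (1 / e) * Y n \<omega>))\<bar> \<le> 1"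
        by (rule order_trans[OF abs_Re_le_cmod n1])
      then show "norm (?c n z) \<le> 2" unfolding real_norm_def by linarith
    qed
  qed (auto simp: N.emeasure_space_1 simp del: space_density)
  then have "(\<lambda>n. (\<integral>z. ?c n z \<partial>std_normal_distribution) / (1 - exp (- 1 / 2))) \<longlonglongrightarrow> 0 / (1 - exp (- 1 / 2))"
    by (intro tendsto_divide) auto
  then show ?thesis
    unfolding div_0
    by (rule Lim_null_comparison[OF always_eventually[OF allI], rotated])
       (unfold real_norm_def abs_of_nonneg[OF measure_nonneg], rule prob_abs_gt_le[OF assms(1) e])
qed

text \<open>Where the distance of \<open>Y\<close> and \<open>Z\<close> is at most \<open>e\<close>,
  the exponentials differ by at most \<open>\<bar>z\<bar> * e\<close>; elsewhere they differ by at
  most 2.\<close>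

lemma norm_char_diff_le:
  fixes Y Z :: "'a \<Rightarrow> real"
  assumes [measurable]: "Y \<in> borel_measurable M" "Z \<in> borel_measurable M" and e: "0 \<le> e"
  shows "norm ((CLINT \<omega>|M. iexp (z * Y \<omega>)) - (CLINT \<omega>|M. iexp (z * Z \<omega>))) \<le> \<bar>z\<bar> * e + 2 * prob {\<omega>\<in>space M. \<bar>Y \<omega> - Z \<omega>\<bar> > e}"
proof -
  have "norm ((CLINT \<omega>|M. iexp (z * Y \<omega>)) - (CLINT \<omega>|M. iexp (z * Z \<omega>))) = norm (CLINT \<omega>|M. iexp (z * Y \<omega>) - iexp (z * Z \<omega>))"
    by (subst Bochner_Integration.integral_diff) (auto intro!: integrable_iexp)
  also have "\<dots> \<le> expectation (\<lambda>\<omega>. norm (iexp (z * Y \<omega>) - iexp (z * Z \<omega>)))" by (rule integral_norm_bound)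
  also have "\<dots> \<le> expectation (\<lambda>\<omega>. \<bar>z\<bar> * e + 2 * indicator {\<omega>\<in>space M. \<bar>Y \<omega> - Z \<omega>\<bar> > e} \<omega>)"
  proof (rule integral_mono)
    show "integrable M (\<lambda>\<omega>. norm (iexp (z * Y \<omega>) - iexp (z * Z \<omega>)))"
      by (intro integrable_norm Bochner_Integration.integrable_diff integrable_iexp) auto
    show "integrable M (\<lambda>\<omega>. \<bar>z\<bar> * e + 2 * indicator {\<omega>\<in>space M. \<bar>Y \<omega> - Z \<omega>\<bar> > e} \<omega>)"
      by (rule integrable_const_bound[where B="\<bar>z\<bar> * e + 2"]) (use e in \<open>auto simp: indicator_def\<close>)
    fix \<omega> assume w: "\<omega> \<in> space M"
    have "iexp (z * Y \<omega>) - iexp (z * Z \<omega>) = iexp (z * Z \<omega>) * (iexp (z * (Y \<omega> - Z \<omega>)) - 1)"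
      by (simp add: algebra_simps flip: exp_add)
    then have n: "norm (iexp (z * Y \<omega>) - iexp (z * Z \<omega>)) = norm (iexp (z * (Y \<omega> - Z \<omega>)) - 1)"
      by (simp add: norm_mult)
    have "norm (iexp (z * (Y \<omega> - Z \<omega>)) - 1) \<le> \<bar>z\<bar> * \<bar>Y \<omega> - Z \<omega>\<bar>" "norm (iexp (z * (Y \<omega> - Z \<omega>)) - 1) \<le> 2"
      using iexp_approx1[of "z * (Y \<omega> - Z \<omega>)" 0] iexp_approx2[of "z * (Y \<omega> - Z \<omega>)" 0] by (simp_all add: abs_mult)
    moreover have "\<bar>z\<bar> * \<bar>Y \<omega> - Z \<omega>\<bar> \<le> \<bar>z\<bar> * e" if "\<bar>Y \<omega> - Z \<omega>\<bar> \<le> e"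
      using that by (intro mult_left_mono) auto
    ultimately show "norm (iexp (z * Y \<omega>) - iexp (z * Z \<omega>)) \<le> \<bar>z\<bar> * e + 2 * indicator {\<omega>\<in>space M. \<bar>Y \<omega> - Z \<omega>\<bar> > e} \<omega>"
      unfolding n using w e by (auto simp: indicator_def not_less intro: order_trans add_increasing)
  qed
  also have "\<dots> = \<bar>z\<bar> * e + 2 * prob {\<omega>\<in>space M. \<bar>Y \<omega> - Z \<omega>\<bar> > e}"
    by (subst Bochner_Integration.integral_add) (auto simp: prob_space intro!: integrable_mult_right integrable_real_indicator simp: emeasure_eq_measure)
  finally show ?thesis .
qed

lemma prob_tendsto_0_imp_char_tendsto:
  fixes Y Z :: "nat \<Rightarrow> 'a \<Rightarrow> real"
  assumes [measurable]: "\<And>n. Y n \<in> borel_measurable M" "\<And>n. Z n \<in> borel_measurable M"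
    and lim: "\<And>e. 0 < e \<Longrightarrow> (\<lambda>n. prob {\<omega>\<in>space M. \<bar>Y n \<omega> - Z n \<omega>\<bar> > e}) \<longlonglongrightarrow> 0"
  shows "(\<lambda>n. (CLINT \<omega>|M. iexp (z * Y n \<omega>)) - (CLINT \<omega>|M. iexp (z * Z n \<omega>))) \<longlonglongrightarrow> 0"
proof (rule LIMSEQ_I)
  fix r :: real assume r: "0 < r"
  define e where "e = r / (2 * (\<bar>z\<bar> + 1))"
  have e: "0 < e" using r by (simp add: e_def)
  have ze: "\<bar>z\<bar> * e \<le> r / 2" using r by (simp add: e_def field_simps)
  have "\<forall>\<^sub>F n in sequentially. prob {\<omega>\<in>space M. \<bar>Y n \<omega> - Z n \<omega>\<bar> > e} < r / 4"
    using order_tendstoD(2)[OF lim[OF e], of "r / 4"] r by simp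
  then obtain N where N: "\<And>n. n \<ge> N \<Longrightarrow> prob {\<omega>\<in>space M. \<bar>Y n \<omega> - Z n \<omega>\<bar> > e} < r / 4"
    by (auto simp: eventually_sequentially)
  show "\<exists>N. \<forall>n\<ge>N. norm ((CLINT \<omega>|M. iexp (z * Y n \<omega>)) - (CLINT \<omega>|M. iexp (z * Z n \<omega>)) - 0) < r"
  proof (intro exI allI impI)
    fix n assume "n \<ge> N"
    with N[of n] norm_char_diff_le[of "Y n" "Z n" e z] e ze
    show "norm ((CLINT \<omega>|M. iexp (z * Y n \<omega>)) - (CLINT \<omega>|M. iexp (z * Z n \<omega>)) - 0) < r" by simp
  qed
qed

lemma conv_in_prob_imp_char_tendsto:
  fixes Y :: "nat \<Rightarrow> 'a \<Rightarrow> real"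
  assumes "\<And>n. Y n \<in> borel_measurable M" "Z \<in> borel_measurable M" and "conv_in_prob M Y Z"
  shows "(\<lambda>n. CLINT \<omega>|M. iexp (z * Y n \<omega>)) \<longlonglongrightarrow> (CLINT \<omega>|M. iexp (z * Z \<omega>))"
  using prob_tendsto_0_imp_char_tendsto[of Y "\<lambda>_. Z" z] assms unfolding conv_in_prob_def
  by (simp add: LIM_zero_iff)

lemma prob_abs_add_gt_le:
  fixes Y Z W :: "'a \<Rightarrow> real"
  assumes [measurable]: "Y \<in> borel_measurable M" "Z \<in> borel_measurable M" "W \<in> borel_measurable M"
    and le: "AE \<omega> in M. \<bar>W \<omega>\<bar> \<le> \<bar>Y \<omega>\<bar> + \<bar>Z \<omega>\<bar>"
  shows "prob {\<omega>\<in>space M. \<bar>W \<omega>\<bar> > e} \<le> prob {\<omega>\<in>space M. \<bar>Y \<omega>\<bar> > e / 2} + prob {\<omega>\<in>space M. \<bar>Z \<omega>\<bar> > e / 2}"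
proof -
  have "prob {\<omega>\<in>space M. \<bar>W \<omega>\<bar> > e} \<le> prob ({\<omega>\<in>space M. \<bar>Y \<omega>\<bar> > e / 2} \<union> {\<omega>\<in>space M. \<bar>Z \<omega>\<bar> > e / 2})"
    using le by (intro finite_measure_mono_AE) auto
  also have "\<dots> \<le> prob {\<omega>\<in>space M. \<bar>Y \<omega>\<bar> > e / 2} + prob {\<omega>\<in>space M. \<bar>Z \<omega>\<bar> > e / 2}"
    by (rule measure_Un_le) auto
  finally show ?thesis .
qed

lemma conv_in_prob_add:
  fixes Y Y' W :: "nat \<Rightarrow> 'a \<Rightarrow> real"
  assumes [measurable]: "\<And>n. Y n \<in> borel_measurable M" "\<And>n. Y' n \<in> borel_measurable M" "\<And>n. W n \<in> borel_measurable M"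
     "Z \<in> borel_measurable M" "Z' \<in> borel_measurable M"
    and c: "conv_in_prob M Y Z" "conv_in_prob M Y' Z'"
    and W: "\<And>n. AE \<omega> in M. W n \<omega> = Y n \<omega> + Y' n \<omega>"
  shows "conv_in_prob M W (\<lambda>\<omega>. Z \<omega> + Z' \<omega>)"
  unfolding conv_in_prob_def
proof (intro allI impI)
  fix e :: real assume e: "e > 0"
  have b: "prob {\<omega>\<in>space M. \<bar>W n \<omega> - (Z \<omega> + Z' \<omega>)\<bar> > e} \<le> prob {\<omega>\<in>space M. \<bar>Y n \<omega> - Z \<omega>\<bar> > e / 2} + prob {\<omega>\<in>space M. \<bar>Y' n \<omega> - Z' \<omega>\<bar> > e / 2}" for n
    by (rule prob_abs_add_gt_le) (use W[of n] in \<open>auto elim!: eventually_mono\<close>)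
  have "(\<lambda>n. prob {\<omega>\<in>space M. \<bar>Y n \<omega> - Z \<omega>\<bar> > e / 2} + prob {\<omega>\<in>space M. \<bar>Y' n \<omega> - Z' \<omega>\<bar> > e / 2}) \<longlonglongrightarrow> 0 + 0"
    using c e half_gt_zero[OF e] unfolding conv_in_prob_def by (intro tendsto_add) blast+
  then show "(\<lambda>n. prob {\<omega>\<in>space M. \<bar>W n \<omega> - (Z \<omega> + Z' \<omega>)\<bar> > e}) \<longlonglongrightarrow> 0"
    unfolding add_0
    by (rule Lim_null_comparison[OF always_eventually[OF allI], rotated])
       (unfold real_norm_def abs_of_nonneg[OF measure_nonneg], rule b)
qed

lemma conv_in_prob_cmult:
  fixes Y :: "nat \<Rightarrow> 'a \<Rightarrow> real"
  assumes [measurable]: "\<And>n. Y n \<in> borel_measurable M" "Z \<in> borel_measurable M"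
    and c: "conv_in_prob M Y Z"
  shows "conv_in_prob M (\<lambda>n \<omega>. c * Y n \<omega>) (\<lambda>\<omega>. c * Z \<omega>)"
  unfolding conv_in_prob_def
proof (intro allI impI)
  fix e :: real assume e: "e > 0"
  have eq: "{\<omega>\<in>space M. \<bar>c * Y n \<omega> - c * Z \<omega>\<bar> > e} = {\<omega>\<in>space M. \<bar>c\<bar> * \<bar>Y n \<omega> - Z \<omega>\<bar> > e}" for n
    by (simp add: abs_mult flip: right_diff_distrib)
  show "(\<lambda>n. prob {\<omega>\<in>space M. \<bar>c * Y n \<omega> - c * Z \<omega>\<bar> > e}) \<longlonglongrightarrow> 0"
  proof (cases "c = 0")
    case False
    then have "{\<omega>\<in>space M. \<bar>c\<bar> * \<bar>Y n \<omega> - Z \<omega>\<bar> > e} = {\<omega>\<in>space M. \<bar>Y n \<omega> - Z \<omega>\<bar> > e / \<bar>c\<bar>}" for n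
      by (simp add: field_simps)
    then show ?thesis using c e False unfolding conv_in_prob_def eq by simp
  qed (use e in simp)
qed

text \<open>A subsequence with summable deviation probabilities converges almost surely by
  Borel-Cantelli, and the Cauchy property carries its limit over to the whole sequence.\<close>

lemma Cauchy_in_prob_imp_conv:
  fixes Y :: "nat \<Rightarrow> 'a \<Rightarrow> real"
  assumes Ym[measurable]: "\<And>n. Y n \<in> borel_measurable M"
    and cauchy: "\<And>e. 0 < e \<Longrightarrow> \<exists>N. \<forall>n\<ge>N. \<forall>m\<ge>N. prob {\<omega>\<in>space M. \<bar>Y n \<omega> - Y m \<omega>\<bar> > e} < e"
  obtains Z where "Z \<in> borel_measurable M" "conv_in_prob M Y Z"
proof -
  have "\<exists>N. \<forall>k. \<forall>n\<ge>N k. \<forall>m\<ge>N k. prob {\<omega>\<in>space M. \<bar>Y n \<omega> - Y m \<omega>\<bar> > (1/2)^k} < (1/2)^k"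
    using cauchy by (intro choice allI) simp
  then obtain N where N: "\<And>k n m. n \<ge> N k \<Longrightarrow> m \<ge> N k \<Longrightarrow> prob {\<omega>\<in>space M. \<bar>Y n \<omega> - Y m \<omega>\<bar> > (1/2)^k} < (1/2)^k"
    by blast
  \<comment> \<open>Summing the thresholds makes \<open>r\<close> monotone in addition to
    \<open>r k \<ge> N k\<close>.\<close>
  define r where "r k = (\<Sum>i\<le>k. N i)" for k
  have rN: "r k \<ge> N k" for k by (simp add: r_def member_le_sum)
  have rm: "r (Suc k) \<ge> r k" for k by (simp add: r_def)
  define A where "A k = {\<omega>\<in>space M. \<bar>Y (r (Suc k)) \<omega> - Y (r k) \<omega>\<bar> > (1/2)^k}" for k
  have [measurable]: "A k \<in> sets M" for k unfolding A_def by measurable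
  have Ab: "prob (A k) \<le> (1/2)^k" for k
    unfolding A_def using N[of k "r (Suc k)" "r k"] rN[of k] rm[of k] by simp
  have "summable (\<lambda>k. prob (A k))"
    by (rule summable_comparison_test'[where N=0 and g="\<lambda>k. (1/2)^k"]) (auto simp: Ab)
  then have "AE \<omega> in M. \<forall>\<^sub>F k in sequentially. \<omega> \<in> space M - A k"
    by (intro borel_cantelli_AE1) (auto simp: emeasure_eq_measure)
  then have conv: "AE \<omega> in M. convergent (\<lambda>k. Y (r k) \<omega>)"
  proof eventually_elim
    case (elim \<omega>)
    then obtain K where K: "\<And>k. k \<ge> K \<Longrightarrow> \<omega> \<in> space M - A k" by (auto simp: eventually_sequentially)
    have "summable (\<lambda>k. Y (r (Suc k)) \<omega> - Y (r k) \<omega>)"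
    proof (rule summable_comparison_test'[where N=K and g="\<lambda>k. (1/2)^k"])
      show "norm (Y (r (Suc k)) \<omega> - Y (r k) \<omega>) \<le> (1 / 2) ^ k" if "k \<ge> K" for k
        using K[OF that] by (auto simp: A_def)
    qed simp
    then have "convergent (\<lambda>n. \<Sum>k<n. Y (r (Suc k)) \<omega> - Y (r k) \<omega>)" by (simp add: summable_iff_convergent)
    then have "convergent (\<lambda>n. Y (r n) \<omega> - Y (r 0) \<omega>)" by (simp add: sum_lessThan_telescope[of "\<lambda>k. Y (r k) \<omega>"])
    then have "convergent (\<lambda>n. (Y (r n) \<omega> - Y (r 0) \<omega>) + Y (r 0) \<omega>)" by (rule convergent_add) (rule convergent_const)
    then show ?case by simp
  qed
  define Z where "Z \<omega> = lim (\<lambda>k. Y (r k) \<omega>)" for \<omega>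
  have Zm[measurable]: "Z \<in> borel_measurable M" unfolding Z_def by measurable
  have lim: "AE \<omega> in M. (\<lambda>k. Y (r k) \<omega>) \<longlonglongrightarrow> Z \<omega>"
    using conv by eventually_elim (simp add: Z_def convergent_LIMSEQ_iff)
  have sub: "(\<lambda>k. prob {\<omega>\<in>space M. \<bar>Y (r k) \<omega> - Z \<omega>\<bar> > e}) \<longlonglongrightarrow> 0" if e: "e > 0" for e
  proof -
    have "(\<lambda>k. expectation (indicator {\<omega>\<in>space M. \<bar>Y (r k) \<omega> - Z \<omega>\<bar> > e} :: _ \<Rightarrow> real)) \<longlonglongrightarrow> expectation (\<lambda>_. 0 :: real)"
    proof (rule integral_dominated_convergence[where w="\<lambda>_. 1"])
      show "AE \<omega> in M. (\<lambda>k. indicator {\<omega>\<in>space M. \<bar>Y (r k) \<omega> - Z \<omega>\<bar> > e} \<omega> :: real) \<longlonglongrightarrow> 0"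
        using lim
      proof eventually_elim
        case (elim \<omega>)
        then have "\<forall>\<^sub>F k in sequentially. dist (Y (r k) \<omega>) (Z \<omega>) < e" using e by (rule tendstoD)
        then have "\<forall>\<^sub>F k in sequentially. indicator {\<omega>\<in>space M. \<bar>Y (r k) \<omega> - Z \<omega>\<bar> > e} \<omega> = (0 :: real)"
          by eventually_elim (auto simp: dist_real_def)
        then show ?case by (rule tendsto_eventually)
      qed
    qed auto
    then show ?thesis by simp
  qed
  have "conv_in_prob M Y Z" unfolding conv_in_prob_def
  proof (intro allI impI LIMSEQ_I)
    fix e q :: real assume e: "e > 0" and q: "q > 0"
    have "0 < min (e / 2) (q / 2)" "1 / 2 < (1::real)" using e q by auto
    then obtain K where K: "(1/2::real)^K < min (e / 2) (q / 2)"
      using real_arch_pow_inv by blast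
    have "\<forall>\<^sub>F k in sequentially. prob {\<omega>\<in>space M. \<bar>Y (r k) \<omega> - Z \<omega>\<bar> > e / 2} < q / 2"
      using order_tendstoD(2)[OF sub, of "e / 2" "q / 2"] e q by simp
    then obtain K' where K': "\<And>k. k \<ge> K' \<Longrightarrow> prob {\<omega>\<in>space M. \<bar>Y (r k) \<omega> - Z \<omega>\<bar> > e / 2} < q / 2"
      by (auto simp: eventually_sequentially)
    define k where "k = max K K'"
    have rk: "r k \<ge> N K"
      using rN[of K] lift_Suc_mono_le[of r K k] rm by (auto simp: k_def)
    have "prob {\<omega>\<in>space M. \<bar>Y n \<omega> - Z \<omega>\<bar> > e} < q" if n: "n \<ge> N K" for n
    proof -
      have "prob {\<omega>\<in>space M. \<bar>Y n \<omega> - Z \<omega>\<bar> > e} \<le> prob {\<omega>\<in>space M. \<bar>Y n \<omega> - Y (r k) \<omega>\<bar> > e / 2} + prob {\<omega>\<in>space M. \<bar>Y (r k) \<omega> - Z \<omega>\<bar> > e / 2}"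
        by (rule prob_abs_add_gt_le) (auto intro!: AE_I2)
      also have "prob {\<omega>\<in>space M. \<bar>Y n \<omega> - Y (r k) \<omega>\<bar> > e / 2} \<le> prob {\<omega>\<in>space M. \<bar>Y n \<omega> - Y (r k) \<omega>\<bar> > (1/2)^K}"
      proof (rule finite_measure_mono)
        have "(1/2)^K < e / 2" using K by linarith
        then show "{\<omega>\<in>space M. \<bar>Y n \<omega> - Y (r k) \<omega>\<bar> > e / 2} \<subseteq> {\<omega>\<in>space M. \<bar>Y n \<omega> - Y (r k) \<omega>\<bar> > (1/2)^K}"
          by (intro subsetI CollectI conjI) (simp_all only: mem_Collect_eq, linarith)
      qed measurable
      also have "\<dots> < (1/2)^K" by (rule N[OF n rk])
      also have "(1/2)^K < q / 2" using K by linarith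
      also have "prob {\<omega>\<in>space M. \<bar>Y (r k) \<omega> - Z \<omega>\<bar> > e / 2} < q / 2" by (rule K') (simp add: k_def)
      finally show ?thesis by simp
    qed
    then show "\<exists>N. \<forall>n\<ge>N. norm (prob {\<omega>\<in>space M. \<bar>Y n \<omega> - Z \<omega>\<bar> > e} - 0) < q"
      by (intro exI[of _ "N K"] allI impI) (simp only: diff_0_right real_norm_def abs_of_nonneg measure_nonneg)
  qed
  with Zm show ?thesis by (rule that)
qed

end

section \<open>Integrals of simple functions\<close>

lemma rr_simpleD:
  assumes "rr_simple m h"
  shows "finite (h ` space m)" "h \<in> borel_measurable m" "{x\<in>space m. h x \<noteq> 0} \<in> fmeasurable m"
  using assms by (auto simp: rr_simple_def simple_function_def intro: borel_measurable_simple_function)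

lemma rr_simple_level:
  assumes h: "rr_simple m h" and y: "y \<noteq> 0"
  shows "{x\<in>space m. h x = y} \<in> fmeasurable m"
proof (rule fmeasurableI2[OF rr_simpleD(3)[OF h]])
  show "{x \<in> space m. h x = y} \<in> sets m" using rr_simpleD(2)[OF h] by measurable
qed (use y in auto)

lemma rr_simple_compose2:
  assumes h: "rr_simple m h" and g: "rr_simple m g" and F: "F 0 0 = (0 :: real)"
  shows "rr_simple m (\<lambda>x. F (h x) (g x))"
  unfolding rr_simple_def
proof
  show s: "simple_function m (\<lambda>x. F (h x) (g x))"
    using h g by (auto simp: rr_simple_def intro: simple_function_compose2)
  show "{x \<in> space m. F (h x) (g x) \<noteq> 0} \<in> fmeasurable m"
  proof (rule fmeasurableI2)
    show "{x\<in>space m. h x \<noteq> 0} \<union> {x\<in>space m. g x \<noteq> 0} \<in> fmeasurable m"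
      using rr_simpleD(3)[OF h] rr_simpleD(3)[OF g] by auto
    show "{x \<in> space m. F (h x) (g x) \<noteq> 0} \<in> sets m"
      using borel_measurable_simple_function[OF s] by measurable
  qed (use F in auto)
qed

lemma rr_simple_linear: "rr_simple m h \<Longrightarrow> rr_simple m g \<Longrightarrow> rr_simple m (\<lambda>x. a * h x + b * g x)"
  by (rule rr_simple_compose2) auto

lemma rr_simple_cmult: "rr_simple m h \<Longrightarrow> rr_simple m (\<lambda>x. a * h x)"
  using rr_simple_compose2[of m h h "\<lambda>u v. a * u"] by simp

lemma rr_simple_diff: "rr_simple m h \<Longrightarrow> rr_simple m g \<Longrightarrow> rr_simple m (\<lambda>x. h x - g x)"
  by (rule rr_simple_compose2) auto

text \<open>\<open>k 0 = 0\<close> confines \<open>k (h x)\<close> to the support of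
  \<open>h\<close>, which has finite measure.\<close>

lemma rr_simple_compose_integrable:
  fixes k :: "real \<Rightarrow> 'b::{banach, second_countable_topology}"
  assumes h: "rr_simple m h" and k: "k 0 = 0"
  shows "integrable m (\<lambda>x. k (h x))"
    and "(\<integral>x. k (h x) \<partial>m) = (\<Sum>y\<in>h ` space m - {0}. measure m {x\<in>space m. h x = y} *\<^sub>R k y)"
proof -
  have eq: "k (h x) = (\<Sum>y\<in>h ` space m - {0}. indicator {x\<in>space m. h x = y} x *\<^sub>R k y)" if x: "x \<in> space m" for x
  proof (cases "h x = 0")
    case True
    then show ?thesis using k x by (auto simp: indicator_def intro!: sum.neutral[symmetric])
  next
    case False
    then have "(\<Sum>y\<in>h ` space m - {0}. indicator {x\<in>space m. h x = y} x *\<^sub>R k y) = (\<Sum>y\<in>{h x}. indicator {x\<in>space m. h x = y} x *\<^sub>R k y)"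
      using x rr_simpleD(1)[OF h] by (intro sum.mono_neutral_right) (auto simp: indicator_def)
    then show ?thesis using x by simp
  qed
  have i: "has_bochner_integral m (\<lambda>x. indicator {x\<in>space m. h x = y} x *\<^sub>R k y) (measure m {x\<in>space m. h x = y} *\<^sub>R k y)"
    if "y \<in> h ` space m - {0}" for y
    using rr_simple_level[OF h, of y] that
    by (intro has_bochner_integral_scaleR_left has_bochner_integral_real_indicator) (auto simp: fmeasurable_def)
  have "has_bochner_integral m (\<lambda>x. \<Sum>y\<in>h ` space m - {0}. indicator {x\<in>space m. h x = y} x *\<^sub>R k y) (\<Sum>y\<in>h ` space m - {0}. measure m {x\<in>space m. h x = y} *\<^sub>R k y)"
    by (intro has_bochner_integral_sum i)
  then have "has_bochner_integral m (\<lambda>x. k (h x)) (\<Sum>y\<in>h ` space m - {0}. measure m {x\<in>space m. h x = y} *\<^sub>R k y)"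
    by (rule has_bochner_integral_cong[THEN iffD1, rotated -1]) (auto simp: eq)
  then show "integrable m (\<lambda>x. k (h x))"
    "(\<integral>x. k (h x) \<partial>m) = (\<Sum>y\<in>h ` space m - {0}. measure m {x\<in>space m. h x = y} *\<^sub>R k y)"
    by (auto simp: has_bochner_integral_iff)
qed

section \<open>Additivity, linearity and characteristic functions for a Levy basis\<close>

locale levy_random_measure = prob_space M for M :: "'w measure" +
  fixes m :: "'a measure" and \<kappa> :: "real \<Rightarrow> complex" and \<Lambda> :: "'a set \<Rightarrow> 'w \<Rightarrow> real"
  assumes basis: "levy_basis M m \<kappa> \<Lambda>"
begin

lemma basis_measurable[measurable]: "A \<in> fmeasurable m \<Longrightarrow> \<Lambda> A \<in> borel_measurable M"
  using basis by (auto simp: levy_basis_def independently_scattered_def)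

lemma basis_sums:
  assumes "range A \<subseteq> fmeasurable m" "disjoint_family A" "(\<Union>n. A n) \<in> fmeasurable m"
  shows "AE \<omega> in M. (\<lambda>n. \<Lambda> (A n) \<omega>) sums \<Lambda> (\<Union>n. A n) \<omega>"
  using basis assms by (auto simp: levy_basis_def independently_scattered_def)

lemma basis_indep:
  fixes A :: "nat \<Rightarrow> 'a set"
  assumes "range A \<subseteq> fmeasurable m" "disjoint_family A"
  shows "indep_vars (\<lambda>_. borel) (\<lambda>n. \<Lambda> (A n)) UNIV"
  using basis assms by (auto simp: levy_basis_def independently_scattered_def)

lemma basis_char: "A \<in> fmeasurable m \<Longrightarrow> (CLINT \<omega>|M. iexp (z * \<Lambda> A \<omega>)) = exp (of_real (measure m A) * \<kappa> z)"
proof -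
  assume A: "A \<in> fmeasurable m"
  have "char (distr M borel (\<Lambda> A)) z = exp (of_real (measure m A) * \<kappa> z)"
    using basis A by (auto simp: levy_basis_def)
  then show ?thesis using A by (simp add: char_def integral_distr)
qed

text \<open>Countable additivity for the constant family of empty sets yields a convergent series
  with constant terms, so the terms vanish.\<close>

lemma basis_empty: "AE \<omega> in M. \<Lambda> {} \<omega> = 0"
proof -
  have "AE \<omega> in M. (\<lambda>n::nat. \<Lambda> {} \<omega>) sums \<Lambda> (\<Union>n::nat. {}) \<omega>"
    by (rule basis_sums) (auto simp: disjoint_family_on_def)
  then show ?thesis
    by eventually_elim (auto simp: summable_const_iff dest: sums_summable)
qed

lemma basis_Un:
  assumes A: "A \<in> fmeasurable m" and B: "B \<in> fmeasurable m" and d: "A \<inter> B = {}"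
  shows "AE \<omega> in M. \<Lambda> (A \<union> B) \<omega> = \<Lambda> A \<omega> + \<Lambda> B \<omega>"
proof -
  \<comment> \<open>Only countable additivity is given, so the two sets are padded with empty ones,
    whose values vanish almost surely.\<close>
  define C where "C n = (if n = 0 then A else if n = 1 then B else {})" for n :: nat
  have U: "(\<Union>n. C n) = A \<union> B" by (auto simp: C_def split: if_splits)
  have "AE \<omega> in M. (\<lambda>n. \<Lambda> (C n) \<omega>) sums \<Lambda> (A \<union> B) \<omega>"
    unfolding U[symmetric]
    by (rule basis_sums) (use A B d in \<open>auto simp: U disjoint_family_on_def C_def\<close>)
  with basis_empty show ?thesis
  proof eventually_elim
    case (elim \<omega>)
    have "(\<lambda>n. \<Lambda> (C n) \<omega>) sums (\<Sum>n\<in>{0,1}. \<Lambda> (C n) \<omega>)"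
      by (rule sums_finite) (auto simp: C_def elim(1))
    then have "(\<lambda>n. \<Lambda> (C n) \<omega>) sums (\<Lambda> A \<omega> + \<Lambda> B \<omega>)" by (simp add: C_def)
    with elim(2) show ?case by (rule sums_unique2)
  qed
qed

lemma basis_UN:
  assumes "finite I" "\<And>i. i \<in> I \<Longrightarrow> B i \<in> fmeasurable m" "disjoint_family_on B I"
  shows "AE \<omega> in M. \<Lambda> (\<Union>i\<in>I. B i) \<omega> = (\<Sum>i\<in>I. \<Lambda> (B i) \<omega>)"
  using assms
proof (induction I rule: finite_induct)
  case empty
  then show ?case using basis_empty by simp
next
  case (insert i I)
  have "AE \<omega> in M. \<Lambda> (B i \<union> (\<Union>i\<in>I. B i)) \<omega> = \<Lambda> (B i) \<omega> + \<Lambda> (\<Union>i\<in>I. B i) \<omega>"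
    by (rule basis_Un) (use insert in \<open>auto simp: disjoint_family_on_def intro!: fmeasurable.finite_UN\<close>)
  moreover have "AE \<omega> in M. \<Lambda> (\<Union>i\<in>I. B i) \<omega> = (\<Sum>i\<in>I. \<Lambda> (B i) \<omega>)"
    by (rule insert.IH) (use insert in \<open>auto simp: disjoint_family_on_def\<close>)
  ultimately show ?case
    by eventually_elim (use insert in simp)
qed

text \<open>The definition sums over the level sets of \<open>h\<close>. Here any finite partition
  on which \<open>h\<close> is constant is allowed, with repeated values \<open>c i\<close>, so that
  several functions can be integrated over a common refinement. Equality is only almost sure because
  additivity of \<Lambda> is.\<close>

lemma simple_integral_representation:
  assumes I: "finite I" and B: "\<And>i. i \<in> I \<Longrightarrow> B i \<in> fmeasurable m" and d: "disjoint_family_on B I"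
    and h: "\<And>x i. i \<in> I \<Longrightarrow> x \<in> B i \<Longrightarrow> h x = c i" "\<And>x. x \<in> space m \<Longrightarrow> x \<notin> (\<Union>i\<in>I. B i) \<Longrightarrow> h x = 0"
    and A: "A \<in> sets m"
  shows "AE \<omega> in M. simple_integral_basis m \<Lambda> A h \<omega> = (\<Sum>i\<in>I. c i * \<Lambda> (A \<inter> B i) \<omega>)"
proof -
  define T where "T = h ` space m - {0}"
  have Bs: "B i \<subseteq> space m" if "i \<in> I" for i using B[OF that] by (auto simp: fmeasurable_def dest: sets.sets_into_space)
  have "h ` space m \<subseteq> c ` I \<union> {0}" using h by (force simp: image_iff)
  then have "finite (h ` space m)" by (rule finite_subset) (use I in simp)
  then have fT: "finite T" by (simp add: T_def)
  have AB: "A \<inter> B i \<in> fmeasurable m" if "i \<in> I" for i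
    using B[OF that] A by (intro fmeasurableI2[OF B[OF that]]) auto
  have lev: "A \<inter> {x\<in>space m. h x = y} = (\<Union>i\<in>{i\<in>I. c i = y}. A \<inter> B i)" if yT: "y \<in> T" for y
  proof (intro equalityI subsetI)
    fix x assume x: "x \<in> A \<inter> {x\<in>space m. h x = y}"
    then obtain i where i: "i \<in> I" "x \<in> B i" using h(2)[of x] yT by (auto simp: T_def)
    then show "x \<in> (\<Union>i\<in>{i\<in>I. c i = y}. A \<inter> B i)" using x h(1)[OF i] by auto
  next
    fix x assume "x \<in> (\<Union>i\<in>{i\<in>I. c i = y}. A \<inter> B i)"
    then obtain i where i: "i \<in> I" "c i = y" "x \<in> A" "x \<in> B i" by auto
    then show "x \<in> A \<inter> {x\<in>space m. h x = y}" using h(1)[OF i(1,4)] Bs[OF i(1)] by auto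
  qed
  have "AE \<omega> in M. \<forall>y\<in>T. \<Lambda> (A \<inter> {x\<in>space m. h x = y}) \<omega> = (\<Sum>i\<in>{i\<in>I. c i = y}. \<Lambda> (A \<inter> B i) \<omega>)"
  proof (rule AE_finite_allI[OF fT])
    fix y assume y: "y \<in> T"
    show "AE \<omega> in M. \<Lambda> (A \<inter> {x\<in>space m. h x = y}) \<omega> = (\<Sum>i\<in>{i\<in>I. c i = y}. \<Lambda> (A \<inter> B i) \<omega>)"
      unfolding lev[OF y]
      by (rule basis_UN) (use I AB d in \<open>auto simp: disjoint_family_on_def\<close>)
  qed
  with basis_empty show ?thesis
  proof eventually_elim
    case (elim \<omega>)
    have "simple_integral_basis m \<Lambda> A h \<omega> = (\<Sum>y\<in>T. \<Sum>i\<in>{i\<in>I. c i = y}. c i * \<Lambda> (A \<inter> B i) \<omega>)"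
      unfolding simple_integral_basis_def T_def[symmetric]
      using elim(2) by (intro sum.cong) (auto simp: sum_distrib_left)
    also have "\<dots> = (\<Sum>y\<in>T. \<Sum>i\<in>{i. i \<in> {i\<in>I. c i \<in> T} \<and> c i = y}. c i * \<Lambda> (A \<inter> B i) \<omega>)"
      by (intro sum.cong) auto
    also have "\<dots> = (\<Sum>i\<in>{i\<in>I. c i \<in> T}. c i * \<Lambda> (A \<inter> B i) \<omega>)"
      by (rule sum.group) (use I fT in auto)
    also have "\<dots> = (\<Sum>i\<in>I. c i * \<Lambda> (A \<inter> B i) \<omega>)"
    proof (rule sum.mono_neutral_left)
      show "\<forall>i\<in>I - {i \<in> I. c i \<in> T}. c i * \<Lambda> (A \<inter> B i) \<omega> = 0"
      proof (rule ballI)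
        fix i assume "i \<in> I - {i \<in> I. c i \<in> T}"
        then have i: "i \<in> I" "c i \<notin> T" by auto
        show "c i * \<Lambda> (A \<inter> B i) \<omega> = 0"
        proof (cases "c i = 0")
          case False
          \<comment> \<open>A nonzero \<open>c i\<close> that is not a value of \<open>h\<close> can
            only belong to an empty cell.\<close>
          have "c i \<in> T" if "x \<in> B i" for x
            using that h(1)[OF i(1) that] Bs[OF i(1)] False by (auto simp: T_def image_iff intro: bexI[of _ x])
          then have "B i = {}" using i(2) by blast
          then show ?thesis using elim(1) by simp
        qed simp
      qed
    qed (use I in auto)
    finally show ?case .
  qed
qed

lemma simple_integral_measurable:
  assumes h: "rr_simple m h" and A: "A \<in> sets m"
  shows "simple_integral_basis m \<Lambda> A h \<in> borel_measurable M"
  unfolding simple_integral_basis_def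
proof (intro borel_measurable_sum borel_measurable_times borel_measurable_const basis_measurable)
  fix y assume "y \<in> h ` space m - {0}"
  then have F: "{x\<in>space m. h x = y} \<in> fmeasurable m" using rr_simple_level[OF h] by auto
  show "A \<inter> {x\<in>space m. h x = y} \<in> fmeasurable m"
    by (rule fmeasurableI2[OF F _ sets.Int[OF A fmeasurableD[OF F]]]) auto
qed

lemma simple_integral_linear:
  assumes h: "rr_simple m h" and g: "rr_simple m g" and A: "A \<in> sets m"
  shows "AE \<omega> in M. simple_integral_basis m \<Lambda> A (\<lambda>x. a * h x + b * g x) \<omega> =
    a * simple_integral_basis m \<Lambda> A h \<omega> + b * simple_integral_basis m \<Lambda> A g \<omega>"
proof -
  \<comment> \<open>The cells are indexed by pairs of values; the pair \<open>(0, 0)\<close> is left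
    out since its cell may have infinite measure.\<close>
  define I where "I = h ` space m \<times> g ` space m - {(0, 0)}"
  define B where "B p = {x\<in>space m. h x = fst p \<and> g x = snd p}" for p
  have I: "finite I" using rr_simpleD(1)[OF h] rr_simpleD(1)[OF g] by (simp add: I_def)
  have d: "disjoint_family_on B I" by (auto simp: disjoint_family_on_def B_def prod_eq_iff)
  have Bf: "B p \<in> fmeasurable m" if "p \<in> I" for p
  proof (rule fmeasurableI2)
    show "{x\<in>space m. h x \<noteq> 0} \<union> {x\<in>space m. g x \<noteq> 0} \<in> fmeasurable m"
      using rr_simpleD(3)[OF h] rr_simpleD(3)[OF g] by auto
    show "B p \<in> sets m" using rr_simpleD(2)[OF h] rr_simpleD(2)[OF g] unfolding B_def by measurable
  qed (use that in \<open>auto simp: B_def I_def prod_eq_iff\<close>)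
  have z: "h x = 0 \<and> g x = 0" if "x \<in> space m" "x \<notin> (\<Union>p\<in>I. B p)" for x
  proof (rule ccontr)
    assume "\<not> (h x = 0 \<and> g x = 0)"
    then have "(h x, g x) \<in> I" "x \<in> B (h x, g x)" using that(1) by (auto simp: I_def B_def)
    with that(2) show False by blast
  qed
  have hB: "h x = fst p" "g x = snd p" if "x \<in> B p" for x p using that by (simp_all add: B_def)
  have "AE \<omega> in M. simple_integral_basis m \<Lambda> A h \<omega> = (\<Sum>p\<in>I. fst p * \<Lambda> (A \<inter> B p) \<omega>)"
    by (rule simple_integral_representation[OF I Bf d _ _ A]) (simp_all add: z hB)
  moreover have "AE \<omega> in M. simple_integral_basis m \<Lambda> A g \<omega> = (\<Sum>p\<in>I. snd p * \<Lambda> (A \<inter> B p) \<omega>)"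
    by (rule simple_integral_representation[OF I Bf d _ _ A]) (simp_all add: z hB)
  moreover have "AE \<omega> in M. simple_integral_basis m \<Lambda> A (\<lambda>x. a * h x + b * g x) \<omega> = (\<Sum>p\<in>I. (a * fst p + b * snd p) * \<Lambda> (A \<inter> B p) \<omega>)"
    by (rule simple_integral_representation[OF I Bf d _ _ A]) (simp_all add: z hB)
  ultimately show ?thesis
    by eventually_elim (simp add: distrib_right sum.distrib sum_distrib_left mult.assoc)
qed

text \<open>\<open>has_rr_integral\<close> demands limits of the integrals over every measurable
  set; this reduces them to integrals over the whole space.\<close>

lemma simple_integral_restrict:
  assumes h: "rr_simple m h" and A: "A \<in> sets m"
  shows "AE \<omega> in M. simple_integral_basis m \<Lambda> (space m) (\<lambda>x. indicator A x * h x) \<omega> = simple_integral_basis m \<Lambda> A h \<omega>"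
proof -
  define I where "I = h ` space m - {0}"
  define B where "B y = A \<inter> {x\<in>space m. h x = y}" for y
  have I: "finite I" using rr_simpleD(1)[OF h] by (simp add: I_def)
  have Bf: "B y \<in> fmeasurable m" if "y \<in> I" for y
  proof -
    have F: "{x\<in>space m. h x = y} \<in> fmeasurable m" using rr_simple_level[OF h, of y] that by (auto simp: I_def)
    show ?thesis unfolding B_def
      by (rule fmeasurableI2[OF F _ sets.Int[OF A fmeasurableD[OF F]]]) auto
  qed
  have "AE \<omega> in M. simple_integral_basis m \<Lambda> (space m) (\<lambda>x. indicator A x * h x) \<omega> = (\<Sum>y\<in>I. y * \<Lambda> (space m \<inter> B y) \<omega>)"
    by (rule simple_integral_representation[OF I Bf])
       (auto simp: disjoint_family_on_def B_def I_def indicator_def)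
  moreover have "space m \<inter> B y = A \<inter> {x\<in>space m. h x = y}" for y by (auto simp: B_def)
  ultimately show ?thesis by (simp add: simple_integral_basis_def I_def)
qed

text \<open>Values on disjoint level sets are independent, so the characteristic function
  factorizes. Independence is assumed for sequences of sets, hence the level sets are numbered and
  followed by empty sets.\<close>

lemma simple_integral_char:
  assumes h: "rr_simple m h" and k0: "\<kappa> 0 = 0"
  shows "(CLINT \<omega>|M. iexp (simple_integral_basis m \<Lambda> (space m) h \<omega>)) = exp (\<integral>x. \<kappa> (h x) \<partial>m)"
proof -
  define I where "I = h ` space m - {0}"
  have I: "finite I" using rr_simpleD(1)[OF h] by (simp add: I_def)
  define B where "B y = {x\<in>space m. h x = y}" for y
  have Bf: "B y \<in> fmeasurable m" if "y \<in> I" for y using rr_simple_level[OF h, of y] that by (auto simp: I_def B_def)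
  obtain e where e: "bij_betw e {0..<card I} I" using ex_bij_betw_nat_finite[OF I] by blast
  define A where "A n = (if n < card I then B (e n) else {})" for n
  have Af: "A n \<in> fmeasurable m" for n
    using bij_betwE[OF e] Bf[of "e n"] by (auto simp: A_def)
  have "disjoint_family A"
    using bij_betw_imp_inj_on[OF e] by (auto simp: disjoint_family_on_def A_def B_def inj_on_def)
  then have ind: "indep_vars (\<lambda>_. borel) (\<lambda>n. \<Lambda> (A n)) {0..<card I}"
    using Af by (intro indep_vars_subset[OF basis_indep]) auto
  have ind2: "indep_vars (\<lambda>_. borel) (\<lambda>n \<omega>. e n * \<Lambda> (A n) \<omega>) {0..<card I}"
    by (rule indep_vars_compose2[OF ind]) simp
  have "simple_integral_basis m \<Lambda> (space m) h \<omega> = (\<Sum>y\<in>I. y * \<Lambda> (B y) \<omega>)" for \<omega>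
  proof -
    have "space m \<inter> B y = B y" for y by (auto simp: B_def)
    then show ?thesis unfolding simple_integral_basis_def I_def[symmetric] B_def[symmetric] by simp
  qed
  also have "(\<Sum>y\<in>I. y * \<Lambda> (B y) \<omega>) = (\<Sum>n\<in>{0..<card I}. e n * \<Lambda> (A n) \<omega>)" for \<omega>
    by (subst sum.reindex_bij_betw[OF e, symmetric]) (auto simp: A_def intro!: sum.cong)
  finally have S: "simple_integral_basis m \<Lambda> (space m) h = (\<lambda>\<omega>. \<Sum>n\<in>{0..<card I}. e n * \<Lambda> (A n) \<omega>)" by auto
  have [measurable]: "\<Lambda> (A n) \<in> borel_measurable M" for n using Af by simp
  have "(CLINT \<omega>|M. iexp (\<Sum>n\<in>{0..<card I}. e n * \<Lambda> (A n) \<omega>)) = char (distr M borel (\<lambda>\<omega>. \<Sum>n\<in>{0..<card I}. e n * \<Lambda> (A n) \<omega>)) 1"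
    by (simp add: char_def integral_distr)
  also have "\<dots> = (\<Prod>n\<in>{0..<card I}. char (distr M borel (\<lambda>\<omega>. e n * \<Lambda> (A n) \<omega>)) 1)"
    by (rule char_distr_sum[OF ind2])
  also have "\<dots> = (\<Prod>n\<in>{0..<card I}. exp (of_real (measure m (A n)) * \<kappa> (e n)))"
    by (intro prod.cong refl) (simp add: char_def integral_distr basis_char[OF Af, symmetric])
  also have "\<dots> = exp (\<Sum>n\<in>{0..<card I}. of_real (measure m (A n)) * \<kappa> (e n))"
    by (simp add: exp_sum)
  also have "(\<Sum>n\<in>{0..<card I}. of_real (measure m (A n)) * \<kappa> (e n)) = (\<Sum>n\<in>{0..<card I}. of_real (measure m (B (e n))) * \<kappa> (e n))"
    by (intro sum.cong) (auto simp: A_def)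
  also have "\<dots> = (\<Sum>y\<in>I. of_real (measure m (B y)) * \<kappa> y)"
    by (rule sum.reindex_bij_betw[OF e])
  also have "\<dots> = (\<integral>x. \<kappa> (h x) \<partial>m)"
    by (subst rr_simple_compose_integrable(2)[OF h, where k=\<kappa>, OF k0]) (simp add: I_def B_def scaleR_conv_of_real)
  finally show ?thesis unfolding S .
qed

end

section \<open>The characteristic function of the integral\<close>

text \<open>Passes from limits along arbitrary pairs of index sequences to a Cauchy-type bound, so
  that dominated convergence and characteristic functions can be used with a single index.
  Counterexample indices for each \<open>N\<close> would form an offending pair.\<close>

lemma double_sequence_tendsto_0:
  fixes F :: "nat \<Rightarrow> nat \<Rightarrow> real"
  assumes F: "\<And>r s :: nat \<Rightarrow> nat. filterlim r at_top sequentially \<Longrightarrow> filterlim s at_top sequentially \<Longrightarrow> (\<lambda>k. F (r k) (s k)) \<longlonglongrightarrow> 0"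
    and e: "0 < e"
  shows "\<exists>N. \<forall>n\<ge>N. \<forall>m\<ge>N. F n m < e"
proof (rule ccontr)
  assume "\<not> ?thesis"
  then have "\<forall>N. \<exists>n m. n \<ge> N \<and> m \<ge> N \<and> F n m \<ge> e" by (meson not_le)
  then obtain r s where rs: "\<And>N. r N \<ge> N" "\<And>N. s N \<ge> N" "\<And>N. F (r N) (s N) \<ge> e" by metis
  have "filterlim r at_top sequentially" "filterlim s at_top sequentially"
    using rs by (auto intro: filterlim_at_top_mono[OF filterlim_ident] always_eventually)
  then have "(\<lambda>k. F (r k) (s k)) \<longlonglongrightarrow> 0" by (rule F)
  then have "\<forall>\<^sub>F k in sequentially. F (r k) (s k) < e" using e by (rule order_tendstoD)
  then obtain N where "\<And>k. k \<ge> N \<Longrightarrow> F (r k) (s k) < e" by (auto simp: eventually_sequentially)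
  then show False using rs(3)[of N] by (meson not_le order_refl)
qed

text \<open>\<open>S\<close> stands for the integral of simple functions, possibly corrected by a drift. The even function
  \<open>\<psi> = - Re \<kappa>\<close> plays the role of a Young function: it controls convergence in probability of \<open>S\<close>.\<close>

locale infdiv_functional = prob_space M for M :: "'w measure" +
  fixes m :: "'a measure" and \<kappa> :: "real \<Rightarrow> complex" and S :: "('a \<Rightarrow> real) \<Rightarrow> 'w \<Rightarrow> real"
  assumes S_measurable[measurable]: "rr_simple m h \<Longrightarrow> S h \<in> borel_measurable M"
    and S_linear: "rr_simple m h \<Longrightarrow> rr_simple m g \<Longrightarrow> AE \<omega> in M. S (\<lambda>x. a * h x + b * g x) \<omega> = a * S h \<omega> + b * S g \<omega>"
    and S_char: "rr_simple m h \<Longrightarrow> (CLINT \<omega>|M. iexp (S h \<omega>)) = exp (\<integral>x. \<kappa> (h x) \<partial>m)"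
    and \<kappa>_cont: "continuous_on UNIV \<kappa>" and \<kappa>_0: "\<kappa> 0 = 0"
    and Re_nonpos: "Re (\<kappa> y) \<le> 0" and Re_even: "Re (\<kappa> (- y)) = Re (\<kappa> y)"
    and Re_quasi: "\<exists>D. \<forall>x y. - Re (\<kappa> (x + y)) \<le> D * (- Re (\<kappa> x) - Re (\<kappa> y))"
begin

definition \<psi> :: "real \<Rightarrow> real" where "\<psi> y = - Re (\<kappa> y)"

lemma \<psi>_nonneg[simp]: "0 \<le> \<psi> y" using Re_nonpos by (simp add: \<psi>_def)
lemma \<psi>_minus: "\<psi> (- y) = \<psi> y" by (simp add: \<psi>_def Re_even)
lemma \<psi>_0[simp]: "\<psi> 0 = 0" by (simp add: \<psi>_def \<kappa>_0)
lemma \<psi>_cont: "continuous_on UNIV \<psi>" unfolding \<psi>_def by (intro continuous_intros \<kappa>_cont)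
lemma \<psi>_measurable[measurable]: "\<psi> \<in> borel_measurable borel" by (rule borel_measurable_continuous_onI[OF \<psi>_cont])

lemma \<psi>_quasi: obtains D where "D > 0" "\<And>x y. \<psi> (x + y) \<le> D * (\<psi> x + \<psi> y)"
proof -
  obtain D where D: "\<And>x y. - Re (\<kappa> (x + y)) \<le> D * (- Re (\<kappa> x) - Re (\<kappa> y))" using Re_quasi by blast
  have "\<psi> (x + y) \<le> max D 1 * (\<psi> x + \<psi> y)" for x y
  proof -
    have "\<psi> (x + y) \<le> D * (\<psi> x + \<psi> y)" using D[of x y] by (simp add: \<psi>_def)
    also have "\<dots> \<le> max D 1 * (\<psi> x + \<psi> y)" by (intro mult_right_mono) auto
    finally show ?thesis .
  qed
  then show ?thesis by (intro that[of "max D 1"]) auto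
qed

lemma S_cmult: "rr_simple m h \<Longrightarrow> AE \<omega> in M. S (\<lambda>x. a * h x) \<omega> = a * S h \<omega>"
  using S_linear[of h h a 0] by simp

lemma S_diff: "rr_simple m h \<Longrightarrow> rr_simple m g \<Longrightarrow> AE \<omega> in M. S (\<lambda>x. h x - g x) \<omega> = S h \<omega> - S g \<omega>"
  using S_linear[of h g 1 "-1"] by simp

lemma norm_S_char:
  assumes h: "rr_simple m h"
  shows "norm (CLINT \<omega>|M. iexp (S h \<omega>)) = exp (- (\<integral>x. \<psi> (h x) \<partial>m))"
proof -
  have "Re (\<integral>x. \<kappa> (h x) \<partial>m) = - (\<integral>x. \<psi> (h x) \<partial>m)"
    using rr_simple_compose_integrable(1)[OF h, of \<kappa>] by (simp add: \<kappa>_0 \<psi>_def integral_Re flip: integral_minus)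
  then show ?thesis by (simp add: S_char[OF h] norm_exp_eq_Re)
qed

text \<open>Weaker than \<open>has_rr_integral\<close>: only the integrals over the whole space have
  to converge, and \<open>S\<close> may be any functional of the locale. This covers the compensated
  functional as well.\<close>

definition wk_approx :: "(nat \<Rightarrow> 'a \<Rightarrow> real) \<Rightarrow> ('a \<Rightarrow> real) \<Rightarrow> ('w \<Rightarrow> real) \<Rightarrow> bool" where
  "wk_approx h f Y \<longleftrightarrow> f \<in> borel_measurable m \<and> Y \<in> borel_measurable M \<and> (\<forall>n. rr_simple m (h n)) \<and>
     (AE x in m. (\<lambda>n. h n x) \<longlonglongrightarrow> f x) \<and> conv_in_prob M (\<lambda>n. S (h n)) Y"

definition wk_integral :: "('a \<Rightarrow> real) \<Rightarrow> ('w \<Rightarrow> real) \<Rightarrow> bool" where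
  "wk_integral f Y \<longleftrightarrow> (\<exists>h. wk_approx h f Y)"

lemma wk_approx_linear:
  assumes h: "wk_approx h f Y" and g: "wk_approx g f' Z"
  shows "wk_approx (\<lambda>n x. a * h n x + b * g n x) (\<lambda>x. a * f x + b * f' x) (\<lambda>\<omega>. a * Y \<omega> + b * Z \<omega>)"
  unfolding wk_approx_def
proof (intro conjI allI)
  show "conv_in_prob M (\<lambda>n. S (\<lambda>x. a * h n x + b * g n x)) (\<lambda>\<omega>. a * Y \<omega> + b * Z \<omega>)"
  proof (rule conv_in_prob_add)
    show "conv_in_prob M (\<lambda>n \<omega>. a * S (h n) \<omega>) (\<lambda>\<omega>. a * Y \<omega>)" "conv_in_prob M (\<lambda>n \<omega>. b * S (g n) \<omega>) (\<lambda>\<omega>. b * Z \<omega>)"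
      using h g by (auto simp: wk_approx_def intro!: conv_in_prob_cmult)
    show "AE \<omega> in M. S (\<lambda>x. a * h n x + b * g n x) \<omega> = a * S (h n) \<omega> + b * S (g n) \<omega>" for n
      using h g by (intro S_linear) (auto simp: wk_approx_def)
  qed (use h g in \<open>auto simp: wk_approx_def rr_simple_linear intro!: borel_measurable_times S_measurable\<close>)
  have "AE x in m. (\<lambda>n. h n x) \<longlonglongrightarrow> f x" "AE x in m. (\<lambda>n. g n x) \<longlonglongrightarrow> f' x"
    using h g by (auto simp: wk_approx_def)
  then show "AE x in m. (\<lambda>n. a * h n x + b * g n x) \<longlonglongrightarrow> a * f x + b * f' x"
    by eventually_elim (intro tendsto_intros)
qed (use h g in \<open>auto simp: wk_approx_def rr_simple_linear\<close>)

lemma wk_integral_linear: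
  "wk_integral f Y \<Longrightarrow> wk_integral f' Z \<Longrightarrow> wk_integral (\<lambda>x. a * f x + b * f' x) (\<lambda>\<omega>. a * Y \<omega> + b * Z \<omega>)"
  unfolding wk_integral_def using wk_approx_linear by blast

lemma wk_approx_cmult: "wk_approx h f Y \<Longrightarrow> wk_approx (\<lambda>n x. a * h n x) (\<lambda>x. a * f x) (\<lambda>\<omega>. a * Y \<omega>)"
  using wk_approx_linear[of h f Y h f Y a 0] by simp

lemma wk_integral_sum:
  assumes "finite I" "I \<noteq> {}" "\<And>i. i \<in> I \<Longrightarrow> wk_integral (f i) (Y i)"
  shows "wk_integral (\<lambda>x. \<Sum>i\<in>I. a i * f i x) (\<lambda>\<omega>. \<Sum>i\<in>I. a i * Y i \<omega>)"
  using assms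
proof (induction I rule: finite_ne_induct)
  case (singleton i)
  then show ?case using wk_integral_linear[of "f i" "Y i" "f i" "Y i" "a i" 0] by simp
next
  case (insert i I)
  then have "wk_integral (f i) (Y i)" "wk_integral (\<lambda>x. \<Sum>i\<in>I. a i * f i x) (\<lambda>\<omega>. \<Sum>i\<in>I. a i * Y i \<omega>)" by auto
  from wk_integral_linear[OF this, of "a i" 1] insert show ?case by simp
qed

text \<open>The differences of the simple integrals tend to 0 in probability, so the moduli
  \<open>exp (- \<integral>\<psi>)\<close> of their characteristic functions tend to 1. Taking
  moduli keeps the logarithm real.\<close>

lemma wk_approx_diff_tendsto:
  assumes h: "wk_approx h f Y" and r: "filterlim r at_top sequentially" and s: "filterlim s at_top sequentially"
  shows "(\<lambda>k. \<integral>x. \<psi> (h (r k) x - h (s k) x) \<partial>m) \<longlonglongrightarrow> 0"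
proof -
  have hs: "rr_simple m (h n)" for n using h by (simp add: wk_approx_def)
  have [measurable]: "S (h n) \<in> borel_measurable M" "Y \<in> borel_measurable M" for n
    using h by (auto simp: wk_approx_def)
  have c: "(\<lambda>n. prob {\<omega>\<in>space M. \<bar>S (h n) \<omega> - Y \<omega>\<bar> > e}) \<longlonglongrightarrow> 0" if "0 < e" for e
    using h that by (auto simp: wk_approx_def conv_in_prob_def)
  have "(\<lambda>k. (CLINT \<omega>|M. iexp (1 * (S (h (r k)) \<omega> - S (h (s k)) \<omega>))) - (CLINT \<omega>|M. iexp (1 * 0))) \<longlonglongrightarrow> 0"
  proof (rule prob_tendsto_0_imp_char_tendsto)
    fix e :: real assume e: "0 < e"
    have le: "prob {\<omega>\<in>space M. \<bar>S (h (r k)) \<omega> - S (h (s k)) \<omega> - 0\<bar> > e} \<le> prob {\<omega>\<in>space M. \<bar>S (h (r k)) \<omega> - Y \<omega>\<bar> > e / 2} + prob {\<omega>\<in>space M. \<bar>S (h (s k)) \<omega> - Y \<omega>\<bar> > e / 2}" for k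
      by (rule prob_abs_add_gt_le) (auto intro!: AE_I2)
    have "(\<lambda>k. prob {\<omega>\<in>space M. \<bar>S (h (r k)) \<omega> - Y \<omega>\<bar> > e / 2} + prob {\<omega>\<in>space M. \<bar>S (h (s k)) \<omega> - Y \<omega>\<bar> > e / 2}) \<longlonglongrightarrow> 0 + 0"
      by (intro tendsto_add filterlim_compose[OF c r] filterlim_compose[OF c s] half_gt_zero e)
    then show "(\<lambda>k. prob {\<omega>\<in>space M. \<bar>S (h (r k)) \<omega> - S (h (s k)) \<omega> - 0\<bar> > e}) \<longlonglongrightarrow> 0"
      unfolding add_0
      by (rule Lim_null_comparison[OF always_eventually[OF allI], rotated])
         (unfold real_norm_def abs_of_nonneg[OF measure_nonneg], rule le)
  qed measurable
  moreover have "(CLINT \<omega>|M. iexp (1 * (S (h (r k)) \<omega> - S (h (s k)) \<omega>))) = (CLINT \<omega>|M. iexp (S (\<lambda>x. h (r k) x - h (s k) x) \<omega>))" for k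
  proof (rule integral_cong_AE)
    have [measurable]: "S (\<lambda>x. h (r k) x - h (s k) x) \<in> borel_measurable M"
      by (intro S_measurable rr_simple_diff hs)
    show "(\<lambda>\<omega>. iexp (S (\<lambda>x. h (r k) x - h (s k) x) \<omega>)) \<in> borel_measurable M" by measurable
    show "AE \<omega> in M. iexp (1 * (S (h (r k)) \<omega> - S (h (s k)) \<omega>)) = iexp (S (\<lambda>x. h (r k) x - h (s k) x) \<omega>)"
      using S_diff[OF hs hs, of "r k" "s k"] by eventually_elim simp
  qed measurable
  ultimately have "(\<lambda>k. (CLINT \<omega>|M. iexp (S (\<lambda>x. h (r k) x - h (s k) x) \<omega>))) \<longlonglongrightarrow> 1"
    by (simp add: prob_space LIM_zero_iff)
  from tendsto_norm[OF this] have "(\<lambda>k. exp (- (\<integral>x. \<psi> (h (r k) x - h (s k) x) \<partial>m))) \<longlonglongrightarrow> 1"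
    by (simp add: norm_S_char rr_simple_diff hs)
  then have "(\<lambda>k. ln (exp (- (\<integral>x. \<psi> (h (r k) x - h (s k) x) \<partial>m)))) \<longlonglongrightarrow> ln 1"
    by (rule tendsto_ln) simp
  then show ?thesis by (simp add: tendsto_minus_cancel_left[symmetric])
qed

text \<open>Fatou's lemma in the second index of the preceding Cauchy bound, where
  \<open>h k\<close> tends to \<open>f\<close> almost everywhere.\<close>

lemma wk_approx_nn_integral:
  assumes h: "wk_approx h f Y" and e: "0 < e"
  shows "\<exists>N. \<forall>n\<ge>N. (\<integral>\<^sup>+x. ennreal (\<psi> (h n x - f x)) \<partial>m) \<le> ennreal e"
proof -
  have hs: "rr_simple m (h n)" for n using h by (simp add: wk_approx_def)
  have [measurable]: "h n \<in> borel_measurable m" for n using rr_simpleD(2)[OF hs] .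
  have lim: "AE x in m. (\<lambda>n. h n x) \<longlonglongrightarrow> f x" using h by (simp add: wk_approx_def)
  obtain N where N: "\<And>n k. n \<ge> N \<Longrightarrow> k \<ge> N \<Longrightarrow> (\<integral>x. \<psi> (h n x - h k x) \<partial>m) < e"
    using double_sequence_tendsto_0[of "\<lambda>n k. \<integral>x. \<psi> (h n x - h k x) \<partial>m", OF wk_approx_diff_tendsto[OF h] e] by blast
  have "(\<integral>\<^sup>+x. ennreal (\<psi> (h n x - f x)) \<partial>m) \<le> ennreal e" if n: "n \<ge> N" for n
  proof -
    have "(\<integral>\<^sup>+x. ennreal (\<psi> (h n x - f x)) \<partial>m) = (\<integral>\<^sup>+x. liminf (\<lambda>k. ennreal (\<psi> (h n x - h k x))) \<partial>m)"
    proof (rule nn_integral_cong_AE)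
      show "AE x in m. ennreal (\<psi> (h n x - f x)) = liminf (\<lambda>k. ennreal (\<psi> (h n x - h k x)))"
        using lim
      proof eventually_elim
        case (elim x)
        have "(\<lambda>k. ennreal (\<psi> (h n x - h k x))) \<longlonglongrightarrow> ennreal (\<psi> (h n x - f x))"
          by (intro tendsto_ennrealI continuous_on_tendsto_compose[OF \<psi>_cont] tendsto_intros elim) auto
        then show ?case by (intro lim_imp_Liminf[symmetric]) auto
      qed
    qed
    also have "\<dots> \<le> liminf (\<lambda>k. \<integral>\<^sup>+x. ennreal (\<psi> (h n x - h k x)) \<partial>m)"
      by (rule nn_integral_liminf) measurable
    also have "\<dots> \<le> ennreal e"
    proof (rule Liminf_le)
      have eq: "(\<integral>\<^sup>+x. ennreal (\<psi> (h n x - h k x)) \<partial>m) = ennreal (\<integral>x. \<psi> (h n x - h k x) \<partial>m)" for k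
        using rr_simple_compose_integrable(1)[OF rr_simple_diff[OF hs hs], of \<psi> n k]
        by (intro nn_integral_eq_integral) auto
      have "(\<integral>\<^sup>+x. ennreal (\<psi> (h n x - h k x)) \<partial>m) \<le> ennreal e" if k: "k \<ge> N" for k
        unfolding eq by (rule ennreal_leI, rule less_imp_le, rule N[OF n k])
      then show "\<forall>\<^sub>F k in sequentially. (\<integral>\<^sup>+x. ennreal (\<psi> (h n x - h k x)) \<partial>m) \<le> ennreal e"
        unfolding eventually_sequentially by blast
    qed simp
    finally show ?thesis .
  qed
  then show ?thesis by blast
qed

lemma wk_approx_integrable:
  assumes h: "wk_approx h f Y"
  shows "integrable m (\<lambda>x. \<psi> (f x))" "\<exists>N. \<forall>n\<ge>N. integrable m (\<lambda>x. \<psi> (h n x - f x))"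
    "(\<lambda>n. \<integral>x. \<psi> (h n x - f x) \<partial>m) \<longlonglongrightarrow> 0"
proof -
  have hs: "rr_simple m (h n)" for n using h by (simp add: wk_approx_def)
  have [measurable]: "h n \<in> borel_measurable m" "f \<in> borel_measurable m" for n
    using rr_simpleD(2)[OF hs] h by (auto simp: wk_approx_def)
  have i: "integrable m (\<lambda>x. \<psi> (h n x - f x))" if "(\<integral>\<^sup>+x. ennreal (\<psi> (h n x - f x)) \<partial>m) \<le> ennreal e" for n e
    using that by (intro integrableI_bounded) (auto simp: top_unique less_top[symmetric])
  obtain N where N: "\<And>n. n \<ge> N \<Longrightarrow> (\<integral>\<^sup>+x. ennreal (\<psi> (h n x - f x)) \<partial>m) \<le> ennreal 1"
    using wk_approx_nn_integral[OF h, of 1] by auto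
  show "\<exists>N. \<forall>n\<ge>N. integrable m (\<lambda>x. \<psi> (h n x - f x))" using i[OF N] by blast
  obtain D where D: "D > 0" "\<And>x y. \<psi> (x + y) \<le> D * (\<psi> x + \<psi> y)" using \<psi>_quasi by blast
  show "integrable m (\<lambda>x. \<psi> (f x))"
  proof (rule Bochner_Integration.integrable_bound)
    show "integrable m (\<lambda>x. D * (\<psi> (h N x - f x) + \<psi> (h N x)))"
      using i[OF N, of N] rr_simple_compose_integrable(1)[OF hs, of \<psi> N] by simp
    have "\<psi> (f x) \<le> D * (\<psi> (h N x - f x) + \<psi> (h N x))" for x
      using D(2)[of "- (h N x - f x)" "h N x"] \<psi>_minus[of "h N x - f x"] by simp
    then show "AE x in m. norm (\<psi> (f x)) \<le> norm (D * (\<psi> (h N x - f x) + \<psi> (h N x)))"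
      by (intro AE_I2) (simp add: order_trans[OF _ abs_ge_self])
  qed measurable
  show "(\<lambda>n. \<integral>x. \<psi> (h n x - f x) \<partial>m) \<longlonglongrightarrow> 0"
  proof (rule LIMSEQ_I)
    fix e :: real assume e: "0 < e"
    obtain N where N: "\<And>n. n \<ge> N \<Longrightarrow> (\<integral>\<^sup>+x. ennreal (\<psi> (h n x - f x)) \<partial>m) \<le> ennreal (e / 2)"
      using wk_approx_nn_integral[OF h, of "e / 2"] e by auto
    have "norm ((\<integral>x. \<psi> (h n x - f x) \<partial>m) - 0) < e" if "n \<ge> N" for n
    proof -
      have "ennreal (\<integral>x. \<psi> (h n x - f x) \<partial>m) \<le> ennreal (e / 2)"
        using N[OF that] i[OF N[OF that]] by (subst nn_integral_eq_integral[symmetric]) auto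
      then have "(\<integral>x. \<psi> (h n x - f x) \<partial>m) \<le> e / 2" using e by (subst (asm) ennreal_le_iff) auto
      then show ?thesis using e by (simp add: abs_of_nonneg)
    qed
    then show "\<exists>N. \<forall>n\<ge>N. norm ((\<integral>x. \<psi> (h n x - f x) \<partial>m) - 0) < e" by blast
  qed
qed

text \<open>The part of \<open>norm (k (h n x) - k (f x))\<close> below
  \<open>E * \<psi> (f x)\<close> tends to 0 by dominated convergence; the excess is at most
  \<open>E * \<psi> (h n x - f x)\<close>, whose integral tends to 0. No majorant of the whole
  sequence \<open>h\<close> is available.\<close>

lemma wk_approx_integral_tendsto:
  fixes k :: "real \<Rightarrow> complex"
  assumes h: "wk_approx h f Y" and kc: "continuous_on UNIV k" and kb: "\<And>y. norm (k y) \<le> C * \<psi> y"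
  shows "integrable m (\<lambda>x. k (f x))" "(\<lambda>n. \<integral>x. k (h n x) \<partial>m) \<longlonglongrightarrow> (\<integral>x. k (f x) \<partial>m)"
proof -
  have hs: "rr_simple m (h n)" for n using h by (simp add: wk_approx_def)
  have [measurable]: "h n \<in> borel_measurable m" "f \<in> borel_measurable m" for n
    using rr_simpleD(2)[OF hs] h by (auto simp: wk_approx_def)
  have [measurable]: "k \<in> borel_measurable borel" by (rule borel_measurable_continuous_onI[OF kc])
  have k0: "k 0 = 0" using kb[of 0] by simp
  note I = wk_approx_integrable[OF h]
  show ik: "integrable m (\<lambda>x. k (f x))"
  proof (rule Bochner_Integration.integrable_bound[OF integrable_mult_right[OF I(1), of C]])
    show "AE x in m. norm (k (f x)) \<le> norm (C * \<psi> (f x))"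
      using kb by (intro AE_I2) (auto intro: order_trans[OF _ abs_ge_self])
  qed measurable
  obtain D where D: "D > 0" "\<And>x y. \<psi> (x + y) \<le> D * (\<psi> x + \<psi> y)" using \<psi>_quasi by blast
  define C' where "C' = max C 0"
  have kb': "norm (k y) \<le> C' * \<psi> y" for y
    using kb[of y] mult_right_mono[of C C' "\<psi> y"] by (simp add: C'_def)
  \<comment> \<open>Quasi-subadditivity bounds
    \<open>C' * \<psi> (h n x) + C' * \<psi> (f x)\<close> by
    \<open>C' * (D + 1) * \<psi> (f x) + C' * D * \<psi> (h n x - f x)\<close>.\<close>
  define E where "E = C' * (D + 1)"
  have E0: "0 \<le> E" using D by (simp add: E_def C'_def)
  have bound: "norm (k (h n x) - k (f x)) \<le> E * \<psi> (f x) + E * \<psi> (h n x - f x)" for n x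
  proof -
    have "\<psi> (h n x) \<le> D * (\<psi> (h n x - f x) + \<psi> (f x))" using D(2)[of "h n x - f x" "f x"] by simp
    then have "C' * \<psi> (h n x) \<le> C' * (D * (\<psi> (h n x - f x) + \<psi> (f x)))" by (intro mult_left_mono) (auto simp: C'_def)
    moreover have "0 \<le> C' * \<psi> (h n x - f x)" by (simp add: C'_def)
    ultimately show ?thesis
      using norm_triangle_ineq4[of "k (h n x)" "k (f x)"] kb'[of "h n x"] kb'[of "f x"]
      by (simp add: E_def algebra_simps)
  qed
  let ?mn = "\<lambda>n x. min (norm (k (h n x) - k (f x))) (E * \<psi> (f x))"
  have iE: "integrable m (\<lambda>x. E * \<psi> (f x))" using I(1) by simp
  have imn: "integrable m (?mn n)" for n
    by (rule Bochner_Integration.integrable_bound[OF iE]) (use E0 in auto)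
  have "(\<lambda>n. \<integral>x. ?mn n x \<partial>m) \<longlonglongrightarrow> (\<integral>x. 0 \<partial>m)"
  proof (rule integral_dominated_convergence[where w="\<lambda>x. E * \<psi> (f x)"])
    have "AE x in m. (\<lambda>n. h n x) \<longlonglongrightarrow> f x" using h by (simp add: wk_approx_def)
    then show "AE x in m. (\<lambda>n. ?mn n x) \<longlonglongrightarrow> 0"
    proof eventually_elim
      case (elim x)
      have "(\<lambda>n. k (h n x)) \<longlonglongrightarrow> k (f x)" by (intro continuous_on_tendsto_compose[OF kc] elim) auto
      then have "(\<lambda>n. ?mn n x) \<longlonglongrightarrow> min (norm (k (f x) - k (f x))) (E * \<psi> (f x))" by (intro tendsto_intros)
      then show ?case using E0 by (simp add: min_absorb1)
    qed
  qed (use iE E0 in auto)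
  then have "(\<lambda>n. (\<integral>x. ?mn n x \<partial>m) + E * (\<integral>x. \<psi> (h n x - f x) \<partial>m)) \<longlonglongrightarrow> 0 + E * 0"
    using I(3) by (intro tendsto_intros) simp_all
  then have lim0: "(\<lambda>n. (\<integral>x. ?mn n x \<partial>m) + E * (\<integral>x. \<psi> (h n x - f x) \<partial>m)) \<longlonglongrightarrow> 0" by simp
  obtain N where N: "\<And>n. n \<ge> N \<Longrightarrow> integrable m (\<lambda>x. \<psi> (h n x - f x))" using I(2) by blast
  have "norm ((\<integral>x. k (h n x) \<partial>m) - (\<integral>x. k (f x) \<partial>m)) \<le> (\<integral>x. ?mn n x \<partial>m) + E * (\<integral>x. \<psi> (h n x - f x) \<partial>m)" if n: "n \<ge> N" for n
  proof -
    have ih: "integrable m (\<lambda>x. k (h n x))" by (rule rr_simple_compose_integrable(1)[OF hs, where k=k, OF k0])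
    have "norm ((\<integral>x. k (h n x) \<partial>m) - (\<integral>x. k (f x) \<partial>m)) = norm (\<integral>x. k (h n x) - k (f x) \<partial>m)"
      using ih ik by simp
    also have "\<dots> \<le> (\<integral>x. norm (k (h n x) - k (f x)) \<partial>m)" by (rule integral_norm_bound)
    also have "\<dots> \<le> (\<integral>x. ?mn n x + E * \<psi> (h n x - f x) \<partial>m)"
    proof (rule integral_mono)
      show "integrable m (\<lambda>x. norm (k (h n x) - k (f x)))" using ih ik by (intro integrable_norm Bochner_Integration.integrable_diff)
      show "integrable m (\<lambda>x. ?mn n x + E * \<psi> (h n x - f x))" using imn N[OF n] by simp
      show "norm (k (h n x) - k (f x)) \<le> ?mn n x + E * \<psi> (h n x - f x)" for x
        using bound[of n x] E0 by (auto simp: min_def)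
    qed
    also have "\<dots> = (\<integral>x. ?mn n x \<partial>m) + E * (\<integral>x. \<psi> (h n x - f x) \<partial>m)"
      using imn N[OF n] by simp
    finally show ?thesis .
  qed
  then have "\<forall>\<^sub>F n in sequentially. norm ((\<integral>x. k (h n x) \<partial>m) - (\<integral>x. k (f x) \<partial>m)) \<le> (\<integral>x. ?mn n x \<partial>m) + E * (\<integral>x. \<psi> (h n x - f x) \<partial>m)"
    by (auto simp: eventually_sequentially)
  from Lim_null_comparison[OF this lim0]
  show "(\<lambda>n. \<integral>x. k (h n x) \<partial>m) \<longlonglongrightarrow> (\<integral>x. k (f x) \<partial>m)" by (simp add: LIM_zero_iff)
qed

lemma wk_approx_char_tendsto:
  assumes h: "wk_approx h f Y"
  shows "(\<lambda>n. exp (\<integral>x. \<kappa> (h n x) \<partial>m)) \<longlonglongrightarrow> (CLINT \<omega>|M. iexp (Y \<omega>))"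
proof -
  have hs: "rr_simple m (h n)" for n using h by (simp add: wk_approx_def)
  have "(\<lambda>n. CLINT \<omega>|M. iexp (1 * S (h n) \<omega>)) \<longlonglongrightarrow> (CLINT \<omega>|M. iexp (1 * Y \<omega>))"
    by (rule conv_in_prob_imp_char_tendsto) (use h in \<open>auto simp: wk_approx_def\<close>)
  then show ?thesis by (simp add: S_char hs)
qed

text \<open>Obtained with \<open>k = \<psi>\<close>, which trivially dominates itself. It is thus
  available before any sector bound for \<kappa> is known.\<close>

lemma wk_integral_norm_char:
  assumes f: "wk_integral f Y"
  shows "integrable m (\<lambda>x. \<psi> (f x))" "norm (CLINT \<omega>|M. iexp (Y \<omega>)) = exp (- (\<integral>x. \<psi> (f x) \<partial>m))"
proof -
  obtain h where h: "wk_approx h f Y" using f by (auto simp: wk_integral_def)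
  have hs: "rr_simple m (h n)" for n using h by (simp add: wk_approx_def)
  show "integrable m (\<lambda>x. \<psi> (f x))" by (rule wk_approx_integrable[OF h])
  have "(\<lambda>n. \<integral>x. complex_of_real (\<psi> (h n x)) \<partial>m) \<longlonglongrightarrow> (\<integral>x. complex_of_real (\<psi> (f x)) \<partial>m)"
    by (rule wk_approx_integral_tendsto[OF h, where C=1]) (auto intro!: continuous_intros continuous_on_compose2[OF \<psi>_cont])
  then have "(\<lambda>n. complex_of_real (\<integral>x. \<psi> (h n x) \<partial>m)) \<longlonglongrightarrow> complex_of_real (\<integral>x. \<psi> (f x) \<partial>m)" by simp
  then have "(\<lambda>n. \<integral>x. \<psi> (h n x) \<partial>m) \<longlonglongrightarrow> (\<integral>x. \<psi> (f x) \<partial>m)" unfolding tendsto_of_real_iff .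
  then have "(\<lambda>n. exp (- (\<integral>x. \<psi> (h n x) \<partial>m))) \<longlonglongrightarrow> exp (- (\<integral>x. \<psi> (f x) \<partial>m))" by (intro tendsto_intros)
  moreover have "(\<lambda>n. exp (- (\<integral>x. \<psi> (h n x) \<partial>m))) \<longlonglongrightarrow> norm (CLINT \<omega>|M. iexp (Y \<omega>))"
    using tendsto_norm[OF wk_approx_char_tendsto[OF h]] norm_S_char[OF hs] by (simp add: S_char[OF hs])
  ultimately show "norm (CLINT \<omega>|M. iexp (Y \<omega>)) = exp (- (\<integral>x. \<psi> (f x) \<partial>m))"
    using LIMSEQ_unique by blast
qed

text \<open>The bound \<open>sector\<close> keeps \<kappa> in a sector around the negative real
  axis, so that the imaginary part of the exponent converges along with the real part.\<close>

lemma wk_integral_char: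
  assumes f: "wk_integral f Y" and sector: "\<And>y. norm (\<kappa> y) \<le> C * \<psi> y"
  shows "integrable m (\<lambda>x. \<kappa> (f x))" "(CLINT \<omega>|M. iexp (Y \<omega>)) = exp (\<integral>x. \<kappa> (f x) \<partial>m)"
proof -
  obtain h where h: "wk_approx h f Y" using f by (auto simp: wk_integral_def)
  note L = wk_approx_integral_tendsto[OF h \<kappa>_cont sector]
  show "integrable m (\<lambda>x. \<kappa> (f x))" by (rule L)
  have "(\<lambda>n. exp (\<integral>x. \<kappa> (h n x) \<partial>m)) \<longlonglongrightarrow> exp (\<integral>x. \<kappa> (f x) \<partial>m)" by (intro tendsto_intros L)
  then show "(CLINT \<omega>|M. iexp (Y \<omega>)) = exp (\<integral>x. \<kappa> (f x) \<partial>m)"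
    using wk_approx_char_tendsto[OF h] LIMSEQ_unique by blast
qed

end

section \<open>Levy's continuity theorem\<close>

inductive trig_sum :: "('a::real_inner \<Rightarrow> real) \<Rightarrow> bool" where
  cos: "trig_sum (\<lambda>x. cos (z \<bullet> x))"
| sin: "trig_sum (\<lambda>x. sin (z \<bullet> x))"
| add: "trig_sum f \<Longrightarrow> trig_sum g \<Longrightarrow> trig_sum (\<lambda>x. f x + g x)"
| scale: "trig_sum f \<Longrightarrow> trig_sum (\<lambda>x. c * f x)"

lemma trig_sum_const: "trig_sum (\<lambda>x. c)"
  using trig_sum.scale[OF trig_sum.cos[of 0], of c] by simp

lemma trig_sum_sum: "finite I \<Longrightarrow> (\<And>i. i \<in> I \<Longrightarrow> trig_sum (f i)) \<Longrightarrow> trig_sum (\<lambda>x. \<Sum>i\<in>I. f i x)"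
  by (induction I rule: finite_induct) (auto intro: trig_sum_const trig_sum.add)

lemma trig_sum_mult_basic:
  assumes "h = (\<lambda>x. cos (z \<bullet> x)) \<or> h = (\<lambda>x. sin (z \<bullet> x))" and "trig_sum g"
  shows "trig_sum (\<lambda>x. h x * g x)"
  using assms(2)
proof induction
  case (cos w)
  have 1: "trig_sum (\<lambda>x. (1/2) * cos ((z - w) \<bullet> x) + (1/2) * cos ((z + w) \<bullet> x))"
    by (intro trig_sum.intros)
  have 2: "trig_sum (\<lambda>x. (1/2) * sin ((z + w) \<bullet> x) + (1/2) * sin ((z - w) \<bullet> x))"
    by (intro trig_sum.intros)
  from assms(1) show ?case
  proof
    assume h: "h = (\<lambda>x. cos (z \<bullet> x))"
    show ?thesis using 1 unfolding h by (simp add: cos_times_cos inner_diff_left inner_add_left add_divide_distrib)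
  next
    assume h: "h = (\<lambda>x. sin (z \<bullet> x))"
    show ?thesis using 2 unfolding h by (simp add: sin_times_cos inner_diff_left inner_add_left add_divide_distrib)
  qed
next
  case (sin w)
  have 1: "trig_sum (\<lambda>x. (1/2) * sin ((z + w) \<bullet> x) + (-1/2) * sin ((z - w) \<bullet> x))"
    by (intro trig_sum.intros)
  have 2: "trig_sum (\<lambda>x. (1/2) * cos ((z - w) \<bullet> x) + (-1/2) * cos ((z + w) \<bullet> x))"
    by (intro trig_sum.intros)
  from assms(1) show ?case
  proof
    assume h: "h = (\<lambda>x. cos (z \<bullet> x))"
    show ?thesis using 1 unfolding h by (simp add: cos_times_sin inner_diff_left inner_add_left diff_divide_distrib)
  next
    assume h: "h = (\<lambda>x. sin (z \<bullet> x))"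
    show ?thesis using 2 unfolding h by (simp add: sin_times_sin inner_diff_left inner_add_left diff_divide_distrib)
  qed
next
  case (add f g)
  then show ?case using trig_sum.add[OF add.IH] by (simp add: distrib_left)
next
  case (scale f c)
  then show ?case using trig_sum.scale[OF scale.IH, of c] by (simp add: mult.left_commute)
qed

lemma trig_sum_mult:
  assumes "trig_sum f" "trig_sum g"
  shows "trig_sum (\<lambda>x. f x * g x)"
  using assms(1)
proof induction
  case (add f h)
  then show ?case using trig_sum.add[OF add.IH] by (simp add: distrib_right)
next
  case (scale f c)
  then show ?case using trig_sum.scale[OF scale.IH, of c] by (simp add: mult.assoc)
qed (use assms(2) in \<open>auto intro: trig_sum_mult_basic\<close>)

lemma trig_sum_continuous: "trig_sum f \<Longrightarrow> continuous_on UNIV f"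
  by (induction rule: trig_sum.induct) (auto intro!: continuous_intros)

lemma trig_sum_bounded: "trig_sum f \<Longrightarrow> \<exists>B. \<forall>x. \<bar>f x\<bar> \<le> B"
proof (induction rule: trig_sum.induct)
  case (add f g)
  then obtain B C where "\<And>x. \<bar>f x\<bar> \<le> B" "\<And>x. \<bar>g x\<bar> \<le> C" by blast
  then have "\<bar>f x + g x\<bar> \<le> B + C" for x by (meson abs_triangle_ineq add_mono order_trans)
  then show ?case by blast
next
  case (scale f c)
  then obtain B where "\<And>x. \<bar>f x\<bar> \<le> B" by blast
  then have "\<bar>c * f x\<bar> \<le> \<bar>c\<bar> * B" for x by (simp add: abs_mult mult_left_mono)
  then show ?case by blast
qed (auto intro: abs_cos_le_one abs_sin_le_one)

text \<open>The wrapping map \<open>x \<mapsto> (cos (x / r), sin (x / r))\<close> embeds the cube of radius \<open>r\<close> into a torus; a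
  polynomial approximation of an extension to the torus is bounded on the whole space.\<close>

lemma trig_sum_approximation:
  fixes g :: "real^'n::finite \<Rightarrow> real"
  assumes cont: "continuous_on UNIV g" and B: "\<And>x. \<bar>g x\<bar> \<le> B" and e: "0 < e" and r: "0 < r"
  obtains q where "trig_sum q" "\<And>x. (\<And>i. \<bar>x $ i\<bar> \<le> r) \<Longrightarrow> \<bar>g x - q x\<bar> < e" "\<And>x. \<bar>q x\<bar> \<le> B + e"
proof -
  define E :: "real^'n \<Rightarrow> (real^'n) \<times> (real^'n)" where "E x = (\<chi> i. cos (x $ i / r), \<chi> i. sin (x $ i / r))" for x
  define S :: "(real^'n) set" where "S = cbox (\<chi> i. - r) (\<chi> i. r)"
  have S: "x \<in> S \<longleftrightarrow> (\<forall>i. \<bar>x $ i\<bar> \<le> r)" for x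
    by (auto simp: S_def mem_box_cart abs_le_iff minus_le_iff)
  have Econt: "continuous_on A E" for A unfolding E_def
    by (intro continuous_intros) (use r in auto)
  have inj: "inj_on E S"
  proof (rule inj_onI)
    fix x y assume x: "x \<in> S" and y: "y \<in> S" and eq: "E x = E y"
    show "x = y"
    proof (rule vec_eq_iff[THEN iffD2], rule allI)
      fix i
      have c: "cos (x $ i / r) = cos (y $ i / r)" "sin (x $ i / r) = sin (y $ i / r)"
        using eq by (auto simp: E_def vec_eq_iff)
      have bx: "\<bar>x $ i / r\<bar> \<le> 1" "\<bar>y $ i / r\<bar> \<le> 1" using x y r by (auto simp: S field_simps)
      \<comment> \<open>The coordinates divided by \<open>r\<close> lie in [-1, 1], inside the
        interval where the sine is injective.\<close>
      have p: "pi / 2 > 1" using pi_gt3 by simp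
      have "x $ i / r = y $ i / r"
        by (rule sin_inj_pi[OF _ _ _ _ c(2)]) (use bx p in linarith)+
      then show "x $ i = y $ i" using r by simp
    qed
  qed
  have cS: "compact S" by (simp add: S_def compact_cbox)
  obtain E' where E': "homeomorphism S (E ` S) E E'"
    using homeomorphism_compact[OF cS Econt refl inj] by blast
  have "continuous_on (E ` S) (g \<circ> E')"
    using E' cont by (intro continuous_on_compose) (auto simp: homeomorphism_def intro: continuous_on_subset)
  moreover have "closedin (top_of_set UNIV) (E ` S)"
    using compact_continuous_image[OF Econt cS] by (simp add: compact_imp_closed)
  moreover have "0 \<le> B" using B[of 0] by linarith
  ultimately obtain G where G: "continuous_on UNIV G" "\<And>y. y \<in> E ` S \<Longrightarrow> G y = (g \<circ> E') y" "\<And>y. norm (G y) \<le> B"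
    using Tietze[of "E ` S" "g \<circ> E'" UNIV B] B by (metis UNIV_I comp_apply real_norm_def)
  define K :: "((real^'n) \<times> (real^'n)) set" where "K = cbox (\<chi> i. -1, \<chi> i. -1) (\<chi> i. 1, \<chi> i. 1)"
  have EK: "E x \<in> K" for x
  proof -
    have "(\<chi> i. cos (x $ i / r)) \<in> cbox (\<chi> i. -1) (\<chi> i. (1 :: real))" "(\<chi> i. sin (x $ i / r)) \<in> cbox (\<chi> i. -1) (\<chi> i. (1 :: real))"
      by (auto simp: mem_box_cart)
    then show ?thesis unfolding K_def E_def cbox_Pair_eq by blast
  qed
  have "compact K" "continuous_on K G" using G(1) by (auto simp: K_def intro: continuous_on_subset)
  then obtain P where P: "real_polynomial_function P" "\<And>y. y \<in> K \<Longrightarrow> \<bar>G y - P y\<bar> < e"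
    using e by (rule Stone_Weierstrass_real_polynomial_function) blast
  have trig: "trig_sum (\<lambda>x. P (E x))"
    using P(1)
  proof induction
    case (linear f)
    interpret bounded_linear f by (rule linear)
    have "f (E x) = (\<Sum>i\<in>UNIV. f (axis i 1, 0) * cos (axis i (1 / r) \<bullet> x)) + (\<Sum>i\<in>UNIV. f (0, axis i 1) * sin (axis i (1 / r) \<bullet> x))" for x
    proof -
      have b: "v = (\<Sum>i\<in>UNIV. (v $ i) *\<^sub>R axis i 1)" for v :: "real^'n"
        using basis_expansion[of v] by (simp add: scalar_mult_eq_scaleR)
      have s: "(\<Sum>i\<in>I. (h i, 0 :: real^'n)) = (\<Sum>i\<in>I. h i, 0)" "(\<Sum>i\<in>I. (0 :: real^'n, h i)) = (0, \<Sum>i\<in>I. h i)" for h :: "'n \<Rightarrow> real^'n" and I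
        by (induction I rule: infinite_finite_induct) (auto simp: zero_prod_def)
      have "E x = (\<Sum>i\<in>UNIV. cos (x $ i / r) *\<^sub>R (axis i 1, 0)) + (\<Sum>i\<in>UNIV. sin (x $ i / r) *\<^sub>R (0, axis i 1))"
        using b[of "\<chi> i. cos (x $ i / r)"] b[of "\<chi> i. sin (x $ i / r)"] by (simp add: E_def s)
      moreover have "f (c *\<^sub>R v, 0) = c * f (v, 0)" "f (0, c *\<^sub>R v) = c * f (0, v)" for c v
        using scale[of c "(v, 0)"] scale[of c "(0, v)"] by simp_all
      ultimately show ?thesis by (simp add: add sum inner_axis' mult.commute)
    qed
    then show ?case by (simp only:) (intro trig_sum.add trig_sum_sum trig_sum.scale trig_sum.cos trig_sum.sin finite)
  qed (auto intro: trig_sum_const trig_sum.add trig_sum_mult)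
  have 1: "\<bar>g x - P (E x)\<bar> < e" if "\<And>i. \<bar>x $ i\<bar> \<le> r" for x
  proof -
    have "x \<in> S" using that by (simp add: S)
    then have "E' (E x) = x" using E' by (simp add: homeomorphism_def)
    then show ?thesis using P(2)[OF EK[of x]] G(2)[of "E x"] \<open>x \<in> S\<close> by simp
  qed
  have 2: "\<bar>P (E x)\<bar> \<le> B + e" for x
    using P(2)[OF EK[of x]] G(3)[of "E x"] by (simp add: abs_le_iff abs_less_iff)
  show ?thesis by (rule that[OF trig 1 2])
qed

section \<open>Tightness and weak convergence from characteristic functions\<close>

lemma trig_sum_integral_tendsto:
  fixes \<mu> :: "nat \<Rightarrow> (real^'n::finite) measure"
  assumes P: "\<And>n. prob_space (\<mu> n)" "prob_space \<nu>" and S: "\<And>n. sets (\<mu> n) = sets borel" "sets \<nu> = sets borel"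
    and lim: "\<And>z. (\<lambda>n. CLINT x|\<mu> n. iexp (z \<bullet> x)) \<longlonglongrightarrow> (CLINT x|\<nu>. iexp (z \<bullet> x))"
    and q: "trig_sum q"
  shows "(\<lambda>n. \<integral>x. q x \<partial>\<mu> n) \<longlonglongrightarrow> (\<integral>x. q x \<partial>\<nu>)"
proof -
  have int: "integrable M f" if p: "prob_space M" "sets M = sets borel" "trig_sum f" for M f
  proof -
    interpret prob_space M by fact
    obtain B where "\<And>x. \<bar>f x\<bar> \<le> B" using trig_sum_bounded[OF p(3)] by blast
    moreover have "f \<in> borel_measurable M"
      using borel_measurable_continuous_onI[OF trig_sum_continuous[OF p(3)]] p(2) measurable_cong_sets by blast
    ultimately show ?thesis by (intro integrable_const_bound[where B=B]) auto
  qed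
  have re: "(\<integral>x. cos (z \<bullet> x) \<partial>M) = Re (CLINT x|M. iexp (z \<bullet> x)) \<and> (\<integral>x. sin (z \<bullet> x) \<partial>M) = Im (CLINT x|M. iexp (z \<bullet> x))"
    if "prob_space M" "sets M = sets borel" for M :: "(real^'n) measure" and z
  proof -
    interpret prob_space M by fact
    have "(\<lambda>x. z \<bullet> x) \<in> borel_measurable M"
      using that(2) measurable_cong_sets[of M borel borel borel] by (simp add: borel_measurable_inner)
    then have "complex_integrable M (\<lambda>x. iexp (z \<bullet> x))" by (intro integrable_iexp) auto
    from integral_Re[OF this] integral_Im[OF this] show ?thesis by (simp add: Re_exp Im_exp)
  qed
  from q show ?thesis
  proof induction
    case (cos z)
    then show ?case using tendsto_Re[OF lim[of z]] P S by (simp add: re)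
  next
    case (sin z)
    then show ?case using tendsto_Im[OF lim[of z]] P S by (simp add: re)
  next
    case (add f g)
    have "integrable (\<mu> n) f" "integrable (\<mu> n) g" for n by (intro int P S add)+
    moreover have "integrable \<nu> f" "integrable \<nu> g" by (intro int P S add)+
    ultimately show ?case using add.IH by (simp add: tendsto_add)
  next
    case (scale f c)
    then show ?case by (simp add: tendsto_mult_left)
  qed
qed


text \<open>The Gaussian averages depend on the law through its characteristic function only. They
  converge along with it and are small for the limit law when \<open>r\<close> is large, so
  tightness is obtained rather than assumed.\<close>

lemma coordinate_tail_bound:
  fixes M :: "(real^'n::finite) measure"
  assumes P: "prob_space M" and S: "sets M = sets borel" and r: "0 < r"
  shows "measure M {x\<in>space M. \<exists>i. \<bar>x $ i\<bar> > r}
    \<le> (\<Sum>i\<in>UNIV. (\<integral>z. 1 - Re (CLINT x|M. iexp (((z / r) *\<^sub>R axis i 1) \<bullet> x)) \<partial>std_normal_distribution) / (1 - exp (- 1 / 2)))"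
proof -
  interpret prob_space M by fact
  have m: "(\<lambda>x. x $ i) \<in> borel_measurable M" for i
    using S measurable_cong_sets[of M borel borel borel] by simp
  have [measurable]: "{x\<in>space M. \<bar>x $ i\<bar> > r} \<in> sets M" for i using m[of i] by measurable
  have "{x\<in>space M. \<exists>i. \<bar>x $ i\<bar> > r} = (\<Union>i\<in>UNIV. {x\<in>space M. \<bar>x $ i\<bar> > r})" by auto
  then have "measure M {x\<in>space M. \<exists>i. \<bar>x $ i\<bar> > r} \<le> (\<Sum>i\<in>UNIV. measure M {x\<in>space M. \<bar>x $ i\<bar> > r})"
    by (simp only:) (rule measure_UNION_le, auto)
  also have "\<dots> \<le> (\<Sum>i\<in>UNIV. (\<integral>z. 1 - Re (CLINT x|M. iexp (((z / r) *\<^sub>R axis i 1) \<bullet> x)) \<partial>std_normal_distribution) / (1 - exp (- 1 / 2)))"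
  proof (rule sum_mono)
    fix i :: 'n
    have eq: "((z / r) *\<^sub>R axis i 1) \<bullet> x = z * (1 / r) * x $ i" for z :: real and x :: "real^'n" by (simp add: inner_axis')
    show "measure M {x\<in>space M. \<bar>x $ i\<bar> > r} \<le> (\<integral>z. 1 - Re (CLINT x|M. iexp (((z / r) *\<^sub>R axis i 1) \<bullet> x)) \<partial>std_normal_distribution) / (1 - exp (- 1 / 2))"
      unfolding eq by (rule prob_abs_gt_le[OF m r])
  qed
  finally show ?thesis .
qed

lemma coordinate_tail_limit:
  fixes M :: "(real^'n::finite) measure"
  assumes P: "prob_space M" and S: "sets M = sets borel"
  shows "(\<lambda>k. \<Sum>i\<in>UNIV. (\<integral>z. 1 - Re (CLINT x|M. iexp (((z / real (Suc k)) *\<^sub>R axis i 1) \<bullet> x)) \<partial>std_normal_distribution) / (1 - exp (- 1 / 2))) \<longlonglongrightarrow> 0"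
proof -
  interpret prob_space M by fact
  have m[measurable]: "(\<lambda>x. x $ i) \<in> borel_measurable M" for i
    using S measurable_cong_sets[of M borel borel borel] by simp
  have "(\<lambda>k. \<integral>z. 1 - Re (CLINT x|M. iexp (((z / real (Suc k)) *\<^sub>R axis i 1) \<bullet> x)) \<partial>std_normal_distribution) \<longlonglongrightarrow> 0" for i :: 'n
  proof -
    have eq: "((z / real (Suc k)) *\<^sub>R axis i 1) \<bullet> x = z * (1 / real (Suc k)) * x $ i" for z :: real and x :: "real^'n" and k by (simp add: inner_axis')
    have "(\<integral>z. 1 - Re (CLINT x|M. iexp (((z / real (Suc k)) *\<^sub>R axis i 1) \<bullet> x)) \<partial>std_normal_distribution)
       = expectation (\<lambda>x. 1 - exp (- ((1 / real (Suc k) * x $ i)\<^sup>2 / 2)))" for k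
      unfolding eq by (rule expectation_exp_neg_square[OF m, symmetric])
    moreover have "(\<lambda>k. expectation (\<lambda>x. 1 - exp (- ((1 / real (Suc k) * x $ i)\<^sup>2 / 2)))) \<longlonglongrightarrow> expectation (\<lambda>x. 0)"
    proof (rule integral_dominated_convergence[where w="\<lambda>_. 1"])
      have "(\<lambda>k. 1 - exp (- ((1 / real (Suc k) * y)\<^sup>2 / 2))) \<longlonglongrightarrow> 0" for y :: real
      proof -
        have "(\<lambda>k. 1 - exp (- ((1 / real (Suc k) * y)\<^sup>2 / 2))) \<longlonglongrightarrow> 1 - exp (- ((0 * y)\<^sup>2 / 2))"
          by (intro tendsto_intros LIMSEQ_Suc lim_1_over_n) simp
        then show ?thesis by simp
      qed
      then show "AE x in M. (\<lambda>k. 1 - exp (- ((1 / real (Suc k) * x $ i)\<^sup>2 / 2))) \<longlonglongrightarrow> 0" by simp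
    qed auto
    ultimately show ?thesis by simp
  qed
  then have "(\<lambda>k. \<Sum>i\<in>(UNIV::'n set). (\<integral>z. 1 - Re (CLINT x|M. iexp (((z / real (Suc k)) *\<^sub>R axis i 1) \<bullet> x)) \<partial>std_normal_distribution) / (1 - exp (- 1 / 2))) \<longlonglongrightarrow> (\<Sum>i\<in>(UNIV::'n set). 0 / (1 - exp (- 1 / 2)))"
    by (intro tendsto_sum tendsto_divide) auto
  then show ?thesis by simp
qed

lemma coordinate_tail_tendsto:
  fixes \<mu> :: "nat \<Rightarrow> (real^'n::finite) measure"
  assumes P: "\<And>n. prob_space (\<mu> n)" and S: "\<And>n. sets (\<mu> n) = sets borel"
    and lim: "\<And>z. (\<lambda>n. CLINT x|\<mu> n. iexp (z \<bullet> x)) \<longlonglongrightarrow> (CLINT x|\<nu>. iexp (z \<bullet> x))"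
  shows "(\<lambda>n. \<Sum>i\<in>UNIV. (\<integral>z. 1 - Re (CLINT x|\<mu> n. iexp (((z / r) *\<^sub>R axis i 1) \<bullet> x)) \<partial>std_normal_distribution) / (1 - exp (- 1 / 2)))
    \<longlonglongrightarrow> (\<Sum>i\<in>UNIV. (\<integral>z. 1 - Re (CLINT x|\<nu>. iexp (((z / r) *\<^sub>R axis i 1) \<bullet> x)) \<partial>std_normal_distribution) / (1 - exp (- 1 / 2)))"
proof -
  interpret N: real_distribution std_normal_distribution by (rule real_dist_normal_dist)
  let ?c = "\<lambda>n i z. Re (CLINT x|\<mu> n. iexp (((z / r) *\<^sub>R axis i 1) \<bullet> x))"
  let ?d = "\<lambda>i z. Re (CLINT x|\<nu>. iexp (((z / r) *\<^sub>R axis i 1) \<bullet> x))"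
  have b: "\<bar>?c n i z\<bar> \<le> 1" for n i z
  proof -
    interpret prob_space "\<mu> n" by (rule P)
    have "norm (CLINT x|\<mu> n. iexp (((z / r) *\<^sub>R axis i 1) \<bullet> x)) \<le> expectation (\<lambda>x. norm (iexp (((z / r) *\<^sub>R axis i 1) \<bullet> x)))"
      by (rule integral_norm_bound)
    then show ?thesis using abs_Re_le_cmod by (simp add: prob_space order_trans[OF abs_Re_le_cmod])
  qed
  have m[measurable]: "?c n i \<in> borel_measurable borel" for n i
  proof -
    interpret prob_space "\<mu> n" by (rule P)
    have [measurable_cong]: "sets (\<mu> n) = sets borel" by (rule S)
    show ?thesis by measurable
  qed
  have cd: "(\<lambda>n. ?c n i z) \<longlonglongrightarrow> ?d i z" for i z by (intro tendsto_Re lim)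
  have [measurable]: "?d i \<in> borel_measurable borel" for i
    by (rule borel_measurable_LIMSEQ_real[OF cd m])
  have "(\<lambda>n. \<integral>z. 1 - ?c n i z \<partial>std_normal_distribution) \<longlonglongrightarrow> (\<integral>z. 1 - ?d i z \<partial>std_normal_distribution)" for i
  proof (rule integral_dominated_convergence[where w="\<lambda>_. 2"])
    show "AE z in std_normal_distribution. (\<lambda>n. 1 - ?c n i z) \<longlonglongrightarrow> 1 - ?d i z"
      by (intro AE_I2 tendsto_diff tendsto_const cd)
    have "norm (1 - ?c n i z) \<le> 2" for n z using b[of n z i] unfolding real_norm_def by linarith
    then show "AE z in std_normal_distribution. norm (1 - ?c n i z) \<le> 2" for n by simp
    show "(\<lambda>z. 1 - ?d i z) \<in> borel_measurable std_normal_distribution" "(\<lambda>z. 1 - ?c n i z) \<in> borel_measurable std_normal_distribution" for n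
      by measurable
    show "integrable std_normal_distribution (\<lambda>_. 2 :: real)" by (rule N.integrable_const)
  qed
  then show ?thesis by (intro tendsto_sum tendsto_divide) auto
qed

lemma integral_diff_bound_by_tail:
  fixes M :: "(real^'n::finite) measure"
  assumes P: "prob_space M" and S: "sets M = sets borel"
    and g: "g \<in> borel_measurable borel" "\<And>x. \<bar>g x\<bar> \<le> B" and q: "q \<in> borel_measurable borel" "\<And>x. \<bar>q x\<bar> \<le> B + e"
    and close: "\<And>x. (\<And>i. \<bar>x $ i\<bar> \<le> r) \<Longrightarrow> \<bar>g x - q x\<bar> < e" and e: "0 < e"
  shows "\<bar>(\<integral>x. g x \<partial>M) - (\<integral>x. q x \<partial>M)\<bar> \<le> e + (2 * B + e) * measure M {x\<in>space M. \<exists>i. \<bar>x $ i\<bar> > r}"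
proof -
  interpret prob_space M by fact
  have [measurable_cong]: "sets M = sets borel" by fact
  note [measurable] = g(1) q(1)
  have ig: "integrable M g" by (rule integrable_const_bound[where B=B]) (use g in auto)
  have iq: "integrable M q" by (rule integrable_const_bound[where B="B + e"]) (use q in auto)
  have "{x\<in>space M. \<exists>i. \<bar>x $ i\<bar> > r} = (\<Union>i\<in>UNIV. {x\<in>space M. \<bar>x $ i\<bar> > r})" by auto
  then have bm[measurable]: "{x\<in>space M. \<exists>i. \<bar>x $ i\<bar> > r} \<in> sets M" by simp
  have "\<bar>(\<integral>x. g x \<partial>M) - (\<integral>x. q x \<partial>M)\<bar> = \<bar>\<integral>x. g x - q x \<partial>M\<bar>" using ig iq by simp
  also have "\<dots> \<le> (\<integral>x. \<bar>g x - q x\<bar> \<partial>M)" by (rule integral_abs_bound)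
  also have "\<dots> \<le> (\<integral>x. e + (2 * B + e) * indicator {x\<in>space M. \<exists>i. \<bar>x $ i\<bar> > r} x \<partial>M)"
  proof (rule integral_mono)
    show "integrable M (\<lambda>x. \<bar>g x - q x\<bar>)" using ig iq by auto
    show "integrable M (\<lambda>x. e + (2 * B + e) * indicator {x\<in>space M. \<exists>i. \<bar>x $ i\<bar> > r} x)"
      by (intro Bochner_Integration.integrable_add integrable_const integrable_mult_right integrable_real_indicator) (auto simp: emeasure_eq_measure)
    fix x assume x: "x \<in> space M"
    show "\<bar>g x - q x\<bar> \<le> e + (2 * B + e) * indicator {x\<in>space M. \<exists>i. \<bar>x $ i\<bar> > r} x"
    proof (cases "\<exists>i. \<bar>x $ i\<bar> > r")
      case True
      have "\<bar>g x - q x\<bar> \<le> \<bar>g x\<bar> + \<bar>q x\<bar>" by (rule abs_triangle_ineq4)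
      with True x g(2)[of x] q(2)[of x] e show ?thesis by simp
    next
      case False
      then have "\<bar>g x - q x\<bar> < e" by (intro close) (simp add: not_less)
      with False show ?thesis by simp
    qed
  qed
  also have "\<dots> = e + (2 * B + e) * measure M {x\<in>space M. \<exists>i. \<bar>x $ i\<bar> > r}"
    by (subst Bochner_Integration.integral_add)
       (auto simp: prob_space emeasure_eq_measure intro!: integrable_mult_right integrable_real_indicator)
  finally show ?thesis .
qed

lemma levy_continuity_cart:
  fixes \<mu> :: "nat \<Rightarrow> (real^'n::finite) measure"
  assumes P: "\<And>n. prob_space (\<mu> n)" "prob_space \<nu>" and S: "\<And>n. sets (\<mu> n) = sets borel" "sets \<nu> = sets borel"
    and lim: "\<And>z. (\<lambda>n. CLINT x|\<mu> n. iexp (z \<bullet> x)) \<longlonglongrightarrow> (CLINT x|\<nu>. iexp (z \<bullet> x))"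
    and g: "continuous_on UNIV g" "bounded (range g)"
  shows "(\<lambda>n. \<integral>x. g x \<partial>\<mu> n) \<longlonglongrightarrow> (\<integral>x. (g x :: real) \<partial>\<nu>)"
proof (rule LIMSEQ_I)
  fix d :: real assume d: "0 < d"
  obtain B where B: "\<And>x. \<bar>g x\<bar> \<le> B" using g(2) by (auto simp: bounded_iff)
  have B0: "0 \<le> B" using B[of 0] by linarith
  \<comment> \<open>The errors are \<open>2 * e\<close> for each of the two replacements of
    \<open>g\<close> by \<open>q\<close> and \<open>e\<close> for the integrals of \<open>q\<close>,
    altogether \<open>5 * d / 8\<close>. The number \<eta> is chosen so that the tail contributes at
    most one \<open>e\<close> to each replacement.\<close>
  define e where "e = d / 8"
  have e: "0 < e" using d by (simp add: e_def)
  define \<eta> where "\<eta> = e / (2 * B + e)"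
  have \<eta>: "0 < \<eta>" "(2 * B + e) * \<eta> = e" using e B0 by (auto simp: \<eta>_def)
  let ?T = "\<lambda>M r. \<Sum>i\<in>(UNIV::'n set). (\<integral>z. 1 - Re (CLINT x|M. iexp (((z / r) *\<^sub>R axis i 1) \<bullet> x)) \<partial>std_normal_distribution) / (1 - exp (- 1 / 2))"
  have "\<forall>\<^sub>F k in sequentially. ?T \<nu> (real (Suc k)) < \<eta>"
    using coordinate_tail_limit[OF P(2) S(2)] \<eta>(1) by (rule order_tendstoD)
  then obtain k where k: "?T \<nu> (real (Suc k)) < \<eta>" by (auto simp: eventually_sequentially)
  define r where "r = real (Suc k)"
  have r: "0 < r" by (simp add: r_def)
  have tn: "\<forall>\<^sub>F n in sequentially. ?T (\<mu> n) r < \<eta>"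
    using coordinate_tail_tendsto[of \<mu> \<nu> r, OF P(1) S(1) lim] k unfolding r_def by (rule order_tendstoD)
  obtain q where q: "trig_sum q" "\<And>x. (\<And>i. \<bar>x $ i\<bar> \<le> r) \<Longrightarrow> \<bar>g x - q x\<bar> < e" "\<And>x. \<bar>q x\<bar> \<le> B + e"
    using trig_sum_approximation[OF g(1) B e r] by blast
  have gm: "g \<in> borel_measurable borel" "q \<in> borel_measurable borel"
    using g(1) trig_sum_continuous[OF q(1)] by (auto intro: borel_measurable_continuous_onI)
  have bound: "\<bar>(\<integral>x. g x \<partial>M) - (\<integral>x. q x \<partial>M)\<bar> \<le> 2 * e" if "prob_space M" "sets M = sets borel" "?T M r < \<eta>" for M
  proof -
    have "measure M {x\<in>space M. \<exists>i. \<bar>x $ i\<bar> > r} \<le> \<eta>"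
      using coordinate_tail_bound[OF that(1,2) r] that(3) by linarith
    then have "(2 * B + e) * measure M {x\<in>space M. \<exists>i. \<bar>x $ i\<bar> > r} \<le> (2 * B + e) * \<eta>"
      using B0 e by (intro mult_left_mono) auto
    moreover have "\<bar>(\<integral>x. g x \<partial>M) - (\<integral>x. q x \<partial>M)\<bar> \<le> e + (2 * B + e) * measure M {x\<in>space M. \<exists>i. \<bar>x $ i\<bar> > r}"
    proof (rule integral_diff_bound_by_tail[OF that(1,2) gm(1) B gm(2) q(3) _ e])
      show "\<bar>g x - q x\<bar> < e" if "\<And>i. \<bar>x $ i\<bar> \<le> r" for x using that by (rule q(2))
    qed
    ultimately show ?thesis using \<eta>(2) by linarith
  qed
  have "\<forall>\<^sub>F n in sequentially. dist (\<integral>x. q x \<partial>\<mu> n) (\<integral>x. q x \<partial>\<nu>) < e"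
    by (rule tendstoD[OF trig_sum_integral_tendsto[OF P S lim q(1)] e])
  with tn have "\<forall>\<^sub>F n in sequentially. norm ((\<integral>x. g x \<partial>\<mu> n) - (\<integral>x. g x \<partial>\<nu>)) < d"
  proof eventually_elim
    case (elim n)
    show ?case
      using bound[OF P(1) S(1) elim(1)] bound[OF P(2) S(2)] k elim(2) d
      unfolding r_def[symmetric] dist_real_def real_norm_def e_def by linarith
  qed
  then show "\<exists>N. \<forall>n\<ge>N. norm ((\<integral>x. g x \<partial>\<mu> n) - (\<integral>x. g x \<partial>\<nu>)) < d"
    by (simp add: eventually_sequentially)
qed

section \<open>Cumulants of Levy measures\<close>

definition compensated_exp :: "real \<Rightarrow> complex" where
  "compensated_exp t = iexp t - 1 - \<i> * of_real t"

definition centered_cumulant :: "real measure \<Rightarrow> real \<Rightarrow> complex" where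
  "centered_cumulant \<mu> z = (CLINT x|\<mu>. compensated_exp (z * x))"

lemma compensated_exp_measurable[measurable]: "compensated_exp \<in> borel_measurable borel"
  unfolding compensated_exp_def by measurable

lemma compensated_exp_0[simp]: "compensated_exp 0 = 0" by (simp add: compensated_exp_def)

lemma Re_compensated_exp: "Re (compensated_exp t) = - (1 - cos t)" by (simp add: compensated_exp_def Re_exp)

lemma compensated_exp_minus: "compensated_exp (- t) = cnj (compensated_exp t)"
  by (simp add: compensated_exp_def exp_cnj)

lemma norm_compensated_exp_le: "norm (compensated_exp t) \<le> t\<^sup>2 / 2"
  using iexp_approx1[of t 1] by (simp add: compensated_exp_def diff_diff_add power2_eq_square)

text \<open>The Taylor remainder is at most
  \<open>\<bar>t\<bar> ^ 3 / 6 \<le> t\<^sup>2 / 6\<close>, which leaves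
  \<open>t\<^sup>2 / 3\<close>.\<close>

lemma one_minus_cos_ge:
  fixes t :: real
  assumes "\<bar>t\<bar> \<le> 1"
  shows "t\<^sup>2 / 4 \<le> 1 - cos t"
proof -
  have s: "(\<Sum>k\<le>2. (\<i> * of_real t) ^ k / fact k) = 1 + \<i> * of_real t - of_real (t\<^sup>2 / 2)"
    by (simp add: numeral_2_eq_2 power2_eq_square) (simp add: complex_eq_iff)
  have "\<bar>Re (iexp t - (1 + \<i> * of_real t - of_real (t\<^sup>2 / 2)))\<bar> \<le> norm (iexp t - (1 + \<i> * of_real t - of_real (t\<^sup>2 / 2)))"
    by (rule abs_Re_le_cmod)
  also have "\<dots> \<le> \<bar>t\<bar> ^ 3 / 6" using iexp_approx1[of t 2] unfolding s by (simp add: eval_nat_numeral)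
  also have "\<dots> \<le> t\<^sup>2 / 6"
  proof -
    have "\<bar>t\<bar> ^ 3 = \<bar>t\<bar> * t\<^sup>2" by (simp add: power3_eq_cube power2_eq_square)
    also have "\<dots> \<le> 1 * t\<^sup>2" by (intro mult_right_mono assms) simp
    finally show ?thesis by simp
  qed
  finally have "\<bar>cos t - (1 - t\<^sup>2 / 2)\<bar> \<le> t\<^sup>2 / 6" by (simp add: Re_exp)
  moreover have "0 \<le> t\<^sup>2" by simp
  ultimately show ?thesis unfolding abs_le_iff by linarith
qed

text \<open>\<open>1 - cos t = 2 * (sin (t / 2))\<^sup>2\<close>, and \<open>\<bar>sin\<bar>\<close>
  is subadditive. Integrated against a Levy measure this is the quasi-subadditivity of \<psi> with
  constant 2.\<close>

lemma one_minus_cos_add_le: "1 - cos (a + b) \<le> 2 * ((1 - cos a) + (1 - cos (b :: real)))"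
proof -
  have c: "1 - cos t = 2 * (sin (t / 2))\<^sup>2" for t :: real
    using cos_double_sin[of "t / 2"] by simp
  have "\<bar>sin (a / 2 + b / 2)\<bar> \<le> \<bar>sin (a / 2)\<bar> + \<bar>sin (b / 2)\<bar>"
  proof -
    have "\<bar>sin (a / 2 + b / 2)\<bar> \<le> \<bar>sin (a / 2)\<bar> * \<bar>cos (b / 2)\<bar> + \<bar>cos (a / 2)\<bar> * \<bar>sin (b / 2)\<bar>"
      unfolding sin_add abs_mult[symmetric] by (rule abs_triangle_ineq)
    also have "\<dots> \<le> \<bar>sin (a / 2)\<bar> * 1 + 1 * \<bar>sin (b / 2)\<bar>"
      by (intro add_mono mult_mono) auto
    finally show ?thesis by simp
  qed
  then have "(sin (a / 2 + b / 2))\<^sup>2 \<le> (\<bar>sin (a / 2)\<bar> + \<bar>sin (b / 2)\<bar>)\<^sup>2"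
    by (metis abs_ge_zero power2_abs power_mono)
  also have "\<dots> \<le> 2 * (sin (a / 2))\<^sup>2 + 2 * (sin (b / 2))\<^sup>2"
    using sum_squares_bound[of "\<bar>sin (a / 2)\<bar>" "\<bar>sin (b / 2)\<bar>"] by (simp add: power2_sum)
  finally show ?thesis by (simp add: c add_divide_distrib)
qed

section \<open>Finiteness properties of Levy measures\<close>

lemma levy_measure_sets: "levy_measure \<mu> \<Longrightarrow> sets \<mu> = sets borel" by (simp add: levy_measure_def)

lemma levy_measure_space: "levy_measure \<mu> \<Longrightarrow> space \<mu> = UNIV"
  using sets_eq_imp_space_eq[of \<mu> borel] by (simp add: levy_measure_def)

lemma levy_measure_integrable_min:
  assumes "levy_measure \<mu>"
  shows "integrable \<mu> (\<lambda>x. min 1 (x\<^sup>2))"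
proof (rule integrableI_bounded)
  have [measurable_cong]: "sets \<mu> = sets borel" using assms by (rule levy_measure_sets)
  show "(\<lambda>x. min 1 (x\<^sup>2)) \<in> borel_measurable \<mu>" by measurable
qed (use assms in \<open>auto simp: levy_measure_def\<close>)

lemma levy_measure_emeasure_finite:
  assumes mu: "levy_measure \<mu>" and r: "0 < r"
  shows "emeasure \<mu> {x. r \<le> \<bar>x\<bar>} < \<infinity>"
proof -
  have [measurable_cong]: "sets \<mu> = sets borel" using mu by (rule levy_measure_sets)
  note sp = levy_measure_space[OF mu]
  define d where "d = min 1 (r\<^sup>2)"
  have d: "0 < d" using r by (simp add: d_def)
  have "emeasure \<mu> {x. r \<le> \<bar>x\<bar>} \<le> emeasure \<mu> {x\<in>space \<mu>. 1 \<le> ennreal (1 / d) * ennreal (min 1 (x\<^sup>2))}"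
  proof (rule emeasure_mono)
    show "{x. r \<le> \<bar>x\<bar>} \<subseteq> {x\<in>space \<mu>. 1 \<le> ennreal (1 / d) * ennreal (min 1 (x\<^sup>2))}"
    proof safe
      fix x :: real assume "r \<le> \<bar>x\<bar>"
      then have "r\<^sup>2 \<le> x\<^sup>2" using r by (metis less_imp_le power2_abs power_mono)
      then have "d \<le> min 1 (x\<^sup>2)" by (auto simp: d_def)
      then have "1 \<le> 1 / d * min 1 (x\<^sup>2)" using d by (simp add: field_simps)
      then have "ennreal 1 \<le> ennreal (1 / d * min 1 (x\<^sup>2))" by (rule ennreal_leI)
      moreover have "ennreal (1 / d * min 1 (x\<^sup>2)) = ennreal (1 / d) * ennreal (min 1 (x\<^sup>2))"
        by (rule ennreal_mult) (use d in auto)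
      ultimately show "1 \<le> ennreal (1 / d) * ennreal (min 1 (x\<^sup>2))" by (simp only: ennreal_1)
    qed (simp add: sp)
  qed measurable
  also have "\<dots> \<le> ennreal (1 / d) * (\<integral>\<^sup>+x. ennreal (min 1 (x\<^sup>2)) * indicator (space \<mu>) x \<partial>\<mu>)"
    by (rule nn_integral_Markov_inequality) auto
  also have "\<dots> < \<infinity>" using mu by (simp add: levy_measure_def ennreal_mult_less_top sp)
  finally show ?thesis .
qed

lemma levy_measure_sigma_finite:
  assumes mu: "levy_measure \<mu>"
  shows "sigma_finite_measure \<mu>"
proof
  have [measurable_cong]: "sets \<mu> = sets borel" using mu by (rule levy_measure_sets)
  note sp = levy_measure_space[OF mu]
  let ?A = "\<lambda>n. {x. 1 / real (Suc n) \<le> \<bar>x\<bar>}"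
  show "\<exists>A. countable A \<and> A \<subseteq> sets \<mu> \<and> \<Union> A = space \<mu> \<and> (\<forall>a\<in>A. emeasure \<mu> a \<noteq> \<infinity>)"
  proof (intro exI[of _ "insert {0} (range ?A)"] conjI ballI)
    show "insert {0} (range ?A) \<subseteq> sets \<mu>" by auto
    have "\<exists>n. 1 / real (Suc n) \<le> \<bar>x\<bar>" if "x \<noteq> 0" for x
      using reals_Archimedean[of "\<bar>x\<bar>"] that by (auto simp: inverse_eq_divide intro: less_imp_le)
    then show "\<Union> (insert {0} (range ?A)) = space \<mu>" by (auto simp: sp)
    show "emeasure \<mu> a \<noteq> \<infinity>" if a: "a \<in> insert {0} (range ?A)" for a
    proof (cases "a = {0}")
      case True
      then show ?thesis using mu by (simp add: levy_measure_def)
    next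
      case False
      then obtain n where "a = ?A n" using a by auto
      then show ?thesis using levy_measure_emeasure_finite[OF mu, of "1 / real (Suc n)"] by (simp add: less_top)
    qed
  qed auto
qed

section \<open>The centered cumulant under a finite second moment\<close>

locale levy_sq =
  fixes \<mu> :: "real measure"
  assumes levy: "levy_measure \<mu>" and sq: "integrable \<mu> (\<lambda>x. x\<^sup>2)"
begin

sublocale sigma_finite_measure \<mu> by (rule levy_measure_sigma_finite[OF levy])

lemma sets_mu[measurable_cong, simp]: "sets \<mu> = sets borel" using levy by (rule levy_measure_sets)
lemma space_mu[simp]: "space \<mu> = UNIV" using levy by (rule levy_measure_space)

definition m2 :: real where "m2 = (\<integral>x. x\<^sup>2 \<partial>\<mu>)"

lemma m2_nonneg: "0 \<le> m2" unfolding m2_def by (rule Bochner_Integration.integral_nonneg) simp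

lemma integrable_cumulant[simp]: "integrable \<mu> (\<lambda>x. compensated_exp (z * x))"
proof (rule Bochner_Integration.integrable_bound[OF integrable_mult_right[OF sq, of "z\<^sup>2"]])
  show "AE x in \<mu>. norm (compensated_exp (z * x)) \<le> norm (z\<^sup>2 * x\<^sup>2)"
    using norm_compensated_exp_le by (intro AE_I2 order_trans[OF norm_compensated_exp_le]) (simp add: power_mult_distrib)
qed measurable

lemma norm_cumulant_le: "norm (centered_cumulant \<mu> z) \<le> m2 * z\<^sup>2"
proof -
  have "norm (centered_cumulant \<mu> z) \<le> (\<integral>x. norm (compensated_exp (z * x)) \<partial>\<mu>)"
    unfolding centered_cumulant_def by (rule integral_norm_bound)
  also have "\<dots> \<le> (\<integral>x. z\<^sup>2 * x\<^sup>2 \<partial>\<mu>)"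
  proof (rule integral_mono)
    show "norm (compensated_exp (z * x)) \<le> z\<^sup>2 * x\<^sup>2" for x
      by (rule order_trans[OF norm_compensated_exp_le]) (simp add: power_mult_distrib)
  qed (use sq in simp_all)
  finally show ?thesis by (simp add: m2_def mult.commute)
qed

text \<open>A Lipschitz bound whose constant grows linearly in the arguments; it makes the
  integrated cumulant continuous under mean-square convergence.\<close>

lemma norm_cumulant_diff_le:
  "norm (centered_cumulant \<mu> y - centered_cumulant \<mu> z) \<le> 2 * m2 * (\<bar>y - z\<bar> * (\<bar>y\<bar> + \<bar>z\<bar>))"
proof -
  have p: "norm ((compensated_exp a) - (compensated_exp b)) \<le> 2 * (\<bar>a - b\<bar> * (\<bar>a\<bar> + \<bar>b\<bar>))" for a b :: real
  proof -
    have "iexp a = iexp b * iexp (a - b)" by (simp flip: exp_add add: right_diff_distrib)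
    \<comment> \<open>The linear terms cancel in this decomposition, so every term is of second
      order.\<close>
    then have "(compensated_exp a) - (compensated_exp b) = (iexp b - 1) * (iexp (a - b) - 1) + compensated_exp (a - b)"
      by (simp add: compensated_exp_def algebra_simps)
    also have "norm \<dots> \<le> \<bar>b\<bar> * \<bar>a - b\<bar> + (a - b)\<^sup>2 / 2"
      using norm_iexp_minus_1_le[of b] norm_iexp_minus_1_le[of "a - b"]
      by (intro order_trans[OF norm_triangle_ineq] add_mono norm_compensated_exp_le)
        (auto simp: norm_mult intro!: mult_mono)
    also have "(a - b)\<^sup>2 / 2 \<le> \<bar>a - b\<bar> * (\<bar>a\<bar> + \<bar>b\<bar>)"
    proof -
      have "(a - b)\<^sup>2 = \<bar>a - b\<bar> * \<bar>a - b\<bar>" by (simp add: power2_eq_square)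
      also have "\<dots> \<le> \<bar>a - b\<bar> * (\<bar>a\<bar> + \<bar>b\<bar>)" by (intro mult_left_mono abs_triangle_ineq4) auto
      finally have "(a - b)\<^sup>2 \<le> \<bar>a - b\<bar> * (\<bar>a\<bar> + \<bar>b\<bar>)" .
      moreover have "0 \<le> (a - b)\<^sup>2" by simp
      ultimately show ?thesis by linarith
    qed
    finally have "norm ((compensated_exp a) - (compensated_exp b)) \<le> \<bar>b\<bar> * \<bar>a - b\<bar> + \<bar>a - b\<bar> * (\<bar>a\<bar> + \<bar>b\<bar>)"
      by simp
    moreover have "\<bar>b\<bar> * \<bar>a - b\<bar> \<le> \<bar>a - b\<bar> * (\<bar>a\<bar> + \<bar>b\<bar>)" by (subst mult.commute) (rule mult_left_mono, auto)
    ultimately show ?thesis by linarith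
  qed
  have "norm (centered_cumulant \<mu> y - centered_cumulant \<mu> z) = norm (CLINT x|\<mu>. (compensated_exp (y * x)) - (compensated_exp (z * x)))"
    unfolding centered_cumulant_def by (subst Bochner_Integration.integral_diff) simp_all
  also have "\<dots> \<le> (\<integral>x. norm ((compensated_exp (y * x)) - (compensated_exp (z * x))) \<partial>\<mu>)"
    by (rule integral_norm_bound)
  also have "\<dots> \<le> (\<integral>x. 2 * (\<bar>y - z\<bar> * (\<bar>y\<bar> + \<bar>z\<bar>)) * x\<^sup>2 \<partial>\<mu>)"
  proof (rule integral_mono)
    show "norm ((compensated_exp (y * x)) - (compensated_exp (z * x))) \<le> 2 * (\<bar>y - z\<bar> * (\<bar>y\<bar> + \<bar>z\<bar>)) * x\<^sup>2" for x
    proof -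
      have "y * x - z * x = (y - z) * x" "x\<^sup>2 = \<bar>x\<bar> * \<bar>x\<bar>" by (simp_all add: left_diff_distrib power2_eq_square)
      then have "2 * (\<bar>y * x - z * x\<bar> * (\<bar>y * x\<bar> + \<bar>z * x\<bar>)) = 2 * (\<bar>y - z\<bar> * (\<bar>y\<bar> + \<bar>z\<bar>)) * x\<^sup>2"
        by (simp only: abs_mult distrib_left distrib_right mult.assoc mult.commute mult.left_commute)
      with p[of "y * x" "z * x"] show ?thesis by simp
    qed
  qed (use sq in \<open>simp_all\<close>)
  finally show ?thesis by (simp add: m2_def mult.commute mult.left_commute)
qed

lemma cumulant_cont: "continuous_on A (centered_cumulant \<mu>)"
proof (rule continuous_on_subset[of UNIV])
  have "isCont (centered_cumulant \<mu>) z" for z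
    unfolding isCont_def
  proof (rule Lim_null[THEN iffD2], rule Lim_null_comparison)
    show "\<forall>\<^sub>F y in at z. norm (centered_cumulant \<mu> y - centered_cumulant \<mu> z) \<le> 2 * m2 * (\<bar>y - z\<bar> * (\<bar>y\<bar> + \<bar>z\<bar>))"
      by (intro always_eventually allI norm_cumulant_diff_le)
    have "((\<lambda>y. 2 * m2 * (\<bar>y - z\<bar> * (\<bar>y\<bar> + \<bar>z\<bar>))) \<longlongrightarrow> 2 * m2 * (\<bar>z - z\<bar> * (\<bar>z\<bar> + \<bar>z\<bar>))) (at z)"
      by (intro tendsto_intros)
    then show "((\<lambda>y. 2 * m2 * (\<bar>y - z\<bar> * (\<bar>y\<bar> + \<bar>z\<bar>))) \<longlongrightarrow> 0) (at z)" by simp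
  qed
  then show "continuous_on UNIV (centered_cumulant \<mu>)" by (simp add: continuous_on_eq_continuous_at)
qed simp

lemma integrable_one_minus_cos[simp]: "integrable \<mu> (\<lambda>x. 1 - cos (z * x))"
proof -
  have "integrable \<mu> (\<lambda>x. - Re (compensated_exp (z * x)))"
    by (intro Bochner_Integration.integrable_minus integrable_Re integrable_cumulant)
  then show ?thesis by (simp only: Re_compensated_exp minus_minus)
qed

lemma Re_cumulant: "Re (centered_cumulant \<mu> z) = - (\<integral>x. 1 - cos (z * x) \<partial>\<mu>)"
proof -
  have "Re (centered_cumulant \<mu> z) = (\<integral>x. Re (compensated_exp (z * x)) \<partial>\<mu>)"
    unfolding centered_cumulant_def by (rule integral_Re[symmetric]) simp
  also have "\<dots> = (\<integral>x. - (1 - cos (z * x)) \<partial>\<mu>)" by (simp only: Re_compensated_exp)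
  finally show ?thesis by (simp only: Bochner_Integration.integral_minus)
qed

lemma cumulant_cnj: "centered_cumulant \<mu> (- z) = cnj (centered_cumulant \<mu> z)"
  by (simp add: centered_cumulant_def compensated_exp_minus)

section \<open>From the tails of the Levy measure to the growth of its cumulant\<close>

lemma tail_finite: "0 < v \<Longrightarrow> emeasure \<mu> {v..} < \<infinity>"
  by (rule le_less_trans[OF emeasure_mono levy_measure_emeasure_finite[OF levy, of v]]) auto

lemma tail_chebyshev:
  assumes v: "0 < v"
  shows "measure \<mu> {v..} \<le> m2 / v\<^sup>2"
proof -
  have "v\<^sup>2 * measure \<mu> {v..} = (\<integral>x. v\<^sup>2 * indicator {v..} x \<partial>\<mu>)" by simp
  also have "\<dots> \<le> (\<integral>x. x\<^sup>2 \<partial>\<mu>)"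
  proof (rule integral_mono)
    show "integrable \<mu> (\<lambda>x. v\<^sup>2 * indicat_real {v..} x)"
      using tail_finite[OF v] by (intro integrable_mult_right integrable_real_indicator) auto
    show "v\<^sup>2 * indicat_real {v..} x \<le> x\<^sup>2" for x using v by (auto simp: indicator_def power_mono)
  qed (rule sq)
  finally show ?thesis using v by (simp add: m2_def field_simps)
qed

lemma tail_measurable[measurable]: "(\<lambda>v. measure \<mu> {v..}) \<in> borel_measurable borel"
proof -
  have "(\<lambda>v. emeasure \<mu> {x\<in>space \<mu>. v \<le> x}) \<in> borel_measurable borel" by measurable
  then have "(\<lambda>v. emeasure \<mu> {v..}) \<in> borel_measurable borel" by (simp add: atLeast_def)
  then show ?thesis unfolding measure_def by measurable
qed

text \<open>Near 0 the bound comes from the limit. Beyond \<open>d\<close> it comes from Chebyshev,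
  because \<open>x powr (b - 2)\<close> is decreasing for \<open>b < 2\<close>.\<close>

lemma tail_bound:
  assumes b: "b < 2" and lim: "((\<lambda>x. x powr b * measure \<mu> {x..}) \<longlongrightarrow> c) (at_right 0)"
  obtains C where "0 < C" "\<And>x. 0 < x \<Longrightarrow> measure \<mu> {x..} \<le> C * x powr (- b)"
proof -
  have "\<forall>\<^sub>F x in at_right 0. x powr b * measure \<mu> {x..} < c + 1" using lim by (rule order_tendstoD) simp
  then obtain d where d: "0 < d" "\<And>x. 0 < x \<Longrightarrow> x < d \<Longrightarrow> x powr b * measure \<mu> {x..} < c + 1"
    by (auto simp: eventually_at_right_field)
  define C where "C = \<bar>c\<bar> + 1 + m2 * d powr (b - 2)"
  have C0: "0 \<le> m2 * d powr (b - 2)" using m2_nonneg by simp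
  have "measure \<mu> {x..} \<le> C * x powr (- b)" if x: "0 < x" for x
  proof -
    have "x powr b * measure \<mu> {x..} \<le> C"
    proof (cases "x < d")
      case True
      then show ?thesis using d(2)[OF x] C0 by (simp add: C_def)
    next
      case False
      have "x powr b * measure \<mu> {x..} \<le> x powr b * (m2 / x\<^sup>2)" by (intro mult_left_mono tail_chebyshev x) simp
      also have "\<dots> = m2 * x powr (b - 2)" using x by (simp add: powr_diff)
      also have "\<dots> \<le> m2 * d powr (b - 2)" using False d(1) b by (intro mult_left_mono m2_nonneg powr_mono2') auto
      finally show ?thesis by (simp add: C_def)
    qed
    then show ?thesis using x by (simp add: powr_minus field_simps)
  qed
  moreover have "0 < C" using C0 by (simp add: C_def)
  ultimately show ?thesis using that by blast
qed

text \<open>An integration by parts: \<open>compensated_exp (z * x)\<close> is the integral of its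
  derivative over \<open>v\<close> in {0..x}, and Fubini replaces \<mu> by its tail
  function.\<close>

lemma half_cumulant_Fubini:
  assumes z: "0 < z"
  shows "(CLINT x|\<mu>. indicator {0<..} x *\<^sub>R (compensated_exp (z * x)))
    = (CLINT v|lborel. (indicator {0<..} v * measure \<mu> {v..}) *\<^sub>R (\<i> * of_real z * (iexp (z * v) - 1)))"
proof -
  interpret P: pair_sigma_finite \<mu> lborel ..
  define f where "f x v = (indicator {0<..} v * indicator {..x} v) *\<^sub>R (\<i> * of_real z * (iexp (z * v) - 1))" for x v :: real
  have fm[measurable]: "case_prod f \<in> borel_measurable (\<mu> \<Otimes>\<^sub>M lborel)"
  proof -
    have "(\<lambda>p. (indicator {0<..} (snd p) * indicator {q::real \<times> real. snd q \<le> fst q} p) *\<^sub>R (\<i> * of_real z * (iexp (z * snd p) - 1))) \<in> borel_measurable (\<mu> \<Otimes>\<^sub>M lborel)"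
      by measurable
    also have "(\<lambda>p. (indicator {0<..} (snd p) * indicator {q::real \<times> real. snd q \<le> fst q} p) *\<^sub>R (\<i> * of_real z * (iexp (z * snd p) - 1))) = case_prod f"
      by (auto simp: f_def fun_eq_iff indicator_def)
    finally show ?thesis .
  qed
  \<comment> \<open>Integrating this bound over \<open>v\<close> gives
    \<open>z\<^sup>2 * x\<^sup>2\<close>, which the second moment makes integrable.\<close>
  have nf: "norm (f x v) \<le> indicator {0..\<bar>x\<bar>} v *\<^sub>R (z\<^sup>2 * \<bar>x\<bar>)" for x v
  proof (cases "0 < v \<and> v \<le> x")
    case True
    have "norm (f x v) = z * norm (iexp (z * v) - 1)" using True z by (simp add: f_def norm_mult)
    also have "\<dots> \<le> z * (z * x)"
      using norm_iexp_minus_1_le[of "z * v"] True z by (intro mult_left_mono) (auto intro: order_trans[OF _ mult_left_mono])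
    finally show ?thesis using True by (simp add: power2_eq_square mult.assoc)
  qed (auto simp: f_def)
  have ib: "integrable lborel (\<lambda>v. indicator {0..\<bar>x\<bar>} v *\<^sub>R (z\<^sup>2 * \<bar>x\<bar>))" for x
    by (intro integrable_scaleR_left integrable_real_indicator) auto
  have fx: "integrable lborel (f x)" for x
    by (rule Bochner_Integration.integrable_bound[OF ib[of x]]) (use nf[of x] in \<open>auto intro!: AE_I2 order_trans[OF nf] simp: f_def\<close>)
  have int: "integrable (\<mu> \<Otimes>\<^sub>M lborel) (case_prod f)"
  proof (rule P.Fubini_integrable[OF fm])
    show "integrable \<mu> (\<lambda>x. \<integral>v. norm (case (x, v) of (x, v) \<Rightarrow> f x v) \<partial>lborel)"
    proof (rule Bochner_Integration.integrable_bound[OF integrable_mult_right[OF sq, of "z\<^sup>2"]])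
      show "AE x in \<mu>. norm (\<integral>v. norm (case (x, v) of (x, v) \<Rightarrow> f x v) \<partial>lborel) \<le> norm (z\<^sup>2 * x\<^sup>2)"
      proof (rule AE_I2)
        fix x
        have "(\<integral>v. norm (f x v) \<partial>lborel) \<le> (\<integral>v. indicator {0..\<bar>x\<bar>} v *\<^sub>R (z\<^sup>2 * \<bar>x\<bar>) \<partial>lborel)"
          using fx ib nf by (intro integral_mono) auto
        also have "\<dots> = z\<^sup>2 * x\<^sup>2" by (simp add: power2_eq_square)
        finally show "norm (\<integral>v. norm (case (x, v) of (x, v) \<Rightarrow> f x v) \<partial>lborel) \<le> norm (z\<^sup>2 * x\<^sup>2)"
          by (simp add: abs_of_nonneg[OF Bochner_Integration.integral_nonneg])
      qed
    qed measurable
    show "AE x in \<mu>. integrable lborel (\<lambda>v. case (x, v) of (x, v) \<Rightarrow> f x v)" using fx by simp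
  qed
  have 1: "(\<integral>v. f x v \<partial>lborel) = indicator {0<..} x *\<^sub>R (compensated_exp (z * x))" for x
  proof (cases "0 < x")
    case True
    have "(\<integral>v. f x v \<partial>lborel) = (\<integral>v. indicator {0..x} v *\<^sub>R (\<i> * of_real z * (iexp (z * v) - 1)) \<partial>lborel)"
    proof (rule integral_cong_AE)
      have "AE v in lborel. v \<noteq> (0::real)" by (rule AE_lborel_singleton)
      then show "AE v in lborel. f x v = indicator {0..x} v *\<^sub>R (\<i> * of_real z * (iexp (z * v) - 1))"
        by eventually_elim (auto simp: f_def indicator_def)
    qed (auto simp: f_def)
    also have "\<dots> = (iexp (z * x) - \<i> * of_real (z * x)) - (iexp (z * 0) - \<i> * of_real (z * 0))"
    proof (rule integral_FTC_atLeastAtMost)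
      show "((\<lambda>v. iexp (z * v) - \<i> * of_real (z * v)) has_vector_derivative \<i> * of_real z * (iexp (z * v) - 1)) (at v within {0..x})" for v
        unfolding has_vector_derivative_complex_iff
        by (auto simp: Re_exp Im_exp algebra_simps intro!: derivative_eq_intros)
    qed (use True in \<open>auto intro!: continuous_intros\<close>)
    finally show ?thesis using True by (simp add: compensated_exp_def)
  next
    case False
    then have "f x v = 0" for v by (auto simp: f_def indicator_def)
    then show ?thesis using False by simp
  qed
  have 2: "(\<integral>x. f x v \<partial>\<mu>) = (indicator {0<..} v * measure \<mu> {v..}) *\<^sub>R (\<i> * of_real z * (iexp (z * v) - 1))" for v
  proof (cases "0 < v")
    case True
    have "(\<integral>x. f x v \<partial>\<mu>) = (\<integral>x. indicator {v..} x *\<^sub>R (\<i> * of_real z * (iexp (z * v) - 1)) \<partial>\<mu>)"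
      using True by (intro Bochner_Integration.integral_cong) (auto simp: f_def indicator_def)
    also have "\<dots> = measure \<mu> {v..} *\<^sub>R (\<i> * of_real z * (iexp (z * v) - 1))"
      using tail_finite[OF True] by (subst integral_scaleR_left) auto
    finally show ?thesis using True by simp
  qed (simp add: f_def)
  show ?thesis using P.Fubini_integral[OF int] unfolding 1 2 by simp
qed

text \<open>After \<open>v = u / z\<close> the scaled tail
  \<open>measure \<mu> {u / z..} / z powr b\<close> tends to \<open>c * u powr - b\<close>. Since
  \<open>tail_bound\<close> holds at all positive arguments, \<open>min u 2 * u powr - b\<close>
  dominates uniformly in \<open>z\<close>, and the limit is the compensated Fourier integral of a
  power.\<close>

lemma half_cumulant_asymptotics:
  assumes b: "1 < b" "b < 2" and lim: "((\<lambda>x. x powr b * measure \<mu> {x..}) \<longlongrightarrow> c) (at_right 0)"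
  shows "((\<lambda>z. (CLINT x|\<mu>. indicator {0<..} x *\<^sub>R (compensated_exp (z * x))) /\<^sub>R z powr b)
     \<longlongrightarrow> of_real (Gamma (2 - b) / (1 - b) * c) * (\<i> * sin (pi * b / 2) - cos (pi * b / 2))) at_top"
proof -
  obtain C where C: "0 < C" "\<And>x. 0 < x \<Longrightarrow> measure \<mu> {x..} \<le> C * x powr (- b)"
    using tail_bound[OF b(2) lim] by blast
  define s where "s z u = (indicator {0<..} u * (measure \<mu> {u / z..} / z powr b)) *\<^sub>R (\<i> * (iexp u - 1))" for z u :: real
  have eq: "(CLINT x|\<mu>. indicator {0<..} x *\<^sub>R (compensated_exp (z * x))) /\<^sub>R z powr b = (CLINT u|lborel. s z u)" if z: "0 < z" for z
  proof -
    have "(CLINT x|\<mu>. indicator {0<..} x *\<^sub>R (compensated_exp (z * x)))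
       = \<bar>1 / z\<bar> *\<^sub>R (CLINT u|lborel. (indicator {0<..} (0 + 1 / z * u) * measure \<mu> {0 + 1 / z * u..}) *\<^sub>R (\<i> * of_real z * (iexp (z * (0 + 1 / z * u)) - 1)))"
      unfolding half_cumulant_Fubini[OF z] by (rule lborel_integral_real_affine) (use z in simp)
    also have "\<dots> = (CLINT u|lborel. \<bar>1 / z\<bar> *\<^sub>R ((indicator {0<..} (0 + 1 / z * u) * measure \<mu> {0 + 1 / z * u..}) *\<^sub>R (\<i> * of_real z * (iexp (z * (0 + 1 / z * u)) - 1))))"
      by (rule integral_scaleR_right[symmetric])
    also have "\<dots> = (CLINT u|lborel. z powr b *\<^sub>R s z u)"
    proof (rule Bochner_Integration.integral_cong)
      fix u :: real
      have "indicator {0<..} (u / z) = (indicator {0<..} u :: real)" using z by (auto simp: indicator_def zero_less_divide_iff)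
      then show "\<bar>1 / z\<bar> *\<^sub>R ((indicator {0<..} (0 + 1 / z * u) * measure \<mu> {0 + 1 / z * u..}) *\<^sub>R (\<i> * of_real z * (iexp (z * (0 + 1 / z * u)) - 1))) = z powr b *\<^sub>R s z u"
        using z by (simp add: s_def scaleR_conv_of_real)
    qed simp
    also have "\<dots> = z powr b *\<^sub>R (CLINT u|lborel. s z u)" by simp
    finally show ?thesis using z by simp
  qed
  have "((\<lambda>z. CLINT u|lborel. s z u) \<longlongrightarrow> (CLINT u|lborel. (\<i> * of_real c) * (indicator {0<..} u *\<^sub>R ((iexp u - 1) * of_real (u powr (- b)))))) at_top"
  proof (rule integral_dominated_convergence_at_top[where w="\<lambda>u. C * (indicator {0<..} u * (min u 2 * u powr (- b)))"])
    show "integrable lborel (\<lambda>u. C * (indicator {0<..} u * (min u 2 * u powr (- b))))"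
      by (intro integrable_mult_right integrable_min_powr b)
    show "s z \<in> borel_measurable lborel" for z unfolding s_def by measurable
    show "AE u in lborel. ((\<lambda>z. s z u) \<longlongrightarrow> (\<i> * of_real c) * (indicator {0<..} u *\<^sub>R ((iexp u - 1) * of_real (u powr (- b))))) at_top"
    proof (rule AE_I2)
      fix u :: real
      show "((\<lambda>z. s z u) \<longlongrightarrow> (\<i> * of_real c) * (indicator {0<..} u *\<^sub>R ((iexp u - 1) * of_real (u powr (- b))))) at_top"
      proof (cases "0 < u")
        case True
        have "filterlim (\<lambda>z. u / z) (at_right 0) at_top"
          using True by real_asymp
        then have "((\<lambda>z. (u / z) powr b * measure \<mu> {u / z..}) \<longlongrightarrow> c) at_top"
          by (rule filterlim_compose[OF lim])
        then have "((\<lambda>z. u powr (- b) * ((u / z) powr b * measure \<mu> {u / z..})) \<longlongrightarrow> u powr (- b) * c) at_top"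
          by (intro tendsto_intros)
        moreover have "\<forall>\<^sub>F z in at_top. u powr (- b) * ((u / z) powr b * measure \<mu> {u / z..}) = measure \<mu> {u / z..} / z powr b"
          using eventually_gt_at_top[of 0] by eventually_elim (use True in \<open>simp add: powr_divide powr_minus\<close>)
        ultimately have "((\<lambda>z. measure \<mu> {u / z..} / z powr b) \<longlongrightarrow> u powr (- b) * c) at_top"
          by (simp cong: tendsto_cong)
        then have "((\<lambda>z. (measure \<mu> {u / z..} / z powr b) *\<^sub>R (\<i> * (iexp u - 1))) \<longlongrightarrow> (u powr (- b) * c) *\<^sub>R (\<i> * (iexp u - 1))) at_top"
          by (intro tendsto_intros)
        then show ?thesis using True by (simp add: s_def scaleR_conv_of_real mult_ac)
      qed (simp add: s_def)
    qed
    show "\<forall>\<^sub>F z in at_top. AE u in lborel. norm (s z u) \<le> C * (indicator {0<..} u * (min u 2 * u powr (- b)))"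
      using eventually_gt_at_top[of 0]
    proof eventually_elim
      case (elim z)
      have "norm (s z u) \<le> C * (indicator {0<..} u * (min u 2 * u powr (- b)))" for u
      proof (cases "0 < u")
        case True
        have "measure \<mu> {u / z..} / z powr b \<le> C * (u / z) powr (- b) / z powr b"
          using C(2)[of "u / z"] True elim by (intro divide_right_mono) auto
        also have "\<dots> = C * u powr (- b)" using True elim by (simp add: powr_divide powr_minus field_simps)
        finally have 1: "measure \<mu> {u / z..} / z powr b \<le> C * u powr (- b)" .
        have "norm (s z u) = measure \<mu> {u / z..} / z powr b * norm (iexp u - 1)"
          using True by (simp add: s_def norm_mult)
        also have "\<dots> \<le> (C * u powr (- b)) * min u 2"
          using 1 norm_iexp_minus_1_le[of u] True C(1) by (intro mult_mono) auto
        finally show ?thesis using True by (simp add: mult_ac)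
      qed (simp add: s_def)
      then show ?case by simp
    qed
  qed measurable
  also have "(CLINT u|lborel. (\<i> * of_real c) * (indicator {0<..} u *\<^sub>R ((iexp u - 1) * of_real (u powr (- b)))))
     = (\<i> * of_real c) * (of_real (Gamma (2 - b) / (1 - b)) * (\<i> * cos (pi * b / 2) + sin (pi * b / 2)))"
    using has_bochner_integral_mult_right[OF has_bochner_integral_iexp_minus_1_powr[OF b], of "\<i> * of_real c"]
    by (intro has_bochner_integral_integral_eq) simp
  also have "\<dots> = of_real (Gamma (2 - b) / (1 - b) * c) * (\<i> * sin (pi * b / 2) - cos (pi * b / 2))"
    by (simp add: algebra_simps)
  finally show ?thesis
    by (rule Lim_transform_eventually) (rule eventually_mono[OF eventually_gt_at_top[of 0]], rule eq[symmetric])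
qed

end

section \<open>The cumulant with truncated compensation\<close>

lemma norm_levy_integrand_le:
  assumes z: "\<bar>z\<bar> \<le> R" and R: "1 \<le> R"
  shows "norm (iexp (z * x) - 1 - \<i> * of_real (z * x * indicator {-1..1} x)) \<le> 2 * R\<^sup>2 * min 1 (x\<^sup>2)"
proof (cases "\<bar>x\<bar> \<le> 1")
  case True
  then have x: "indicator {-1..1} x = (1 :: real)" "min 1 (x\<^sup>2) = x\<^sup>2" by (auto simp: indicator_def abs_le_iff abs_square_le_1 minus_le_iff)
  have "norm (compensated_exp (z * x)) \<le> (z * x)\<^sup>2 / 2" by (rule norm_compensated_exp_le)
  also have "\<dots> \<le> (z * x)\<^sup>2" by simp
  also have "\<dots> \<le> R\<^sup>2 * x\<^sup>2" unfolding power_mult_distrib using z by (intro mult_right_mono) (auto simp: abs_le_square_iff[symmetric])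
  also have "\<dots> \<le> 2 * R\<^sup>2 * x\<^sup>2" by simp
  finally show ?thesis using x by (simp add: compensated_exp_def)
next
  case False
  then have x: "indicator {-1..1} x = (0 :: real)" by (auto simp: indicator_def)
  have "1 < \<bar>x\<bar>" using False by simp
  then have "1 \<le> x\<^sup>2" using abs_square_le_1[of x] by linarith
  then have m: "min 1 (x\<^sup>2) = 1" by simp
  have "norm (iexp (z * x) - 1) \<le> 2" using norm_iexp_minus_1_le[of "z * x"] by simp
  moreover have "1 \<le> R\<^sup>2" using R by simp
  ultimately show ?thesis unfolding x m by simp
qed

lemma levy_integrand_integrable:
  assumes "levy_measure \<mu>"
  shows "integrable \<mu> (\<lambda>x. iexp (z * x) - 1 - \<i> * of_real (z * x * indicator {-1..1} x))"
proof (rule Bochner_Integration.integrable_bound)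
  have [measurable_cong]: "sets \<mu> = sets borel" using assms by (rule levy_measure_sets)
  show "(\<lambda>x. iexp (z * x) - 1 - \<i> * of_real (z * x * indicator {-1..1} x)) \<in> borel_measurable \<mu>" by measurable
  show "integrable \<mu> (\<lambda>x. 2 * (max 1 \<bar>z\<bar>)\<^sup>2 * min 1 (x\<^sup>2))" by (intro integrable_mult_right levy_measure_integrable_min assms)
  show "AE x in \<mu>. norm (iexp (z * x) - 1 - \<i> * of_real (z * x * indicator {-1..1} x)) \<le> norm (2 * (max 1 \<bar>z\<bar>)\<^sup>2 * min 1 (x\<^sup>2))"
    by (intro AE_I2 order_trans[OF norm_levy_integrand_le[where R="max 1 \<bar>z\<bar>"]]) auto
qed

text \<open>Drift and compensating term are purely imaginary, so the real part of the exponent is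
  the same before and after centering, and it makes sense for every Levy measure.\<close>

lemma Re_levy_cumulant:
  assumes "levy_measure \<mu>"
  shows "integrable \<mu> (\<lambda>x. 1 - cos (z * x))" "Re (levy_cumulant a 0 \<mu> z) = - (\<integral>x. 1 - cos (z * x) \<partial>\<mu>)"
proof -
  let ?g = "\<lambda>x. iexp (z * x) - 1 - \<i> * of_real (z * x * indicator {-1..1} x)"
  have re: "Re (?g x) = - (1 - cos (z * x))" for x by (simp add: Re_exp)
  have "integrable \<mu> (\<lambda>x. - Re (?g x))"
    by (intro Bochner_Integration.integrable_minus integrable_Re levy_integrand_integrable assms)
  then show "integrable \<mu> (\<lambda>x. 1 - cos (z * x))" by (simp only: re minus_minus)
  have "Re (levy_cumulant a 0 \<mu> z) = Re (CLINT x|\<mu>. ?g x)" by (simp add: levy_cumulant_def)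
  also have "\<dots> = (\<integral>x. Re (?g x) \<partial>\<mu>)" by (intro integral_Re[symmetric] levy_integrand_integrable assms)
  also have "\<dots> = (\<integral>x. - (1 - cos (z * x)) \<partial>\<mu>)" by (simp only: re)
  finally show "Re (levy_cumulant a 0 \<mu> z) = - (\<integral>x. 1 - cos (z * x) \<partial>\<mu>)"
    by (simp only: Bochner_Integration.integral_minus)
qed

lemma levy_cumulant_0: "levy_cumulant a b \<mu> 0 = 0" by (simp add: levy_cumulant_def)

lemma levy_cumulant_cont:
  assumes mu: "levy_measure \<mu>"
  shows "continuous_on UNIV (levy_cumulant a b \<mu>)"
proof -
  have [measurable_cong]: "sets \<mu> = sets borel" using mu by (rule levy_measure_sets)
  have "isCont (\<lambda>z. CLINT x|\<mu>. iexp (z * x) - 1 - \<i> * of_real (z * x * indicator {-1..1} x)) z" for z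
    unfolding continuous_at_sequentially
  proof safe
    fix X assume X: "X \<longlonglongrightarrow> z"
    then obtain B where B: "\<And>n. \<bar>X n\<bar> \<le> B" using Bseq_def[of X] convergent_imp_Bseq[OF convergentI[OF X]] by auto
    define R where "R = max 1 B"
    have R: "\<bar>X n\<bar> \<le> R" "1 \<le> R" for n using B[of n] by (auto simp: R_def)
    show "((\<lambda>z. CLINT x|\<mu>. iexp (z * x) - 1 - \<i> * of_real (z * x * indicator {-1..1} x)) \<circ> X) \<longlonglongrightarrow> (CLINT x|\<mu>. iexp (z * x) - 1 - \<i> * of_real (z * x * indicator {-1..1} x))"
      unfolding comp_def
    proof (rule integral_dominated_convergence[where w="\<lambda>x. 2 * R\<^sup>2 * min 1 (x\<^sup>2)"])
      show "AE x in \<mu>. (\<lambda>n. iexp (X n * x) - 1 - \<i> * of_real (X n * x * indicator {-1..1} x)) \<longlonglongrightarrow> iexp (z * x) - 1 - \<i> * of_real (z * x * indicator {-1..1} x)"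
        by (intro AE_I2 tendsto_intros X)
      show "AE x in \<mu>. norm (iexp (X n * x) - 1 - \<i> * of_real (X n * x * indicator {-1..1} x)) \<le> 2 * R\<^sup>2 * min 1 (x\<^sup>2)" for n
        by (intro AE_I2 norm_levy_integrand_le R)
      show "integrable \<mu> (\<lambda>x. 2 * R\<^sup>2 * min 1 (x\<^sup>2))" by (intro integrable_mult_right levy_measure_integrable_min mu)
    qed measurable
  qed
  then show ?thesis
    unfolding levy_cumulant_def[abs_def] by (intro continuous_intros continuous_at_imp_continuous_on ballI) auto
qed

lemma Re_levy_cumulant_props:
  assumes mu: "levy_measure \<mu>"
  shows "Re (levy_cumulant a 0 \<mu> y) \<le> 0" "Re (levy_cumulant a 0 \<mu> (- y)) = Re (levy_cumulant a 0 \<mu> y)"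
    "- Re (levy_cumulant a 0 \<mu> (x + y)) \<le> 2 * (- Re (levy_cumulant a 0 \<mu> x) - Re (levy_cumulant a 0 \<mu> y))"
proof -
  note R = Re_levy_cumulant[OF mu]
  show "Re (levy_cumulant a 0 \<mu> y) \<le> 0" unfolding R(2) by (simp add: Bochner_Integration.integral_nonneg)
  show "Re (levy_cumulant a 0 \<mu> (- y)) = Re (levy_cumulant a 0 \<mu> y)" unfolding R(2) by simp
  have "(\<integral>t. 1 - cos ((x + y) * t) \<partial>\<mu>) \<le> (\<integral>t. 2 * ((1 - cos (x * t)) + (1 - cos (y * t))) \<partial>\<mu>)"
  proof (rule integral_mono)
    show "1 - cos ((x + y) * t) \<le> 2 * ((1 - cos (x * t)) + (1 - cos (y * t)))" for t
      unfolding distrib_right by (rule one_minus_cos_add_le)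
    show "integrable \<mu> (\<lambda>t. 2 * ((1 - cos (x * t)) + (1 - cos (y * t))))"
      by (intro integrable_mult_right Bochner_Integration.integrable_add R(1))
  qed (rule R(1))
  also have "\<dots> = 2 * ((\<integral>t. 1 - cos (x * t) \<partial>\<mu>) + (\<integral>t. 1 - cos (y * t) \<partial>\<mu>))"
    by (subst integral_mult_right_zero, subst Bochner_Integration.integral_add[OF R(1) R(1)]) simp
  finally show "- Re (levy_cumulant a 0 \<mu> (x + y)) \<le> 2 * (- Re (levy_cumulant a 0 \<mu> x) - Re (levy_cumulant a 0 \<mu> y))"
    unfolding R(2) by simp
qed

context levy_sq
begin

lemma integrable_large_jumps: "integrable \<mu> (\<lambda>x. x * (1 - indicator {-1..1} x))"
proof (rule Bochner_Integration.integrable_bound[OF sq])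
  have "\<bar>x * (1 - indicator {-1..1} x)\<bar> \<le> x\<^sup>2" for x :: real
  proof (cases "\<bar>x\<bar> \<le> 1")
    case False
    then have "\<bar>x\<bar> * 1 \<le> \<bar>x\<bar> * \<bar>x\<bar>" by (intro mult_left_mono) auto
    then show ?thesis by (auto simp: indicator_def power2_eq_square)
  qed (auto simp: indicator_def abs_le_iff minus_le_iff)
  then show "AE x in \<mu>. norm (x * (1 - indicator {-1..1} x)) \<le> norm (x\<^sup>2)" by simp
qed measurable

text \<open>The mean of the infinitely divisible law with triplet
  \<open>(a, 0, \<mu>)\<close>.\<close>

definition drift :: "real \<Rightarrow> real" where "drift a = a + (\<integral>x. x * (1 - indicator {-1..1} x) \<partial>\<mu>)"

lemma levy_cumulant_eq_centered: "levy_cumulant a 0 \<mu> z = \<i> * of_real (z * drift a) + centered_cumulant \<mu> z"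
proof -
  let ?l = "\<lambda>x. x * (1 - indicator {-1..1} x) :: real"
  have "(CLINT x|\<mu>. iexp (z * x) - 1 - \<i> * of_real (z * x * indicator {-1..1} x)) = (CLINT x|\<mu>. compensated_exp (z * x) + \<i> * of_real z * of_real (?l x))"
    by (intro Bochner_Integration.integral_cong) (auto simp: compensated_exp_def indicator_def)
  also have "\<dots> = centered_cumulant \<mu> z + (CLINT x|\<mu>. \<i> * of_real z * of_real (?l x))"
    unfolding centered_cumulant_def
    by (rule Bochner_Integration.integral_add[OF integrable_cumulant]) (intro integrable_mult_right integrable_of_real integrable_large_jumps)
  also have "(CLINT x|\<mu>. \<i> * of_real z * of_real (?l x)) = \<i> * of_real z * of_real (\<integral>x. ?l x \<partial>\<mu>)"
    by (simp only: integral_mult_right_zero integral_complex_of_real)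
  finally show ?thesis by (simp add: levy_cumulant_def drift_def distrib_left)
qed

end

text \<open>Merges the cases \<open>c = 0\<close> and \<open>c \<noteq> 0\<close> of the definition
  into one limit statement.\<close>

lemma power_asymp_at_0D:
  assumes "power_asymp_at_0 F c b"
  shows "((\<lambda>x. x powr b * F x) \<longlongrightarrow> c) (at_right 0)"
proof (cases "c = 0")
  case True
  then show ?thesis using assms by (simp add: power_asymp_at_0_def)
next
  case False
  then have "((\<lambda>x. F x / (c * x powr (- b))) \<longlongrightarrow> 1) (at_right 0)"
    using assms by (intro asymp_equivD_strong) (auto simp: power_asymp_at_0_def eventually_at_right_less intro!: eventually_mono[OF eventually_at_right_less])
  then have "((\<lambda>x. c * (F x / (c * x powr (- b)))) \<longlongrightarrow> c * 1) (at_right 0)" by (intro tendsto_intros)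
  then have "((\<lambda>x. c * (F x / (c * x powr (- b)))) \<longlongrightarrow> c) (at_right 0)" by simp
  then show ?thesis
  proof (rule Lim_transform_eventually)
    show "\<forall>\<^sub>F x in at_right 0. c * (F x / (c * x powr (- b))) = x powr b * F x"
      using eventually_at_right_less[of 0] by eventually_elim (use False in \<open>simp add: powr_minus field_simps\<close>)
  qed
qed

section \<open>Stable asymptotics and the sector bound of the centered cumulant\<close>

lemma stable_omega_minus: "stable_omega (- z) b c d = cnj (stable_omega z b c d)"
  by (simp add: stable_omega_def sgn_minus)

lemma stable_omega_scale: "0 < r \<Longrightarrow> stable_omega (r * z) b c d = stable_omega z b c d"
  by (simp add: stable_omega_def sgn_mult)

text \<open>For \<open>1 < b < 2\<close> both \<open>Gamma (2 - b) / (1 - b)\<close> and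
  \<open>cos (pi * b / 2)\<close> are negative.\<close>

lemma Re_stable_omega_pos:
  assumes b: "1 < b" "b < 2" and c: "0 < c + d"
  shows "0 < Re (stable_omega z b c d)"
proof -
  have "cos (pi * b / 2) < 0"
  proof -
    have "cos (pi * b / 2) = - sin (pi * (b - 1) / 2)"
      by (simp add: right_diff_distrib diff_divide_distrib sin_diff)
    moreover have "sin (pi * (b - 1) / 2) > 0" using b by (intro sin_gt_zero) auto
    ultimately show ?thesis by simp
  qed
  moreover have "Gamma (2 - b) / (1 - b) < 0" using b by (intro divide_pos_neg Gamma_real_pos) auto
  ultimately have "0 < Gamma (2 - b) / (1 - b) * ((c + d) * cos (pi * b / 2))"
    using c by (intro mult_neg_neg mult_pos_neg)
  then show ?thesis by (simp add: stable_omega_def)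
qed

locale stable_levy = levy_sq +
  fixes b cp cm :: real
  assumes b: "1 < b" "b < 2" and c: "0 \<le> cp" "0 \<le> cm" "0 < cp + cm"
    and tail_pos: "power_asymp_at_0 (\<lambda>x. measure \<mu> {x..}) cp b"
    and tail_neg: "power_asymp_at_0 (\<lambda>x. measure \<mu> {..-x}) cm b"
begin

text \<open>The lower tail of \<mu> is the upper tail of its reflection, so the asymptotics on the
  positive half-line also serve the negative one; conjugation undoes the reflection.\<close>

lemma reflected: "levy_sq (distr \<mu> borel uminus)"
proof
  have "(\<integral>\<^sup>+x. ennreal (min 1 (x\<^sup>2)) \<partial>distr \<mu> borel uminus) = (\<integral>\<^sup>+x. ennreal (min 1 (x\<^sup>2)) \<partial>\<mu>)"
    by (subst nn_integral_distr) auto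
  moreover have "emeasure (distr \<mu> borel uminus) {0} = emeasure \<mu> {0}"
  proof -
    have "uminus -` {0} = {0 :: real}" by auto
    then show ?thesis by (subst emeasure_distr) auto
  qed
  ultimately show "levy_measure (distr \<mu> borel uminus)" using levy by (simp add: levy_measure_def)
  show "integrable (distr \<mu> borel uminus) (\<lambda>x. x\<^sup>2)" by (subst integrable_distr_eq) (use sq in auto)
qed

lemma cumulant_asymptotics_pos:
  "((\<lambda>z. centered_cumulant \<mu> z /\<^sub>R z powr b) \<longlongrightarrow> - stable_omega 1 b cp cm) at_top"
proof -
  interpret R: levy_sq "distr \<mu> borel uminus" by (rule reflected)
  let ?P = "\<lambda>z. CLINT x|\<mu>. indicator {0<..} x *\<^sub>R compensated_exp (z * x)"
  let ?N = "\<lambda>z. CLINT x|distr \<mu> borel uminus. indicator {0<..} x *\<^sub>R compensated_exp (z * x)"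
  have i: "integrable \<mu> (\<lambda>x. indicator A x *\<^sub>R compensated_exp (z * x))" if "A \<in> sets borel" for A z
    using that integrable_cumulant by (intro integrable_mult_indicator) auto
  have split: "centered_cumulant \<mu> z = ?P z + cnj (?N z)" for z
  proof -
    have "?N z = (CLINT x|\<mu>. indicator {0<..} (- x) *\<^sub>R compensated_exp (z * - x))"
      by (rule integral_distr) auto
    then have "cnj (?N z) = (CLINT x|\<mu>. cnj (indicator {0<..} (- x) *\<^sub>R compensated_exp (z * - x)))"
      by (simp only: Bochner_Integration.integral_cnj)
    also have "\<dots> = (CLINT x|\<mu>. indicator {..<0} x *\<^sub>R compensated_exp (z * x))"
      by (intro Bochner_Integration.integral_cong) (auto simp: indicator_def compensated_exp_minus)
    finally have "?P z + cnj (?N z) = (CLINT x|\<mu>. indicator {0<..} x *\<^sub>R compensated_exp (z * x) + indicator {..<0} x *\<^sub>R compensated_exp (z * x))"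
      using i by simp
    also have "\<dots> = centered_cumulant \<mu> z"
      unfolding centered_cumulant_def
    proof (rule Bochner_Integration.integral_cong)
      show "indicator {0<..} x *\<^sub>R compensated_exp (z * x) + indicator {..<0} x *\<^sub>R compensated_exp (z * x) = compensated_exp (z * x)" for x
        by (cases "x = 0") (auto simp: indicator_def)
    qed simp
    finally show ?thesis by simp
  qed
  have "measure (distr \<mu> borel uminus) {x..} = measure \<mu> {..-x}" for x
  proof -
    have "uminus -` {x..} = {..-x}" by auto
    then show ?thesis by (subst measure_distr) auto
  qed
  then have l: "((\<lambda>x. x powr b * measure (distr \<mu> borel uminus) {x..}) \<longlongrightarrow> cm) (at_right 0)"
    using power_asymp_at_0D[OF tail_neg] by simp
  have "((\<lambda>z. ?P z /\<^sub>R z powr b + cnj (?N z /\<^sub>R z powr b)) \<longlongrightarrow>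
     of_real (Gamma (2 - b) / (1 - b) * cp) * (\<i> * sin (pi * b / 2) - cos (pi * b / 2)) +
     cnj (of_real (Gamma (2 - b) / (1 - b) * cm) * (\<i> * sin (pi * b / 2) - cos (pi * b / 2)))) at_top"
    by (intro tendsto_add tendsto_cnj half_cumulant_asymptotics[OF b power_asymp_at_0D[OF tail_pos]] R.half_cumulant_asymptotics[OF b l])
  also have "of_real (Gamma (2 - b) / (1 - b) * cp) * (\<i> * sin (pi * b / 2) - cos (pi * b / 2)) +
     cnj (of_real (Gamma (2 - b) / (1 - b) * cm) * (\<i> * sin (pi * b / 2) - cos (pi * b / 2))) = - stable_omega 1 b cp cm"
    by (simp add: stable_omega_def complex_eq_iff algebra_simps)
  also have "(\<lambda>z. ?P z /\<^sub>R z powr b + cnj (?N z /\<^sub>R z powr b)) = (\<lambda>z. centered_cumulant \<mu> z /\<^sub>R z powr b)"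
    unfolding split by (simp add: scaleR_add_right)
  finally show ?thesis .
qed

text \<open>The arguments run to plus or minus infinity according to the sign of \<open>g\<close>;
  the negative side follows from the conjugate symmetry of the cumulant.\<close>

lemma cumulant_asymptotics:
  assumes y: "filterlim (\<lambda>n. y n * sgn g) at_top F" and g: "g \<noteq> 0"
  shows "((\<lambda>n. centered_cumulant \<mu> (y n) /\<^sub>R \<bar>y n\<bar> powr b) \<longlongrightarrow> - stable_omega g b cp cm) F"
proof -
  have ev: "\<forall>\<^sub>F n in F. 0 < y n * sgn g" using y by (simp add: filterlim_at_top_dense)
  have L: "((\<lambda>n. centered_cumulant \<mu> (y n * sgn g) /\<^sub>R (y n * sgn g) powr b) \<longlongrightarrow> - stable_omega 1 b cp cm) F"
    by (rule filterlim_compose[OF cumulant_asymptotics_pos y])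
  show ?thesis
  proof (cases "0 < g")
    case True
    have "stable_omega g b cp cm = stable_omega 1 b cp cm" using stable_omega_scale[OF True, of 1] by simp
    moreover have "\<forall>\<^sub>F n in F. centered_cumulant \<mu> (y n * sgn g) /\<^sub>R (y n * sgn g) powr b = centered_cumulant \<mu> (y n) /\<^sub>R \<bar>y n\<bar> powr b"
      using ev by eventually_elim (use True in simp)
    ultimately show ?thesis using L by (auto elim: Lim_transform_eventually)
  next
    case False
    then have g: "g < 0" using g by simp
    have "stable_omega g b cp cm = cnj (stable_omega 1 b cp cm)"
      using stable_omega_scale[of "- g" "-1" b cp cm] g by (simp add: stable_omega_minus)
    moreover have "((\<lambda>n. cnj (centered_cumulant \<mu> (y n * sgn g) /\<^sub>R (y n * sgn g) powr b)) \<longlongrightarrow> cnj (- stable_omega 1 b cp cm)) F"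
      using L by (rule tendsto_cnj)
    moreover have "\<forall>\<^sub>F n in F. cnj (centered_cumulant \<mu> (y n * sgn g) /\<^sub>R (y n * sgn g) powr b) = centered_cumulant \<mu> (y n) /\<^sub>R \<bar>y n\<bar> powr b"
      using ev by eventually_elim (use g in \<open>simp add: cumulant_cnj[symmetric]\<close>)
    ultimately show ?thesis by (auto elim: Lim_transform_eventually)
  qed
qed

lemma cumulant_growth_Re:
  obtains Y d where "0 < Y" "0 < d" "\<And>y. Y \<le> \<bar>y\<bar> \<Longrightarrow> d * \<bar>y\<bar> powr b \<le> - Re (centered_cumulant \<mu> y)"
proof -
  define d where "d = Re (stable_omega 1 b cp cm) / 2"
  have d: "0 < d" using Re_stable_omega_pos[OF b c(3)] by (simp add: d_def)
  have "((\<lambda>z. Re (centered_cumulant \<mu> z /\<^sub>R z powr b)) \<longlongrightarrow> Re (- stable_omega 1 b cp cm)) at_top"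
    by (rule tendsto_Re[OF cumulant_asymptotics_pos])
  moreover have "Re (- stable_omega 1 b cp cm) < - d" using d by (simp add: d_def)
  ultimately have "\<forall>\<^sub>F z in at_top. Re (centered_cumulant \<mu> z /\<^sub>R z powr b) < - d" by (rule order_tendstoD)
  then obtain Y where Y: "\<And>z. Y \<le> z \<Longrightarrow> Re (centered_cumulant \<mu> z /\<^sub>R z powr b) < - d"
    by (auto simp: eventually_at_top_linorder)
  have *: "d * z powr b \<le> - Re (centered_cumulant \<mu> z)" if "max Y 1 \<le> z" for z
  proof -
    have p: "0 < z powr b" using that by simp
    have "Re (centered_cumulant \<mu> z) / z powr b < - d" using Y[of z] that by (simp add: divide_inverse mult.commute)
    then have "Re (centered_cumulant \<mu> z) < - d * z powr b" using p by (simp add: pos_divide_less_eq)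
    then show ?thesis by simp
  qed
  have "d * \<bar>y\<bar> powr b \<le> - Re (centered_cumulant \<mu> y)" if "max Y 1 \<le> \<bar>y\<bar>" for y
  proof -
    have "Re (centered_cumulant \<mu> \<bar>y\<bar>) = Re (centered_cumulant \<mu> y)"
      by (cases "0 \<le> y") (simp_all add: cumulant_cnj)
    then show ?thesis using *[OF that] by simp
  qed
  then show ?thesis using that[of "max Y 1" d] d by simp
qed

text \<open>Large arguments are covered by the asymptotics. For arguments below \<open>Y1\<close>
  the quadratic bound suffices, since \<open>z\<^sup>2 = z powr (2 - b) * z powr b\<close> and
  \<open>b < 2\<close>.\<close>

lemma cumulant_le_powr:
  obtains C where "0 < C" "\<And>y. norm (centered_cumulant \<mu> y) \<le> C * \<bar>y\<bar> powr b"
proof -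
  have "((\<lambda>z. norm (centered_cumulant \<mu> z /\<^sub>R z powr b)) \<longlongrightarrow> norm (- stable_omega 1 b cp cm)) at_top"
    by (rule tendsto_norm[OF cumulant_asymptotics_pos])
  then have "\<forall>\<^sub>F z in at_top. norm (centered_cumulant \<mu> z /\<^sub>R z powr b) < norm (- stable_omega 1 b cp cm) + 1"
    by (rule order_tendstoD) simp
  then obtain Y where Y: "\<And>z. Y \<le> z \<Longrightarrow> norm (centered_cumulant \<mu> z /\<^sub>R z powr b) < norm (- stable_omega 1 b cp cm) + 1"
    by (auto simp: eventually_at_top_linorder)
  define Y1 where "Y1 = max Y 1"
  define C where "C = norm (- stable_omega 1 b cp cm) + 1 + m2 * Y1 powr (2 - b)"
  have c0: "0 \<le> m2 * Y1 powr (2 - b)" using m2_nonneg by simp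
  have *: "norm (centered_cumulant \<mu> z) \<le> C * z powr b" if z: "0 < z" for z
  proof (cases "Y1 \<le> z")
    case True
    have "norm (centered_cumulant \<mu> z) / z powr b \<le> C"
      using Y[of z] True c0 by (simp add: C_def Y1_def divide_inverse mult.commute)
    then show ?thesis using z by (simp add: pos_divide_le_eq)
  next
    case False
    have "norm (centered_cumulant \<mu> z) \<le> m2 * z\<^sup>2" by (rule norm_cumulant_le)
    also have "z\<^sup>2 = z powr (2 - b) * z powr b" using z by (simp flip: powr_add)
    also have "m2 * (z powr (2 - b) * z powr b) \<le> m2 * (Y1 powr (2 - b) * z powr b)"
      using False z b by (intro mult_left_mono mult_right_mono m2_nonneg powr_mono2) auto
    also have "\<dots> \<le> C * z powr b" unfolding mult.assoc[symmetric] by (intro mult_right_mono) (auto simp: C_def)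
    finally show ?thesis .
  qed
  have "norm (centered_cumulant \<mu> y) \<le> C * \<bar>y\<bar> powr b" for y
  proof -
    have n: "norm (centered_cumulant \<mu> \<bar>y\<bar>) = norm (centered_cumulant \<mu> y)"
      by (cases "0 \<le> y") (simp_all add: cumulant_cnj)
    show ?thesis
    proof (cases "y = 0")
      case False
      then show ?thesis using *[of "\<bar>y\<bar>"] n by simp
    qed (simp add: centered_cumulant_def)
  qed
  moreover have "0 < C" using c0 by (simp add: C_def add_pos_nonneg add_nonneg_pos)
  ultimately show ?thesis using that by blast
qed

text \<open>Without jumps in {-r..r} the real part of the cumulant would be bounded by
  \<open>2 * m2 / r\<^sup>2\<close>, against its growth like
  \<open>\<bar>y\<bar> powr b\<close>.\<close>

lemma small_jumps_pos:
  assumes r: "0 < r"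
  shows "0 < (\<integral>x. indicator {-r..r} x * x\<^sup>2 \<partial>\<mu>)"
proof (rule ccontr)
  have i: "integrable \<mu> (\<lambda>x. indicator {-r..r} x * x\<^sup>2)"
    using integrable_mult_indicator[OF _ sq, of "{-r..r}"] by simp
  assume "\<not> ?thesis"
  moreover have "0 \<le> (\<integral>x. indicator {-r..r} x * x\<^sup>2 \<partial>\<mu>)" by (rule Bochner_Integration.integral_nonneg) simp
  ultimately have "(\<integral>x. indicator {-r..r} x * x\<^sup>2 \<partial>\<mu>) = 0" by simp
  then have ae: "AE x in \<mu>. indicator {-r..r} x * x\<^sup>2 = 0"
    using integral_nonneg_eq_0_iff_AE[OF i] by simp
  have le: "- Re (centered_cumulant \<mu> y) \<le> 2 * m2 / r\<^sup>2" for y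
  proof -
    have "- Re (centered_cumulant \<mu> y) = (\<integral>x. 1 - cos (y * x) \<partial>\<mu>)" by (simp add: Re_cumulant)
    also have "\<dots> \<le> (\<integral>x. 2 / r\<^sup>2 * x\<^sup>2 \<partial>\<mu>)"
    proof (rule integral_mono_AE)
      show "AE x in \<mu>. 1 - cos (y * x) \<le> 2 / r\<^sup>2 * x\<^sup>2"
        using ae
      proof eventually_elim
        case (elim x)
        show ?case
        proof (cases "x \<in> {-r..r}")
          case True
          then show ?thesis using elim by simp
        next
          case False
          then have "r \<le> \<bar>x\<bar>" by auto
          then have "r\<^sup>2 \<le> x\<^sup>2" using r by (metis less_imp_le power2_abs power_mono)
          then have "2 \<le> 2 / r\<^sup>2 * x\<^sup>2" using r by (simp add: field_simps)
          moreover have "1 - cos (y * x) \<le> 2" using cos_ge_minus_one[of "y * x"] by linarith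
          ultimately show ?thesis by linarith
        qed
      qed
    qed (use sq in simp_all)
    finally show ?thesis by (simp add: m2_def mult.commute)
  qed
  obtain Y d where Y: "0 < Y" "0 < d" "\<And>y. Y \<le> \<bar>y\<bar> \<Longrightarrow> d * \<bar>y\<bar> powr b \<le> - Re (centered_cumulant \<mu> y)"
    using cumulant_growth_Re by blast
  have "filterlim (\<lambda>y::real. d * y powr b) at_top at_top" using Y(2) b by real_asymp
  then have "\<forall>\<^sub>F y in at_top. 2 * m2 / r\<^sup>2 < d * y powr b" by (simp add: filterlim_at_top_dense)
  moreover have "\<forall>\<^sub>F y in at_top. d * y powr b \<le> 2 * m2 / r\<^sup>2"
    using eventually_ge_at_top[of Y]
  proof eventually_elim
    case (elim y)
    then show ?case using Y(1) Y(3)[of y] le[of y] by simp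
  qed
  ultimately have "\<forall>\<^sub>F y::real in at_top. False" by eventually_elim simp
  then show False by simp
qed

text \<open>Beyond \<open>Y\<close> both sides are of order \<open>\<bar>y\<bar> powr b\<close>. Up
  to \<open>Y\<close> both are of order \<open>y\<^sup>2\<close>: the lower bound uses only jumps of
  size at most \<open>1 / Y\<close>, for which \<open>\<bar>y * x\<bar> \<le> 1\<close> and
  \<open>one_minus_cos_ge\<close> applies.\<close>

lemma cumulant_sector:
  obtains C where "\<And>y. norm (centered_cumulant \<mu> y) \<le> C * (- Re (centered_cumulant \<mu> y))"
proof -
  obtain Y d where Y: "0 < Y" "0 < d" "\<And>y. Y \<le> \<bar>y\<bar> \<Longrightarrow> d * \<bar>y\<bar> powr b \<le> - Re (centered_cumulant \<mu> y)"
    using cumulant_growth_Re by blast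
  obtain C where C: "0 < C" "\<And>y. norm (centered_cumulant \<mu> y) \<le> C * \<bar>y\<bar> powr b"
    using cumulant_le_powr by blast
  define s where "s = (\<integral>x. indicator {-(1/Y)..1/Y} x * x\<^sup>2 \<partial>\<mu>)"
  have s: "0 < s" unfolding s_def using Y(1) by (intro small_jumps_pos) simp
  have low: "s / 4 * y\<^sup>2 \<le> - Re (centered_cumulant \<mu> y)" if y: "\<bar>y\<bar> \<le> Y" for y
  proof -
    have i: "integrable \<mu> (\<lambda>x. y\<^sup>2 / 4 * (indicator {-(1/Y)..1/Y} x * x\<^sup>2))"
      using integrable_mult_indicator[OF _ sq, of "{-(1/Y)..1/Y}"] by simp
    have "s / 4 * y\<^sup>2 = (\<integral>x. y\<^sup>2 / 4 * (indicator {-(1/Y)..1/Y} x * x\<^sup>2) \<partial>\<mu>)"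
      by (simp only: s_def integral_mult_right_zero) simp
    also have "\<dots> \<le> (\<integral>x. 1 - cos (y * x) \<partial>\<mu>)"
    proof (rule integral_mono[OF i])
      fix x
      show "y\<^sup>2 / 4 * (indicator {-(1/Y)..1/Y} x * x\<^sup>2) \<le> 1 - cos (y * x)"
      proof (cases "\<bar>x\<bar> \<le> 1 / Y")
        case True
        then have "\<bar>y\<bar> * \<bar>x\<bar> \<le> Y * (1 / Y)" using y Y(1) by (intro mult_mono) auto
        then have "(y * x)\<^sup>2 / 4 \<le> 1 - cos (y * x)" using Y(1) by (intro one_minus_cos_ge) (simp add: abs_mult)
        then show ?thesis using True by (simp add: indicator_def abs_le_iff minus_le_iff power_mult_distrib)
      next
        case False
        then have "indicator {-(1/Y)..1/Y} x = (0 :: real)" by (auto simp: indicator_def)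
        then show ?thesis by simp
      qed
    qed simp
    finally show ?thesis by (simp add: Re_cumulant)
  qed
  define E where "E = C / d + 4 * m2 / s"
  have "norm (centered_cumulant \<mu> y) \<le> E * (- Re (centered_cumulant \<mu> y))" for y
  proof (cases "\<bar>y\<bar> \<le> Y")
    case True
    have "norm (centered_cumulant \<mu> y) \<le> m2 * y\<^sup>2" by (rule norm_cumulant_le)
    also have "\<dots> = 4 * m2 / s * (s / 4 * y\<^sup>2)" using s by simp
    also have "\<dots> \<le> 4 * m2 / s * (- Re (centered_cumulant \<mu> y))"
      using low[OF True] s m2_nonneg by (intro mult_left_mono) auto
    also have "\<dots> \<le> E * (- Re (centered_cumulant \<mu> y))"
    proof (rule mult_right_mono)
      show "0 \<le> - Re (centered_cumulant \<mu> y)" using low[OF True] s by (meson divide_nonneg_pos less_imp_le mult_nonneg_nonneg order_trans zero_le_power2 zero_less_numeral)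
    qed (use C(1) Y(2) in \<open>simp add: E_def\<close>)
    finally show ?thesis .
  next
    case False
    have "norm (centered_cumulant \<mu> y) \<le> C / d * (d * \<bar>y\<bar> powr b)" using C(2)[of y] Y(2) by simp
    also have "\<dots> \<le> C / d * (- Re (centered_cumulant \<mu> y))"
      using Y(3)[of y] False C(1) Y(2) by (intro mult_left_mono) auto
    also have "\<dots> \<le> E * (- Re (centered_cumulant \<mu> y))"
    proof (rule mult_right_mono)
      have "0 \<le> d * \<bar>y\<bar> powr b" using Y(2) by simp
      then show "0 \<le> - Re (centered_cumulant \<mu> y)" using Y(3)[of y] False by linarith
    qed (use s m2_nonneg in \<open>simp add: E_def\<close>)
    finally show ?thesis .
  qed
  then show ?thesis by (rule that)
qed

end

section \<open>The supOU process\<close>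

text \<open>Exponents of differences tending to 0 make their characteristic functions tend to 1,
  hence the simple integrals are Cauchy in probability and converge.\<close>

lemma (in infdiv_functional) S_Cauchy_conv:
  assumes hs: "\<And>n. rr_simple m (h n)"
    and H: "\<And>z r s. filterlim r at_top sequentially \<Longrightarrow> filterlim s at_top sequentially \<Longrightarrow>
       (\<lambda>k. \<integral>x. \<kappa> (z * (h (r k) x - h (s k) x)) \<partial>m) \<longlonglongrightarrow> 0"
  obtains Y where "Y \<in> borel_measurable M" "conv_in_prob M (\<lambda>n. S (h n)) Y"
proof (rule Cauchy_in_prob_imp_conv)
  show Sm: "S (h n) \<in> borel_measurable M" for n by (rule S_measurable[OF hs])
  fix e :: real assume e: "0 < e"
  show "\<exists>N. \<forall>n\<ge>N. \<forall>k\<ge>N. prob {\<omega>\<in>space M. \<bar>S (h n) \<omega> - S (h k) \<omega>\<bar> > e} < e"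
  proof (rule double_sequence_tendsto_0[OF _ e])
    fix r s :: "nat \<Rightarrow> nat" assume r: "filterlim r at_top sequentially" and s: "filterlim s at_top sequentially"
    show "(\<lambda>k. prob {\<omega>\<in>space M. \<bar>S (h (r k)) \<omega> - S (h (s k)) \<omega>\<bar> > e}) \<longlonglongrightarrow> 0"
    proof (rule char_tendsto_1_imp_prob_tendsto_0[OF _ _ e])
      show "(\<lambda>\<omega>. S (h (r k)) \<omega> - S (h (s k)) \<omega>) \<in> borel_measurable M" for k
        by (intro borel_measurable_diff Sm)
      fix z :: real
      have "(CLINT \<omega>|M. iexp (z * (S (h (r k)) \<omega> - S (h (s k)) \<omega>))) = exp (\<integral>x. \<kappa> (z * (h (r k) x - h (s k) x)) \<partial>m)" for k
      proof -
        let ?g = "\<lambda>x. z * (h (r k) x - h (s k) x)"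
        have g: "rr_simple m ?g" by (intro rr_simple_cmult rr_simple_diff hs)
        have "(CLINT \<omega>|M. iexp (z * (S (h (r k)) \<omega> - S (h (s k)) \<omega>))) = (CLINT \<omega>|M. iexp (S ?g \<omega>))"
        proof (rule integral_cong_AE)
          show "(\<lambda>\<omega>. iexp (z * (S (h (r k)) \<omega> - S (h (s k)) \<omega>))) \<in> borel_measurable M" using Sm by measurable
          show "(\<lambda>\<omega>. iexp (S ?g \<omega>)) \<in> borel_measurable M" using S_measurable[OF g] by measurable
          show "AE \<omega> in M. iexp (z * (S (h (r k)) \<omega> - S (h (s k)) \<omega>)) = iexp (S ?g \<omega>)"
            using S_diff[OF hs hs, of "r k" "s k"] S_cmult[OF rr_simple_diff[OF hs hs, of "r k" "s k"], of z]
            by eventually_elim simp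
        qed
        then show ?thesis by (simp only: S_char[OF g])
      qed
      moreover have "(\<lambda>k. exp (\<integral>x. \<kappa> (z * (h (r k) x - h (s k) x)) \<partial>m)) \<longlonglongrightarrow> exp 0"
        by (intro tendsto_intros H r s)
      ultimately show "(\<lambda>k. CLINT \<omega>|M. iexp (z * (S (h (r k)) \<omega> - S (h (s k)) \<omega>))) \<longlonglongrightarrow> 1" by simp
    qed
  qed
qed (use that in blast)

lemma norm_exp_minus_1_le:
  assumes "Re w \<le> 0"
  shows "norm (exp w - 1) \<le> norm w"
proof -
  have "norm (exp w - exp 0) \<le> 1 * norm (w - 0)"
  proof (rule field_differentiable_bound[where S="{z. Re z \<le> 0}" and f'=exp])
    show "convex {z. Re z \<le> 0}" by (rule convex_halfspace_Re_le)
    show "(exp has_field_derivative exp z) (at z within {z. Re z \<le> 0})" for z by (auto intro!: derivative_eq_intros)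
  qed (use assms in \<open>auto simp: norm_exp_eq_Re\<close>)
  then show ?thesis by simp
qed

section \<open>Riemann sums and cumulants in mean square\<close>

lemma square_integral_le:
  fixes u :: "real \<Rightarrow> real"
  assumes u: "integrable lborel u" and t: "0 < t" and supp: "\<And>s. s \<notin> {0..t} \<Longrightarrow> u s = 0"
  shows "ennreal ((\<integral>s. u s \<partial>lborel)\<^sup>2) \<le> ennreal t * (\<integral>\<^sup>+s. ennreal ((u s)\<^sup>2) \<partial>lborel)"
proof (cases "(\<integral>\<^sup>+s. ennreal ((u s)\<^sup>2) \<partial>lborel) < \<infinity>")
  case False
  then show ?thesis using t by (simp add: less_top[symmetric] ennreal_mult_top top_unique)
next
  case True
  have i2: "integrable lborel (\<lambda>s. (u s)\<^sup>2)"
    using True u by (intro integrableI_bounded) auto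
  \<comment> \<open>Cauchy-Schwarz by completing the square: \<open>c\<close> is the mean of
    \<open>u\<close> over the interval.\<close>
  define c where "c = (\<integral>s. u s \<partial>lborel) / t"
  have ii: "integrable lborel (\<lambda>s. indicator {0..t} s :: real)" by (intro integrable_real_indicator) (use t in auto)
  have "0 \<le> (\<integral>s. (u s - c * indicator {0..t} s)\<^sup>2 \<partial>lborel)" by (rule Bochner_Integration.integral_nonneg) simp
  also have "(\<lambda>s. (u s - c * indicator {0..t} s)\<^sup>2) = (\<lambda>s. (u s)\<^sup>2 - 2 * c * u s + c\<^sup>2 * indicator {0..t} s)"
    using supp by (auto simp: fun_eq_iff indicator_def power2_diff power_mult_distrib)
  also have "(\<integral>s. (u s)\<^sup>2 - 2 * c * u s + c\<^sup>2 * indicator {0..t} s \<partial>lborel) = (\<integral>s. (u s)\<^sup>2 \<partial>lborel) - 2 * c * (\<integral>s. u s \<partial>lborel) + c\<^sup>2 * t"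
    using i2 u ii t by simp
  also have "\<dots> = (\<integral>s. (u s)\<^sup>2 \<partial>lborel) - (\<integral>s. u s \<partial>lborel)\<^sup>2 / t"
    using t by (simp add: c_def power2_eq_square field_simps)
  finally have "(\<integral>s. u s \<partial>lborel)\<^sup>2 \<le> t * (\<integral>s. (u s)\<^sup>2 \<partial>lborel)" using t by (simp add: field_simps)
  then have "ennreal ((\<integral>s. u s \<partial>lborel)\<^sup>2) \<le> ennreal (t * (\<integral>s. (u s)\<^sup>2 \<partial>lborel))" by (rule ennreal_leI)
  also have "\<dots> = ennreal t * (\<integral>\<^sup>+s. ennreal ((u s)\<^sup>2) \<partial>lborel)"
    using t i2 by (simp add: ennreal_mult Bochner_Integration.integral_nonneg nn_integral_eq_integral)
  finally show ?thesis .
qed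

text \<open>Cauchy-Schwarz in time, then Fubini, bounds the error by the mean-square modulus over
  one mesh width. It is applied both to the kernels under the control measure and to X under the
  probability measure.\<close>

lemma Riemann_sum_L2_bound:
  fixes V :: "real \<Rightarrow> 'a \<Rightarrow> real" and n :: nat
  assumes M: "sigma_finite_measure M" and V[measurable]: "(\<lambda>(s, x). V s x) \<in> borel_measurable (borel \<Otimes>\<^sub>M M)"
    and t: "0 \<le> t" and n: "0 < n" and d: "0 \<le> d"
    and close: "\<And>s r. s \<in> {0..t} \<Longrightarrow> r \<in> {0..t} \<Longrightarrow> \<bar>s - r\<bar> \<le> t / n \<Longrightarrow> (\<integral>\<^sup>+x. ennreal ((V s x - V r x)\<^sup>2) \<partial>M) \<le> ennreal d"
    and int: "AE x in M. set_integrable lborel {0..t} (\<lambda>s. V s x)"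
  shows "(\<integral>\<^sup>+x. ennreal (((LBINT s:{0..t}. V s x) - (\<Sum>k\<in>{..<n}. t / real n * V (real k * (t / real n)) x))\<^sup>2) \<partial>M) \<le> ennreal (t\<^sup>2 * d)"
proof (cases "t = 0")
  case True
  have "(LBINT s:{0..0}. V s x) = 0" for x
    unfolding set_lebesgue_integral_def
    by (rule integral_eq_zero_AE, rule eventually_mono[OF AE_lborel_singleton[of 0]]) (auto simp: indicator_def)
  then show ?thesis using True by simp
next
  case False
  interpret M: sigma_finite_measure M by fact
  interpret P: pair_sigma_finite lborel M ..
  have t: "0 < t" using t False by simp
  define h where "h = t / n"
  have h: "0 < h" "real n * h = t" using t n by (auto simp: h_def)
  define W where "W s x = (\<Sum>k<n. indicator {real k * h..<real (Suc k) * h} s * V (real k * h) x)" for s x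
  define u where "u s x = indicator {0..t} s * V s x - W s x" for s x
  have Vm: "V c \<in> borel_measurable M" for c
    using measurable_compose[OF measurable_Pair1'[of c borel M] V] by simp
  have [measurable]: "(\<lambda>(s, x). u s x) \<in> borel_measurable (lborel \<Otimes>\<^sub>M M)"
    using Vm unfolding u_def W_def by measurable
  have Wi: "has_bochner_integral lborel (\<lambda>s. W s x) (\<Sum>k<n. h * V (real k * h) x)" for x
    unfolding W_def
  proof (intro has_bochner_integral_sum has_bochner_integral_mult_left)
    fix k
    have "real k * h \<le> real (Suc k) * h" using h(1) by (intro mult_right_mono) auto
    then have "has_bochner_integral lborel (indicator {real k * h..<real (Suc k) * h}) (measure lborel {real k * h..<real (Suc k) * h})"
      by (intro has_bochner_integral_real_indicator) simp_all
    also have "measure lborel {real k * h..<real (Suc k) * h} = h"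
      using h by (simp add: distrib_right)
    finally show "has_bochner_integral lborel (indicator {real k * h..<real (Suc k) * h}) h" .
  qed
  have W_val: "\<exists>k<n. s \<in> {real k * h..<real (Suc k) * h} \<and> (\<forall>x. W s x = V (real k * h) x)" if s: "0 \<le> s" "s < t" for s
  proof -
    define k where "k = nat \<lfloor>s / h\<rfloor>"
    have k: "real k \<le> s / h" "s / h < real k + 1" using s h by (auto simp: k_def)
    then have sk: "s \<in> {real k * h..<real (Suc k) * h}" using h by (simp add: field_simps)
    have "s / h < real n" using s h by (simp add: field_simps)
    then have kn: "k < n" using k(1) by linarith
    have "W s x = V (real k * h) x" for x
    proof -
      have "W s x = (\<Sum>j<n. if j = k then V (real k * h) x else 0)"
        unfolding W_def
      proof (rule sum.cong)
        fix j
        show "indicator {real j * h..<real (Suc j) * h} s * V (real j * h) x = (if j = k then V (real k * h) x else 0)"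
        proof (cases "j = k")
          case False
          have "s \<notin> {real j * h..<real (Suc j) * h}"
          proof
            assume "s \<in> {real j * h..<real (Suc j) * h}"
            then have "real j \<le> s / h" "s / h < real (Suc j)" using h by (auto simp: field_simps)
            then have "j < Suc k" "k < Suc j" using k by linarith+
            then show False using False by simp
          qed
          then show ?thesis using False by simp
        qed (use sk in simp)
      qed simp
      then show ?thesis using kn by simp
    qed
    then show ?thesis using sk kn by blast
  qed
  have supp: "u s x = 0" if "s \<notin> {0..t}" for s x
  proof -
    have "W s x = 0" unfolding W_def
    proof (rule sum.neutral, rule ballI)
      fix k assume "k \<in> {..<n}"
      then have "real (Suc k) \<le> real n" by simp
      then have "real (Suc k) * h \<le> t" unfolding h(2)[symmetric] using h(1) by (intro mult_right_mono) auto
      moreover have "0 \<le> real k * h" using h by simp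
      ultimately have "s \<notin> {real k * h..<real (Suc k) * h}" using that by auto
      then show "indicator {real k * h..<real (Suc k) * h} s * V (real k * h) x = 0" by simp
    qed
    then show ?thesis using that by (simp add: u_def)
  qed
  have "(\<integral>\<^sup>+x. ennreal (((LBINT s:{0..t}. V s x) - (\<Sum>k\<in>{..<n}. t / real n * V (real k * (t / real n)) x))\<^sup>2) \<partial>M) \<le> (\<integral>\<^sup>+x. ennreal t * (\<integral>\<^sup>+s. ennreal ((u s x)\<^sup>2) \<partial>lborel) \<partial>M)"
  proof (rule nn_integral_mono_AE)
    show "AE x in M. ennreal (((LBINT s:{0..t}. V s x) - (\<Sum>k\<in>{..<n}. t / real n * V (real k * (t / real n)) x))\<^sup>2) \<le> ennreal t * (\<integral>\<^sup>+s. ennreal ((u s x)\<^sup>2) \<partial>lborel)"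
      using int
    proof eventually_elim
      case (elim x)
      have i: "integrable lborel (\<lambda>s. indicator {0..t} s * V s x)" using elim by (simp add: set_integrable_def)
      have "integrable lborel (\<lambda>s. u s x)" unfolding u_def
        using i Wi[of x] by (intro Bochner_Integration.integrable_diff) (auto simp: has_bochner_integral_iff)
      moreover have "(\<integral>s. u s x \<partial>lborel) = (LBINT s:{0..t}. V s x) - (\<Sum>k\<in>{..<n}. t / real n * V (real k * (t / real n)) x)"
        unfolding u_def using i Wi[of x]
        by (subst Bochner_Integration.integral_diff) (auto simp: has_bochner_integral_iff set_lebesgue_integral_def h_def)
      ultimately show ?case using square_integral_le[of "\<lambda>s. u s x" t] t supp by simp
    qed
  qed
  also have "\<dots> = ennreal t * (\<integral>\<^sup>+x. \<integral>\<^sup>+s. ennreal ((u s x)\<^sup>2) \<partial>lborel \<partial>M)"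
    by (rule nn_integral_cmult) measurable
  also have "(\<integral>\<^sup>+x. \<integral>\<^sup>+s. ennreal ((u s x)\<^sup>2) \<partial>lborel \<partial>M) = (\<integral>\<^sup>+s. \<integral>\<^sup>+x. ennreal ((u s x)\<^sup>2) \<partial>M \<partial>lborel)"
    by (rule P.Fubini') measurable
  also have "\<dots> \<le> (\<integral>\<^sup>+s. ennreal d * indicator {0..t} s \<partial>lborel)"
  proof (rule nn_integral_mono_AE)
    \<comment> \<open>The cells are half-open, so the right endpoint lies in none of them.\<close>
    have "AE s in lborel. s \<noteq> t" by (rule AE_lborel_singleton)
    then show "AE s in lborel. (\<integral>\<^sup>+x. ennreal ((u s x)\<^sup>2) \<partial>M) \<le> ennreal d * indicator {0..t} s"
    proof eventually_elim
      case (elim s)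
      show ?case
      proof (cases "s \<in> {0..t}")
        case True
        then obtain k where k: "k < n" "s \<in> {real k * h..<real (Suc k) * h}" "\<And>x. W s x = V (real k * h) x"
          using W_val[of s] elim by auto
        have "real k * h \<le> real n * h" using k(1) h by (intro mult_right_mono) auto
        then have "real k * h \<in> {0..t}" using h by simp
        moreover have "\<bar>s - real k * h\<bar> \<le> t / n" using k(2) unfolding h_def[symmetric] by (auto simp: distrib_right)
        ultimately have "(\<integral>\<^sup>+x. ennreal ((V s x - V (real k * h) x)\<^sup>2) \<partial>M) \<le> ennreal d" using True by (intro close)
        then show ?thesis using True k(3) by (simp add: u_def)
      qed (simp add: supp)
    qed
  qed
  also have "(\<integral>\<^sup>+s. ennreal d * indicator {0..t} s \<partial>lborel) = ennreal d * ennreal t"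
    using t by (subst nn_integral_cmult_indicator) auto
  finally have "(\<integral>\<^sup>+x. ennreal (((LBINT s:{0..t}. V s x) - (\<Sum>k\<in>{..<n}. t / real n * V (real k * (t / real n)) x))\<^sup>2) \<partial>M) \<le> ennreal t * (ennreal d * ennreal t)"
    by (simp add: mult_left_mono)
  also have "ennreal t * (ennreal d * ennreal t) = ennreal (t\<^sup>2 * d)"
    using t d by (simp add: power2_eq_square mult_ac flip: ennreal_mult)
  finally show ?thesis .
qed

context levy_sq
begin

text \<open>The difference of the cumulants is at most a multiple of
  \<open>D * (\<bar>g\<bar> + \<bar>f\<bar>)\<close> with \<open>D = \<bar>g - f\<bar>\<close>.
  Weighting this as \<open>(1 + 1 / e) * D\<^sup>2 + e * f\<^sup>2\<close> leaves a term that
  vanishes in the limit and one that is small with \<open>e\<close>.\<close>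

lemma cumulant_L2_tendsto:
  fixes g :: "nat \<Rightarrow> 'a \<Rightarrow> real"
  assumes [measurable]: "\<And>n. g n \<in> borel_measurable m" "f \<in> borel_measurable m"
    and f: "(\<integral>\<^sup>+x. ennreal ((f x)\<^sup>2) \<partial>m) < \<infinity>"
    and g: "\<And>n. (\<integral>\<^sup>+x. ennreal ((g n x)\<^sup>2) \<partial>m) < \<infinity>"
    and lim: "(\<lambda>n. \<integral>\<^sup>+x. ennreal ((g n x - f x)\<^sup>2) \<partial>m) \<longlonglongrightarrow> 0"
  shows "integrable m (\<lambda>x. centered_cumulant \<mu> (f x))"
    and "(\<lambda>n. \<integral>x. centered_cumulant \<mu> (g n x) \<partial>m) \<longlonglongrightarrow> (\<integral>x. centered_cumulant \<mu> (f x) \<partial>m)"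
proof -
  have [measurable]: "centered_cumulant \<mu> \<in> borel_measurable borel"
    by (rule borel_measurable_continuous_onI[OF cumulant_cont])
  have int: "integrable m (\<lambda>x. centered_cumulant \<mu> (q x))" if [measurable]: "q \<in> borel_measurable m" and q: "(\<integral>\<^sup>+x. ennreal ((q x)\<^sup>2) \<partial>m) < \<infinity>" for q
  proof (rule Bochner_Integration.integrable_bound)
    have "integrable m (\<lambda>x. (q x)\<^sup>2)" using q by (intro integrableI_bounded) auto
    then show "integrable m (\<lambda>x. m2 * (q x)\<^sup>2)" by simp
    show "AE x in m. norm (centered_cumulant \<mu> (q x)) \<le> norm (m2 * (q x)\<^sup>2)"
      by (intro AE_I2 order_trans[OF norm_cumulant_le]) simp
  qed measurable
  show "integrable m (\<lambda>x. centered_cumulant \<mu> (f x))" by (rule int[OF _ f]) measurable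
  have f2: "integrable m (\<lambda>x. (f x)\<^sup>2)" using f by (intro integrableI_bounded) auto
  have d2: "integrable m (\<lambda>x. (g n x - f x)\<^sup>2)" for n
  proof (rule Bochner_Integration.integrable_bound)
    have "integrable m (\<lambda>x. (g n x)\<^sup>2)" using g[of n] by (intro integrableI_bounded) auto
    then show "integrable m (\<lambda>x. 2 * (g n x)\<^sup>2 + 2 * (f x)\<^sup>2)" using f2 by simp
    have "(a - b)\<^sup>2 \<le> 2 * a\<^sup>2 + 2 * b\<^sup>2" for a b :: real
      using sum_squares_bound[of a "- b"] by (simp add: power2_diff)
    then show "AE x in m. norm ((g n x - f x)\<^sup>2) \<le> norm (2 * (g n x)\<^sup>2 + 2 * (f x)\<^sup>2)" by simp
  qed measurable
  have "(\<lambda>n. ennreal (\<integral>x. (g n x - f x)\<^sup>2 \<partial>m)) \<longlonglongrightarrow> ennreal 0"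
    using lim d2 by (simp add: nn_integral_eq_integral)
  then have lim': "(\<lambda>n. \<integral>x. (g n x - f x)\<^sup>2 \<partial>m) \<longlonglongrightarrow> 0"
    by (subst (asm) tendsto_ennreal_iff) (auto simp: Bochner_Integration.integral_nonneg)
  have m2': "0 \<le> 2 * m2" using m2_nonneg by simp
  have bound: "norm ((\<integral>x. centered_cumulant \<mu> (g n x) \<partial>m) - (\<integral>x. centered_cumulant \<mu> (f x) \<partial>m))
     \<le> 2 * m2 * ((1 + 1 / e) * (\<integral>x. (g n x - f x)\<^sup>2 \<partial>m) + e * (\<integral>x. (f x)\<^sup>2 \<partial>m))" if e: "0 < e" for n e
  proof -
    have ig: "integrable m (\<lambda>x. centered_cumulant \<mu> (g n x))" by (rule int[OF _ g]) measurable
    have iff: "integrable m (\<lambda>x. centered_cumulant \<mu> (f x))" by (rule int[OF _ f]) measurable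
    have "norm ((\<integral>x. centered_cumulant \<mu> (g n x) \<partial>m) - (\<integral>x. centered_cumulant \<mu> (f x) \<partial>m)) = norm (\<integral>x. centered_cumulant \<mu> (g n x) - centered_cumulant \<mu> (f x) \<partial>m)"
      using ig iff by simp
    also have "\<dots> \<le> (\<integral>x. norm (centered_cumulant \<mu> (g n x) - centered_cumulant \<mu> (f x)) \<partial>m)" by (rule integral_norm_bound)
    also have "\<dots> \<le> (\<integral>x. 2 * m2 * ((1 + 1 / e) * (g n x - f x)\<^sup>2 + e * (f x)\<^sup>2) \<partial>m)"
    proof (rule integral_mono)
      show "integrable m (\<lambda>x. norm (centered_cumulant \<mu> (g n x) - centered_cumulant \<mu> (f x)))" using ig iff by simp
      show "integrable m (\<lambda>x. 2 * m2 * ((1 + 1 / e) * (g n x - f x)\<^sup>2 + e * (f x)\<^sup>2))" using d2 f2 by simp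
      fix x
      define D where "D = \<bar>g n x - f x\<bar>"
      define E where "E = \<bar>f x\<bar>"
      \<comment> \<open>Young's inequality with weight \<open>e\<close>.\<close>
      have "2 * (D * E) \<le> 1 / e * D\<^sup>2 + e * E\<^sup>2"
      proof -
        have "0 \<le> (D - e * E)\<^sup>2 / e" using e by simp
        also have "\<dots> = 1 / e * D\<^sup>2 + e * E\<^sup>2 - 2 * (D * E)" using e by (simp add: power2_eq_square field_simps)
        finally show ?thesis by simp
      qed
      moreover have "\<bar>g n x\<bar> \<le> D + E" by (simp add: D_def E_def)
      then have "D * (\<bar>g n x\<bar> + E) \<le> D * (D + 2 * E)" by (intro mult_left_mono) (auto simp: D_def)
      ultimately have "D * (\<bar>g n x\<bar> + E) \<le> (1 + 1 / e) * D\<^sup>2 + e * E\<^sup>2"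
        by (simp add: algebra_simps power2_eq_square)
      then have "2 * m2 * (D * (\<bar>g n x\<bar> + E)) \<le> 2 * m2 * ((1 + 1 / e) * D\<^sup>2 + e * E\<^sup>2)"
        by (intro mult_left_mono m2')
      with norm_cumulant_diff_le[of "g n x" "f x"]
      show "norm (centered_cumulant \<mu> (g n x) - centered_cumulant \<mu> (f x)) \<le> 2 * m2 * ((1 + 1 / e) * (g n x - f x)\<^sup>2 + e * (f x)\<^sup>2)"
        by (simp add: D_def E_def)
    qed
    also have "\<dots> = 2 * m2 * ((1 + 1 / e) * (\<integral>x. (g n x - f x)\<^sup>2 \<partial>m) + e * (\<integral>x. (f x)\<^sup>2 \<partial>m))"
      using d2 f2 by simp
    finally show ?thesis .
  qed
  \<comment> \<open>The added 1 keeps \<open>A\<close> positive, so that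
    \<open>e = r / (2 * A)\<close> makes the second error smaller than \<open>r / 2\<close>.\<close>
  define A where "A = 2 * m2 * (\<integral>x. (f x)\<^sup>2 \<partial>m) + 1"
  have A: "0 < A" using m2' by (simp add: A_def add_nonneg_pos Bochner_Integration.integral_nonneg)
  show "(\<lambda>n. \<integral>x. centered_cumulant \<mu> (g n x) \<partial>m) \<longlonglongrightarrow> (\<integral>x. centered_cumulant \<mu> (f x) \<partial>m)"
  proof (rule LIMSEQ_I)
    fix r :: real assume r: "0 < r"
    define e where "e = r / (2 * A)"
    have e: "0 < e" using r A by (simp add: e_def)
    have "2 * m2 * (e * (\<integral>x. (f x)\<^sup>2 \<partial>m)) = e * (A - 1)" by (simp add: A_def)
    also have "\<dots> < e * A" using e by simp
    also have "\<dots> = r / 2" using A by (simp add: e_def)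
    finally have eA: "2 * m2 * (e * (\<integral>x. (f x)\<^sup>2 \<partial>m)) < r / 2" .
    have "(\<lambda>n. 2 * m2 * ((1 + 1 / e) * (\<integral>x. (g n x - f x)\<^sup>2 \<partial>m))) \<longlonglongrightarrow> 2 * m2 * ((1 + 1 / e) * 0)"
      by (intro tendsto_intros lim')
    then have "\<forall>\<^sub>F n in sequentially. 2 * m2 * ((1 + 1 / e) * (\<integral>x. (g n x - f x)\<^sup>2 \<partial>m)) < r / 2"
      by (rule order_tendstoD) (use r in simp)
    then have "\<forall>\<^sub>F n in sequentially. norm ((\<integral>x. centered_cumulant \<mu> (g n x) \<partial>m) - (\<integral>x. centered_cumulant \<mu> (f x) \<partial>m)) < r"
    proof eventually_elim
      case (elim n)
      show ?case using bound[OF e, of n] elim eA unfolding distrib_left by linarith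
    qed
    then show "\<exists>N. \<forall>n\<ge>N. norm ((\<integral>x. centered_cumulant \<mu> (g n x) \<partial>m) - (\<integral>x. centered_cumulant \<mu> (f x) \<partial>m)) < r"
      by (simp add: eventually_sequentially)
  qed
qed

end

section \<open>Mean-square regularity of the supOU kernel\<close>

lemma supOU_kernel_eq: "supOU_kernel t (\<xi>, s) = (if s \<le> \<xi> * t then exp (s - \<xi> * t) else 0)"
  by (simp add: supOU_kernel_def)

lemma supOU_kernel_square_integral:
  "has_bochner_integral lborel (\<lambda>s. (supOU_kernel t (\<xi>, s))\<^sup>2) (1 / 2)"
proof -
  have "has_bochner_integral lborel (\<lambda>r::real. indicator {0<..} r * (r powr (1 - 1) * exp (- (2 * r)))) (Gamma 1 * 2 powr (- 1))"
    by (rule has_bochner_integral_Gamma_scaled) auto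
  then have "has_bochner_integral lborel (\<lambda>s. indicator {0<..} (\<xi> * t + -1 * s) * ((\<xi> * t + -1 * s) powr (1 - 1) * exp (- (2 * (\<xi> * t + -1 * s))))) ((Gamma 1 * 2 powr (- 1)) /\<^sub>R \<bar>-1\<bar>)"
    by (subst (asm) lborel_has_bochner_integral_real_affine_iff[where c="-1" and t="\<xi> * t"]) auto
  then have "has_bochner_integral lborel (\<lambda>s. indicator {0<..} (\<xi> * t - s) * exp (2 * (s - \<xi> * t))) (1 / 2)"
    by (rule has_bochner_integral_cong[THEN iffD1, rotated -1]) (auto simp: indicator_def powr_minus algebra_simps)
  then show ?thesis
  proof (rule has_bochner_integral_cong_AE[THEN iffD1, rotated -1])
    have "AE s in lborel. s \<noteq> \<xi> * t" by (rule AE_lborel_singleton)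
    then show "AE s in lborel. indicator {0<..} (\<xi> * t - s) * exp (2 * (s - \<xi> * t)) = (supOU_kernel t (\<xi>, s))\<^sup>2"
      by eventually_elim (auto simp: supOU_kernel_eq indicator_def power2_eq_square simp flip: exp_add)
  qed (auto simp: supOU_kernel_def)
qed

text \<open>On the support of the earlier kernel the later one is its multiple by
  \<open>q = exp (- \<xi> * (t - s))\<close>, so the cross term is \<open>q\<close> times a
  square.\<close>

lemma supOU_kernel_diff_square_integral:
  assumes xi: "0 < \<xi>" and st: "s \<le> t"
  shows "has_bochner_integral lborel (\<lambda>u. (supOU_kernel s (\<xi>, u) - supOU_kernel t (\<xi>, u))\<^sup>2) (1 - exp (- \<xi> * (t - s)))"
proof -
  define q where "q = exp (- \<xi> * (t - s))"
  have le: "\<xi> * s \<le> \<xi> * t" using xi st by simp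
  have prod: "supOU_kernel s (\<xi>, u) * supOU_kernel t (\<xi>, u) = q * (supOU_kernel s (\<xi>, u))\<^sup>2" for u
    using le by (auto simp: supOU_kernel_eq q_def power2_eq_square algebra_simps simp flip: exp_add)
  have "has_bochner_integral lborel (\<lambda>u. (supOU_kernel s (\<xi>, u))\<^sup>2 + (supOU_kernel t (\<xi>, u))\<^sup>2 - 2 * q * (supOU_kernel s (\<xi>, u))\<^sup>2) (1 / 2 + 1 / 2 - 2 * q * (1 / 2))"
    by (intro has_bochner_integral_diff has_bochner_integral_add has_bochner_integral_mult_right supOU_kernel_square_integral)
  moreover have "(supOU_kernel s (\<xi>, u))\<^sup>2 + (supOU_kernel t (\<xi>, u))\<^sup>2 - 2 * q * (supOU_kernel s (\<xi>, u))\<^sup>2 = (supOU_kernel s (\<xi>, u) - supOU_kernel t (\<xi>, u))\<^sup>2" for u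
    unfolding power2_diff using prod[of u] by (simp add: mult.assoc)
  ultimately show ?thesis by (simp add: q_def)
qed

locale supOU_measure =
  fixes \<pi> :: "real measure"
  assumes prob_pi: "prob_space \<pi>" and sets_pi[measurable_cong]: "sets \<pi> = sets borel_pos"
begin

sublocale pi: prob_space \<pi> by (rule prob_pi)

abbreviation control :: "(real \<times> real) measure" where "control \<equiv> \<pi> \<Otimes>\<^sub>M lborel"

lemma space_pi: "space \<pi> = {0<..}"
  using sets_eq_imp_space_eq[OF sets_pi] by (simp add: space_restrict_space)

lemma id_measurable_pi[measurable]: "(\<lambda>x. x) \<in> borel_measurable \<pi>"
  by (rule measurable_cong_sets[THEN equalityD2, THEN subsetD, OF sets_pi refl]) (rule measurable_restrict_space1, simp)

lemma control_sigma_finite: "sigma_finite_measure control"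
  by (intro sigma_finite_pair_measure pi.sigma_finite_measure_axioms lborel.sigma_finite_measure_axioms)

lemma nn_integral_control:
  assumes "f \<in> borel_measurable control"
  shows "(\<integral>\<^sup>+p. f p \<partial>control) = (\<integral>\<^sup>+\<xi>. \<integral>\<^sup>+u. f (\<xi>, u) \<partial>lborel \<partial>\<pi>)"
  by (rule lborel.nn_integral_fst[symmetric, OF assms])

lemma supOU_kernel_measurable2[measurable]: "(\<lambda>(t, p). supOU_kernel t p) \<in> borel_measurable (borel \<Otimes>\<^sub>M control)"
proof -
  have "(\<lambda>q. exp (- fst (snd q) * fst q + snd (snd q)) * indicator {x. 0 \<le> x} (fst (snd q) * fst q - snd (snd q))) \<in> borel_measurable (borel \<Otimes>\<^sub>M control)"
    by measurable
  then show ?thesis by (simp add: supOU_kernel_def case_prod_beta atLeast_def)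
qed

lemma supOU_kernel_measurable[measurable]: "supOU_kernel t \<in> borel_measurable control"
  using measurable_compose[OF measurable_Pair1'[of t borel control] supOU_kernel_measurable2] by simp

lemma nn_integral_kernel_square: "(\<integral>\<^sup>+p. ennreal ((supOU_kernel t p)\<^sup>2) \<partial>control) = ennreal (1 / 2)"
proof -
  have "(\<integral>\<^sup>+u. ennreal ((supOU_kernel t (\<xi>, u))\<^sup>2) \<partial>lborel) = ennreal (1 / 2)" for \<xi>
  proof -
    note B = supOU_kernel_square_integral[of t \<xi>, unfolded has_bochner_integral_iff]
    show ?thesis unfolding conjunct2[OF B, symmetric] by (rule nn_integral_eq_integral[OF conjunct1[OF B]]) simp
  qed
  then show ?thesis by (subst nn_integral_control) (auto simp: pi.emeasure_space_1)
qed

text \<open>The squared mean-square distance of two kernels whose times differ by \<open>h\<close>,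
  averaged over the rate \<xi>. No rate of decay in \<open>h\<close> is claimed, since \<pi> may
  charge large \<xi>.\<close>

definition kernel_modulus :: "real \<Rightarrow> real" where "kernel_modulus h = (\<integral>\<xi>. 1 - exp (- \<xi> * h) \<partial>\<pi>)"

lemma kernel_modulus_integrable: "0 \<le> h \<Longrightarrow> integrable \<pi> (\<lambda>\<xi>. 1 - exp (- \<xi> * h))"
  by (rule pi.integrable_const_bound[where B=1]) (auto simp: space_pi)

lemma kernel_modulus_nonneg: "0 \<le> h \<Longrightarrow> 0 \<le> kernel_modulus h"
  unfolding kernel_modulus_def by (rule Bochner_Integration.integral_nonneg) (auto simp: space_pi)

lemma kernel_modulus_tendsto: 
  assumes h: "h \<longlonglongrightarrow> 0" "\<And>n. 0 \<le> h n"
  shows "(\<lambda>n. kernel_modulus (h n)) \<longlonglongrightarrow> 0"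
proof -
  have "(\<lambda>n. \<integral>\<xi>. 1 - exp (- \<xi> * h n) \<partial>\<pi>) \<longlonglongrightarrow> (\<integral>\<xi>. 1 - exp (- \<xi> * 0) \<partial>\<pi>)"
    by (rule integral_dominated_convergence[where w="\<lambda>_. 1"])
       (use h in \<open>auto simp: space_pi intro!: AE_I2 tendsto_eq_intros\<close>)
  then show ?thesis by (simp add: kernel_modulus_def)
qed

lemma nn_integral_kernel_diff:
  assumes h: "\<bar>s - t\<bar> \<le> h"
  shows "(\<integral>\<^sup>+p. ennreal ((supOU_kernel s p - supOU_kernel t p)\<^sup>2) \<partial>control) \<le> ennreal (kernel_modulus h)"
proof -
  have *: "(\<integral>\<^sup>+p. ennreal ((supOU_kernel s p - supOU_kernel t p)\<^sup>2) \<partial>control) \<le> ennreal (kernel_modulus h)"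
    if st: "s \<le> t" "t - s \<le> h" for s t
  proof -
    have "(\<integral>\<^sup>+u. ennreal ((supOU_kernel s (\<xi>, u) - supOU_kernel t (\<xi>, u))\<^sup>2) \<partial>lborel) \<le> ennreal (1 - exp (- \<xi> * h))" if "\<xi> \<in> space \<pi>" for \<xi>
    proof -
      have xi: "0 < \<xi>" using that by (simp add: space_pi)
      have "(\<integral>\<^sup>+u. ennreal ((supOU_kernel s (\<xi>, u) - supOU_kernel t (\<xi>, u))\<^sup>2) \<partial>lborel) = ennreal (1 - exp (- \<xi> * (t - s)))"
        using supOU_kernel_diff_square_integral[OF xi st(1)] by (subst nn_integral_eq_integral) (auto simp: has_bochner_integral_iff)
      also have "\<dots> \<le> ennreal (1 - exp (- \<xi> * h))" using st(2) xi by (intro ennreal_leI) simp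
      finally show ?thesis .
    qed
    then have "(\<integral>\<^sup>+p. ennreal ((supOU_kernel s p - supOU_kernel t p)\<^sup>2) \<partial>control) \<le> (\<integral>\<^sup>+\<xi>. ennreal (1 - exp (- \<xi> * h)) \<partial>\<pi>)"
      by (subst nn_integral_control) (auto intro!: nn_integral_mono)
    also have "\<dots> = ennreal (kernel_modulus h)"
      unfolding kernel_modulus_def
      by (rule nn_integral_eq_integral[OF kernel_modulus_integrable]) (use st in \<open>auto simp: space_pi\<close>)
    finally show ?thesis .
  qed
  show ?thesis
  proof (cases "s \<le> t")
    case True
    then show ?thesis using * h by simp
  next
    case False
    then have "(\<integral>\<^sup>+p. ennreal ((supOU_kernel t p - supOU_kernel s p)\<^sup>2) \<partial>control) \<le> ennreal (kernel_modulus h)" using * h by simp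
    then show ?thesis by (simp add: power2_commute)
  qed
qed

definition kernel_sum :: "real \<Rightarrow> nat \<Rightarrow> real \<times> real \<Rightarrow> real" where
  "kernel_sum t n p = (\<Sum>k\<in>{..<n}. t / real n * supOU_kernel (real k * (t / real n)) p)"

definition kernel_integral :: "real \<Rightarrow> real \<times> real \<Rightarrow> real" where
  "kernel_integral t p = (LBINT s:{0..t}. supOU_kernel s p)"

lemma kernel_integral_measurable[measurable]: "kernel_integral t \<in> borel_measurable control"
proof -
  have "(\<lambda>p. \<integral>s. indicator {0..t} s *\<^sub>R supOU_kernel s p \<partial>lborel) \<in> borel_measurable control"
    by (rule lborel.borel_measurable_lebesgue_integral) measurable
  then show ?thesis by (simp add: kernel_integral_def[abs_def] set_lebesgue_integral_def)
qed

lemma kernel_sum_measurable[measurable]: "kernel_sum t n \<in> borel_measurable control"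
  unfolding kernel_sum_def by measurable

lemma supOU_kernel_bound: "\<bar>supOU_kernel s p\<bar> \<le> 1"
  by (cases p) (simp add: supOU_kernel_eq)

lemma kernel_sum_L2_bound:
  assumes t: "0 \<le> t" and n: "0 < n"
  shows "(\<integral>\<^sup>+p. ennreal ((kernel_integral t p - kernel_sum t n p)\<^sup>2) \<partial>control) \<le> ennreal (t\<^sup>2 * kernel_modulus (t / n))"
  unfolding kernel_integral_def kernel_sum_def
proof (rule Riemann_sum_L2_bound[OF control_sigma_finite])
  show "AE p in control. set_integrable lborel {0..t} (\<lambda>s. supOU_kernel s p)"
  proof (rule AE_I2)
    fix p assume p: "p \<in> space control"
    have m: "(\<lambda>s. supOU_kernel s p) \<in> borel_measurable borel"
      using measurable_compose[OF measurable_Pair2'[OF p] supOU_kernel_measurable2] by simp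
    show "set_integrable lborel {0..t} (\<lambda>s. supOU_kernel s p)" unfolding set_integrable_def
    proof (rule Bochner_Integration.integrable_bound[of _ "indicator {0..t} :: real \<Rightarrow> real"])
      show "integrable lborel (indicat_real {0..t})" by (rule integrable_real_indicator) (use t in auto)
      show "(\<lambda>s. indicat_real {0..t} s *\<^sub>R supOU_kernel s p) \<in> borel_measurable lborel" 
        by (intro borel_measurable_scaleR borel_measurable_indicator) (use m in auto)
    qed (use supOU_kernel_bound in \<open>auto simp: indicator_def\<close>)
  qed
  show "0 \<le> kernel_modulus (t / real n)" using t by (intro kernel_modulus_nonneg) simp
qed (use t n nn_integral_kernel_diff in auto)

lemma nn_integral_square_sum_finite:
  fixes f :: "'i \<Rightarrow> 'b \<Rightarrow> real" and c :: "'i \<Rightarrow> real"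
  assumes [measurable]: "\<And>i. i \<in> I \<Longrightarrow> f i \<in> borel_measurable m"
    and "\<And>i. i \<in> I \<Longrightarrow> (\<integral>\<^sup>+p. ennreal ((f i p)\<^sup>2) \<partial>m) < \<infinity>"
  shows "(\<integral>\<^sup>+p. ennreal ((\<Sum>i\<in>I. c i * f i p)\<^sup>2) \<partial>m) \<le> (\<Sum>i\<in>I. ennreal (card I * (c i)\<^sup>2) * (\<integral>\<^sup>+p. ennreal ((f i p)\<^sup>2) \<partial>m))"
proof -
  have "(\<integral>\<^sup>+p. ennreal ((\<Sum>i\<in>I. c i * f i p)\<^sup>2) \<partial>m) \<le> (\<integral>\<^sup>+p. (\<Sum>i\<in>I. ennreal (card I * (c i)\<^sup>2) * ennreal ((f i p)\<^sup>2)) \<partial>m)"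
  proof (rule nn_integral_mono)
    fix p
    have "(\<Sum>i\<in>I. c i * f i p)\<^sup>2 \<le> (\<Sum>i\<in>I. (c i * f i p)\<^sup>2) * card I" by (rule sum_squared_le_sum_of_squares)
    also have "\<dots> = (\<Sum>i\<in>I. (card I * (c i)\<^sup>2) * (f i p)\<^sup>2)" by (simp add: sum_distrib_left power_mult_distrib mult_ac)
    finally have "ennreal ((\<Sum>i\<in>I. c i * f i p)\<^sup>2) \<le> ennreal (\<Sum>i\<in>I. (card I * (c i)\<^sup>2) * (f i p)\<^sup>2)" by (rule ennreal_leI)
    also have "\<dots> = (\<Sum>i\<in>I. ennreal (card I * (c i)\<^sup>2) * ennreal ((f i p)\<^sup>2))"
      by (simp add: sum_ennreal[symmetric] ennreal_mult)
    finally show "ennreal ((\<Sum>i\<in>I. c i * f i p)\<^sup>2) \<le> (\<Sum>i\<in>I. ennreal (card I * (c i)\<^sup>2) * ennreal ((f i p)\<^sup>2))" .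
  qed
  also have "\<dots> = (\<Sum>i\<in>I. \<integral>\<^sup>+p. ennreal (card I * (c i)\<^sup>2) * ennreal ((f i p)\<^sup>2) \<partial>m)"
    by (rule nn_integral_sum) measurable
  also have "\<dots> = (\<Sum>i\<in>I. ennreal (card I * (c i)\<^sup>2) * (\<integral>\<^sup>+p. ennreal ((f i p)\<^sup>2) \<partial>m))"
    by (intro sum.cong refl nn_integral_cmult) measurable
  finally show ?thesis .
qed

lemma nn_integral_square_sum_less_top:
  fixes f :: "'i \<Rightarrow> 'b \<Rightarrow> real" and c :: "'i \<Rightarrow> real"
  assumes "\<And>i. i \<in> I \<Longrightarrow> f i \<in> borel_measurable m"
    and "\<And>i. i \<in> I \<Longrightarrow> (\<integral>\<^sup>+p. ennreal ((f i p)\<^sup>2) \<partial>m) < \<infinity>"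
  shows "(\<integral>\<^sup>+p. ennreal ((\<Sum>i\<in>I. c i * f i p)\<^sup>2) \<partial>m) < \<infinity>"
proof (rule le_less_trans[OF nn_integral_square_sum_finite[OF assms]])
  show "(\<Sum>i\<in>I. ennreal (card I * (c i)\<^sup>2) * (\<integral>\<^sup>+p. ennreal ((f i p)\<^sup>2) \<partial>m)) < \<infinity>"
    using assms(2) by (cases "finite I") (auto simp: ennreal_mult_less_top)
qed

lemma kernel_sum_L2: "(\<integral>\<^sup>+p. ennreal ((kernel_sum t n p)\<^sup>2) \<partial>control) < \<infinity>"
  unfolding kernel_sum_def
  by (rule nn_integral_square_sum_less_top) (simp_all only: nn_integral_kernel_square infinity_ennreal_def ennreal_less_top supOU_kernel_measurable)

lemma kernel_integral_L2:
  assumes t: "0 \<le> t"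
  shows "(\<integral>\<^sup>+p. ennreal ((kernel_integral t p)\<^sup>2) \<partial>control) < \<infinity>"
proof -
  \<comment> \<open>The integral is its distance to the Riemann sum with a single node plus that
    sum; summing over \<open>bool\<close> makes the bound for finite sums applicable.\<close>
  have "(\<integral>\<^sup>+p. ennreal ((\<Sum>b\<in>UNIV. 1 * (if b then kernel_integral t p - kernel_sum t 1 p else kernel_sum t 1 p))\<^sup>2) \<partial>control) < \<infinity>"
  proof (rule nn_integral_square_sum_less_top)
    fix b :: bool
    show "(\<integral>\<^sup>+p. ennreal ((if b then kernel_integral t p - kernel_sum t 1 p else kernel_sum t 1 p)\<^sup>2) \<partial>control) < \<infinity>"
    proof (cases b)
      case True
      have "(\<integral>\<^sup>+p. ennreal ((kernel_integral t p - kernel_sum t 1 p)\<^sup>2) \<partial>control) < \<infinity>"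
        by (rule le_less_trans[OF kernel_sum_L2_bound[OF t]]) auto
      then show ?thesis using True by simp
    qed (use kernel_sum_L2[of t 1] in simp)
  qed measurable
  then show ?thesis by (simp add: UNIV_bool)
qed

end

text \<open>\<open>2 * n\<^sup>2 * (1 - cos (y / n))\<close> tends to \<open>y\<^sup>2\<close>, so
  Fatou's lemma turns a bound on the characteristic function near 0 into one on the second
  moment.\<close>

lemma (in prob_space) second_moment_liminf:
  fixes Y :: "'a \<Rightarrow> real"
  assumes [measurable]: "Y \<in> borel_measurable M"
    and b: "\<And>n. 2 * (real (Suc n))\<^sup>2 * (1 - Re (CLINT \<omega>|M. iexp (1 / real (Suc n) * Y \<omega>))) \<le> c"
  shows "(\<integral>\<^sup>+\<omega>. ennreal ((Y \<omega>)\<^sup>2) \<partial>M) \<le> ennreal c"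
proof -
  let ?u = "\<lambda>n \<omega>. 2 * (real (Suc n))\<^sup>2 * (1 - cos (1 / real (Suc n) * Y \<omega>))"
  have i: "integrable M (\<lambda>\<omega>. cos (1 / real (Suc n) * Y \<omega>))" for n by (rule integrable_const_bound[where B=1]) auto
  have lim: "(\<lambda>n. 2 * (real (Suc n))\<^sup>2 * (1 - cos (1 / real (Suc n) * y))) \<longlonglongrightarrow> y\<^sup>2" for y :: real
  proof -
    have "((\<lambda>x. 2 * x\<^sup>2 * (1 - cos (1 / x * y))) \<longlongrightarrow> y\<^sup>2) at_top" by real_asymp (simp add: power2_eq_square)
    moreover have "filterlim (\<lambda>n. real (Suc n)) at_top sequentially" by real_asymp
    ultimately show ?thesis by (rule filterlim_compose)
  qed
  have "(\<integral>\<^sup>+\<omega>. ennreal ((Y \<omega>)\<^sup>2) \<partial>M) = (\<integral>\<^sup>+\<omega>. liminf (\<lambda>n. ennreal (?u n \<omega>)) \<partial>M)"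
    by (intro nn_integral_cong lim_imp_Liminf[symmetric] tendsto_ennrealI lim) simp
  also have "\<dots> \<le> liminf (\<lambda>n. \<integral>\<^sup>+\<omega>. ennreal (?u n \<omega>) \<partial>M)"
    by (rule nn_integral_liminf) measurable
  also have "\<dots> \<le> ennreal c"
  proof (rule Liminf_le)
    have "(\<integral>\<^sup>+\<omega>. ennreal (?u n \<omega>) \<partial>M) \<le> ennreal c" for n
    proof -
      have re: "Re (CLINT \<omega>|M. iexp (1 / real (Suc n) * Y \<omega>)) = expectation (\<lambda>\<omega>. cos (1 / real (Suc n) * Y \<omega>))"
      proof -
        have "complex_integrable M (\<lambda>\<omega>. iexp (1 / real (Suc n) * Y \<omega>))" by (rule integrable_iexp) auto
        from integral_Re[OF this] show ?thesis by (simp only: Re_exp) simp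
      qed
      have "(\<integral>\<^sup>+\<omega>. ennreal (?u n \<omega>) \<partial>M) = ennreal (expectation (?u n))"
        using i[of n] by (intro nn_integral_eq_integral) auto
      also have "expectation (?u n) = 2 * (real (Suc n))\<^sup>2 * (1 - Re (CLINT \<omega>|M. iexp (1 / real (Suc n) * Y \<omega>)))"
        unfolding re using i[of n] by (simp add: prob_space)
      also have "ennreal \<dots> \<le> ennreal c" by (rule ennreal_leI[OF b])
      finally show ?thesis .
    qed
    then show "\<forall>\<^sub>F n in sequentially. (\<integral>\<^sup>+\<omega>. ennreal (?u n \<omega>) \<partial>M) \<le> ennreal c" by simp
  qed simp
  finally show ?thesis .
qed

lemma (in prob_space) L2_tendsto_imp_conv_in_prob:
  fixes Y :: "nat \<Rightarrow> 'a \<Rightarrow> real"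
  assumes [measurable]: "\<And>n. Y n \<in> borel_measurable M" "Z \<in> borel_measurable M"
    and lim: "(\<lambda>n. \<integral>\<^sup>+\<omega>. ennreal ((Z \<omega> - Y n \<omega>)\<^sup>2) \<partial>M) \<longlonglongrightarrow> 0"
  shows "conv_in_prob M Y Z"
  unfolding conv_in_prob_def
proof (intro allI impI)
  fix e :: real assume e: "0 < e"
  have le: "emeasure M {\<omega>\<in>space M. \<bar>Y n \<omega> - Z \<omega>\<bar> > e} \<le> ennreal (1 / e\<^sup>2) * (\<integral>\<^sup>+\<omega>. ennreal ((Z \<omega> - Y n \<omega>)\<^sup>2) \<partial>M)" for n
  proof -
    have "emeasure M {\<omega>\<in>space M. \<bar>Y n \<omega> - Z \<omega>\<bar> > e} \<le> emeasure M {\<omega>\<in>space M. 1 \<le> ennreal (1 / e\<^sup>2) * ennreal ((Z \<omega> - Y n \<omega>)\<^sup>2)}"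
    proof (rule emeasure_mono)
      show "{\<omega>\<in>space M. \<bar>Y n \<omega> - Z \<omega>\<bar> > e} \<subseteq> {\<omega>\<in>space M. 1 \<le> ennreal (1 / e\<^sup>2) * ennreal ((Z \<omega> - Y n \<omega>)\<^sup>2)}"
      proof (intro subsetI CollectI conjI; elim CollectE conjE)
        fix \<omega> assume w: "\<bar>Y n \<omega> - Z \<omega>\<bar> > e"
        have "e\<^sup>2 \<le> \<bar>Y n \<omega> - Z \<omega>\<bar>\<^sup>2" using w e by (intro power_mono) auto
        then have "1 \<le> 1 / e\<^sup>2 * (Z \<omega> - Y n \<omega>)\<^sup>2" using e by (simp add: power2_commute field_simps)
        then have "ennreal 1 \<le> ennreal (1 / e\<^sup>2 * (Z \<omega> - Y n \<omega>)\<^sup>2)" by (rule ennreal_leI)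
        moreover have "ennreal (1 / e\<^sup>2 * (Z \<omega> - Y n \<omega>)\<^sup>2) = ennreal (1 / e\<^sup>2) * ennreal ((Z \<omega> - Y n \<omega>)\<^sup>2)"
          by (rule ennreal_mult) auto
        ultimately show "1 \<le> ennreal (1 / e\<^sup>2) * ennreal ((Z \<omega> - Y n \<omega>)\<^sup>2)" by (simp only: ennreal_1)
      qed
    qed measurable
    also have "\<dots> \<le> ennreal (1 / e\<^sup>2) * (\<integral>\<^sup>+\<omega>. ennreal ((Z \<omega> - Y n \<omega>)\<^sup>2) * indicator (space M) \<omega> \<partial>M)"
      by (rule nn_integral_Markov_inequality) measurable
    also have "(\<integral>\<^sup>+\<omega>. ennreal ((Z \<omega> - Y n \<omega>)\<^sup>2) * indicator (space M) \<omega> \<partial>M) = (\<integral>\<^sup>+\<omega>. ennreal ((Z \<omega> - Y n \<omega>)\<^sup>2) \<partial>M)"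
      by (rule nn_integral_cong) simp
    finally show ?thesis .
  qed
  have "(\<lambda>n. ennreal (1 / e\<^sup>2) * (\<integral>\<^sup>+\<omega>. ennreal ((Z \<omega> - Y n \<omega>)\<^sup>2) \<partial>M)) \<longlonglongrightarrow> ennreal (1 / e\<^sup>2) * 0"
    by (rule ennreal_tendsto_cmult[OF _ lim]) simp
  then have lim': "(\<lambda>n. ennreal (1 / e\<^sup>2) * (\<integral>\<^sup>+\<omega>. ennreal ((Z \<omega> - Y n \<omega>)\<^sup>2) \<partial>M)) \<longlonglongrightarrow> 0" by simp
  have "(\<lambda>n. emeasure M {\<omega>\<in>space M. \<bar>Y n \<omega> - Z \<omega>\<bar> > e}) \<longlonglongrightarrow> 0"
    by (rule tendsto_sandwich[OF _ _ tendsto_const lim']) (simp, intro always_eventually allI, rule le)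
  then have "(\<lambda>n. ennreal (prob {\<omega>\<in>space M. \<bar>Y n \<omega> - Z \<omega>\<bar> > e})) \<longlonglongrightarrow> ennreal 0"
    by (simp add: emeasure_eq_measure)
  then show "(\<lambda>n. prob {\<omega>\<in>space M. \<bar>Y n \<omega> - Z \<omega>\<bar> > e}) \<longlonglongrightarrow> 0"
    by (subst (asm) tendsto_ennreal_iff) auto
qed

section \<open>The uncentered functional and the second moment of the Levy measure\<close>

locale supOU_setup = supOU_measure \<pi> + levy_random_measure M "\<pi> \<Otimes>\<^sub>M lborel" "levy_cumulant a 0 \<mu>" \<Lambda>
  for M :: "'w measure" and a :: real and \<mu> \<pi> :: "real measure" and \<Lambda> :: "(real \<times> real) set \<Rightarrow> 'w \<Rightarrow> real" +
  fixes X :: "real \<Rightarrow> 'w \<Rightarrow> real"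
  assumes levy_mu: "levy_measure \<mu>"
    and X_rr: "\<And>t. has_rr_integral M (\<pi> \<Otimes>\<^sub>M lborel) \<Lambda> (supOU_kernel t) (X t)"
    and X_measurable2[measurable]: "(\<lambda>(s, \<omega>). X s \<omega>) \<in> borel_measurable (borel \<Otimes>\<^sub>M M)"
    and X_sq: "\<And>s. integrable M (\<lambda>\<omega>. (X s \<omega>)\<^sup>2)"
    and X_mean: "\<And>s. (\<integral>\<omega>. X s \<omega> \<partial>M) = 0"
begin

text \<open>The real part of the cumulant has the required properties for every Levy measure. The
  drift in its imaginary part need not be bounded by \<psi>, so only moduli of characteristic
  functions are drawn from \<open>F\<close>.\<close>

sublocale F: infdiv_functional M control "levy_cumulant a 0 \<mu>" "simple_integral_basis control \<Lambda> (space control)"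
proof
  show "simple_integral_basis control \<Lambda> (space control) h \<in> borel_measurable M" if "rr_simple control h" for h
    using that by (rule simple_integral_measurable[OF _ sets.top])
  show "AE \<omega> in M. simple_integral_basis control \<Lambda> (space control) (\<lambda>x. a * h x + b * g x) \<omega> =
      a * simple_integral_basis control \<Lambda> (space control) h \<omega> + b * simple_integral_basis control \<Lambda> (space control) g \<omega>"
    if "rr_simple control h" "rr_simple control g" for h g a b
    using that by (rule simple_integral_linear[OF _ _ sets.top])
  show "(CLINT \<omega>|M. iexp (simple_integral_basis control \<Lambda> (space control) h \<omega>)) = exp (CLINT x|control. levy_cumulant a 0 \<mu> (h x))"
    if "rr_simple control h" for h using that levy_cumulant_0 by (rule simple_integral_char)
  show "\<exists>D. \<forall>x y. - Re (levy_cumulant a 0 \<mu> (x + y)) \<le> D * (- Re (levy_cumulant a 0 \<mu> x) - Re (levy_cumulant a 0 \<mu> y))"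
    using Re_levy_cumulant_props(3)[OF levy_mu] by blast
qed (use Re_levy_cumulant_props[OF levy_mu] levy_cumulant_cont[OF levy_mu] levy_cumulant_0 in auto)

lemma X_measurable[measurable]: "X s \<in> borel_measurable M"
  using X_rr[of s] by (simp add: has_rr_integral_def)

lemma X_wk: "F.wk_integral (supOU_kernel t) (X t)"
  using X_rr[of t] unfolding has_rr_integral_def F.wk_integral_def F.wk_approx_def by auto

lemma X_integrable: "integrable M (X s)"
  by (rule square_integrable_imp_integrable[OF X_measurable X_sq])

text \<open>The finite variance of \<open>X 0\<close> bounds \<open>\<integral> \<psi> (z k) d(\<pi> \<times> Leb)\<close> by \<open>v z\<^sup>2\<close> for small \<open>z\<close>; letting \<open>z \<rightarrow> 0\<close>, Fatou's lemma
  yields the second moment of the Levy measure.\<close>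

lemma sq_mu: "integrable \<mu> (\<lambda>x. x\<^sup>2)"
proof -
  note id_measurable_pi[measurable del]
  have [measurable_cong]: "sets \<mu> = sets borel" using levy_mu by (rule levy_measure_sets)
  define v where "v = expectation (\<lambda>\<omega>. (X 0 \<omega>)\<^sup>2)"
  have v0: "0 \<le> v" unfolding v_def by (rule Bochner_Integration.integral_nonneg) simp
  let ?k = "supOU_kernel 0"
  have psi: "(\<integral>p. F.\<psi> (z * ?k p) \<partial>control) \<le> v * z\<^sup>2" "integrable control (\<lambda>p. F.\<psi> (z * ?k p))" if z: "z\<^sup>2 * v \<le> 1" for z
  proof -
    have "F.wk_integral (\<lambda>p. z * ?k p) (\<lambda>\<omega>. z * X 0 \<omega>)"
      using F.wk_integral_linear[OF X_wk X_wk, of z 0 0 0] by simp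
    note N = F.wk_integral_norm_char[OF this]
    show "integrable control (\<lambda>p. F.\<psi> (z * ?k p))" by (rule N)
    have "norm ((CLINT \<omega>|M. iexp (z * X 0 \<omega>)) - 1) \<le> z\<^sup>2 * v / 2"
    proof -
      have i: "integrable M (\<lambda>\<omega>. iexp (z * X 0 \<omega>))" by (intro integrable_iexp) auto
      have ix: "integrable M (\<lambda>\<omega>. \<i> * of_real (z * X 0 \<omega>))"
        by (intro integrable_mult_right integrable_of_real X_integrable)
      have "(CLINT \<omega>|M. \<i> * of_real (z * X 0 \<omega>)) = 0"
        by (subst integral_mult_right_zero, subst integral_complex_of_real) (simp add: X_mean)
      then have "(CLINT \<omega>|M. iexp (z * X 0 \<omega>)) - 1 = (CLINT \<omega>|M. compensated_exp (z * X 0 \<omega>))"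
        unfolding compensated_exp_def using i ix by (simp add: prob_space)
      also have "norm \<dots> \<le> expectation (\<lambda>\<omega>. norm (compensated_exp (z * X 0 \<omega>)))" by (rule integral_norm_bound)
      also have "\<dots> \<le> expectation (\<lambda>\<omega>. z\<^sup>2 / 2 * (X 0 \<omega>)\<^sup>2)"
      proof (rule integral_mono)
        show "integrable M (\<lambda>\<omega>. norm (compensated_exp (z * X 0 \<omega>)))"
          unfolding compensated_exp_def using i ix by (intro integrable_norm Bochner_Integration.integrable_diff) auto
        show "norm (compensated_exp (z * X 0 \<omega>)) \<le> z\<^sup>2 / 2 * (X 0 \<omega>)\<^sup>2" for \<omega>
          using norm_compensated_exp_le[of "z * X 0 \<omega>"] by (simp add: power_mult_distrib)
      qed (use X_sq in simp)
      finally show ?thesis by (simp add: v_def)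
    qed
    then have "1 - z\<^sup>2 * v / 2 \<le> norm (CLINT \<omega>|M. iexp (z * X 0 \<omega>))"
      using norm_triangle_ineq2[of 1 "1 - (CLINT \<omega>|M. iexp (z * X 0 \<omega>))"] by (simp add: norm_minus_commute)
    then have le: "1 - z\<^sup>2 * v / 2 \<le> exp (- (\<integral>p. F.\<psi> (z * ?k p) \<partial>control))" using N(2) by simp
    \<comment> \<open>The inequality \<open>exp (- x) \<le> 1 - x / 2\<close> is used for
      \<open>x\<close> in [0, 1], which is why \<open>z\<^sup>2 * v \<le> 1\<close> is
      assumed.\<close>
    have "exp (- (z\<^sup>2 * v)) \<le> 1 - z\<^sup>2 * v / 2"
    proof -
      define x where "x = z\<^sup>2 * v"
      have x: "0 \<le> x" "x \<le> 1" using z v0 by (auto simp: x_def)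
      have "1 + x \<le> exp x" by (rule exp_ge_add_one_self)
      have "1 \<le> (1 - x / 2) * (1 + x)" using x mult_left_mono[OF x(2) x(1)] by (simp add: algebra_simps)
      also have "\<dots> \<le> (1 - x / 2) * exp x" using x by (intro mult_left_mono exp_ge_add_one_self) auto
      finally show ?thesis unfolding x_def[symmetric] by (simp add: exp_minus field_simps)
    qed
    with le have "exp (- (z\<^sup>2 * v)) \<le> exp (- (\<integral>p. F.\<psi> (z * ?k p) \<partial>control))" by linarith
    then show "(\<integral>p. F.\<psi> (z * ?k p) \<partial>control) \<le> v * z\<^sup>2" by (simp add: mult.commute)
  qed
  have psi_eq: "F.\<psi> z = (\<integral>x. 1 - cos (z * x) \<partial>\<mu>)" for z
    by (simp add: F.\<psi>_def Re_levy_cumulant[OF levy_mu])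
  obtain n0 :: nat where n0: "v \<le> real n0" using real_arch_simple by blast
  \<comment> \<open>The shift by \<open>n0\<close> makes \<open>z = 1 / c n\<close> admissible in
    \<open>psi\<close> for every \<open>n\<close>.\<close>
  define c where "c n = real (Suc (n + n0))" for n
  have cpos: "0 < c n" for n by (simp add: c_def)
  have cv: "(1 / c n)\<^sup>2 * v \<le> 1" for n
  proof -
    have "v \<le> c n" using n0 by (simp add: c_def)
    also have "c n \<le> (c n)\<^sup>2" unfolding power2_eq_square by (simp add: c_def)
    finally show ?thesis using cpos[of n] by (simp add: power_divide)
  qed
  have lim: "(\<lambda>n. (c n)\<^sup>2 * (1 - cos (1 / c n * y))) \<longlonglongrightarrow> y\<^sup>2 / 2" for y :: real
  proof -
    have "((\<lambda>x. x\<^sup>2 * (1 - cos (1 / x * y))) \<longlongrightarrow> y\<^sup>2 / 2) at_top" by real_asymp (simp add: power2_eq_square)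
    moreover have "filterlim c at_top sequentially" unfolding c_def by real_asymp
    ultimately show ?thesis by (rule filterlim_compose)
  qed
  let ?N = "\<integral>\<^sup>+x. ennreal (x\<^sup>2) \<partial>\<mu>"
  have N_measurable: "(\<lambda>x. ennreal (x\<^sup>2)) \<in> borel_measurable \<mu>" by measurable
  \<comment> \<open>First use of Fatou, over the jumps, for a fixed value \<open>y\<close> of the
    kernel; the second use is over the control measure.\<close>
  have inner: "ennreal (y\<^sup>2 / 2) * ?N \<le> liminf (\<lambda>n. ennreal ((c n)\<^sup>2 * F.\<psi> (1 / c n * y)))" for y
  proof -
    have "ennreal (y\<^sup>2 / 2) * ?N = (\<integral>\<^sup>+x. ennreal ((y * x)\<^sup>2 / 2) \<partial>\<mu>)"
      unfolding nn_integral_cmult[OF N_measurable, symmetric]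
      by (intro nn_integral_cong) (simp add: power_mult_distrib flip: ennreal_mult)
    also have "\<dots> = (\<integral>\<^sup>+x. liminf (\<lambda>n. ennreal ((c n)\<^sup>2 * (1 - cos (1 / c n * y * x)))) \<partial>\<mu>)"
    proof (intro nn_integral_cong lim_imp_Liminf[symmetric] tendsto_ennrealI)
      show "(\<lambda>n. (c n)\<^sup>2 * (1 - cos (1 / c n * y * x))) \<longlonglongrightarrow> (y * x)\<^sup>2 / 2" for x
        using lim[of "y * x"] by (simp only: mult.assoc)
    qed simp
    also have "\<dots> \<le> liminf (\<lambda>n. \<integral>\<^sup>+x. ennreal ((c n)\<^sup>2 * (1 - cos (1 / c n * y * x))) \<partial>\<mu>)"
      by (rule nn_integral_liminf) measurable
    also have "(\<lambda>n. \<integral>\<^sup>+x. ennreal ((c n)\<^sup>2 * (1 - cos (1 / c n * y * x))) \<partial>\<mu>) = (\<lambda>n. ennreal ((c n)\<^sup>2 * F.\<psi> (1 / c n * y)))"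
    proof
      fix n
      have "integrable \<mu> (\<lambda>x. (c n)\<^sup>2 * (1 - cos (1 / c n * y * x)))"
        by (intro integrable_mult_right Re_levy_cumulant(1)[OF levy_mu])
      from nn_integral_eq_integral[OF this]
      show "(\<integral>\<^sup>+x. ennreal ((c n)\<^sup>2 * (1 - cos (1 / c n * y * x))) \<partial>\<mu>) = ennreal ((c n)\<^sup>2 * F.\<psi> (1 / c n * y))"
        by (simp add: psi_eq)
    qed
    finally show ?thesis .
  qed
  \<comment> \<open>The kernel has squared norm 1/2 and the Taylor coefficient is 1/2. The point is
    that the factor in front of the second moment is not zero.\<close>
  have "ennreal (1 / 4) * ?N = (\<integral>\<^sup>+p. ennreal ((?k p)\<^sup>2 / 2) * ?N \<partial>control)"
  proof -
    have "(\<integral>\<^sup>+p. ennreal ((?k p)\<^sup>2 / 2) * ?N \<partial>control) = (\<integral>\<^sup>+p. ennreal (1 / 2) * ennreal ((?k p)\<^sup>2) \<partial>control) * ?N"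
    proof -
      have "(\<integral>\<^sup>+p. ennreal ((?k p)\<^sup>2 / 2) * ?N \<partial>control) = (\<integral>\<^sup>+p. ennreal ((?k p)\<^sup>2 / 2) \<partial>control) * ?N"
        by (rule nn_integral_multc) measurable
      also have "(\<integral>\<^sup>+p. ennreal ((?k p)\<^sup>2 / 2) \<partial>control) = (\<integral>\<^sup>+p. ennreal (1 / 2) * ennreal ((?k p)\<^sup>2) \<partial>control)"
        by (intro nn_integral_cong) (subst ennreal_mult[symmetric], auto)
      finally show ?thesis .
    qed
    also have "(\<integral>\<^sup>+p. ennreal (1 / 2) * ennreal ((?k p)\<^sup>2) \<partial>control) = ennreal (1 / 2) * ennreal (1 / 2)"
      by (subst nn_integral_cmult) (measurable, simp only: nn_integral_kernel_square)
    also have "ennreal (1 / 2) * ennreal (1 / 2) = ennreal (1 / 4)" by (subst ennreal_mult[symmetric]) auto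
    finally show ?thesis by simp
  qed
  also have "\<dots> \<le> (\<integral>\<^sup>+p. liminf (\<lambda>n. ennreal ((c n)\<^sup>2 * F.\<psi> (1 / c n * ?k p))) \<partial>control)"
    by (rule nn_integral_mono) (rule inner)
  also have "\<dots> \<le> liminf (\<lambda>n. \<integral>\<^sup>+p. ennreal ((c n)\<^sup>2 * F.\<psi> (1 / c n * ?k p)) \<partial>control)"
    by (rule nn_integral_liminf) measurable
  also have "\<dots> \<le> ennreal v"
  proof (rule Liminf_le)
    have "(\<integral>\<^sup>+p. ennreal ((c n)\<^sup>2 * F.\<psi> (1 / c n * ?k p)) \<partial>control) \<le> ennreal v" for n
    proof -
      note P = psi[OF cv[of n]]
      have "(\<integral>\<^sup>+p. ennreal ((c n)\<^sup>2 * F.\<psi> (1 / c n * ?k p)) \<partial>control) = ennreal (\<integral>p. (c n)\<^sup>2 * F.\<psi> (1 / c n * ?k p) \<partial>control)"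
        by (rule nn_integral_eq_integral[OF integrable_mult_right[OF P(2)]]) simp
      also have "(\<integral>p. (c n)\<^sup>2 * F.\<psi> (1 / c n * ?k p) \<partial>control) = (c n)\<^sup>2 * (\<integral>p. F.\<psi> (1 / c n * ?k p) \<partial>control)" by simp
      also have "\<dots> \<le> (c n)\<^sup>2 * (v * (1 / c n)\<^sup>2)" by (intro mult_left_mono P(1)) simp
      also have "\<dots> = v" using cpos[of n] by (simp add: power_divide)
      finally show ?thesis by (simp add: ennreal_leI)
    qed
    then show "\<forall>\<^sub>F n in sequentially. (\<integral>\<^sup>+p. ennreal ((c n)\<^sup>2 * F.\<psi> (1 / c n * ?k p)) \<partial>control) \<le> ennreal v" by simp
  qed simp
  finally have "ennreal (1 / 4) * ?N < \<infinity>" by (rule le_less_trans) simp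
  then have "?N < \<infinity>" by (auto simp: ennreal_mult_less_top ennreal_mult_eq_top_iff less_top[symmetric])
  then show ?thesis by (intro integrableI_bounded) auto
qed

end

context prob_space
begin

lemma conv_in_prob_AE_cong:
  fixes Y :: "nat \<Rightarrow> 'a \<Rightarrow> real"
  assumes [measurable]: "\<And>n. Y n \<in> borel_measurable M" "Z \<in> borel_measurable M" "Z' \<in> borel_measurable M"
    and c: "conv_in_prob M Y Z" and ae: "AE \<omega> in M. Z \<omega> = Z' \<omega>"
  shows "conv_in_prob M Y Z'"
proof -
  have "measure M {\<omega>\<in>space M. \<bar>Y n \<omega> - Z \<omega>\<bar> > e} = measure M {\<omega>\<in>space M. \<bar>Y n \<omega> - Z' \<omega>\<bar> > e}" for n e
    by (rule measure_eq_AE) (use ae in auto)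
  then show ?thesis using c by (simp add: conv_in_prob_def)
qed

text \<open>Two events of probability below 1/2 cannot cover the space, so some outcome is close to
  both \<open>d n\<close> and \<open>d k\<close>; hence the numbers themselves form a Cauchy
  sequence.\<close>

lemma conv_in_prob_constants:
  fixes d :: "nat \<Rightarrow> real"
  assumes [measurable]: "W \<in> borel_measurable M" and c: "conv_in_prob M (\<lambda>n _. d n) W"
  shows "\<exists>c. AE \<omega> in M. W \<omega> = c"
proof -
  have lim: "(\<lambda>n. prob {\<omega>\<in>space M. \<bar>d n - W \<omega>\<bar> > e}) \<longlonglongrightarrow> 0" if "0 < e" for e
    using c that by (simp add: conv_in_prob_def)
  have "Cauchy d"
  proof (rule metric_CauchyI)
    fix e :: real assume e: "0 < e"
    have "\<forall>\<^sub>F n in sequentially. prob {\<omega>\<in>space M. \<bar>d n - W \<omega>\<bar> > e / 3} < 1 / 2"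
      using e by (intro order_tendstoD(2)[OF lim]) auto
    then obtain N where N: "\<And>n. n \<ge> N \<Longrightarrow> prob {\<omega>\<in>space M. \<bar>d n - W \<omega>\<bar> > e / 3} < 1 / 2"
      by (auto simp: eventually_sequentially)
    have "dist (d n) (d k) < e" if "n \<ge> N" "k \<ge> N" for n k
    proof (rule ccontr)
      assume "\<not> dist (d n) (d k) < e"
      then have ge: "e \<le> \<bar>d n - d k\<bar>" by (simp add: dist_real_def)
      have tri: "\<bar>d n - d k\<bar> \<le> \<bar>d n - W \<omega>\<bar> + \<bar>d k - W \<omega>\<bar>" for \<omega> by linarith
      have "space M \<subseteq> {\<omega>\<in>space M. \<bar>d n - W \<omega>\<bar> > e / 3} \<union> {\<omega>\<in>space M. \<bar>d k - W \<omega>\<bar> > e / 3}"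
      proof
        fix \<omega> assume "\<omega> \<in> space M"
        moreover have "\<bar>d n - W \<omega>\<bar> > e / 3 \<or> \<bar>d k - W \<omega>\<bar> > e / 3" using ge tri[of \<omega>] e by linarith
        ultimately show "\<omega> \<in> {\<omega>\<in>space M. \<bar>d n - W \<omega>\<bar> > e / 3} \<union> {\<omega>\<in>space M. \<bar>d k - W \<omega>\<bar> > e / 3}" by blast
      qed
      then have "prob (space M) \<le> prob ({\<omega>\<in>space M. \<bar>d n - W \<omega>\<bar> > e / 3} \<union> {\<omega>\<in>space M. \<bar>d k - W \<omega>\<bar> > e / 3})"
        by (intro finite_measure_mono) auto
      also have "\<dots> \<le> prob {\<omega>\<in>space M. \<bar>d n - W \<omega>\<bar> > e / 3} + prob {\<omega>\<in>space M. \<bar>d k - W \<omega>\<bar> > e / 3}"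
        by (rule measure_Un_le) auto
      also have "\<dots> < 1" using N[OF that(1)] N[OF that(2)] by linarith
      finally show False by (simp add: prob_space)
    qed
    then show "\<exists>N. \<forall>n\<ge>N. \<forall>k\<ge>N. dist (d n) (d k) < e" by blast
  qed
  then obtain c where dc: "d \<longlonglongrightarrow> c" using Cauchy_convergent convergent_def by blast
  have "AE \<omega> in M. \<bar>c - W \<omega>\<bar> \<le> 1 / real (Suc k)" for k
  proof -
    define e where "e = 1 / real (Suc k)"
    have e: "0 < e" by (simp add: e_def)
    have "\<forall>\<^sub>F n in sequentially. dist (d n) c < e / 2" using dc e by (intro tendstoD) auto
    then have "\<forall>\<^sub>F n in sequentially. prob {\<omega>\<in>space M. \<bar>c - W \<omega>\<bar> > e} \<le> prob {\<omega>\<in>space M. \<bar>d n - W \<omega>\<bar> > e / 2}"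
    proof eventually_elim
      case (elim n)
      have tri: "\<bar>c - W \<omega>\<bar> \<le> \<bar>d n - W \<omega>\<bar> + \<bar>d n - c\<bar>" for \<omega> by linarith
      show ?case
      proof (rule finite_measure_mono)
        show "{\<omega>\<in>space M. \<bar>c - W \<omega>\<bar> > e} \<subseteq> {\<omega>\<in>space M. \<bar>d n - W \<omega>\<bar> > e / 2}"
        proof
          fix \<omega> assume w: "\<omega> \<in> {\<omega>\<in>space M. \<bar>c - W \<omega>\<bar> > e}"
          then have "\<bar>d n - W \<omega>\<bar> > e / 2" using tri[of \<omega>] elim unfolding dist_real_def mem_Collect_eq by linarith
          then show "\<omega> \<in> {\<omega>\<in>space M. \<bar>d n - W \<omega>\<bar> > e / 2}" using w by blast
        qed
      qed measurable
    qed
    then have "prob {\<omega>\<in>space M. \<bar>c - W \<omega>\<bar> > e} \<le> 0"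
      by (rule tendsto_lowerbound[OF lim[OF half_gt_zero[OF e]]]) simp
    then have "prob {\<omega>\<in>space M. \<bar>c - W \<omega>\<bar> > e} = 0" using measure_nonneg[of M] by (simp add: order_antisym)
    then have "emeasure M {\<omega>\<in>space M. \<bar>c - W \<omega>\<bar> > e} = 0" by (simp add: emeasure_eq_measure)
    then have "AE \<omega> in M. \<omega> \<notin> {\<omega>\<in>space M. \<bar>c - W \<omega>\<bar> > e}" by (intro AE_not_in) (auto simp: null_sets_def)
    then show ?thesis using AE_space by eventually_elim (auto simp: e_def)
  qed
  then have "AE \<omega> in M. \<forall>k. \<bar>c - W \<omega>\<bar> \<le> 1 / real (Suc k)" by (simp add: AE_all_countable)
  then have "AE \<omega> in M. W \<omega> = c"
  proof eventually_elim
    case (elim \<omega>)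
    have "\<bar>c - W \<omega>\<bar> \<le> 0"
      by (rule LIMSEQ_le_const[OF LIMSEQ_Suc[OF lim_1_over_n]]) (use elim in auto)
    then show ?case by simp
  qed
  then show ?thesis by blast
qed

end

section \<open>The compensated functional and its agreement with X\<close>

locale supOU_stable = supOU_setup M a \<mu> \<pi> \<Lambda> X
  for M :: "'w measure" and a :: real and \<mu> \<pi> :: "real measure"
    and \<Lambda> :: "(real \<times> real) set \<Rightarrow> 'w \<Rightarrow> real" and X +
  fixes b cp cm :: real
  assumes b: "1 < b" "b < 2" and c: "0 \<le> cp" "0 \<le> cm" "0 < cp + cm"
    and tail_pos: "power_asymp_at_0 (\<lambda>x. measure \<mu> {x..}) cp b"
    and tail_neg: "power_asymp_at_0 (\<lambda>x. measure \<mu> {..-x}) cm b"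
begin

sublocale L: stable_levy \<mu> b cp cm
  by unfold_locales (use levy_mu sq_mu b c tail_pos tail_neg in auto)

abbreviation "\<kappa>0 \<equiv> centered_cumulant \<mu>"
abbreviation "S1 \<equiv> simple_integral_basis control \<Lambda> (space control)"

text \<open>The simple integral minus its mean.\<close>

definition S0 :: "(real \<times> real \<Rightarrow> real) \<Rightarrow> 'w \<Rightarrow> real" where
  "S0 h \<omega> = S1 h \<omega> - L.drift a * (\<integral>p. h p \<partial>control)"

lemma \<kappa>0_0: "\<kappa>0 0 = 0" by (simp add: centered_cumulant_def)

lemma Re_\<kappa>0: "Re (\<kappa>0 y) = Re (levy_cumulant a 0 \<mu> y)"
  by (simp add: L.levy_cumulant_eq_centered)

lemma simple_integrable: "rr_simple control h \<Longrightarrow> integrable control h"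
  using rr_simple_compose_integrable(1)[of control h "\<lambda>y. y"] by simp

text \<open>Subtracting the mean multiplies the characteristic function by a deterministic phase,
  which cancels the drift and leaves the centered cumulant in the exponent.\<close>

sublocale C: infdiv_functional M control "centered_cumulant \<mu>" S0
proof
  show "S0 h \<in> borel_measurable M" if "rr_simple control h" for h
    unfolding S0_def using F.S_measurable[OF that] by measurable
  show "AE \<omega> in M. S0 (\<lambda>x. r * h x + q * g x) \<omega> = r * S0 h \<omega> + q * S0 g \<omega>"
    if "rr_simple control h" "rr_simple control g" for h g r q
    using F.S_linear[OF that, of r q]
  proof eventually_elim
    case (elim \<omega>)
    have "(\<integral>p. r * h p + q * g p \<partial>control) = r * (\<integral>p. h p \<partial>control) + q * (\<integral>p. g p \<partial>control)"
      using simple_integrable[OF that(1)] simple_integrable[OF that(2)] by simp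
    with elim show ?case unfolding S0_def by (simp add: algebra_simps)
  qed
  show "(CLINT \<omega>|M. iexp (S0 h \<omega>)) = exp (CLINT x|control. \<kappa>0 (h x))" if h: "rr_simple control h" for h
  proof -
    let ?d = "L.drift a * (\<integral>p. h p \<partial>control)"
    have ih: "integrable control (\<lambda>p. complex_of_real (h p))" using simple_integrable[OF h] by simp
    have i0: "integrable control (\<lambda>p. \<kappa>0 (h p))" by (rule rr_simple_compose_integrable(1)[OF h]) (rule \<kappa>0_0)
    have "(CLINT \<omega>|M. iexp (S0 h \<omega>)) = (CLINT \<omega>|M. iexp (S1 h \<omega>) * exp (- (\<i> * of_real ?d)))"
      by (intro Bochner_Integration.integral_cong) (simp_all add: S0_def right_diff_distrib exp_diff exp_minus divide_inverse)
    also have "\<dots> = (CLINT \<omega>|M. iexp (S1 h \<omega>)) * exp (- (\<i> * of_real ?d))" by simp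
    also have "\<dots> = exp ((CLINT p|control. levy_cumulant a 0 \<mu> (h p)) - \<i> * of_real ?d)"
      by (simp add: F.S_char[OF h] exp_diff exp_minus divide_inverse)
    also have "(CLINT p|control. levy_cumulant a 0 \<mu> (h p)) = (CLINT p|control. \<i> * of_real (L.drift a) * of_real (h p) + \<kappa>0 (h p))"
      by (simp add: L.levy_cumulant_eq_centered mult_ac)
    also have "\<dots> = (CLINT p|control. \<i> * of_real (L.drift a) * of_real (h p)) + (CLINT p|control. \<kappa>0 (h p))"
      by (rule Bochner_Integration.integral_add[OF integrable_mult_right[OF ih] i0])
    also have "(CLINT p|control. \<i> * of_real (L.drift a) * of_real (h p)) = \<i> * of_real ?d"
      by (simp only: integral_mult_right_zero integral_complex_of_real) simp
    finally show ?thesis by simp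
  qed
  show "\<exists>D. \<forall>x y. - Re (\<kappa>0 (x + y)) \<le> D * (- Re (\<kappa>0 x) - Re (\<kappa>0 y))"
    unfolding Re_\<kappa>0 using Re_levy_cumulant_props(3)[OF levy_mu] by blast
qed (use Re_levy_cumulant_props[OF levy_mu] L.cumulant_cont \<kappa>0_0 in \<open>auto simp: Re_\<kappa>0\<close>)

text \<open>The drift is invisible to the real part, so Cauchy estimates obtained for
  \<open>F\<close> can be used for \<open>C\<close>.\<close>

lemma C_psi_eq: "C.\<psi> = F.\<psi>"
  by (simp add: fun_eq_iff C.\<psi>_def F.\<psi>_def Re_\<kappa>0)

lemma sector: obtains C where "\<And>y. norm (\<kappa>0 y) \<le> C * C.\<psi> y"
  using L.cumulant_sector unfolding C.\<psi>_def by blast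

lemma wk_char:
  assumes "C.wk_integral f Y"
  shows "integrable control (\<lambda>x. \<kappa>0 (f x))" "(CLINT \<omega>|M. iexp (Y \<omega>)) = exp (\<integral>x. \<kappa>0 (f x) \<partial>control)"
proof -
  obtain C where C: "\<And>y. norm (\<kappa>0 y) \<le> C * C.\<psi> y" using sector by blast
  show "integrable control (\<lambda>x. \<kappa>0 (f x))" "(CLINT \<omega>|M. iexp (Y \<omega>)) = exp (\<integral>x. \<kappa>0 (f x) \<partial>control)"
    by (rule C.wk_integral_char[OF assms C])+
qed

text \<open>The exponent has nonpositive real part, so \<open>exp w - 1\<close> is at most
  \<open>norm w\<close>, and the quadratic bound of the cumulant applies. This yields the second
  moments of X and of its increments.\<close>

lemma wk_char_minus_1:
  assumes f: "C.wk_integral f Y" and L2: "(\<integral>\<^sup>+p. ennreal ((f p)\<^sup>2) \<partial>control) \<le> ennreal q" and q: "0 \<le> q"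
  shows "norm ((CLINT \<omega>|M. iexp (z * Y \<omega>)) - 1) \<le> L.m2 * (z\<^sup>2 * q)"
proof -
  have [measurable]: "f \<in> borel_measurable control" using f by (auto simp: C.wk_integral_def C.wk_approx_def)
  have f2: "integrable control (\<lambda>p. (f p)\<^sup>2)"
    using L2 by (intro integrableI_bounded) (auto simp: top_unique less_top[symmetric])
  have "ennreal (\<integral>p. (f p)\<^sup>2 \<partial>control) \<le> ennreal q"
    using L2 nn_integral_eq_integral[OF f2] by simp
  then have fq: "(\<integral>p. (f p)\<^sup>2 \<partial>control) \<le> q" using q by (subst (asm) ennreal_le_iff) auto
  have zf: "C.wk_integral (\<lambda>p. z * f p) (\<lambda>\<omega>. z * Y \<omega>)"
    using C.wk_integral_linear[OF f f, of z 0] by simp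
  note W = wk_char[OF zf]
  have "Re (\<integral>p. \<kappa>0 (z * f p) \<partial>control) = (\<integral>p. Re (\<kappa>0 (z * f p)) \<partial>control)" by (rule integral_Re[OF W(1), symmetric])
  also have "\<dots> \<le> 0"
    using Bochner_Integration.integral_nonneg[of control "\<lambda>p. - Re (\<kappa>0 (z * f p))"] C.Re_nonpos by simp
  finally have "norm ((CLINT \<omega>|M. iexp (z * Y \<omega>)) - 1) \<le> norm (\<integral>p. \<kappa>0 (z * f p) \<partial>control)"
    unfolding W(2) by (rule norm_exp_minus_1_le)
  also have "\<dots> \<le> (\<integral>p. norm (\<kappa>0 (z * f p)) \<partial>control)" by (rule integral_norm_bound)
  also have "\<dots> \<le> (\<integral>p. L.m2 * (z\<^sup>2 * (f p)\<^sup>2) \<partial>control)"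
  proof (rule integral_mono)
    show "norm (\<kappa>0 (z * f p)) \<le> L.m2 * (z\<^sup>2 * (f p)\<^sup>2)" for p
      using L.norm_cumulant_le[of "z * f p"] by (simp add: power_mult_distrib)
  qed (use W(1) f2 in \<open>auto intro!: integrable_norm\<close>)
  also have "\<dots> = L.m2 * (z\<^sup>2 * (\<integral>p. (f p)\<^sup>2 \<partial>control))" by simp
  also have "\<dots> \<le> L.m2 * (z\<^sup>2 * q)" using fq by (intro mult_left_mono L.m2_nonneg) auto
  finally show ?thesis .
qed

text \<open>The characteristic function is 1 + O(z^2) at 0, whereas a nonzero mean would add a
  linear term.\<close>

lemma mean_zero:
  assumes f: "C.wk_integral f Y" and L2: "(\<integral>\<^sup>+p. ennreal ((f p)\<^sup>2) \<partial>control) \<le> ennreal q" and q: "0 \<le> q"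
    and [measurable]: "Y \<in> borel_measurable M" and Y2: "integrable M (\<lambda>\<omega>. (Y \<omega>)\<^sup>2)"
  shows "expectation Y = 0"
proof -
  have Yi: "integrable M Y" by (rule square_integrable_imp_integrable[OF _ Y2]) measurable
  define K where "K = L.m2 * q + expectation (\<lambda>\<omega>. (Y \<omega>)\<^sup>2) / 2"
  have "\<bar>z * expectation Y\<bar> \<le> K * z\<^sup>2" for z
  proof -
    have i: "integrable M (\<lambda>\<omega>. iexp (z * Y \<omega>))" by (intro integrable_iexp) auto
    have iy: "integrable M (\<lambda>\<omega>. \<i> * of_real (z * Y \<omega>))" by (intro integrable_mult_right integrable_of_real Yi)
    have "(CLINT \<omega>|M. compensated_exp (z * Y \<omega>)) = (CLINT \<omega>|M. iexp (z * Y \<omega>)) - 1 - (CLINT \<omega>|M. \<i> * of_real (z * Y \<omega>))"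
      unfolding compensated_exp_def using i iy by (subst Bochner_Integration.integral_diff, simp, simp, subst Bochner_Integration.integral_diff) (auto simp: prob_space)
    also have "(CLINT \<omega>|M. \<i> * of_real (z * Y \<omega>)) = \<i> * of_real (z * expectation Y)"
      by (simp only: integral_mult_right_zero integral_complex_of_real)
    finally have "\<i> * of_real (z * expectation Y) = ((CLINT \<omega>|M. iexp (z * Y \<omega>)) - 1) - (CLINT \<omega>|M. compensated_exp (z * Y \<omega>))" by simp
    then have "norm (\<i> * complex_of_real (z * expectation Y)) \<le> norm ((CLINT \<omega>|M. iexp (z * Y \<omega>)) - 1) + norm (CLINT \<omega>|M. compensated_exp (z * Y \<omega>))"
      by (simp only: norm_triangle_ineq4)
    moreover have "norm (CLINT \<omega>|M. compensated_exp (z * Y \<omega>)) \<le> z\<^sup>2 / 2 * expectation (\<lambda>\<omega>. (Y \<omega>)\<^sup>2)"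
    proof -
      have "norm (CLINT \<omega>|M. compensated_exp (z * Y \<omega>)) \<le> expectation (\<lambda>\<omega>. norm (compensated_exp (z * Y \<omega>)))" by (rule integral_norm_bound)
      also have "\<dots> \<le> expectation (\<lambda>\<omega>. z\<^sup>2 / 2 * (Y \<omega>)\<^sup>2)"
      proof (rule integral_mono)
        show "integrable M (\<lambda>\<omega>. norm (compensated_exp (z * Y \<omega>)))"
          unfolding compensated_exp_def using i iy by (intro integrable_norm Bochner_Integration.integrable_diff) auto
        show "norm (compensated_exp (z * Y \<omega>)) \<le> z\<^sup>2 / 2 * (Y \<omega>)\<^sup>2" for \<omega>
          using norm_compensated_exp_le[of "z * Y \<omega>"] by (simp add: power_mult_distrib)
      qed (use Y2 in simp)
      finally show ?thesis by simp
    qed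
    moreover have "norm (\<i> * complex_of_real (z * expectation Y)) = \<bar>z * expectation Y\<bar>"
      by (simp only: norm_mult norm_ii norm_of_real mult_1)
    ultimately show ?thesis using wk_char_minus_1[OF f L2 q, of z] by (simp add: K_def algebra_simps)
  qed
  then have le: "\<bar>expectation Y\<bar> \<le> K * (1 / real (Suc n))" for n
  proof -
    assume *: "\<And>z. \<bar>z * expectation Y\<bar> \<le> K * z\<^sup>2"
    have "1 / real (Suc n) * \<bar>expectation Y\<bar> \<le> 1 / real (Suc n) * (K * (1 / real (Suc n)))"
      using *[of "1 / real (Suc n)"] by (simp add: abs_mult power2_eq_square mult_ac)
    then show ?thesis by (subst (asm) mult_le_cancel_left_pos) auto
  qed
  have "\<bar>expectation Y\<bar> \<le> K * 0"
    by (rule LIMSEQ_le_const[OF tendsto_mult_left[OF LIMSEQ_Suc[OF lim_1_over_n]]]) (use le in auto)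
  then show ?thesis by simp
qed

text \<open>The drift part of the integral is not controlled by \<open>\<psi>\<close>. It is a deterministic limit, hence constant, and
  that constant vanishes because both \<open>X t\<close> and the compensated integral have mean zero.\<close>

lemma X_wk0: "C.wk_integral (supOU_kernel t) (X t)"
proof -
  obtain h where h: "F.wk_approx h (supOU_kernel t) (X t)" using X_wk[of t] by (auto simp: F.wk_integral_def)
  have hs: "rr_simple control (h n)" for n using h by (simp add: F.wk_approx_def)
  have S0m[measurable]: "S0 (h n) \<in> borel_measurable M" and S1m[measurable]: "S1 (h n) \<in> borel_measurable M" for n
    using C.S_measurable[OF hs] F.S_measurable[OF hs] by auto
  obtain C where C: "\<And>y. norm (\<kappa>0 y) \<le> C * C.\<psi> y" using sector by blast
  obtain Y where Y[measurable]: "Y \<in> borel_measurable M" and SY: "conv_in_prob M (\<lambda>n. S0 (h n)) Y"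
  proof (rule C.S_Cauchy_conv[OF hs])
    fix z :: real and r s :: "nat \<Rightarrow> nat"
    assume r: "filterlim r at_top sequentially" and s: "filterlim s at_top sequentially"
    \<comment> \<open>The Cauchy estimate is known for \<open>F\<close>; the sector bound upgrades
      it to the complex exponents of the compensated functional, along the same simple functions
      \<open>h\<close>.\<close>
    have "(\<lambda>k. \<integral>x. F.\<psi> (z * h (r k) x - z * h (s k) x) \<partial>control) \<longlonglongrightarrow> 0"
      by (rule F.wk_approx_diff_tendsto[OF F.wk_approx_cmult[OF h] r s])
    then have "(\<lambda>k. C * (\<integral>x. F.\<psi> (z * (h (r k) x - h (s k) x)) \<partial>control)) \<longlonglongrightarrow> C * 0"
      by (intro tendsto_mult_left) (simp add: right_diff_distrib)
    then have lim: "(\<lambda>k. C * (\<integral>x. F.\<psi> (z * (h (r k) x - h (s k) x)) \<partial>control)) \<longlonglongrightarrow> 0" by simp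
    have "norm (\<integral>x. \<kappa>0 (z * (h (r k) x - h (s k) x)) \<partial>control) \<le> C * (\<integral>x. F.\<psi> (z * (h (r k) x - h (s k) x)) \<partial>control)" for k
    proof -
      have g: "rr_simple control (\<lambda>x. z * (h (r k) x - h (s k) x))" by (intro rr_simple_cmult rr_simple_diff hs)
      have "norm (\<integral>x. \<kappa>0 (z * (h (r k) x - h (s k) x)) \<partial>control) \<le> (\<integral>x. norm (\<kappa>0 (z * (h (r k) x - h (s k) x))) \<partial>control)"
        by (rule integral_norm_bound)
      also have "\<dots> \<le> (\<integral>x. C * F.\<psi> (z * (h (r k) x - h (s k) x)) \<partial>control)"
      proof (rule integral_mono)
        show "integrable control (\<lambda>x. norm (\<kappa>0 (z * (h (r k) x - h (s k) x))))"
          using rr_simple_compose_integrable(1)[OF g, of \<kappa>0] \<kappa>0_0 by (intro integrable_norm) auto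
        show "integrable control (\<lambda>x. C * F.\<psi> (z * (h (r k) x - h (s k) x)))"
          using rr_simple_compose_integrable(1)[OF g, of F.\<psi>] by simp
      qed (use C C_psi_eq in auto)
      finally show ?thesis by simp
    qed
    then show "(\<lambda>k. \<integral>x. \<kappa>0 (z * (h (r k) x - h (s k) x)) \<partial>control) \<longlonglongrightarrow> 0"
      by (intro Lim_null_comparison[OF always_eventually[OF allI] lim])
  qed
  have CY: "C.wk_approx h (supOU_kernel t) Y"
    using h SY Y by (simp add: C.wk_approx_def F.wk_approx_def)
  then have wY: "C.wk_integral (supOU_kernel t) Y" by (auto simp: C.wk_integral_def)
  define d where "d n = L.drift a * (\<integral>p. h n p \<partial>control)" for n
  have "conv_in_prob M (\<lambda>n _. d n) (\<lambda>\<omega>. X t \<omega> + -1 * Y \<omega>)"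
  proof (rule conv_in_prob_add)
    show "conv_in_prob M (\<lambda>n. S1 (h n)) (X t)" using h by (simp add: F.wk_approx_def)
    show "conv_in_prob M (\<lambda>n \<omega>. -1 * S0 (h n) \<omega>) (\<lambda>\<omega>. -1 * Y \<omega>)" by (rule conv_in_prob_cmult[OF _ _ SY]) auto
    show "AE \<omega> in M. d n = S1 (h n) \<omega> + -1 * S0 (h n) \<omega>" for n by (simp add: S0_def d_def)
  qed auto
  then obtain c where c: "AE \<omega> in M. X t \<omega> + -1 * Y \<omega> = c"
    using conv_in_prob_constants[of "\<lambda>\<omega>. X t \<omega> + -1 * Y \<omega>" d] by auto
  have Y_AE: "AE \<omega> in M. Y \<omega> = X t \<omega> - c" using c by eventually_elim simp
  have "integrable M (\<lambda>\<omega>. (X t \<omega> - c)\<^sup>2)"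
    unfolding power2_diff using X_sq X_integrable by simp
  then have Y2: "integrable M (\<lambda>\<omega>. (Y \<omega>)\<^sup>2)"
    by (rule integrable_cong_AE_imp) (use Y_AE in auto)
  have "expectation Y = 0"
    by (rule mean_zero[OF wY _ _ Y Y2, of "1 / 2"]) (simp_all only: nn_integral_kernel_square order_refl zero_le_divide_1_iff zero_le_numeral)
  moreover have "expectation Y = expectation (\<lambda>\<omega>. X t \<omega> - c)" by (rule integral_cong_AE) (use Y_AE in auto)
  ultimately have "c = 0" using X_integrable X_mean by (simp add: prob_space)
  then have "AE \<omega> in M. Y \<omega> = X t \<omega>" using Y_AE by simp
  then have "conv_in_prob M (\<lambda>n. S0 (h n)) (X t)"
    by (intro conv_in_prob_AE_cong[OF _ _ _ SY]) auto
  then show ?thesis using CY by (auto simp: C.wk_integral_def C.wk_approx_def)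
qed

lemma X_L2_diff: "(\<integral>\<^sup>+\<omega>. ennreal ((X s \<omega> - X t \<omega>)\<^sup>2) \<partial>M) \<le> ennreal (2 * L.m2 * kernel_modulus \<bar>s - t\<bar>)"
proof (rule second_moment_liminf)
  fix n
  have w: "C.wk_integral (\<lambda>p. supOU_kernel s p - supOU_kernel t p) (\<lambda>\<omega>. X s \<omega> - X t \<omega>)"
    using C.wk_integral_linear[OF X_wk0[of s] X_wk0[of t], of 1 "-1"] by simp
  let ?z = "1 / real (Suc n)"
  have "\<bar>Re ((CLINT \<omega>|M. iexp (?z * (X s \<omega> - X t \<omega>))) - 1)\<bar> \<le> L.m2 * (?z\<^sup>2 * kernel_modulus \<bar>s - t\<bar>)"
    by (rule order_trans[OF abs_Re_le_cmod wk_char_minus_1[OF w nn_integral_kernel_diff kernel_modulus_nonneg]]) auto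
  then have "1 - Re (CLINT \<omega>|M. iexp (?z * (X s \<omega> - X t \<omega>))) \<le> L.m2 * (?z\<^sup>2 * kernel_modulus \<bar>s - t\<bar>)"
    unfolding minus_complex.sel one_complex.sel by linarith
  then have "2 * (real (Suc n))\<^sup>2 * (1 - Re (CLINT \<omega>|M. iexp (?z * (X s \<omega> - X t \<omega>)))) \<le> 2 * (real (Suc n))\<^sup>2 * (L.m2 * (?z\<^sup>2 * kernel_modulus \<bar>s - t\<bar>))"
    by (intro mult_left_mono) auto
  also have "\<dots> = 2 * L.m2 * kernel_modulus \<bar>s - t\<bar>" by (simp add: power_divide)
  finally show "2 * (real (Suc n))\<^sup>2 * (1 - Re (CLINT \<omega>|M. iexp (?z * (X s \<omega> - X t \<omega>)))) \<le> 2 * L.m2 * kernel_modulus \<bar>s - t\<bar>" .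
qed measurable

lemma X_L2: "(\<integral>\<^sup>+\<omega>. ennreal ((X s \<omega>)\<^sup>2) \<partial>M) \<le> ennreal L.m2"
proof (rule second_moment_liminf)
  fix n
  let ?z = "1 / real (Suc n)"
  have "\<bar>Re ((CLINT \<omega>|M. iexp (?z * X s \<omega>)) - 1)\<bar> \<le> L.m2 * (?z\<^sup>2 * (1 / 2))"
    by (rule order_trans[OF abs_Re_le_cmod wk_char_minus_1[OF X_wk0]]) (auto simp only: nn_integral_kernel_square)
  then have "1 - Re (CLINT \<omega>|M. iexp (?z * X s \<omega>)) \<le> L.m2 * (?z\<^sup>2 * (1 / 2))"
    unfolding minus_complex.sel one_complex.sel by linarith
  then have "2 * (real (Suc n))\<^sup>2 * (1 - Re (CLINT \<omega>|M. iexp (?z * X s \<omega>))) \<le> 2 * (real (Suc n))\<^sup>2 * (L.m2 * (?z\<^sup>2 * (1 / 2)))"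
    by (intro mult_left_mono) auto
  also have "\<dots> = L.m2" by (simp add: power_divide)
  finally show "2 * (real (Suc n))\<^sup>2 * (1 - Re (CLINT \<omega>|M. iexp (?z * X s \<omega>))) \<le> L.m2" .
qed measurable

text \<open>Joint measurability and the uniform second moment give a finite expectation of the
  integral of \<open>\<bar>X s\<bar>\<close> by Fubini. Only on a null set can
  \<open>integrated_process\<close> fall back on the default value of the Bochner integral.\<close>

lemma X_path_integrable:
  "AE \<omega> in M. set_integrable lborel {0..t} (\<lambda>s. X s \<omega>)"
proof -
  interpret P: pair_sigma_finite lborel M ..
  have m: "(\<lambda>(s, \<omega>). X s \<omega>) \<in> borel_measurable (lborel \<Otimes>\<^sub>M M)" by measurable
  have "(\<integral>\<^sup>+\<omega>. \<integral>\<^sup>+s. ennreal (indicator {0..t} s * \<bar>X s \<omega>\<bar>) \<partial>lborel \<partial>M) = (\<integral>\<^sup>+s. \<integral>\<^sup>+\<omega>. ennreal (indicator {0..t} s * \<bar>X s \<omega>\<bar>) \<partial>M \<partial>lborel)"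
    by (rule P.Fubini') measurable
  also have "\<dots> \<le> (\<integral>\<^sup>+s. ennreal (1 + L.m2) * indicator {0..t} s \<partial>lborel)"
  proof (rule nn_integral_mono)
    fix s
    have "(\<integral>\<^sup>+\<omega>. ennreal \<bar>X s \<omega>\<bar> \<partial>M) \<le> (\<integral>\<^sup>+\<omega>. ennreal 1 + ennreal ((X s \<omega>)\<^sup>2) \<partial>M)"
    proof (rule nn_integral_mono)
      fix \<omega>
      have "\<bar>y\<bar> \<le> 1 + y\<^sup>2" for y :: real
        using zero_le_power2[of "\<bar>y\<bar> - 1"] zero_le_power2[of y] unfolding power2_diff power2_abs power_one by linarith
      then show "ennreal \<bar>X s \<omega>\<bar> \<le> ennreal 1 + ennreal ((X s \<omega>)\<^sup>2)"
        using ennreal_plus[of 1 "(X s \<omega>)\<^sup>2"] ennreal_leI[of "\<bar>X s \<omega>\<bar>" "1 + (X s \<omega>)\<^sup>2"] by simp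
    qed
    also have "\<dots> = (\<integral>\<^sup>+\<omega>. ennreal 1 \<partial>M) + (\<integral>\<^sup>+\<omega>. ennreal ((X s \<omega>)\<^sup>2) \<partial>M)" by (rule nn_integral_add) measurable
    also have "\<dots> \<le> ennreal 1 + ennreal L.m2"
      by (intro add_mono X_L2) (simp add: emeasure_space_1)
    also have "\<dots> = ennreal (1 + L.m2)" using L.m2_nonneg by (subst ennreal_plus) auto
    finally have "(\<integral>\<^sup>+\<omega>. ennreal \<bar>X s \<omega>\<bar> \<partial>M) \<le> ennreal (1 + L.m2)" .
    then show "(\<integral>\<^sup>+\<omega>. ennreal (indicator {0..t} s * \<bar>X s \<omega>\<bar>) \<partial>M) \<le> ennreal (1 + L.m2) * indicator {0..t} s"
      by (auto simp: indicator_def)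
  qed
  also have "\<dots> = ennreal (1 + L.m2) * emeasure lborel {0..t}" by (rule nn_integral_cmult_indicator) simp
  also have "\<dots> < \<infinity>" by (auto simp: ennreal_mult_less_top emeasure_lborel_Icc_eq)
  finally have "(\<integral>\<^sup>+\<omega>. \<integral>\<^sup>+s. ennreal (indicator {0..t} s * \<bar>X s \<omega>\<bar>) \<partial>lborel \<partial>M) \<noteq> \<infinity>" by simp
  moreover have "(\<lambda>\<omega>. \<integral>\<^sup>+s. ennreal (indicator {0..t} s * \<bar>X s \<omega>\<bar>) \<partial>lborel) \<in> borel_measurable M" by measurable
  ultimately have "AE \<omega> in M. (\<integral>\<^sup>+s. ennreal (indicator {0..t} s * \<bar>X s \<omega>\<bar>) \<partial>lborel) \<noteq> \<infinity>"
    by (intro nn_integral_PInf_AE)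
  then show ?thesis using AE_space
  proof eventually_elim
    case (elim \<omega>)
    have [measurable]: "(\<lambda>s. X s \<omega>) \<in> borel_measurable borel"
      using measurable_compose[OF measurable_Pair2'[OF elim(2)] X_measurable2] by simp
    show ?case unfolding set_integrable_def
      using elim(1) by (intro integrableI_bounded) (auto simp: abs_mult less_top)
  qed
qed

section \<open>The integrated process as a mean-square limit of Riemann sums\<close>

lemma integrated_measurable[measurable]: "integrated_process X t \<in> borel_measurable M"
proof -
  have "(\<lambda>\<omega>. \<integral>s. indicator {0..t} s *\<^sub>R X s \<omega> \<partial>lborel) \<in> borel_measurable M"
    by (rule lborel.borel_measurable_lebesgue_integral) measurable
  then show ?thesis by (simp add: integrated_process_def[abs_def] set_lebesgue_integral_def)
qed

definition X_sum :: "real \<Rightarrow> nat \<Rightarrow> 'w \<Rightarrow> real" where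
  "X_sum t n \<omega> = (\<Sum>k\<in>{..<n}. t / real n * X (real k * (t / real n)) \<omega>)"

lemma X_sum_measurable[measurable]: "X_sum t n \<in> borel_measurable M" unfolding X_sum_def by measurable

lemma X_sum_L2_bound:
  assumes t: "0 \<le> t" and n: "0 < n"
  shows "(\<integral>\<^sup>+\<omega>. ennreal ((integrated_process X t \<omega> - X_sum t n \<omega>)\<^sup>2) \<partial>M) \<le> ennreal (t\<^sup>2 * (2 * L.m2 * kernel_modulus (t / n)))"
  unfolding integrated_process_def X_sum_def
proof (rule Riemann_sum_L2_bound[OF sigma_finite_measure_axioms X_measurable2 t n])
  have k: "kernel_modulus x \<le> kernel_modulus y" if "0 \<le> x" "x \<le> y" for x y
    unfolding kernel_modulus_def using that
    by (intro integral_mono kernel_modulus_integrable) (auto simp: space_pi)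
  show "0 \<le> 2 * L.m2 * kernel_modulus (t / real n)" using t L.m2_nonneg by (intro mult_nonneg_nonneg kernel_modulus_nonneg) auto
  show "(\<integral>\<^sup>+\<omega>. ennreal ((X s \<omega> - X r \<omega>)\<^sup>2) \<partial>M) \<le> ennreal (2 * L.m2 * kernel_modulus (t / real n))" if "\<bar>s - r\<bar> \<le> t / real n" for s r
    by (rule order_trans[OF X_L2_diff]) (intro ennreal_leI mult_left_mono k that, use L.m2_nonneg in auto)
qed (rule X_path_integrable)

lemma X_sum_wk: "C.wk_integral (kernel_sum t (Suc n)) (X_sum t (Suc n))"
  unfolding kernel_sum_def[abs_def] X_sum_def[abs_def]
  by (rule C.wk_integral_sum) (auto intro: X_wk0)

lemma joint_char_integrated:
  fixes c \<tau> :: "'i \<Rightarrow> real"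
  assumes I: "finite I" "I \<noteq> {}" and \<tau>: "\<And>i. i \<in> I \<Longrightarrow> 0 \<le> \<tau> i"
  shows "integrable control (\<lambda>p. \<kappa>0 (\<Sum>i\<in>I. c i * kernel_integral (\<tau> i) p))"
    "(CLINT \<omega>|M. iexp (\<Sum>i\<in>I. c i * integrated_process X (\<tau> i) \<omega>)) = exp (\<integral>p. \<kappa>0 (\<Sum>i\<in>I. c i * kernel_integral (\<tau> i) p) \<partial>control)"
proof -
  let ?F = "\<lambda>p. \<Sum>i\<in>I. c i * kernel_integral (\<tau> i) p"
  \<comment> \<open>\<open>Suc n\<close> nodes, so that the mesh is never a division by zero. The
    same error bound \<open>sum0\<close> serves the kernels (\<open>e = 1\<close>) and the process
    (\<open>e = 2 * L.m2\<close>).\<close>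
  let ?g = "\<lambda>n p. \<Sum>i\<in>I. c i * kernel_sum (\<tau> i) (Suc n) p"
  let ?Y = "\<lambda>\<omega>. \<Sum>i\<in>I. c i * integrated_process X (\<tau> i) \<omega>"
  let ?Yn = "\<lambda>n \<omega>. \<Sum>i\<in>I. c i * X_sum (\<tau> i) (Suc n) \<omega>"
  have km: "(\<lambda>n. kernel_modulus (\<tau> i / real (Suc n))) \<longlonglongrightarrow> 0" if "i \<in> I" for i
    by (rule kernel_modulus_tendsto) (use \<tau>[OF that] LIMSEQ_Suc[OF lim_const_over_n] in auto)
  have sum0: "(\<lambda>n. \<Sum>i\<in>I. ennreal (card I * (c i)\<^sup>2) * ennreal ((\<tau> i)\<^sup>2 * (e * kernel_modulus (\<tau> i / real (Suc n))))) \<longlonglongrightarrow> 0" for e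
  proof -
    have "(\<lambda>n. \<Sum>i\<in>I. ennreal (card I * (c i)\<^sup>2) * ennreal ((\<tau> i)\<^sup>2 * (e * kernel_modulus (\<tau> i / real (Suc n))))) \<longlonglongrightarrow> (\<Sum>i\<in>I. ennreal (card I * (c i)\<^sup>2) * ennreal ((\<tau> i)\<^sup>2 * (e * 0)))"
      by (intro tendsto_sum ennreal_tendsto_cmult tendsto_ennrealI tendsto_mult tendsto_const km) auto
    then show ?thesis by simp
  qed
  have lim_g: "(\<lambda>n. \<integral>\<^sup>+p. ennreal ((?g n p - ?F p)\<^sup>2) \<partial>control) \<longlonglongrightarrow> 0"
  proof (rule tendsto_sandwich[OF _ _ tendsto_const sum0[of 1]])
    have "(\<integral>\<^sup>+p. ennreal ((?g n p - ?F p)\<^sup>2) \<partial>control) \<le> (\<Sum>i\<in>I. ennreal (card I * (c i)\<^sup>2) * ennreal ((\<tau> i)\<^sup>2 * (1 * kernel_modulus (\<tau> i / real (Suc n)))))" for n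
    proof -
      have "(?g n p - ?F p)\<^sup>2 = (\<Sum>i\<in>I. c i * (kernel_integral (\<tau> i) p - kernel_sum (\<tau> i) (Suc n) p))\<^sup>2" for p
        by (subst power2_commute) (simp add: right_diff_distrib sum_subtractf)
      moreover have "(\<integral>\<^sup>+p. ennreal ((\<Sum>i\<in>I. c i * (kernel_integral (\<tau> i) p - kernel_sum (\<tau> i) (Suc n) p))\<^sup>2) \<partial>control)
         \<le> (\<Sum>i\<in>I. ennreal (card I * (c i)\<^sup>2) * (\<integral>\<^sup>+p. ennreal ((kernel_integral (\<tau> i) p - kernel_sum (\<tau> i) (Suc n) p)\<^sup>2) \<partial>control))"
        by (rule nn_integral_square_sum_finite) (use \<tau> in \<open>auto intro!: le_less_trans[OF kernel_sum_L2_bound]\<close>)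
      moreover have "\<dots> \<le> (\<Sum>i\<in>I. ennreal (card I * (c i)\<^sup>2) * ennreal ((\<tau> i)\<^sup>2 * (1 * kernel_modulus (\<tau> i / real (Suc n)))))"
        by (intro sum_mono mult_left_mono) (use kernel_sum_L2_bound[OF \<tau>, of _ "Suc n"] in auto)
      ultimately show ?thesis by simp
    qed
    then show "\<forall>\<^sub>F n in sequentially. (\<integral>\<^sup>+p. ennreal ((?g n p - ?F p)\<^sup>2) \<partial>control) \<le> (\<Sum>i\<in>I. ennreal (card I * (c i)\<^sup>2) * ennreal ((\<tau> i)\<^sup>2 * (1 * kernel_modulus (\<tau> i / real (Suc n)))))"
      by (intro always_eventually allI)
  qed simp
  have lim_Y: "(\<lambda>n. \<integral>\<^sup>+\<omega>. ennreal ((?Y \<omega> - ?Yn n \<omega>)\<^sup>2) \<partial>M) \<longlonglongrightarrow> 0"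
  proof (rule tendsto_sandwich[OF _ _ tendsto_const sum0[of "2 * L.m2"]])
    have "(\<integral>\<^sup>+\<omega>. ennreal ((?Y \<omega> - ?Yn n \<omega>)\<^sup>2) \<partial>M) \<le> (\<Sum>i\<in>I. ennreal (card I * (c i)\<^sup>2) * ennreal ((\<tau> i)\<^sup>2 * (2 * L.m2 * kernel_modulus (\<tau> i / real (Suc n)))))" for n
    proof -
      have "(?Y \<omega> - ?Yn n \<omega>)\<^sup>2 = (\<Sum>i\<in>I. c i * (integrated_process X (\<tau> i) \<omega> - X_sum (\<tau> i) (Suc n) \<omega>))\<^sup>2" for \<omega>
        by (simp add: right_diff_distrib sum_subtractf)
      moreover have "(\<integral>\<^sup>+\<omega>. ennreal ((\<Sum>i\<in>I. c i * (integrated_process X (\<tau> i) \<omega> - X_sum (\<tau> i) (Suc n) \<omega>))\<^sup>2) \<partial>M)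
         \<le> (\<Sum>i\<in>I. ennreal (card I * (c i)\<^sup>2) * (\<integral>\<^sup>+\<omega>. ennreal ((integrated_process X (\<tau> i) \<omega> - X_sum (\<tau> i) (Suc n) \<omega>)\<^sup>2) \<partial>M))"
        by (rule nn_integral_square_sum_finite) (use \<tau> in \<open>auto intro!: le_less_trans[OF X_sum_L2_bound]\<close>)
      moreover have "\<dots> \<le> (\<Sum>i\<in>I. ennreal (card I * (c i)\<^sup>2) * ennreal ((\<tau> i)\<^sup>2 * (2 * L.m2 * kernel_modulus (\<tau> i / real (Suc n)))))"
        by (intro sum_mono mult_left_mono) (use X_sum_L2_bound[OF \<tau>, of _ "Suc n"] in auto)
      ultimately show ?thesis by simp
    qed
    then show "\<forall>\<^sub>F n in sequentially. (\<integral>\<^sup>+\<omega>. ennreal ((?Y \<omega> - ?Yn n \<omega>)\<^sup>2) \<partial>M) \<le> (\<Sum>i\<in>I. ennreal (card I * (c i)\<^sup>2) * ennreal ((\<tau> i)\<^sup>2 * (2 * L.m2 * kernel_modulus (\<tau> i / real (Suc n)))))"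
      by (intro always_eventually allI)
  qed simp
  have gL2: "(\<integral>\<^sup>+p. ennreal ((?g n p)\<^sup>2) \<partial>control) < \<infinity>" for n
    by (rule nn_integral_square_sum_less_top) (rule kernel_sum_measurable kernel_sum_L2)+
  have FL2: "(\<integral>\<^sup>+p. ennreal ((?F p)\<^sup>2) \<partial>control) < \<infinity>"
    by (rule nn_integral_square_sum_less_top) (rule kernel_integral_measurable, erule kernel_integral_L2[OF \<tau>])
  note CL = L.cumulant_L2_tendsto[of ?g control ?F, OF _ _ FL2 gL2 lim_g]
  show "integrable control (\<lambda>p. \<kappa>0 (?F p))" by (rule CL) measurable
  have "(\<lambda>n. \<integral>p. \<kappa>0 (?g n p) \<partial>control) \<longlonglongrightarrow> (\<integral>p. \<kappa>0 (?F p) \<partial>control)" by (rule CL) measurable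
  then have 1: "(\<lambda>n. exp (\<integral>p. \<kappa>0 (?g n p) \<partial>control)) \<longlonglongrightarrow> exp (\<integral>p. \<kappa>0 (?F p) \<partial>control)" by (rule tendsto_exp)
  have "conv_in_prob M ?Yn ?Y" by (rule L2_tendsto_imp_conv_in_prob[OF _ _ lim_Y]) measurable
  then have "(\<lambda>n. CLINT \<omega>|M. iexp (1 * ?Yn n \<omega>)) \<longlonglongrightarrow> (CLINT \<omega>|M. iexp (1 * ?Y \<omega>))"
    by (rule conv_in_prob_imp_char_tendsto[rotated 2]) measurable
  moreover have "(CLINT \<omega>|M. iexp (1 * ?Yn n \<omega>)) = exp (\<integral>p. \<kappa>0 (?g n p) \<partial>control)" for n
    using wk_char(2)[OF C.wk_integral_sum[OF I X_sum_wk, of c]] by simp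
  ultimately show "(CLINT \<omega>|M. iexp (?Y \<omega>)) = exp (\<integral>p. \<kappa>0 (?F p) \<partial>control)"
    using 1 LIMSEQ_unique by fastforce
qed

end

section \<open>The scaling limit of the cumulants\<close>

lemma sets_lborel_pos[measurable_cong]: "sets lborel_pos = sets borel_pos"
  by (simp add: sets_restrict_space)

lemma fst_measurable_lborel_pos[measurable]: "fst \<in> borel_measurable (lborel_pos \<Otimes>\<^sub>M (N :: 'b measure))"
proof -
  have "(\<lambda>x. x) \<in> borel_measurable lborel_pos" by (rule measurable_restrict_space1) simp
  then show ?thesis by (rule measurable_compose[OF measurable_fst])
qed

lemma nn_integral_lborel_pos:
  "(\<integral>\<^sup>+x. f x \<partial>lborel_pos) = (\<integral>\<^sup>+x. f x * indicator {0<..} x \<partial>lborel)"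
  by (rule nn_integral_restrict_space) simp

lemma nn_integral_lborel_pos_scale:
  assumes f: "f \<in> borel_measurable borel_pos" and T: "0 < T"
  shows "(\<integral>\<^sup>+x. f x \<partial>lborel_pos) = (\<integral>\<^sup>+x. ennreal (1 / T) * f (x / T) \<partial>lborel_pos)"
proof -
  have m: "(\<lambda>x. f x * indicator {0<..} x) \<in> borel_measurable borel"
    using f by (subst (asm) borel_measurable_restrict_space_iff_ennreal) auto
  have "(\<integral>\<^sup>+x. f x \<partial>lborel_pos) = ennreal \<bar>1 / T\<bar> * (\<integral>\<^sup>+x. f (0 + 1 / T * x) * indicator {0<..} (0 + 1 / T * x) \<partial>lborel)"
    unfolding nn_integral_lborel_pos by (rule nn_integral_real_affine[OF m]) (use T in simp)
  also have "\<dots> = (\<integral>\<^sup>+x. ennreal \<bar>1 / T\<bar> * (f (0 + 1 / T * x) * indicator {0<..} (0 + 1 / T * x)) \<partial>lborel)"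
    by (rule nn_integral_cmult[symmetric]) (use measurable_compose[OF _ m, of "\<lambda>x. 0 + 1 / T * x" borel] in simp)
  also have "\<dots> = (\<integral>\<^sup>+x. ennreal (1 / T) * f (x / T) * indicator {0<..} x \<partial>lborel)"
    using T by (intro nn_integral_cong) (auto simp: indicator_def zero_less_divide_iff)
  finally show ?thesis unfolding nn_integral_lborel_pos .
qed

section \<open>The limit kernel and an integrable envelope\<close>

lemma Z_kernel_measurable[measurable]: "Z_kernel t \<in> borel_measurable (lborel_pos \<Otimes>\<^sub>M lborel)"
proof -
  have "(\<lambda>q. (if fst q > 0 \<and> t - snd q > 0 then 1 - exp (- fst q * (t - snd q)) else 0)
      - (if fst q > 0 \<and> - snd q > 0 then 1 - exp (- fst q * (- snd q)) else 0)) \<in> borel_measurable (lborel_pos \<Otimes>\<^sub>M lborel)"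
    by measurable
  then show ?thesis by (simp add: Z_kernel_def frak_f_def case_prod_beta)
qed

text \<open>For fixed signs \<open>frak_f x u\<close> depends on the product \<open>x * u\<close>
  only.\<close>

lemma Z_kernel_scale: "0 < T \<Longrightarrow> Z_kernel (T * t) (x / T, T * s) = Z_kernel t (x, s)"
proof -
  assume T: "0 < T"
  have "T * t - T * s = T * (t - s)" by (simp add: algebra_simps)
  then show ?thesis using T by (auto simp: Z_kernel_def frak_f_def zero_less_mult_iff zero_less_divide_iff mult_less_0_iff)
qed

text \<open>Only times \<open>s \<ge> u / x\<close> contribute, so the exponential is integrated
  from \<open>max 0 (u / x)\<close> to \<open>t\<close>. For negative \<open>u\<close> the lower
  limit 0 produces the second term of \<open>Z_kernel\<close>.\<close>

lemma (in supOU_measure) kernel_integral_eq: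
  assumes x: "0 < x" and t: "0 \<le> t"
  shows "kernel_integral t (x, u) = Z_kernel t (x, u / x) / x"
proof -
  define a where "a = max 0 (u / x)"
  have ind: "indicator {0..t} s * supOU_kernel s (x, u) = exp (- x * s + u) * indicator {a..t} s" for s
    using x by (auto simp: supOU_kernel_def a_def indicator_def pos_divide_le_eq mult.commute)
  have eq: "kernel_integral t (x, u) = (\<integral>s. exp (- x * s + u) * indicator {a..t} s \<partial>lborel)"
    by (simp add: kernel_integral_def set_lebesgue_integral_def ind)
  show ?thesis
  proof (cases "a \<le> t")
    case True
    have "(\<integral>s. exp (- x * s + u) * indicator {a..t} s \<partial>lborel) = - exp (- x * t + u) / x - - exp (- x * a + u) / x"
    proof (rule integral_FTC_Icc_real[OF True])
      show "((\<lambda>s. - exp (- x * s + u) / x) has_real_derivative exp (- x * s + u)) (at s)" for s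
        using x by (auto intro!: derivative_eq_intros)
    qed (intro isCont_exp' continuous_intros)
    then have "kernel_integral t (x, u) = (exp (- x * a + u) - exp (- x * t + u)) / x"
      unfolding eq by (simp add: diff_divide_distrib)
    moreover have "Z_kernel t (x, u / x) = exp (- x * a + u) - exp (- x * t + u)"
    proof -
      have "- x * (t - u / x) = - x * t + u" "x * (u / x) = u" using x by (auto simp: algebra_simps)
      moreover have "t \<le> u / x \<Longrightarrow> t = u / x" using True by (simp add: a_def)
      ultimately show ?thesis using x t True
        by (cases "u < 0"; cases "t = u / x") (auto simp: Z_kernel_def frak_f_def a_def max_def zero_less_divide_iff divide_less_0_iff not_less zero_le_divide_iff)
    qed
    ultimately show ?thesis by simp
  next
    case False
    then have "t < u / x" using t by (auto simp: a_def max_def split: if_splits)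
    then have "Z_kernel t (x, u / x) = 0" using x t by (simp add: Z_kernel_def frak_f_def)
    moreover have "indicator {a..t} = (\<lambda>_. 0 :: real)" using False by (auto simp: indicator_def)
    ultimately show ?thesis unfolding eq by simp
  qed
qed

text \<open>A bound for \<open>\<bar>Z_kernel t\<bar>\<close> that is monotone in \<open>t\<close>
  and a product under the power function: \<open>min 1 (x * t)\<close> bounds
  \<open>1 - exp (- x * t)\<close>, and the second factor records the exponential decay for
  \<open>s < 0\<close> and the support in \<open>s \<le> t\<close>.\<close>

definition Z_envelope :: "real \<Rightarrow> real \<times> real \<Rightarrow> real" where
  "Z_envelope t = (\<lambda>(x, s). min 1 (x * t) * (if s < 0 then exp (x * s) else if s \<le> t then 1 else 0))"

lemma Z_envelope_measurable[measurable]: "Z_envelope t \<in> borel_measurable (lborel_pos \<Otimes>\<^sub>M lborel)"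
proof -
  have "(\<lambda>q. min 1 (fst q * t) * (if snd q < 0 then exp (fst q * snd q) else if snd q \<le> t then 1 else 0)) \<in> borel_measurable (lborel_pos \<Otimes>\<^sub>M lborel)"
    by measurable
  then show ?thesis by (simp add: Z_envelope_def case_prod_beta)
qed

lemma Z_envelope_mono:
  assumes "0 < x" "s \<le> t" "0 \<le> s"
  shows "Z_envelope s (x, u) \<le> Z_envelope t (x, u)"
  unfolding Z_envelope_def prod.case
proof (rule mult_mono)
  have "x * s \<le> x * t" using assms by simp
  then show "min 1 (x * s) \<le> min 1 (x * t)" by linarith
qed (use assms in auto)

lemma Z_kernel_le_envelope:
  assumes x: "0 < x" and t: "0 \<le> t"
  shows "\<bar>Z_kernel t (x, s)\<bar> \<le> Z_envelope t (x, s)"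
proof -
  have le: "1 - exp (- (x * r)) \<le> min 1 (x * t)" "0 \<le> 1 - exp (- (x * r))" if "r \<le> t" "0 \<le> r" for r
  proof -
    have "x * r \<le> x * t" "0 \<le> x * r" using x that by auto
    then show "1 - exp (- (x * r)) \<le> min 1 (x * t)" "0 \<le> 1 - exp (- (x * r))"
      using exp_ge_add_one_self[of "- (x * r)"] by auto
  qed
  consider "s < 0" | "0 \<le> s" "s < t" | "0 \<le> s" "t \<le> s" by linarith
  then show ?thesis
  proof cases
    case 1
    have "Z_kernel t (x, s) = exp (x * s) * (1 - exp (- (x * t)))"
      using 1 x t by (simp add: Z_kernel_def frak_f_def algebra_simps exp_add[symmetric])
    then show ?thesis using 1 le[OF order_refl t] by (simp add: Z_envelope_def abs_mult mult.commute mult_right_mono)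
  next
    case 2
    then have "Z_kernel t (x, s) = 1 - exp (- (x * (t - s)))" using x by (simp add: Z_kernel_def frak_f_def)
    then show ?thesis using 2 le[of "t - s"] by (simp add: Z_envelope_def)
  next
    case 3
    then have "Z_kernel t (x, s) = 0" by (simp add: Z_kernel_def frak_f_def)
    then show ?thesis using x t 3 by (auto simp: Z_envelope_def)
  qed
qed

lemma nn_integral_envelope_inner:
  assumes x: "0 < x" and t: "0 \<le> t" and r: "0 < r"
  shows "(\<integral>\<^sup>+s. ennreal (Z_envelope t (x, s) powr r) \<partial>lborel) \<le> ennreal (min 1 (x * t) powr r * (1 / (r * x) + t))"
proof -
  let ?e = "\<lambda>s. indicator {..<0} s * exp (r * x * s) :: real"
  have m: "0 \<le> min 1 (x * t)" using x t by simp
  have e: "(\<integral>\<^sup>+s. ennreal (?e s) \<partial>lborel) = ennreal (1 / (r * x))"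
  proof -
    have "(\<integral>\<^sup>+s. ennreal (?e s) \<partial>lborel) = ennreal \<bar>-1\<bar> * (\<integral>\<^sup>+s. ennreal (?e (0 + -1 * s)) \<partial>lborel)"
    proof (rule nn_integral_real_affine)
      show "(\<lambda>s. ennreal (?e s)) \<in> borel_measurable borel"
        by (intro measurable_compose[OF _ measurable_ennreal] borel_measurable_times borel_measurable_indicator) (simp, measurable)
    qed simp
    also have "(\<lambda>s. ?e (0 + -1 * s)) = (\<lambda>s. indicator {0<..} s * (s powr (1 - 1) * exp (- (r * x * s))))"
      by (auto simp: indicator_def)
    also have "ennreal \<bar>-1\<bar> * (\<integral>\<^sup>+s. ennreal (indicator {0<..} s * (s powr (1 - 1) * exp (- (r * x * s)))) \<partial>lborel) = ennreal (Gamma 1 * (r * x) powr - 1)"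
      by (subst nn_integral_Gamma_scaled) (use r x in auto)
    finally show ?thesis using r x by (simp add: powr_minus divide_inverse)
  qed
  have "(\<integral>\<^sup>+s. ennreal (Z_envelope t (x, s) powr r) \<partial>lborel)
    = (\<integral>\<^sup>+s. ennreal (min 1 (x * t) powr r) * (ennreal (?e s) + indicator {0..t} s) \<partial>lborel)"
  proof (rule nn_integral_cong)
    fix s
    have "Z_envelope t (x, s) powr r = min 1 (x * t) powr r * (?e s + indicator {0..t} s)"
      using m r by (auto simp: Z_envelope_def powr_mult exp_powr_real mult_ac indicator_def)
    then show "ennreal (Z_envelope t (x, s) powr r) = ennreal (min 1 (x * t) powr r) * (ennreal (?e s) + indicator {0..t} s)"
      by (simp add: ennreal_mult ennreal_indicator)
  qed
  also have "\<dots> = ennreal (min 1 (x * t) powr r) * ((\<integral>\<^sup>+s. ennreal (?e s) \<partial>lborel) + (\<integral>\<^sup>+s. indicator {0..t} s \<partial>lborel))"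
    by (subst nn_integral_cmult, measurable, subst nn_integral_add) auto
  also have "\<dots> = ennreal (min 1 (x * t) powr r * (1 / (r * x) + t))"
    unfolding e using t r x by (simp add: ennreal_mult)
  finally show ?thesis by simp
qed

text \<open>After integration over \<open>s\<close>, the integrand is of order
  \<open>x powr (q + r - 1)\<close> near 0 and at most of order \<open>x powr q\<close> at infinity,
  hence the conditions \<open>- r < q\<close> and \<open>q < -1\<close>. The two majorants have
  parameters \<open>q + r\<close> and \<open>q + 3\<close>, both in (0, 2).\<close>

lemma nn_integral_envelope:
  assumes t: "0 \<le> t" and r: "0 < r" "r < 2" and q: "- r < q" "q < -1"
  shows "(\<integral>\<^sup>+p. ennreal (fst p powr q * Z_envelope t p powr r) \<partial>(lborel_pos \<Otimes>\<^sub>M lborel)) < \<infinity>"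
proof -
  let ?w = "\<lambda>a v. indicator {0<..} v * (v powr (a - 1) / (1 + v\<^sup>2)) :: real"
  define C1 where "C1 = 2 * t powr r * (1 / r + t)"
  define C2 where "C2 = 2 * (1 / r + t)"
  have w0: "0 \<le> ?w a v" for a v by (simp add: indicator_def)
  have C: "0 \<le> C1" "0 \<le> C2" using t r by (auto simp: C1_def C2_def)
  have "(\<integral>\<^sup>+p. ennreal (fst p powr q * Z_envelope t p powr r) \<partial>(lborel_pos \<Otimes>\<^sub>M lborel))
    = (\<integral>\<^sup>+x. \<integral>\<^sup>+s. ennreal (fst (x, s) powr q * Z_envelope t (x, s) powr r) \<partial>lborel \<partial>lborel_pos)"
    by (rule lborel.nn_integral_fst[symmetric]) measurable
  also have "\<dots> = (\<integral>\<^sup>+x. (\<integral>\<^sup>+s. ennreal (x powr q) * ennreal (Z_envelope t (x, s) powr r) \<partial>lborel) * indicator {0<..} x \<partial>lborel)"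
    unfolding nn_integral_lborel_pos by (simp add: ennreal_mult)
  also have "\<dots> \<le> (\<integral>\<^sup>+x. ennreal (C1 * ?w (q + r) x + C2 * ?w (q + 3) x) \<partial>lborel)"
  proof (rule nn_integral_mono)
    fix x :: real
    show "(\<integral>\<^sup>+s. ennreal (x powr q) * ennreal (Z_envelope t (x, s) powr r) \<partial>lborel) * indicator {0<..} x \<le> ennreal (C1 * ?w (q + r) x + C2 * ?w (q + 3) x)"
    proof (cases "0 < x")
      case x: True
      have "(\<lambda>s. ennreal (Z_envelope t (x, s) powr r)) \<in> borel_measurable lborel" unfolding Z_envelope_def prod.case by measurable
      then have "(\<integral>\<^sup>+s. ennreal (x powr q) * ennreal (Z_envelope t (x, s) powr r) \<partial>lborel) = ennreal (x powr q) * (\<integral>\<^sup>+s. ennreal (Z_envelope t (x, s) powr r) \<partial>lborel)"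
        by (rule nn_integral_cmult)
      also have "\<dots> \<le> ennreal (x powr q) * ennreal (min 1 (x * t) powr r * (1 / (r * x) + t))"
        by (intro mult_left_mono nn_integral_envelope_inner x t r) simp
      also have "\<dots> = ennreal (x powr q * (min 1 (x * t) powr r * (1 / (r * x) + t)))" by (simp add: ennreal_mult')
      also have "x powr q * (min 1 (x * t) powr r * (1 / (r * x) + t)) \<le> C1 * ?w (q + r) x + C2 * ?w (q + 3) x"
      proof (cases "x \<le> 1")
        case True
        have x2: "x\<^sup>2 \<le> 1" using True x by (simp add: power_le_one)
        have "t * x \<le> t" using x True t by (simp add: mult_left_le)
        then have "t \<le> t / x" using x by (simp add: pos_le_divide_eq)
        then have "1 / (r * x) + t \<le> (1 / r + t) / x"
          by (simp add: add_divide_distrib)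
        moreover have "min 1 (x * t) powr r \<le> x powr r * t powr r"
          unfolding powr_mult[symmetric] using x t r by (intro powr_mono2) auto
        ultimately have "x powr q * (min 1 (x * t) powr r * (1 / (r * x) + t)) \<le> x powr q * (x powr r * t powr r * ((1 / r + t) / x))"
          using x t r by (intro mult_left_mono mult_mono) auto
        also have "\<dots> = t powr r * (1 / r + t) * x powr (q + r - 1)" using x by (simp add: powr_add powr_diff)
        also have "\<dots> \<le> t powr r * (1 / r + t) * (2 * ?w (q + r) x)"
        proof (rule mult_left_mono)
          have "x powr (q + r - 1) * (1 + x\<^sup>2) \<le> x powr (q + r - 1) * 2" using x2 by (intro mult_left_mono) auto
          then show "x powr (q + r - 1) \<le> 2 * ?w (q + r) x" using x
            by (simp add: pos_le_divide_eq add_pos_nonneg mult.commute)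
        qed (use t r in auto)
        also have "\<dots> = C1 * ?w (q + r) x" by (simp add: C1_def)
        finally show ?thesis using mult_nonneg_nonneg[OF C(2) w0[of x "q + 3"]] by linarith
      next
        case False
        have x2: "1 \<le> x\<^sup>2" using False by simp
        have "1 / (r * x) + t \<le> 1 / r + t"
          using x False r by (simp add: field_simps)
        moreover have "min 1 (x * t) powr r \<le> 1"
          using x t r powr_mono2[of r "min 1 (x * t)" 1] by auto
        ultimately have "x powr q * (min 1 (x * t) powr r * (1 / (r * x) + t)) \<le> x powr q * (1 * (1 / r + t))"
          using x t r by (intro mult_left_mono mult_mono) auto
        also have "\<dots> \<le> (1 / r + t) * (2 * ?w (q + 3) x)"
        proof -
          have "x powr (q + 3 - 1) = x powr q * x\<^sup>2" using x by (simp add: powr_add powr_numeral)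
          moreover have "x powr q * (1 + x\<^sup>2) \<le> x powr q * (2 * x\<^sup>2)" using x2 by (intro mult_left_mono) auto
          ultimately have "x powr q \<le> 2 * ?w (q + 3) x" using x
            by (simp add: pos_le_divide_eq add_pos_nonneg mult_ac)
          then have "(1 / r + t) * x powr q \<le> (1 / r + t) * (2 * ?w (q + 3) x)" using t r by (intro mult_left_mono) auto
          then show ?thesis by (simp add: mult_ac)
        qed
        also have "\<dots> = C2 * ?w (q + 3) x" by (simp add: C2_def)
        finally show ?thesis using mult_nonneg_nonneg[OF C(1) w0[of x "q + r"]] by linarith
      qed
      finally show ?thesis using x by (simp add: ennreal_leI)
    qed simp
  qed
  also have "\<dots> = ennreal (\<integral>x. C1 * ?w (q + r) x + C2 * ?w (q + 3) x \<partial>lborel)"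
  proof (rule nn_integral_eq_integral)
    have "integrable lborel (?w (q + r))" "integrable lborel (?w (q + 3))"
      by (rule integrable.intros[OF has_bochner_integral_power_over_1_plus_square], use q r in simp, use q r in simp)+
    then show "integrable lborel (\<lambda>x. C1 * ?w (q + r) x + C2 * ?w (q + 3) x)"
      by (intro Bochner_Integration.integrable_add integrable_mult_right)
    show "AE x in lborel. 0 \<le> C1 * ?w (q + r) x + C2 * ?w (q + 3) x" by (intro AE_I2 add_nonneg_nonneg mult_nonneg_nonneg C w0)
  qed
  also have "\<dots> < \<infinity>" by simp
  finally show ?thesis .
qed

lemma powr_sum_envelope:
  assumes x: "0 < x" and t: "\<And>i. i \<in> I \<Longrightarrow> 0 \<le> t i \<and> t i \<le> \<tau>" and r: "0 < r"
  shows "\<bar>\<Sum>i\<in>I. z i * Z_kernel (t i) (x, s)\<bar> powr r \<le> (\<Sum>i\<in>I. \<bar>z i\<bar>) powr r * Z_envelope \<tau> (x, s) powr r"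
proof -
  have "\<bar>\<Sum>i\<in>I. z i * Z_kernel (t i) (x, s)\<bar> \<le> (\<Sum>i\<in>I. \<bar>z i * Z_kernel (t i) (x, s)\<bar>)" by (rule sum_abs)
  also have "\<dots> \<le> (\<Sum>i\<in>I. \<bar>z i\<bar> * Z_envelope \<tau> (x, s))"
    unfolding abs_mult
  proof (intro sum_mono mult_left_mono)
    fix i assume "i \<in> I"
    then show "\<bar>Z_kernel (t i) (x, s)\<bar> \<le> Z_envelope \<tau> (x, s)"
      using t x by (intro order_trans[OF Z_kernel_le_envelope Z_envelope_mono]) auto
  qed simp
  also have "\<dots> = (\<Sum>i\<in>I. \<bar>z i\<bar>) * Z_envelope \<tau> (x, s)" by (simp add: sum_distrib_right)
  finally show ?thesis using r unfolding powr_mult[symmetric] by (intro powr_mono2) auto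
qed

section \<open>Both control measures over one reference measure\<close>

lemma Z_control_eq:
  "Z_control \<alpha> \<beta> = density (lborel_pos \<Otimes>\<^sub>M lborel) (\<lambda>p. ennreal (\<alpha> * fst p powr (\<alpha> - \<beta>)))"
proof -
  have id: "(\<lambda>x. x) \<in> borel_measurable lborel_pos" by (rule measurable_restrict_space1) simp
  have m: "(\<lambda>x. ennreal (\<alpha> * x powr (\<alpha> - \<beta>))) \<in> borel_measurable lborel_pos"
    using id by measurable
  have l: "density lborel (\<lambda>_. 1) = lborel" by (rule density_1)
  have "density lborel_pos (\<lambda>x. ennreal (\<alpha> * x powr (\<alpha> - \<beta>))) \<Otimes>\<^sub>M density lborel (\<lambda>_. 1)
    = density (lborel_pos \<Otimes>\<^sub>M lborel) (\<lambda>(x, y). ennreal (\<alpha> * x powr (\<alpha> - \<beta>)) * 1)"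
    by (rule pair_measure_density[OF m]) (simp_all add: l lborel.sigma_finite_measure_axioms)
  then show ?thesis by (simp add: Z_control_def l case_prod_unfold)
qed

text \<open>The substitution \<open>\<xi> = \<eta> / T\<close>, \<open>s = \<eta> \<sigma>\<close>, under which the integrated kernel becomes a multiple of the
  kernel of the limit process.\<close>

lemma supOU_control_eq:
  assumes p[measurable]: "p \<in> borel_measurable borel" and pi: "\<pi> = density lborel_pos (\<lambda>x. ennreal (p x))" and sf: "sigma_finite_measure \<pi>"
    and p0: "\<And>x. 0 \<le> p x" and T: "0 < T"
  shows "\<pi> \<Otimes>\<^sub>M lborel = distr (density (lborel_pos \<Otimes>\<^sub>M lborel) (\<lambda>q. ennreal (fst q / T * p (fst q / T)))) (\<pi> \<Otimes>\<^sub>M lborel) (\<lambda>q. (fst q / T, fst q * snd q))"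
    (is "_ = distr (density ?Q ?w) _ ?\<phi>")
    and "(\<lambda>q. (fst q / T, fst q * snd q)) \<in> (lborel_pos \<Otimes>\<^sub>M lborel) \<rightarrow>\<^sub>M (\<pi> \<Otimes>\<^sub>M lborel)"
proof -
  have sp[measurable_cong]: "sets \<pi> = sets borel_pos" unfolding pi by (simp add: sets_restrict_space)
  have "(\<lambda>q :: real \<times> real. fst q / T) \<in> ?Q \<rightarrow>\<^sub>M borel_pos"
    by (rule measurable_restrict_space2) (use T in \<open>auto simp: space_pair_measure space_restrict_space\<close>)
  then have m1: "(\<lambda>q :: real \<times> real. fst q / T) \<in> ?Q \<rightarrow>\<^sub>M \<pi>" by measurable
  show phi[measurable]: "?\<phi> \<in> ?Q \<rightarrow>\<^sub>M (\<pi> \<Otimes>\<^sub>M lborel)"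
    by (rule measurable_Pair[OF m1]) measurable
  have w[measurable]: "?w \<in> borel_measurable ?Q" by measurable
  show "\<pi> \<Otimes>\<^sub>M lborel = distr (density ?Q ?w) (\<pi> \<Otimes>\<^sub>M lborel) ?\<phi>"
  proof (rule measure_eqI)
    fix A :: "(real \<times> real) set" assume A: "A \<in> sets (\<pi> \<Otimes>\<^sub>M lborel)"
    have A2: "A \<in> sets (borel_pos \<Otimes>\<^sub>M lborel)" using A sets_pair_measure_cong[OF sp refl, of "lborel :: real measure"] by simp
    have ip: "(\<lambda>x. x) \<in> borel_measurable borel_pos" by (rule measurable_restrict_space1) simp
    have in1[measurable]: "(\<lambda>x. \<integral>\<^sup>+u. indicator A (x, u) \<partial>lborel) \<in> borel_measurable borel_pos"
      using A2 by measurable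
    have pm[measurable]: "(\<lambda>x. ennreal (p x)) \<in> borel_measurable borel_pos"
      by (rule measurable_restrict_space1) simp
    have "emeasure (\<pi> \<Otimes>\<^sub>M lborel) A = (\<integral>\<^sup>+x. \<integral>\<^sup>+u. indicator A (x, u) \<partial>lborel \<partial>\<pi>)"
      using A by (simp add: lborel.nn_integral_fst)
    also have "\<dots> = (\<integral>\<^sup>+x. ennreal (p x) * (\<integral>\<^sup>+u. indicator A (x, u) \<partial>lborel) \<partial>lborel_pos)"
      unfolding pi by (rule nn_integral_density) measurable
    also have "\<dots> = (\<integral>\<^sup>+x. ennreal (1 / T) * (ennreal (p (x / T)) * (\<integral>\<^sup>+u. indicator A (x / T, u) \<partial>lborel)) \<partial>lborel_pos)"
      by (rule nn_integral_lborel_pos_scale[OF _ T]) measurable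
    also have "\<dots> = (\<integral>\<^sup>+x. \<integral>\<^sup>+s. ?w (x, s) * indicator A (?\<phi> (x, s)) \<partial>lborel \<partial>lborel_pos)"
    proof (rule nn_integral_cong)
      fix x assume "x \<in> space lborel_pos"
      then have x: "0 < x" by (simp add: space_restrict_space)
      have sl: "(\<lambda>u. indicator A (x / T, u) :: ennreal) \<in> borel_measurable borel"
        using measurable_compose[OF measurable_Pair1'[of "x / T" \<pi> lborel], of "indicator A" borel] A x T sets_eq_imp_space_eq[OF sp]
        by (simp add: space_restrict_space)
      have "(\<integral>\<^sup>+u. indicator A (x / T, u) \<partial>lborel) = ennreal \<bar>x\<bar> * (\<integral>\<^sup>+s. indicator A (x / T, 0 + x * s) \<partial>lborel)"
        by (rule nn_integral_real_affine[OF sl]) (use x in simp)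
      then have "ennreal (1 / T) * (ennreal (p (x / T)) * (\<integral>\<^sup>+u. indicator A (x / T, u) \<partial>lborel))
        = (ennreal (1 / T) * ennreal (p (x / T)) * ennreal x) * (\<integral>\<^sup>+s. indicator A (x / T, x * s) \<partial>lborel)"
        using x by (simp add: mult_ac)
      also have "ennreal (1 / T) * ennreal (p (x / T)) * ennreal x = ennreal (x / T * p (x / T))"
        using x T p0 by (simp add: ennreal_mult[symmetric] mult_ac)
      also have "\<dots> * (\<integral>\<^sup>+s. indicator A (x / T, x * s) \<partial>lborel) = (\<integral>\<^sup>+s. ennreal (x / T * p (x / T)) * indicator A (x / T, x * s) \<partial>lborel)"
        by (rule nn_integral_cmult[symmetric]) (use measurable_compose[OF _ sl, of "\<lambda>s. x * s" lborel] in simp)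
      finally show "ennreal (1 / T) * (ennreal (p (x / T)) * (\<integral>\<^sup>+u. indicator A (x / T, u) \<partial>lborel)) = (\<integral>\<^sup>+s. ?w (x, s) * indicator A (?\<phi> (x, s)) \<partial>lborel)"
        by simp
    qed
    also have "\<dots> = (\<integral>\<^sup>+q. ?w q * indicator A (?\<phi> q) \<partial>?Q)"
      by (rule lborel.nn_integral_fst) (use A in measurable)
    also have "\<dots> = (\<integral>\<^sup>+q. indicator A (?\<phi> q) \<partial>density ?Q ?w)"
      by (rule nn_integral_density[symmetric]) (use A in measurable)
    also have "\<dots> = (\<integral>\<^sup>+q. indicator A q \<partial>distr (density ?Q ?w) (\<pi> \<Otimes>\<^sub>M lborel) ?\<phi>)"
      by (rule nn_integral_distr[symmetric]) (use A in measurable)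
    also have "\<dots> = emeasure (distr (density ?Q ?w) (\<pi> \<Otimes>\<^sub>M lborel) ?\<phi>) A" using A by simp
    finally show "emeasure (\<pi> \<Otimes>\<^sub>M lborel) A = emeasure (distr (density ?Q ?w) (\<pi> \<Otimes>\<^sub>M lborel) ?\<phi>) A" .
  qed simp
qed

lemma stable_cumulant_measurable[measurable]: "stable_cumulant b c d \<in> borel_measurable borel"
  unfolding stable_cumulant_def[abs_def] stable_omega_def by measurable

section \<open>Convergence of the rescaled characteristic exponents\<close>

locale supOU_limit = supOU_measure \<pi> + stable_levy \<mu> \<beta> cp cm
  for \<pi> \<mu> :: "real measure" and \<beta> cp cm :: real +
  fixes p l :: "real \<Rightarrow> real" and \<alpha> :: real
  assumes p_meas[measurable]: "p \<in> borel_measurable borel" and p_nonneg: "\<And>x. 0 \<le> p x"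
    and pi_density: "\<pi> = density lborel_pos (\<lambda>x. ennreal (p x))"
    and alpha: "0 < \<alpha>" and slow: "slowly_varying l"
    and p_asymp: "p \<sim>[at_right 0] (\<lambda>x. \<alpha> * l (1 / x) * x powr (\<alpha> - 1))"
    and beta_gt: "1 + \<alpha> < \<beta>"
begin

abbreviation "\<kappa>0 \<equiv> centered_cumulant \<mu>"

lemma \<kappa>0_measurable[measurable]: "\<kappa>0 \<in> borel_measurable borel"
  using cumulant_cont by (intro borel_measurable_continuous_onI) (auto simp: continuous_on_eq_continuous_at)

definition norming :: "real \<Rightarrow> real" where
  "norming T = T powr (1 - \<alpha> / \<beta>) * l T powr (1 / \<beta>)"

lemma eventually_l_pos: "\<forall>\<^sub>F T in at_top. 0 < l T"
  by (rule slowly_varying_eventually_pos[OF slow])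

lemma norming_pos: "0 < T \<Longrightarrow> 0 < l T \<Longrightarrow> 0 < norming T" by (simp add: norming_def)

lemma norming_powr: "0 < T \<Longrightarrow> 0 < l T \<Longrightarrow> norming T powr \<beta> = T powr \<beta> / T powr \<alpha> * l T"
proof -
  assume "0 < T" "0 < l T"
  have "(1 - \<alpha> / \<beta>) * \<beta> = \<beta> - \<alpha>" "1 / \<beta> * \<beta> = 1" using b by (auto simp: left_diff_distrib)
  then have "norming T powr \<beta> = T powr (\<beta> - \<alpha>) * l T powr 1"
    unfolding norming_def powr_mult powr_powr by simp
  then show ?thesis using \<open>0 < l T\<close> by (simp add: powr_diff)
qed

text \<open>The norming is made for this cancellation: all powers of \<open>T\<close> disappear and
  a factor \<open>1 / l T\<close> remains, to be matched by \<open>a\<close>, which will contain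
  \<open>l (T / x)\<close>.\<close>

lemma weight_identity:
  assumes "0 < T" "0 < l T" "0 < x"
  shows "x / T * (a * (x / T) powr (\<alpha> - 1)) * (T / (norming T * x)) powr \<beta> = a / l T * x powr (\<alpha> - \<beta>)"
proof -
  have n: "0 < norming T" using assms by (intro norming_pos)
  have 1: "x / T * (x / T) powr (\<alpha> - 1) = x powr \<alpha> / T powr \<alpha>"
    using assms by (simp add: powr_diff powr_divide)
  have "(T / (norming T * x)) powr \<beta> = T powr \<beta> / (norming T powr \<beta> * x powr \<beta>)"
    using assms n by (simp add: powr_divide powr_mult)
  also have "\<dots> = T powr \<alpha> / (l T * x powr \<beta>)"
    unfolding norming_powr[OF assms(1,2)] using assms by simp
  finally have 2: "(T / (norming T * x)) powr \<beta> = T powr \<alpha> / (l T * x powr \<beta>)" .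
  have "x / T * (a * (x / T) powr (\<alpha> - 1)) * (T / (norming T * x)) powr \<beta> = a * (x / T * (x / T) powr (\<alpha> - 1)) * (T / (norming T * x)) powr \<beta>"
    by (simp add: mult_ac)
  also have "\<dots> = a / l T * x powr (\<alpha> - \<beta>)" unfolding 1 2 using assms by (simp add: powr_diff)
  finally show ?thesis .
qed

lemma l_power_bounds:
  assumes d: "0 < d"
  obtains K where "0 < K" "\<forall>\<^sub>F T in at_top. l T \<le> K * T powr d" "\<forall>\<^sub>F T in at_top. 1 / l T \<le> K * T powr d"
proof -
  obtain X where X: "X > 0" "\<And>x. x \<ge> X \<Longrightarrow> l x > 0"
    "\<And>x y. X \<le> x \<Longrightarrow> x \<le> y \<Longrightarrow> l y \<le> exp d * (y / x) powr d * l x"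
    "\<And>x y. X \<le> x \<Longrightarrow> x \<le> y \<Longrightarrow> l x \<le> exp d * (y / x) powr d * l y"
    using slowly_varying_quotient_bound[OF slow d] by blast
  define K where "K = max (exp d * l X / X powr d) (exp d / (l X * X powr d))"
  have lX: "0 < l X" using X by simp
  have K: "0 < K" "exp d * l X / X powr d \<le> K" "exp d / (l X * X powr d) \<le> K"
    using X(1) lX by (auto simp: K_def less_max_iff_disj)
  have "l T \<le> K * T powr d \<and> 1 / l T \<le> K * T powr d" if T: "X \<le> T" for T
  proof
    have "l T \<le> exp d * (T / X) powr d * l X" using X(3)[OF order_refl T] .
    also have "\<dots> = exp d * l X / X powr d * T powr d" using X(1) T by (simp add: powr_divide)
    also have "\<dots> \<le> K * T powr d" by (intro mult_right_mono K) simp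
    finally show "l T \<le> K * T powr d" .
    have "1 / l T \<le> exp d * (T / X) powr d / l X"
      using X(4)[OF order_refl T] lX X(2)[OF T] by (simp add: field_simps)
    also have "\<dots> = exp d / (l X * X powr d) * T powr d" using X(1) T by (simp add: powr_divide)
    also have "\<dots> \<le> K * T powr d" by (intro mult_right_mono K) simp
    finally show "1 / l T \<le> K * T powr d" .
  qed
  then show ?thesis using that[of K] K(1) by (auto simp: eventually_at_top_linorder)
qed

lemma T_over_norming: "filterlim (\<lambda>T. T / norming T) at_top at_top"
proof -
  obtain K where K: "0 < K" "\<forall>\<^sub>F T in at_top. l T \<le> K * T powr (\<alpha> / 2)"
    using l_power_bounds[of "\<alpha> / 2"] alpha by (metis half_gt_zero)
  \<comment> \<open>\<open>T / norming T\<close> is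
    \<open>T powr (\<alpha> / \<beta>) / l T powr (1 / \<beta>)\<close>; half of the exponent is
    spent on \<open>l\<close>, the other half is \<open>k\<close>.\<close>
  define k where "k = \<alpha> / (2 * \<beta>)"
  have k: "0 < k" using alpha b by (simp add: k_def)
  have "filterlim (\<lambda>T. 1 / K powr (1 / \<beta>) * T powr k) at_top at_top"
    using k K(1) by real_asymp
  moreover have "\<forall>\<^sub>F T in at_top. 1 / K powr (1 / \<beta>) * T powr k \<le> T / norming T"
    using K(2) eventually_l_pos eventually_gt_at_top[of 0]
  proof eventually_elim
    case (elim T)
    have "l T powr (1 / \<beta>) \<le> (K * T powr (\<alpha> / 2)) powr (1 / \<beta>)"
      using elim b by (intro powr_mono2) auto
    also have "\<dots> = K powr (1 / \<beta>) * T powr k"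
      using K(1) by (simp add: powr_mult powr_powr k_def)
    finally have le: "l T powr (1 / \<beta>) \<le> K powr (1 / \<beta>) * T powr k" .
    have "\<alpha> / \<beta> = k + k" using b by (simp add: k_def field_simps)
    then have 1: "T powr (\<alpha> / \<beta>) = T powr k * T powr k" by (simp only: powr_add)
    have "T / norming T = T powr (\<alpha> / \<beta>) / l T powr (1 / \<beta>)"
      using elim by (simp add: norming_def powr_diff)
    moreover have "1 / K powr (1 / \<beta>) * T powr k \<le> T powr (\<alpha> / \<beta>) / l T powr (1 / \<beta>)"
      unfolding 1 using le elim K(1) by (simp add: field_simps)
    ultimately show ?case by simp
  qed
  ultimately show ?thesis by (rule filterlim_at_top_mono)
qed

lemma remainder_rate: "((\<lambda>T. T / norming T powr \<beta>) \<longlongrightarrow> 0) at_top"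
proof -
  \<comment> \<open>Half of the gap in \<open>1 + \<alpha> < \<beta>\<close> absorbs
    \<open>1 / l T\<close>, the other half gives the decay.\<close>
  define d where "d = (\<beta> - 1 - \<alpha>) / 2"
  have d: "0 < d" using beta_gt by (simp add: d_def)
  obtain K where K: "0 < K" "\<forall>\<^sub>F T in at_top. 1 / l T \<le> K * T powr d"
    using l_power_bounds[OF d] by blast
  show ?thesis
  proof (rule tendsto_sandwich[OF _ _ tendsto_const])
    show "((\<lambda>T. K * T powr - d) \<longlongrightarrow> 0) at_top" using d by real_asymp
    have rw: "T / norming T powr \<beta> = T powr (- d - d) * (1 / l T)" if "0 < T" "0 < l T" for T
    proof -
      have "- d - d = 1 + \<alpha> - \<beta>" by (simp add: d_def)
      then show ?thesis using that by (simp add: norming_powr powr_add powr_diff)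
    qed
    show "\<forall>\<^sub>F T in at_top. 0 \<le> T / norming T powr \<beta>"
      using eventually_ge_at_top[of 0] by eventually_elim simp
    show "\<forall>\<^sub>F T in at_top. T / norming T powr \<beta> \<le> K * T powr - d"
      using K(2) eventually_l_pos eventually_gt_at_top[of 0]
    proof eventually_elim
      case (elim T)
      have "T powr (- d - d) * (1 / l T) \<le> T powr (- d - d) * (K * T powr d)"
        by (intro mult_left_mono elim) simp
      also have "\<dots> = K * T powr - d" by (simp add: powr_add[symmetric])
      finally show ?case unfolding rw[OF elim(3,2)] .
    qed
  qed
qed

context
  fixes I :: "'i set" and t z :: "'i \<Rightarrow> real"
  assumes I: "finite I" and t: "\<forall>i\<in>I. 0 \<le> t i"
begin

text \<open>A common upper bound of the times that also makes sense for an empty index set.\<close>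

definition "\<tau> = (\<Sum>i\<in>I. t i)"
definition "limit_kernel q = (\<Sum>i\<in>I. z i * Z_kernel (t i) q)"
definition "scaled_cumulant T q = \<kappa>0 (\<Sum>i\<in>I. z i / norming T * kernel_integral (T * t i) q)"

lemma \<tau>: "0 \<le> \<tau>" "i \<in> I \<Longrightarrow> t i \<le> \<tau>"
  unfolding \<tau>_def using I t by (auto intro: sum_nonneg member_le_sum)

lemma limit_kernel_measurable[measurable]: "limit_kernel \<in> borel_measurable (lborel_pos \<Otimes>\<^sub>M lborel)"
  unfolding limit_kernel_def[abs_def] by measurable

lemma scaled_cumulant_measurable[measurable]: "scaled_cumulant T \<in> borel_measurable control"
  unfolding scaled_cumulant_def[abs_def] by measurable

lemma scaled_cumulant_integrable:
  assumes T: "0 \<le> T"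
  shows "integrable control (scaled_cumulant T)"
proof (rule integrableI_bounded)
  let ?F = "\<lambda>q. \<Sum>i\<in>I. z i / norming T * kernel_integral (T * t i) q"
  have L2: "(\<integral>\<^sup>+q. ennreal ((?F q)\<^sup>2) \<partial>control) < \<infinity>"
    by (rule nn_integral_square_sum_less_top, rule kernel_integral_measurable, rule kernel_integral_L2)
      (use T t in simp)
  have "(\<integral>\<^sup>+q. ennreal (norm (scaled_cumulant T q)) \<partial>control) \<le> (\<integral>\<^sup>+q. ennreal m2 * ennreal ((?F q)\<^sup>2) \<partial>control)"
    using norm_cumulant_le m2_nonneg
    by (intro nn_integral_mono) (auto simp: scaled_cumulant_def ennreal_mult[symmetric] intro!: ennreal_leI)
  also have "\<dots> = ennreal m2 * (\<integral>\<^sup>+q. ennreal ((?F q)\<^sup>2) \<partial>control)" by (rule nn_integral_cmult) measurable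
  also have "\<dots> < \<infinity>" using L2 by (auto simp: ennreal_mult_less_top)
  finally show "(\<integral>\<^sup>+q. ennreal (norm (scaled_cumulant T q)) \<partial>control) < \<infinity>" .
qed measurable

lemma scaled_cumulant_eq:
  assumes T: "0 \<le> T" and x: "0 < x"
  shows "scaled_cumulant T (x, u) = \<kappa>0 ((\<Sum>i\<in>I. z i * Z_kernel (T * t i) (x, u / x)) / (norming T * x))"
proof -
  have "(\<Sum>i\<in>I. z i / norming T * kernel_integral (T * t i) (x, u)) = (\<Sum>i\<in>I. z i * Z_kernel (T * t i) (x, u / x) / (norming T * x))"
    using T t x by (intro sum.cong) (auto simp: kernel_integral_eq)
  then show ?thesis by (simp add: scaled_cumulant_def sum_divide_distrib)
qed

text \<open>The scaling of the kernel absorbs \<open>T\<close>. What remains is the factor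
  \<open>T / (norming T * x)\<close>, which tends to infinity for fixed \<open>x\<close>.\<close>

lemma scaled_cumulant_transform:
  assumes T: "0 < T" and x: "0 < x"
  shows "scaled_cumulant T (x / T, x * s) = \<kappa>0 (T / (norming T * x) * limit_kernel (x, s))"
proof -
  have "x * s / (x / T) = T * s" using x by simp
  then have eq: "(\<Sum>i\<in>I. z i * Z_kernel (T * t i) (x / T, x * s / (x / T))) = limit_kernel (x, s)"
    by (simp only: limit_kernel_def Z_kernel_scale[OF T])
  have "scaled_cumulant T (x / T, x * s) = \<kappa>0 (limit_kernel (x, s) / (norming T * (x / T)))"
    unfolding eq[symmetric] by (rule scaled_cumulant_eq) (use T x in auto)
  also have "limit_kernel (x, s) / (norming T * (x / T)) = T / (norming T * x) * limit_kernel (x, s)" by simp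
  finally show ?thesis .
qed

text \<open>The region \<open>\<xi> > e\<close> contributes \<open>O(T\<^sup>1\<^sup>+\<^sup>\<alpha>\<^sup>-\<^sup>\<beta> / l(T))\<close>; this is where \<open>1 + \<alpha> < \<beta>\<close> enters.\<close>

lemma scaled_cumulant_large_bound:
  assumes T: "1 \<le> T" "0 < l T" and e: "0 < e" and C: "0 < C" "\<And>y. norm (\<kappa>0 y) \<le> C * \<bar>y\<bar> powr \<beta>"
  shows "norm (\<integral>q. indicator {e<..} (fst q) *\<^sub>R scaled_cumulant T q \<partial>control)
    \<le> C * (\<Sum>i\<in>I. \<bar>z i\<bar>) powr \<beta> * (e powr - \<beta> * (1 / \<beta>) + e powr (1 - \<beta>) * \<tau>) * (T / norming T powr \<beta>)"
    (is "_ \<le> ?B")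
proof -
  let ?S = "(\<Sum>i\<in>I. \<bar>z i\<bar>) powr \<beta>"
  have n: "0 < norming T" using T by (intro norming_pos) auto
  have B: "0 \<le> ?B" using C(1) b e \<tau>(1) T by auto
  have inner: "(\<integral>\<^sup>+u. ennreal (norm (scaled_cumulant T (x, u))) \<partial>lborel) \<le> ennreal ?B" if x: "e < x" for x
  proof -
    have x0: "0 < x" using e x by simp
    have m: "(\<lambda>u. ennreal (Z_envelope (T * \<tau>) (x, u / x) powr \<beta>)) \<in> borel_measurable borel"
      unfolding Z_envelope_def prod.case by measurable
    let ?c = "C * ?S / (norming T * x) powr \<beta>"
    have c: "0 \<le> ?c" using C(1) by simp
    have "(\<integral>\<^sup>+u. ennreal (norm (scaled_cumulant T (x, u))) \<partial>lborel) \<le> (\<integral>\<^sup>+u. ennreal ?c * ennreal (Z_envelope (T * \<tau>) (x, u / x) powr \<beta>) \<partial>lborel)"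
    proof (rule nn_integral_mono)
      fix u
      have "norm (scaled_cumulant T (x, u)) \<le> C * \<bar>(\<Sum>i\<in>I. z i * Z_kernel (T * t i) (x, u / x)) / (norming T * x)\<bar> powr \<beta>"
      proof -
        have "scaled_cumulant T (x, u) = \<kappa>0 ((\<Sum>i\<in>I. z i * Z_kernel (T * t i) (x, u / x)) / (norming T * x))"
          by (rule scaled_cumulant_eq[OF _ x0]) (use T in simp)
        then show ?thesis by (simp only: C(2))
      qed
      also have "\<dots> = C * (\<bar>\<Sum>i\<in>I. z i * Z_kernel (T * t i) (x, u / x)\<bar> powr \<beta> / (norming T * x) powr \<beta>)"
        using n x0 by (simp add: abs_divide powr_divide)
      also have "\<dots> \<le> C * (?S * Z_envelope (T * \<tau>) (x, u / x) powr \<beta> / (norming T * x) powr \<beta>)"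
        using C(1) x0 T t \<tau> b by (intro mult_left_mono divide_right_mono powr_sum_envelope) auto
      finally show "ennreal (norm (scaled_cumulant T (x, u))) \<le> ennreal ?c * ennreal (Z_envelope (T * \<tau>) (x, u / x) powr \<beta>)"
        using c by (simp add: ennreal_mult[symmetric] ennreal_leI)
    qed
    also have "\<dots> = ennreal ?c * (\<integral>\<^sup>+u. ennreal (Z_envelope (T * \<tau>) (x, u / x) powr \<beta>) \<partial>lborel)"
      by (rule nn_integral_cmult) (use m in simp)
    also have "(\<integral>\<^sup>+u. ennreal (Z_envelope (T * \<tau>) (x, u / x) powr \<beta>) \<partial>lborel)
        = ennreal \<bar>x\<bar> * (\<integral>\<^sup>+s. ennreal (Z_envelope (T * \<tau>) (x, (0 + x * s) / x) powr \<beta>) \<partial>lborel)"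
      by (rule nn_integral_real_affine[OF m]) (use x0 in simp)
    also have "\<dots> = ennreal x * (\<integral>\<^sup>+s. ennreal (Z_envelope (T * \<tau>) (x, s) powr \<beta>) \<partial>lborel)" using x0 by simp
    also have "ennreal ?c * \<dots> \<le> ennreal ?c * (ennreal x * ennreal (1 / (\<beta> * x) + T * \<tau>))"
    proof (intro mult_left_mono order_trans[OF nn_integral_envelope_inner] ennreal_leI)
      have "min 1 (x * (T * \<tau>)) powr \<beta> \<le> 1" using b x0 T \<tau> powr_mono2[of \<beta> "min 1 (x * (T * \<tau>))" 1] by auto
      moreover have "0 \<le> 1 / (\<beta> * x) + T * \<tau>" using b x0 T \<tau> by auto
      ultimately show "min 1 (x * (T * \<tau>)) powr \<beta> * (1 / (\<beta> * x) + T * \<tau>) \<le> 1 / (\<beta> * x) + T * \<tau>"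
        by (rule mult_left_le_one_le[rotated 2]) simp
    qed (use b x0 T \<tau> in auto)
    also have "\<dots> = ennreal (?c * (x * (1 / (\<beta> * x) + T * \<tau>)))"
      using c x0 T \<tau> b by (simp add: ennreal_mult[symmetric] del: ennreal_plus)
    also have "?c * (x * (1 / (\<beta> * x) + T * \<tau>)) = C * ?S / norming T powr \<beta> * (x powr - \<beta> * (1 / \<beta>) + x powr (1 - \<beta>) * (T * \<tau>))"
    proof -
      have "x powr (1 - \<beta>) = x / x powr \<beta>" using x0 by (simp add: powr_diff)
      then show ?thesis using x0 n b by (simp add: powr_mult powr_minus field_simps)
    qed
    also have "ennreal \<dots> \<le> ennreal ?B"
    proof (rule ennreal_leI)
      \<comment> \<open>The exponents of \<open>x\<close> are negative, so the bound is largest at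
        \<open>e\<close>; \<open>T \<ge> 1\<close> then allows a common factor \<open>T\<close>. As
        \<pi> has mass 1, the outer integral adds nothing.\<close>
      have "x powr - \<beta> * (1 / \<beta>) + x powr (1 - \<beta>) * (T * \<tau>) \<le> e powr - \<beta> * (1 / \<beta>) + e powr (1 - \<beta>) * (T * \<tau>)"
        using x e b T \<tau> by (intro add_mono mult_right_mono powr_mono2') auto
      also have "\<dots> \<le> e powr - \<beta> * (1 / \<beta>) * T + e powr (1 - \<beta>) * (T * \<tau>)"
        using T b mult_left_mono[of 1 T "e powr - \<beta> * (1 / \<beta>)"] by auto
      also have "\<dots> = (e powr - \<beta> * (1 / \<beta>) + e powr (1 - \<beta>) * \<tau>) * T" by (simp add: algebra_simps)
      finally have "C * ?S / norming T powr \<beta> * (x powr - \<beta> * (1 / \<beta>) + x powr (1 - \<beta>) * (T * \<tau>)) \<le> C * ?S / norming T powr \<beta> * ((e powr - \<beta> * (1 / \<beta>) + e powr (1 - \<beta>) * \<tau>) * T)"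
        using C(1) by (intro mult_left_mono) auto
      then show "C * ?S / norming T powr \<beta> * (x powr - \<beta> * (1 / \<beta>) + x powr (1 - \<beta>) * (T * \<tau>)) \<le> ?B" by simp
    qed
    finally show ?thesis .
  qed
  have i: "integrable control (\<lambda>q. indicator {e<..} (fst q) *\<^sub>R scaled_cumulant T q)"
    by (rule Bochner_Integration.integrable_bound[OF scaled_cumulant_integrable[of T]]) (use T in \<open>auto simp: indicator_def\<close>)
  have "ennreal (norm (\<integral>q. indicator {e<..} (fst q) *\<^sub>R scaled_cumulant T q \<partial>control)) \<le> (\<integral>\<^sup>+q. norm (indicator {e<..} (fst q) *\<^sub>R scaled_cumulant T q) \<partial>control)"
    by (rule integral_norm_bound_ennreal[OF i])
  also have "\<dots> = (\<integral>\<^sup>+x. \<integral>\<^sup>+u. norm (indicator {e<..} (fst (x, u)) *\<^sub>R scaled_cumulant T (x, u)) \<partial>lborel \<partial>\<pi>)"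
    by (rule nn_integral_control) measurable
  also have "\<dots> \<le> (\<integral>\<^sup>+x. ennreal ?B \<partial>\<pi>)"
  proof (rule nn_integral_mono)
    fix x
    show "(\<integral>\<^sup>+u. norm (indicator {e<..} (fst (x, u)) *\<^sub>R scaled_cumulant T (x, u)) \<partial>lborel) \<le> ennreal ?B"
      using inner[of x] by (cases "e < x") auto
  qed
  also have "\<dots> = ennreal ?B" by (simp add: pi.emeasure_space_1)
  finally show ?thesis using B by (subst (asm) ennreal_le_iff) auto
qed

lemma scaled_cumulant_large_tendsto:
  assumes e: "0 < e"
  shows "((\<lambda>T. \<integral>q. indicator {e<..} (fst q) *\<^sub>R scaled_cumulant T q \<partial>control) \<longlongrightarrow> 0) at_top"
proof -
  obtain C where C: "0 < C" "\<And>y. norm (\<kappa>0 y) \<le> C * \<bar>y\<bar> powr \<beta>" using cumulant_le_powr by blast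
  let ?K = "C * (\<Sum>i\<in>I. \<bar>z i\<bar>) powr \<beta> * (e powr - \<beta> * (1 / \<beta>) + e powr (1 - \<beta>) * \<tau>)"
  show ?thesis
  proof (rule Lim_null_comparison)
    show "\<forall>\<^sub>F T in at_top. norm (\<integral>q. indicator {e<..} (fst q) *\<^sub>R scaled_cumulant T q \<partial>control) \<le> ?K * (T / norming T powr \<beta>)"
      using eventually_ge_at_top[of 1] eventually_l_pos
      by eventually_elim (rule scaled_cumulant_large_bound[OF _ _ e C])
    show "((\<lambda>T. ?K * (T / norming T powr \<beta>)) \<longlongrightarrow> 0) at_top"
      by (rule tendsto_mult_right_zero[OF remainder_rate])
  qed
qed

text \<open>The integrand over \<open>\<xi> \<le> e\<close> after the substitution, including the
  weight of the transformed control measure.\<close>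

definition "near_part e T q = indicator {..e} (fst q / T) *\<^sub>R ((fst q / T * p (fst q / T)) *\<^sub>R \<kappa>0 (T / (norming T * fst q) * limit_kernel q))"

lemma near_part_measurable[measurable]: "near_part e T \<in> borel_measurable (lborel_pos \<Otimes>\<^sub>M lborel)"
  unfolding near_part_def[abs_def] by measurable

lemma scaled_cumulant_small_eq:
  assumes T: "0 < T"
  shows "(\<integral>q. indicator {..e} (fst q) *\<^sub>R scaled_cumulant T q \<partial>control) = (\<integral>q. near_part e T q \<partial>(lborel_pos \<Otimes>\<^sub>M lborel))"
proof -
  let ?Q = "lborel_pos \<Otimes>\<^sub>M lborel :: (real \<times> real) measure"
  let ?w = "\<lambda>q :: real \<times> real. fst q / T * p (fst q / T)"
  let ?\<phi> = "\<lambda>q :: real \<times> real. (fst q / T, fst q * snd q)"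
  let ?g = "\<lambda>q. indicator {..e} (fst q) *\<^sub>R scaled_cumulant T q"
  note tr = supOU_control_eq[OF p_meas pi_density pi.sigma_finite_measure_axioms p_nonneg T]
  have phi[measurable]: "?\<phi> \<in> ?Q \<rightarrow>\<^sub>M control" by (rule tr(2))
  have g[measurable]: "?g \<in> borel_measurable control" by measurable
  have "(\<integral>q. ?g q \<partial>control) = (\<integral>q. ?g q \<partial>distr (density ?Q (\<lambda>q. ennreal (?w q))) control ?\<phi>)"
    using tr(1) by simp
  also have "\<dots> = (\<integral>q. ?g (?\<phi> q) \<partial>density ?Q (\<lambda>q. ennreal (?w q)))"
    by (rule integral_distr) measurable
  also have "\<dots> = (\<integral>q. ?w q *\<^sub>R ?g (?\<phi> q) \<partial>?Q)"
  proof (rule integral_density)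
    show "AE q in ?Q. 0 \<le> ?w q"
      using T p_nonneg by (intro AE_I2) (auto simp: space_pair_measure space_restrict_space intro!: mult_nonneg_nonneg)
  qed measurable
  also have "\<dots> = (\<integral>q. near_part e T q \<partial>?Q)"
  proof (rule Bochner_Integration.integral_cong[OF refl])
    fix q assume "q \<in> space ?Q"
    then have "0 < fst q" by (auto simp: space_pair_measure space_restrict_space)
    then show "?w q *\<^sub>R ?g (?\<phi> q) = near_part e T q"
      using scaled_cumulant_transform[OF T, of "fst q" "snd q"] by (simp add: near_part_def)
  qed
  finally show ?thesis .
qed

text \<open>For fixed \<open>x\<close> the cutoff is eventually inactive. The argument of the
  cumulant runs to infinity with the sign of the limit kernel, the density may be replaced by its
  asymptotic form (\<open>r\<close> tends to 1), and \<open>l (T / x) / l T\<close> tends to 1.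
  Where the limit kernel vanishes, both sides are 0.\<close>

lemma near_part_tendsto:
  assumes e: "0 < e" and x: "0 < x"
  shows "((\<lambda>T. near_part e T (x, u)) \<longlongrightarrow> (\<alpha> * x powr (\<alpha> - \<beta>)) *\<^sub>R stable_cumulant \<beta> cp cm (limit_kernel (x, u))) at_top"
proof (cases "limit_kernel (x, u) = 0")
  case True
  then show ?thesis by (simp add: near_part_def centered_cumulant_def stable_cumulant_def)
next
  case False
  define g where "g = limit_kernel (x, u)"
  have g: "g \<noteq> 0" using False by (simp add: g_def)
  define y where "y T = T / (norming T * x) * g" for T
  define r where "r T = p (x / T) / (\<alpha> * l (T / x) * (x / T) powr (\<alpha> - 1))" for T
  have xT: "filterlim (\<lambda>T. x / T) (at_right 0) at_top" using x by real_asymp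
  have Tx: "filterlim (\<lambda>T. T / x) at_top at_top" using x by real_asymp
  have lx: "\<forall>\<^sub>F T in at_top. 0 < l (T / x)" by (rule eventually_compose_filterlim[OF eventually_l_pos Tx])
  have y_top: "filterlim (\<lambda>T. y T * sgn g) at_top at_top"
  proof -
    have "filterlim (\<lambda>T. \<bar>g\<bar> / x * (T / norming T)) at_top at_top"
      using g x by (intro filterlim_tendsto_pos_mult_at_top[OF tendsto_const _ T_over_norming]) auto
    moreover have "\<bar>g\<bar> / x * (T / norming T) = y T * sgn g" for T
      by (simp add: y_def abs_sgn[of g] mult_ac)
    ultimately show ?thesis by simp
  qed
  have L: "((\<lambda>T. \<kappa>0 (y T) /\<^sub>R \<bar>y T\<bar> powr \<beta>) \<longlongrightarrow> - stable_omega g \<beta> cp cm) at_top"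
    by (rule cumulant_asymptotics[OF y_top g])
  have r: "(r \<longlongrightarrow> 1) at_top"
  proof -
    \<comment> \<open>Asymptotic equivalence reads 0 / 0 as 1; this case is eventually excluded
      because the comparison function is positive along \<open>x / T\<close>.\<close>
    have "((\<lambda>v. if p v = 0 \<and> \<alpha> * l (1 / v) * v powr (\<alpha> - 1) = 0 then 1 else p v / (\<alpha> * l (1 / v) * v powr (\<alpha> - 1))) \<longlongrightarrow> 1) (at_right 0)"
      using p_asymp by (simp add: asymp_equiv_def)
    from filterlim_compose[OF this xT]
    show ?thesis
    proof (rule Lim_transform_eventually)
      show "\<forall>\<^sub>F T in at_top. (if p (x / T) = 0 \<and> \<alpha> * l (1 / (x / T)) * (x / T) powr (\<alpha> - 1) = 0 then 1 else p (x / T) / (\<alpha> * l (1 / (x / T)) * (x / T) powr (\<alpha> - 1))) = r T"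
        using lx eventually_gt_at_top[of 0] by eventually_elim (use alpha x in \<open>auto simp: r_def\<close>)
    qed
  qed
  have q: "((\<lambda>T. l (T / x) / l T) \<longlongrightarrow> 1) at_top"
    using slow x unfolding slowly_varying_def by (auto dest!: spec[of _ "1 / x"])
  have "((\<lambda>T. (r T * \<alpha> * (l (T / x) / l T) * x powr (\<alpha> - \<beta>) * \<bar>g\<bar> powr \<beta>) *\<^sub>R (\<kappa>0 (y T) /\<^sub>R \<bar>y T\<bar> powr \<beta>)) \<longlongrightarrow> (1 * \<alpha> * 1 * x powr (\<alpha> - \<beta>) * \<bar>g\<bar> powr \<beta>) *\<^sub>R - stable_omega g \<beta> cp cm) at_top"
    by (intro tendsto_scaleR tendsto_mult tendsto_const L r q)
  also have "(1 * \<alpha> * 1 * x powr (\<alpha> - \<beta>) * \<bar>g\<bar> powr \<beta>) *\<^sub>R - stable_omega g \<beta> cp cm = (\<alpha> * x powr (\<alpha> - \<beta>)) *\<^sub>R stable_cumulant \<beta> cp cm g"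
    by (simp add: stable_cumulant_def scaleR_conv_of_real)
  finally show ?thesis unfolding g_def[symmetric]
  proof (rule Lim_transform_eventually)
    have "\<forall>\<^sub>F T in at_top. x / e \<le> T" by (rule eventually_ge_at_top)
    then show "\<forall>\<^sub>F T in at_top. (r T * \<alpha> * (l (T / x) / l T) * x powr (\<alpha> - \<beta>) * \<bar>g\<bar> powr \<beta>) *\<^sub>R (\<kappa>0 (y T) /\<^sub>R \<bar>y T\<bar> powr \<beta>) = near_part e T (x, u)"
      using lx eventually_l_pos eventually_gt_at_top[of 0]
    proof eventually_elim
      case (elim T)
      have n: "0 < norming T" using elim by (intro norming_pos)
      have y0: "\<bar>y T\<bar> powr \<beta> \<noteq> 0" using n x g elim by (simp add: y_def)
      have ye: "\<bar>y T\<bar> powr \<beta> = (T / (norming T * x)) powr \<beta> * \<bar>g\<bar> powr \<beta>"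
      proof -
        have "\<bar>y T\<bar> = T / (norming T * x) * \<bar>g\<bar>" using n x elim by (simp add: y_def abs_mult)
        then show ?thesis by (simp only: powr_mult)
      qed
      have pe: "p (x / T) = r T * \<alpha> * l (T / x) * (x / T) powr (\<alpha> - 1)" using elim x alpha by (simp add: r_def)
      have "x / T * p (x / T) * \<bar>y T\<bar> powr \<beta> = x / T * (r T * \<alpha> * l (T / x) * (x / T) powr (\<alpha> - 1)) * (T / (norming T * x)) powr \<beta> * \<bar>g\<bar> powr \<beta>"
        unfolding pe ye by (simp only: mult.assoc)
      also have "\<dots> = r T * \<alpha> * (l (T / x) / l T) * x powr (\<alpha> - \<beta>) * \<bar>g\<bar> powr \<beta>"
        unfolding weight_identity[OF elim(4,3) x] by simp
      finally have w: "r T * \<alpha> * (l (T / x) / l T) * x powr (\<alpha> - \<beta>) * \<bar>g\<bar> powr \<beta> = x / T * p (x / T) * \<bar>y T\<bar> powr \<beta>" ..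
      have "x / T \<le> e" using elim e by (simp add: field_simps)
      then have "near_part e T (x, u) = (x / T * p (x / T)) *\<^sub>R \<kappa>0 (y T)" by (simp add: near_part_def y_def g_def)
      also have "\<dots> = (x / T * p (x / T) * \<bar>y T\<bar> powr \<beta>) *\<^sub>R (\<kappa>0 (y T) /\<^sub>R \<bar>y T\<bar> powr \<beta>)" using y0 by simp
      finally show ?case unfolding w ..
    qed
  qed
qed

text \<open>The Potter bounds replace \<open>l (T / x) / l T\<close> by
  \<open>exp d * (x powr d + x powr - d)\<close>. The conditions on \<open>d\<close> keep both
  exponents \<open>\<alpha> - \<beta> + d\<close> and \<open>\<alpha> - \<beta> - d\<close> strictly
  between \<open>- \<beta>\<close> and -1, as \<open>nn_integral_envelope\<close> requires.\<close>

lemma near_part_dominated: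
  obtains e K d where "0 < e" "0 < K" "0 < d" "d < \<alpha>" "d < \<beta> - 1 - \<alpha>"
    "\<forall>\<^sub>F T in at_top. \<forall>x>0. \<forall>u. norm (near_part e T (x, u)) \<le> K * (x powr (\<alpha> - \<beta> + d) * Z_envelope \<tau> (x, u) powr \<beta> + x powr (\<alpha> - \<beta> - d) * Z_envelope \<tau> (x, u) powr \<beta>)"
proof -
  obtain C where C: "0 < C" "\<And>y. norm (\<kappa>0 y) \<le> C * \<bar>y\<bar> powr \<beta>" using cumulant_le_powr by blast
  define d where "d = min \<alpha> (\<beta> - 1 - \<alpha>) / 2"
  have d: "0 < d" "d < \<alpha>" "d < \<beta> - 1 - \<alpha>" using alpha beta_gt by (auto simp: d_def)
  obtain X where X: "X > 0" "\<And>x. x \<ge> X \<Longrightarrow> l x > 0"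
    "\<And>x y. X \<le> x \<Longrightarrow> x \<le> y \<Longrightarrow> l y \<le> exp d * (y / x) powr d * l x"
    "\<And>x y. X \<le> x \<Longrightarrow> x \<le> y \<Longrightarrow> l x \<le> exp d * (y / x) powr d * l y"
    using slowly_varying_quotient_bound[OF slow d(1)] by blast
  have "\<forall>\<^sub>F v in at_right 0. (if p v = 0 \<and> \<alpha> * l (1 / v) * v powr (\<alpha> - 1) = 0 then 1 else p v / (\<alpha> * l (1 / v) * v powr (\<alpha> - 1))) < 2"
    using p_asymp unfolding asymp_equiv_def by (rule order_tendstoD) simp
  then obtain e0 where e0: "0 < e0" "\<And>v. 0 < v \<Longrightarrow> v < e0 \<Longrightarrow> (if p v = 0 \<and> \<alpha> * l (1 / v) * v powr (\<alpha> - 1) = 0 then 1 else p v / (\<alpha> * l (1 / v) * v powr (\<alpha> - 1))) < 2"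
    unfolding eventually_at_right_field by blast
  \<comment> \<open>With this cutoff, \<open>x / T \<le> e\<close> forces
    \<open>T / x \<ge> X\<close>, the range of the Potter bounds, and puts \<open>x / T\<close>
    below \<open>e0\<close>, where the density is at most twice its asymptotic form.\<close>
  define e where "e = min (e0 / 2) (1 / X)"
  have e: "0 < e" "e < e0" "e \<le> 1 / X" using e0 X(1) by (auto simp: e_def)
  have p_le: "0 < l (1 / v) \<and> X \<le> 1 / v \<and> p v \<le> 2 * \<alpha> * l (1 / v) * v powr (\<alpha> - 1)" if v: "0 < v" "v \<le> e" for v
  proof -
    have "v \<le> 1 / X" using v e by linarith
    then have Xv: "X \<le> 1 / v" using v X(1) by (simp add: field_simps)
    then have lv: "0 < l (1 / v)" by (rule X(2))
    have pos: "0 < \<alpha> * l (1 / v) * v powr (\<alpha> - 1)" using lv alpha v by simp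
    have "p v / (\<alpha> * l (1 / v) * v powr (\<alpha> - 1)) < 2" using e0(2)[of v] v e pos by (simp split: if_splits)
    then have "p v < 2 * (\<alpha> * l (1 / v) * v powr (\<alpha> - 1))" using pos by (simp only: pos_divide_less_eq)
    then show ?thesis using Xv lv by simp
  qed
  define S where "S = (\<Sum>i\<in>I. \<bar>z i\<bar>) powr \<beta>"
  \<comment> \<open>\<open>S + 1\<close> instead of \<open>S\<close> keeps \<open>K\<close> positive
    when all weights vanish.\<close>
  define K where "K = 2 * \<alpha> * C * (S + 1) * exp d"
  have K: "0 < K" using alpha C(1) by (simp add: K_def S_def add_nonneg_pos)
  have "norm (near_part e T (x, u)) \<le> K * (x powr (\<alpha> - \<beta> + d) * Z_envelope \<tau> (x, u) powr \<beta> + x powr (\<alpha> - \<beta> - d) * Z_envelope \<tau> (x, u) powr \<beta>)" (is "_ \<le> ?R")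
    if T: "max X 1 \<le> T" and x: "0 < x" for T x u
  proof (cases "x / T \<le> e")
    case False
    then show ?thesis using K by (simp add: near_part_def)
  next
    case True
    have T0: "0 < T" "X \<le> T" using T by auto
    have lT: "0 < l T" using X(2) T0 by simp
    have n: "0 < norming T" using T0 lT by (intro norming_pos)
    have P: "0 < l (T / x)" "X \<le> T / x" "p (x / T) \<le> 2 * \<alpha> * l (T / x) * (x / T) powr (\<alpha> - 1)"
      using p_le[of "x / T"] True x T0 by auto
    define E where "E = Z_envelope \<tau> (x, u) powr \<beta>"
    have GE: "\<bar>limit_kernel (x, u)\<bar> powr \<beta> \<le> S * E"
      unfolding limit_kernel_def S_def E_def using t \<tau> b x by (intro powr_sum_envelope) auto
    have "norm (near_part e T (x, u)) = x / T * p (x / T) * norm (\<kappa>0 (T / (norming T * x) * limit_kernel (x, u)))"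
      using True x T0 p_nonneg by (simp add: near_part_def)
    also have "\<dots> \<le> x / T * (2 * \<alpha> * l (T / x) * (x / T) powr (\<alpha> - 1)) * (C * \<bar>T / (norming T * x) * limit_kernel (x, u)\<bar> powr \<beta>)"
      by (rule mult_mono[OF mult_left_mono[OF P(3)] C(2)]) (use x T0 P(1) alpha in auto)
    also have "\<bar>T / (norming T * x) * limit_kernel (x, u)\<bar> powr \<beta> = (T / (norming T * x)) powr \<beta> * \<bar>limit_kernel (x, u)\<bar> powr \<beta>"
    proof -
      have "\<bar>T / (norming T * x) * limit_kernel (x, u)\<bar> = T / (norming T * x) * \<bar>limit_kernel (x, u)\<bar>" using n x T0 by (simp add: abs_mult)
      then show ?thesis by (simp only: powr_mult)
    qed
    also have "x / T * (2 * \<alpha> * l (T / x) * (x / T) powr (\<alpha> - 1)) * (C * ((T / (norming T * x)) powr \<beta> * \<bar>limit_kernel (x, u)\<bar> powr \<beta>))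
      = (x / T * (2 * \<alpha> * l (T / x) * (x / T) powr (\<alpha> - 1)) * (T / (norming T * x)) powr \<beta>) * (C * \<bar>limit_kernel (x, u)\<bar> powr \<beta>)"
      by (simp only: mult_ac)
    also have "\<dots> = 2 * \<alpha> * C * (l (T / x) / l T) * x powr (\<alpha> - \<beta>) * \<bar>limit_kernel (x, u)\<bar> powr \<beta>"
      unfolding weight_identity[OF T0(1) lT x] by simp
    also have "\<dots> \<le> 2 * \<alpha> * C * (exp d * (x powr d + x powr - d)) * x powr (\<alpha> - \<beta>) * ((S + 1) * E)"
    proof (intro mult_mono mult_left_mono mult_right_mono)
      show "l (T / x) / l T \<le> exp d * (x powr d + x powr - d)"
      proof (cases "x \<le> 1")
        case True
        have "T \<le> T / x" using True x T0 by (simp add: pos_le_divide_eq mult_left_le)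
        from X(3)[OF T0(2) this] have "l (T / x) / l T \<le> exp d * (T / x / T) powr d"
          using lT by (simp add: pos_divide_le_eq)
        also have "T / x / T = 1 / x" using T0 by simp
        also have "(1 / x) powr d = x powr - d" using x by (simp add: powr_minus_divide powr_divide)
        finally show ?thesis by (rule order_trans) (simp add: mult_left_mono)
      next
        case False
        have "T / x \<le> T" using False x T0 by (simp add: pos_divide_le_eq)
        from X(4)[OF P(2) this] have "l (T / x) / l T \<le> exp d * (T / (T / x)) powr d"
          using lT by (simp add: pos_divide_le_eq)
        also have "T / (T / x) = x" using T0 x by simp
        finally show ?thesis by (rule order_trans) (simp add: mult_left_mono)
      qed
      have "0 \<le> E" by (simp add: E_def)
      then show "\<bar>limit_kernel (x, u)\<bar> powr \<beta> \<le> (S + 1) * E" using GE by (simp add: algebra_simps)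
    qed (use alpha C(1) P(1) lT in auto)
    also have "\<dots> = K * ((x powr d + x powr - d) * x powr (\<alpha> - \<beta>) * E)"
      by (simp add: K_def)
    also have "(x powr d + x powr - d) * x powr (\<alpha> - \<beta>) * E = x powr (\<alpha> - \<beta> + d) * E + x powr (\<alpha> - \<beta> - d) * E"
      using powr_add[of x "\<alpha> - \<beta>" d] powr_add[of x "\<alpha> - \<beta>" "- d"] by (simp add: algebra_simps)
    finally show ?thesis by (simp only: E_def)
  qed
  then have "\<forall>\<^sub>F T in at_top. \<forall>x>0. \<forall>u. norm (near_part e T (x, u)) \<le> K * (x powr (\<alpha> - \<beta> + d) * Z_envelope \<tau> (x, u) powr \<beta> + x powr (\<alpha> - \<beta> - d) * Z_envelope \<tau> (x, u) powr \<beta>)"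
    unfolding eventually_at_top_linorder by (intro exI[of _ "max X 1"]) blast
  then show ?thesis by (rule that[OF e(1) K d])
qed

lemma scaled_cumulant_integral_tendsto:
  "((\<lambda>T. \<integral>q. scaled_cumulant T q \<partial>control) \<longlongrightarrow> (\<integral>q. stable_cumulant \<beta> cp cm (limit_kernel q) \<partial>Z_control \<alpha> \<beta>)) at_top"
proof -
  let ?Q = "lborel_pos \<Otimes>\<^sub>M lborel :: (real \<times> real) measure"
  let ?h = "\<lambda>q. (\<alpha> * fst q powr (\<alpha> - \<beta>)) *\<^sub>R stable_cumulant \<beta> cp cm (limit_kernel q)"
  obtain e K d where e: "0 < e" and K: "0 < K" and d: "0 < d" "d < \<alpha>" "d < \<beta> - 1 - \<alpha>" and
    dom: "\<forall>\<^sub>F T in at_top. \<forall>x>0. \<forall>u. norm (near_part e T (x, u)) \<le> K * (x powr (\<alpha> - \<beta> + d) * Z_envelope \<tau> (x, u) powr \<beta> + x powr (\<alpha> - \<beta> - d) * Z_envelope \<tau> (x, u) powr \<beta>)"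
    by (rule near_part_dominated)
  let ?W = "\<lambda>q. K * (fst q powr (\<alpha> - \<beta> + d) * Z_envelope \<tau> q powr \<beta> + fst q powr (\<alpha> - \<beta> - d) * Z_envelope \<tau> q powr \<beta>)"
  have pos: "AE q in ?Q. 0 < fst q" by (intro AE_I2) (auto simp: space_pair_measure space_restrict_space)
  have env: "integrable ?Q (\<lambda>q. fst q powr r * Z_envelope \<tau> q powr \<beta>)" if r: "- \<beta> < r" "r < -1" for r
  proof (rule integrableI_bounded)
    show "(\<integral>\<^sup>+q. ennreal (norm (fst q powr r * Z_envelope \<tau> q powr \<beta>)) \<partial>?Q) < \<infinity>"
      using nn_integral_envelope[OF \<tau>(1) _ b(2) r] b by (simp add: abs_mult)
  qed measurable
  have "integrable ?Q ?W"
    using d alpha by (intro integrable_mult_right Bochner_Integration.integrable_add env) auto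
  moreover have "AE q in ?Q. ((\<lambda>T. near_part e T q) \<longlongrightarrow> ?h q) at_top"
    using pos
  proof eventually_elim
    case (elim q)
    then show ?case using near_part_tendsto[OF e elim, of "snd q"] by simp
  qed
  moreover have "\<forall>\<^sub>F T in at_top. AE q in ?Q. norm (near_part e T q) \<le> ?W q"
    using dom
  proof eventually_elim
    case (elim T)
    show ?case using pos
    proof eventually_elim
      case (elim q)
      then show ?case using \<open>\<forall>x>0. \<forall>u. norm (near_part e T (x, u)) \<le> _ x u\<close>[rule_format, of "fst q" "snd q"] by simp
    qed
  qed
  ultimately have "((\<lambda>T. \<integral>q. near_part e T q \<partial>?Q) \<longlongrightarrow> (\<integral>q. ?h q \<partial>?Q)) at_top"
    by (intro integral_dominated_convergence_at_top[where w = ?W]) measurable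
  moreover have "(\<integral>q. ?h q \<partial>?Q) = (\<integral>q. stable_cumulant \<beta> cp cm (limit_kernel q) \<partial>Z_control \<alpha> \<beta>)"
    unfolding Z_control_eq
  proof (rule integral_density[symmetric])
    show "(\<lambda>q. stable_cumulant \<beta> cp cm (limit_kernel q)) \<in> borel_measurable ?Q"
      by (rule measurable_compose[OF limit_kernel_measurable stable_cumulant_measurable])
    show "(\<lambda>q. \<alpha> * fst q powr (\<alpha> - \<beta>)) \<in> borel_measurable ?Q" by measurable
    show "AE q in ?Q. 0 \<le> \<alpha> * fst q powr (\<alpha> - \<beta>)" using alpha by simp
  qed
  ultimately have "((\<lambda>T. (\<integral>q. near_part e T q \<partial>?Q) + (\<integral>q. indicator {e<..} (fst q) *\<^sub>R scaled_cumulant T q \<partial>control)) \<longlongrightarrow> (\<integral>q. stable_cumulant \<beta> cp cm (limit_kernel q) \<partial>Z_control \<alpha> \<beta>) + 0) at_top"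
    by (intro tendsto_add scaled_cumulant_large_tendsto e) simp
  then show ?thesis unfolding add_0_right
  proof (rule Lim_transform_eventually)
    show "\<forall>\<^sub>F T in at_top. (\<integral>q. near_part e T q \<partial>?Q) + (\<integral>q. indicator {e<..} (fst q) *\<^sub>R scaled_cumulant T q \<partial>control) = (\<integral>q. scaled_cumulant T q \<partial>control)"
      using eventually_gt_at_top[of 0]
    proof eventually_elim
      case (elim T)
      have i: "integrable control (\<lambda>q. indicator A (fst q) *\<^sub>R scaled_cumulant T q)" if "A \<in> sets borel" for A
        by (rule Bochner_Integration.integrable_bound[OF scaled_cumulant_integrable[of T]]) (use elim that in \<open>auto simp: indicator_def\<close>)
      have "(\<integral>q. near_part e T q \<partial>?Q) + (\<integral>q. indicator {e<..} (fst q) *\<^sub>R scaled_cumulant T q \<partial>control)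
        = (\<integral>q. indicator {..e} (fst q) *\<^sub>R scaled_cumulant T q + indicator {e<..} (fst q) *\<^sub>R scaled_cumulant T q \<partial>control)"
        unfolding scaled_cumulant_small_eq[OF elim, symmetric] by (rule Bochner_Integration.integral_add[symmetric]) (simp_all add: i)
      also have "\<dots> = (\<integral>q. scaled_cumulant T q \<partial>control)"
        by (rule Bochner_Integration.integral_cong) (auto simp: indicator_def)
      finally show ?case .
    qed
  qed
qed

end

lemma cumulant_integral_tendsto:
  assumes "finite I" "\<And>i. i \<in> I \<Longrightarrow> 0 \<le> t i"
  shows "((\<lambda>T. \<integral>q. \<kappa>0 (\<Sum>i\<in>I. z i / norming T * kernel_integral (T * t i) q) \<partial>control) \<longlongrightarrow> (\<integral>q. stable_cumulant \<beta> cp cm (\<Sum>i\<in>I. z i * Z_kernel (t i) q) \<partial>Z_control \<alpha> \<beta>)) at_top"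
proof -
  have t': "\<forall>i\<in>I. 0 \<le> t i" using assms(2) by blast
  show ?thesis
    using scaled_cumulant_integral_tendsto[OF assms(1) t', where z = z] unfolding scaled_cumulant_def[OF assms(1) t'] limit_kernel_def[OF assms(1) t'] .
qed

end

section \<open>Stable random measures and the limit process\<close>

text \<open>Writing \<open>\<bar>y\<bar> powr b * sgn y\<close> through positive and negative parts
  removes the jump of the sign, so that continuity at 0 can be read off.\<close>

lemma stable_cumulant_eq:
  "stable_cumulant b c d y = - of_real (Gamma (2 - b) / (1 - b)) *
     (of_real ((c + d) * cos (pi * b / 2) * \<bar>y\<bar> powr b) - \<i> * of_real ((c - d) * sin (pi * b / 2) * (max 0 y powr b - max 0 (- y) powr b)))"
proof -
  have e: "\<bar>y\<bar> powr b * sgn y = max 0 y powr b - max 0 (- y) powr b"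
    by (cases y "0 :: real" rule: linorder_cases) auto
  show ?thesis unfolding stable_cumulant_def stable_omega_def e[symmetric] of_real_mult by (simp add: algebra_simps)
qed

lemma stable_cumulant_cont:
  assumes "0 < b"
  shows "continuous_on UNIV (stable_cumulant b c d)"
proof -
  have p: "continuous_on UNIV (\<lambda>y. f y powr b)" if "continuous_on UNIV f" "\<And>y. 0 \<le> f y" for f :: "real \<Rightarrow> real"
    by (rule continuous_on_powr'[OF that(1) continuous_on_const]) (use that(2) assms in simp)
  have a: "continuous_on UNIV (\<lambda>y :: real. \<bar>y\<bar>)" "continuous_on UNIV (\<lambda>y :: real. max 0 y)" "continuous_on UNIV (\<lambda>y :: real. max 0 (- y))"
    by (intro continuous_intros)+
  show ?thesis
    unfolding stable_cumulant_eq[abs_def]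
    by (intro continuous_on_mult continuous_on_diff continuous_on_minus continuous_on_of_real continuous_on_const p a) auto
qed

lemma Re_stable_cumulant: "Re (stable_cumulant b c d y) = - (\<bar>y\<bar> powr b * Re (stable_omega 1 b c d))"
  by (simp add: stable_cumulant_def stable_omega_def)

lemma norm_stable_cumulant_le:
  obtains C where "0 \<le> C" "\<And>y. norm (stable_cumulant b c d y) \<le> C * \<bar>y\<bar> powr b"
proof
  let ?C = "\<bar>Gamma (2 - b) / (1 - b)\<bar> * (\<bar>(c + d) * cos (pi * b / 2)\<bar> + \<bar>(c - d) * sin (pi * b / 2)\<bar>)"
  show "0 \<le> ?C" by simp
  fix y :: real
  have "norm (stable_omega y b c d) \<le> ?C"
  proof -
    have "\<bar>(c - d) * sgn y * sin (pi * b / 2)\<bar> \<le> \<bar>(c - d) * sin (pi * b / 2)\<bar>"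
      by (auto simp: abs_mult sgn_real_def)
    then have "norm (complex_of_real ((c + d) * cos (pi * b / 2)) - \<i> * of_real ((c - d) * sgn y * sin (pi * b / 2))) \<le> \<bar>(c + d) * cos (pi * b / 2)\<bar> + \<bar>(c - d) * sin (pi * b / 2)\<bar>"
      by (intro order_trans[OF norm_triangle_ineq4]) (simp only: norm_mult norm_ii norm_of_real mult_1_left add_left_mono)
    then show ?thesis unfolding stable_omega_def norm_mult norm_of_real by (intro mult_left_mono) auto
  qed
  then have "\<bar>y\<bar> powr b * norm (stable_omega y b c d) \<le> \<bar>y\<bar> powr b * ?C" by (intro mult_left_mono) auto
  then show "norm (stable_cumulant b c d y) \<le> ?C * \<bar>y\<bar> powr b"
    by (simp add: stable_cumulant_def norm_mult mult.commute)
qed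

lemma abs_add_powr_le:
  fixes x y :: real
  assumes "0 < b"
  shows "\<bar>x + y\<bar> powr b \<le> 2 powr b * (\<bar>x\<bar> powr b + \<bar>y\<bar> powr b)"
proof -
  have "\<bar>x + y\<bar> powr b \<le> (2 * max \<bar>x\<bar> \<bar>y\<bar>) powr b" using assms by (intro powr_mono2) auto
  also have "\<dots> = 2 powr b * max \<bar>x\<bar> \<bar>y\<bar> powr b" by (simp add: powr_mult)
  also have "max \<bar>x\<bar> \<bar>y\<bar> powr b \<le> \<bar>x\<bar> powr b + \<bar>y\<bar> powr b" by (simp add: max_def)
  finally show ?thesis by simp
qed

section \<open>Existence and joint laws of the stable integrals\<close>

lemma (in prob_space) conv_in_prob_AE_cong_seq:
  fixes Y :: "nat \<Rightarrow> 'a \<Rightarrow> real"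
  assumes [measurable]: "\<And>n. Y n \<in> borel_measurable M" "\<And>n. Y' n \<in> borel_measurable M" "Z \<in> borel_measurable M"
    and c: "conv_in_prob M Y Z" and ae: "\<And>n. AE \<omega> in M. Y n \<omega> = Y' n \<omega>"
  shows "conv_in_prob M Y' Z"
proof -
  have "measure M {\<omega>\<in>space M. \<bar>Y n \<omega> - Z \<omega>\<bar> > e} = measure M {\<omega>\<in>space M. \<bar>Y' n \<omega> - Z \<omega>\<bar> > e}" for n e
    by (rule measure_eq_AE) (use ae[of n] in auto)
  then show ?thesis using c by (simp add: conv_in_prob_def)
qed

text \<open>Simple functions dominated by \<open>2 * \<bar>f\<bar>\<close> inherit an integrable
  power, and finitely many values then force a support of finite measure.\<close>

lemma rr_simple_sequence_powr:
  fixes f :: "'a \<Rightarrow> real"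
  assumes f[measurable]: "f \<in> borel_measurable m" and b: "0 < b" and fin: "integrable m (\<lambda>x. \<bar>f x\<bar> powr b)"
  obtains h where "\<And>n. rr_simple m (h n)" "\<And>x. x \<in> space m \<Longrightarrow> (\<lambda>n. h n x) \<longlonglongrightarrow> f x"
    "\<And>n x. x \<in> space m \<Longrightarrow> \<bar>h n x\<bar> \<le> 2 * \<bar>f x\<bar>"
proof -
  obtain h where h: "\<And>n. simple_function m (h n)" "\<And>x. x \<in> space m \<Longrightarrow> (\<lambda>n. h n x) \<longlonglongrightarrow> f x"
    "\<And>n x. x \<in> space m \<Longrightarrow> dist (h n x) 0 \<le> 2 * dist (f x) 0"
    using borel_measurable_implies_sequence_metric[OF f, of 0] by blast
  have le: "\<bar>h n x\<bar> \<le> 2 * \<bar>f x\<bar>" if "x \<in> space m" for n x using h(3)[OF that] by simp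
  have "rr_simple m (h n)" for n
  proof -
    have "(\<integral>\<^sup>+x. norm (\<bar>h n x\<bar> powr b) \<partial>m) \<le> (\<integral>\<^sup>+x. norm (2 powr b * \<bar>f x\<bar> powr b) \<partial>m)"
    proof (rule nn_integral_mono)
      fix x assume "x \<in> space m"
      then have "\<bar>h n x\<bar> powr b \<le> (2 * \<bar>f x\<bar>) powr b" using le[of x n] b by (intro powr_mono2) auto
      then show "ennreal (norm (\<bar>h n x\<bar> powr b)) \<le> ennreal (norm (2 powr b * \<bar>f x\<bar> powr b))"
        by (intro ennreal_leI) (simp add: powr_mult)
    qed
    also have "\<dots> < \<infinity>" using integrable_mult_right[OF fin, of "2 powr b"] by (simp only: integrable_iff_bounded)
    finally have fin: "(\<integral>\<^sup>+x. norm (\<bar>h n x\<bar> powr b) \<partial>m) < \<infinity>" .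
    have "simple_function m (\<lambda>x. \<bar>h n x\<bar> powr b)" by (rule simple_function_compose1[OF h(1)])
    then have "simple_function m (\<lambda>x. ennreal (norm (\<bar>h n x\<bar> powr b)))" by (rule simple_function_compose1)
    from simple_function_finite_support[OF this fin] have "emeasure m {x\<in>space m. h n x \<noteq> 0} \<noteq> \<infinity>" by simp
    moreover have "{x\<in>space m. h n x \<noteq> 0} \<in> sets m"
      using borel_measurable_simple_function[OF h(1), of n] by measurable
    ultimately show ?thesis using h(1) by (simp add: rr_simple_def fmeasurable_def less_top)
  qed
  then show ?thesis using that h(2) le by blast
qed

locale stable_random_measure = levy_random_measure M m "stable_cumulant b cp cm" K
  for M :: "'w measure" and m :: "'a measure" and b cp cm :: real and K +
  assumes b: "1 < b" "b < 2" and c: "0 < cp + cm"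
begin

abbreviation "\<kappa> \<equiv> stable_cumulant b cp cm"

lemma Re_omega_pos: "0 < Re (stable_omega 1 b cp cm)" by (rule Re_stable_omega_pos[OF b c])

sublocale infdiv_functional M m "stable_cumulant b cp cm" "simple_integral_basis m K (space m)"
proof
  have k0: "stable_cumulant b cp cm 0 = 0" by (simp add: stable_cumulant_def)
  then show "stable_cumulant b cp cm 0 = 0" .
  show "simple_integral_basis m K (space m) h \<in> borel_measurable M" if "rr_simple m h" for h
    using that by (rule simple_integral_measurable[OF _ sets.top])
  show "AE \<omega> in M. simple_integral_basis m K (space m) (\<lambda>x. r * h x + q * g x) \<omega> =
      r * simple_integral_basis m K (space m) h \<omega> + q * simple_integral_basis m K (space m) g \<omega>"
    if "rr_simple m h" "rr_simple m g" for h g r q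
    using that by (rule simple_integral_linear[OF _ _ sets.top])
  show "(CLINT \<omega>|M. iexp (simple_integral_basis m K (space m) h \<omega>)) = exp (CLINT x|m. \<kappa> (h x))"
    if "rr_simple m h" for h using that k0 by (rule simple_integral_char)
  show "continuous_on UNIV \<kappa>" using b by (intro stable_cumulant_cont) simp
  show "Re (\<kappa> y) \<le> 0" for y using Re_omega_pos by (simp add: Re_stable_cumulant)
  show "Re (\<kappa> (- y)) = Re (\<kappa> y)" for y by (simp add: Re_stable_cumulant)
  show "\<exists>D. \<forall>x y. - Re (\<kappa> (x + y)) \<le> D * (- Re (\<kappa> x) - Re (\<kappa> y))"
  proof (intro exI allI)
    fix x y
    have "\<bar>x + y\<bar> powr b * Re (stable_omega 1 b cp cm) \<le> 2 powr b * (\<bar>x\<bar> powr b + \<bar>y\<bar> powr b) * Re (stable_omega 1 b cp cm)"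
      using Re_omega_pos b by (intro mult_right_mono abs_add_powr_le) auto
    then show "- Re (\<kappa> (x + y)) \<le> 2 powr b * (- Re (\<kappa> x) - Re (\<kappa> y))"
      by (simp add: Re_stable_cumulant algebra_simps)
  qed
qed

lemma stable_sector: obtains C where "\<And>y. norm (\<kappa> y) \<le> C * \<psi> y"
proof -
  obtain C where C: "0 \<le> C" "\<And>y. norm (\<kappa> y) \<le> C * \<bar>y\<bar> powr b" using norm_stable_cumulant_le[of b cp cm] by blast
  have "norm (\<kappa> y) \<le> C / Re (stable_omega 1 b cp cm) * \<psi> y" for y
    using C(2)[of y] Re_omega_pos by (simp add: \<psi>_def Re_stable_cumulant)
  then show ?thesis by (rule that)
qed

text \<open>Differences of two approximants are at most \<open>4 * \<bar>f\<bar>\<close>, so their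
  exponents tend to 0 by dominated convergence. The indicator of \<open>A\<close> only decreases
  them, which gives the limit over every measurable set from the same sequence.\<close>

lemma rr_integrable_powr:
  assumes f[measurable]: "f \<in> borel_measurable m" and fin: "integrable m (\<lambda>x. \<bar>f x\<bar> powr b)"
  shows "rr_integrable M m K f"
proof -
  have b0: "0 < b" using b by simp
  obtain h where h: "\<And>n. rr_simple m (h n)" "\<And>x. x \<in> space m \<Longrightarrow> (\<lambda>n. h n x) \<longlonglongrightarrow> f x"
    "\<And>n x. x \<in> space m \<Longrightarrow> \<bar>h n x\<bar> \<le> 2 * \<bar>f x\<bar>"
    using rr_simple_sequence_powr[OF f b0 fin] by blast
  obtain C where C: "0 \<le> C" "\<And>y. norm (\<kappa> y) \<le> C * \<bar>y\<bar> powr b" using norm_stable_cumulant_le[of b cp cm] by blast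
  have hm[measurable]: "h n \<in> borel_measurable m" for n by (rule rr_simpleD(2)[OF h(1)])
  have conv: "\<exists>V\<in>borel_measurable M. conv_in_prob M (\<lambda>n. simple_integral_basis m K A (h n)) V" if A[measurable]: "A \<in> sets m" for A
  proof -
    let ?g = "\<lambda>n x. indicator A x * h n x"
    have g: "rr_simple m (?g n)" for n
    proof -
      have s: "simple_function m (indicator A :: 'a \<Rightarrow> real)" using A by (rule simple_function_indicator)
      have "simple_function m (?g n)" using s h(1)[of n] by (auto simp: rr_simple_def)
      moreover have "{x\<in>space m. ?g n x \<noteq> 0} \<in> fmeasurable m"
        by (rule fmeasurableI2[OF rr_simpleD(3)[OF h(1)[of n]]]) (auto, measurable)
      ultimately show ?thesis by (simp add: rr_simple_def)
    qed
    obtain V where V: "V \<in> borel_measurable M" "conv_in_prob M (\<lambda>n. simple_integral_basis m K (space m) (?g n)) V"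
    proof (rule S_Cauchy_conv[OF g])
      fix z :: real and r s :: "nat \<Rightarrow> nat"
      assume r: "filterlim r at_top sequentially" and s: "filterlim s at_top sequentially"
      let ?d = "\<lambda>k x. z * (?g (r k) x - ?g (s k) x)"
      let ?w = "\<lambda>x. C * ((4 * \<bar>z\<bar>) powr b * \<bar>f x\<bar> powr b)"
      have "(\<lambda>k. \<integral>x. \<kappa> (?d k x) \<partial>m) \<longlonglongrightarrow> (\<integral>x. 0 \<partial>m)"
      proof (rule integral_dominated_convergence[where w = ?w])
        show "integrable m ?w" using fin by (intro integrable_mult_right)
        show "AE x in m. (\<lambda>k. \<kappa> (?d k x)) \<longlonglongrightarrow> 0"
        proof (rule AE_I2)
          fix x assume x: "x \<in> space m"
          have "(\<lambda>k. ?d k x) \<longlonglongrightarrow> z * (indicator A x * f x - indicator A x * f x)"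
            by (intro tendsto_intros filterlim_compose[OF h(2)[OF x] r] filterlim_compose[OF h(2)[OF x] s])
          then have "(\<lambda>k. \<kappa> (?d k x)) \<longlonglongrightarrow> \<kappa> 0"
            using \<kappa>_cont by (intro isCont_tendsto_compose[of _ \<kappa>]) (auto simp: continuous_on_eq_continuous_at)
          then show "(\<lambda>k. \<kappa> (?d k x)) \<longlonglongrightarrow> 0" by (simp only: \<kappa>_0)
        qed
        show "AE x in m. norm (\<kappa> (?d k x)) \<le> ?w x" for k
        proof (rule AE_I2)
          fix x assume x: "x \<in> space m"
          have "\<bar>?g (r k) x - ?g (s k) x\<bar> \<le> 4 * \<bar>f x\<bar>"
            using h(3)[OF x, of "r k"] h(3)[OF x, of "s k"] by (auto simp: indicator_def)
          then have "\<bar>?d k x\<bar> \<le> 4 * \<bar>z\<bar> * \<bar>f x\<bar>" using mult_left_mono[of _ _ "\<bar>z\<bar>"] by (fastforce simp: abs_mult mult_ac)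
          then have "\<bar>?d k x\<bar> powr b \<le> (4 * \<bar>z\<bar> * \<bar>f x\<bar>) powr b" using b by (intro powr_mono2) auto
          also have "\<dots> = (4 * \<bar>z\<bar>) powr b * \<bar>f x\<bar> powr b" by (rule powr_mult)
          finally show "norm (\<kappa> (?d k x)) \<le> ?w x"
            using C(1) by (intro order_trans[OF C(2)] mult_left_mono) auto
        qed
      qed measurable
      then show "(\<lambda>k. \<integral>x. \<kappa> (?d k x) \<partial>m) \<longlonglongrightarrow> 0" by simp
    qed (rule that)
    have "conv_in_prob M (\<lambda>n. simple_integral_basis m K A (h n)) V"
      by (rule conv_in_prob_AE_cong_seq[OF _ _ V(1) V(2)])
        (intro simple_integral_measurable g h(1) sets.top A simple_integral_restrict)+
    then show ?thesis using V(1) by blast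
  qed
  obtain Y where "Y \<in> borel_measurable M" "conv_in_prob M (\<lambda>n. simple_integral_basis m K (space m) (h n)) Y"
    using conv[OF sets.top] by blast
  then have "has_rr_integral M m K f Y"
    unfolding has_rr_integral_def using h(1,2) conv f by (intro conjI exI[of _ h]) auto
  then show ?thesis by (auto simp: rr_integrable_def)
qed

lemma joint_char_rr_integral:
  assumes I: "finite I" "I \<noteq> {}" and f: "\<And>i. i \<in> I \<Longrightarrow> has_rr_integral M m K (f i) (Y i)"
  shows "(CLINT \<omega>|M. iexp (\<Sum>i\<in>I. z i * Y i \<omega>)) = exp (\<integral>x. \<kappa> (\<Sum>i\<in>I. z i * f i x) \<partial>m)"
proof -
  obtain C where C: "\<And>y. norm (\<kappa> y) \<le> C * \<psi> y" using stable_sector by blast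
  have "wk_integral (f i) (Y i)" if "i \<in> I" for i
    using f[OF that] unfolding has_rr_integral_def wk_integral_def wk_approx_def by auto
  then show ?thesis by (intro wk_integral_char(2)[OF wk_integral_sum[OF I] C])
qed

end

lemma borel_measurable_vec_lambda:
  assumes "\<And>j. (\<lambda>x. f x j) \<in> borel_measurable M"
  shows "(\<lambda>x. (\<chi> j. f x j) :: real^'n::finite) \<in> borel_measurable M"
proof (rule borel_measurable_euclidean_space[THEN iffD2], rule ballI)
  fix i :: "real^'n" assume "i \<in> Basis"
  then obtain j where "i = axis j 1" by (auto simp: Basis_vec_def)
  then show "(\<lambda>x. (\<chi> j. f x j) \<bullet> i) \<in> borel_measurable M" using assms by (simp add: inner_axis)
qed

text \<open>By \<open>0 < \<alpha>\<close> and \<open>1 + \<alpha> < \<beta>\<close> the exponent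
  \<open>\<alpha> - \<beta>\<close> lies strictly between \<open>- \<beta>\<close> and -1, the range
  of \<open>nn_integral_envelope\<close>.\<close>

lemma Z_kernel_integrable_powr:
  assumes s: "0 \<le> s" and b: "1 + \<alpha> < \<beta>" "\<beta> < 2" and \<alpha>: "0 < \<alpha>"
  shows "integrable (Z_control \<alpha> \<beta>) (\<lambda>q. \<bar>Z_kernel s q\<bar> powr \<beta>)"
proof -
  let ?Q = "lborel_pos \<Otimes>\<^sub>M lborel :: (real \<times> real) measure"
  have b0: "0 < \<beta>" using b \<alpha> by simp
  have "integrable ?Q (\<lambda>q. (\<alpha> * fst q powr (\<alpha> - \<beta>)) *\<^sub>R \<bar>Z_kernel s q\<bar> powr \<beta>)"
  proof (rule integrableI_bounded)
    have "(\<integral>\<^sup>+q. ennreal (norm ((\<alpha> * fst q powr (\<alpha> - \<beta>)) *\<^sub>R \<bar>Z_kernel s q\<bar> powr \<beta>)) \<partial>?Q)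
      \<le> (\<integral>\<^sup>+q. ennreal \<alpha> * ennreal (fst q powr (\<alpha> - \<beta>) * Z_envelope s q powr \<beta>) \<partial>?Q)"
    proof (rule nn_integral_mono)
      fix q assume "q \<in> space ?Q"
      then have "0 < fst q" by (auto simp: space_pair_measure space_restrict_space)
      then have "\<bar>Z_kernel s q\<bar> \<le> Z_envelope s q"
        using Z_kernel_le_envelope[of "fst q" s "snd q"] s by simp
      then have "\<bar>Z_kernel s q\<bar> powr \<beta> \<le> Z_envelope s q powr \<beta>" using b0 by (intro powr_mono2) auto
      then have "norm ((\<alpha> * fst q powr (\<alpha> - \<beta>)) *\<^sub>R \<bar>Z_kernel s q\<bar> powr \<beta>) \<le> \<alpha> * (fst q powr (\<alpha> - \<beta>) * Z_envelope s q powr \<beta>)"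
        using \<alpha> by (simp add: abs_mult mult.assoc mult_left_mono)
      then show "ennreal (norm ((\<alpha> * fst q powr (\<alpha> - \<beta>)) *\<^sub>R \<bar>Z_kernel s q\<bar> powr \<beta>)) \<le> ennreal \<alpha> * ennreal (fst q powr (\<alpha> - \<beta>) * Z_envelope s q powr \<beta>)"
        using \<alpha> by (subst ennreal_mult[symmetric]) (auto intro: ennreal_leI)
    qed
    also have "\<dots> = ennreal \<alpha> * (\<integral>\<^sup>+q. ennreal (fst q powr (\<alpha> - \<beta>) * Z_envelope s q powr \<beta>) \<partial>?Q)"
      by (rule nn_integral_cmult) measurable
    also have "\<dots> < \<infinity>"
      using nn_integral_envelope[OF s b0 b(2), of "\<alpha> - \<beta>"] \<alpha> b by (simp add: ennreal_mult_less_top)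
    finally show "(\<integral>\<^sup>+q. ennreal (norm ((\<alpha> * fst q powr (\<alpha> - \<beta>)) *\<^sub>R \<bar>Z_kernel s q\<bar> powr \<beta>)) \<partial>?Q) < \<infinity>" .
  qed measurable
  then show ?thesis
    unfolding Z_control_eq by (subst integrable_density) (use \<alpha> in \<open>auto intro!: borel_measurable_times\<close>)
qed

text \<open>The first conjunct provides the integrals defining Z, so that the second, which speaks
  of all versions Z, is not vacuous. X and K live on separate probability spaces, since only laws
  are compared.\<close>

theorem theorem3p3:
  fixes M :: "'w measure" and N :: "'v measure"
    and X :: "real \<Rightarrow> 'w \<Rightarrow> real"
    and \<mu> \<pi> :: "real measure"
    and p l :: "real \<Rightarrow> real"
    and a b \<alpha> \<beta> cp cm :: real
    and K :: "(real \<times> real) set \<Rightarrow> 'v \<Rightarrow> real"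
    and t :: "'n::finite \<Rightarrow> real"
  assumes supOU: "supOU_process M a b \<mu> \<pi> X"
    and measurable_process: "(\<lambda>(s, \<omega>). X s \<omega>) \<in> borel_measurable (borel \<Otimes>\<^sub>M M)"
    and finite_variance: "\<And>s. integrable M (\<lambda>\<omega>. (X s \<omega>)\<^sup>2)"
    and zero_mean: "\<And>s. (\<integral>\<omega>. X s \<omega> \<partial>M) = 0"
    and p_measurable: "p \<in> borel_measurable borel_pos"
    and p_nonneg: "\<And>x. x > 0 \<Longrightarrow> p x \<ge> 0"
    and pi_density: "\<pi> = density lborel_pos (\<lambda>x. ennreal (p x))"
    and alpha: "0 < \<alpha>" "\<alpha> < 1"
    and slow: "slowly_varying l"
    and p_asymp: "p \<sim>[at_right 0] (\<lambda>x. \<alpha> * l (1 / x) * x powr (\<alpha> - 1))"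
    and coeffs: "\<beta> > 0" "cp \<ge> 0" "cm \<ge> 0" "cp + cm > 0"
    and tail_pos: "power_asymp_at_0 (\<lambda>x. measure \<mu> {x..}) cp \<beta>"
    and tail_neg: "power_asymp_at_0 (\<lambda>x. measure \<mu> {..-x}) cm \<beta>"
    and no_gaussian: "b = 0"
    and beta: "1 + \<alpha> < \<beta>" "\<beta> < 2"
    and K: "levy_basis N (Z_control \<alpha> \<beta>) (stable_cumulant \<beta> cp cm) K"
    and times: "\<And>j. t j \<ge> 0"
  shows "(\<forall>s\<ge>0. rr_integrable N (Z_control \<alpha> \<beta>) K (Z_kernel s)) \<and>
    (\<forall>Z. (\<forall>s\<ge>0. has_rr_integral N (Z_control \<alpha> \<beta>) K (Z_kernel s) (Z s)) \<longrightarrow>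
      weak_conv_along
        (\<lambda>T::real. distr M borel (\<lambda>\<omega>. \<chi> j.
           1 / (T powr (1 - \<alpha> / \<beta>) * l T powr (1 / \<beta>)) * integrated_process X (T * t j) \<omega>))
        (distr N borel (\<lambda>\<omega>. \<chi> j. Z (t j) \<omega>))
        at_top)"
proof -
  \<comment> \<open>The density is given on the positive half-line only; the extension by 0 is
    measurable and nonnegative everywhere.\<close>
  define p' where "p' x = (if 0 < x then p x else 0)" for x
  have X: "levy_measure \<mu>" "prob_space \<pi>" "sets \<pi> = sets borel_pos"
    using supOU by (auto simp: supOU_process_def levy_triplet_def)
  obtain \<Lambda> where \<Lambda>: "levy_basis M (\<pi> \<Otimes>\<^sub>M lborel) (levy_cumulant a 0 \<mu>) \<Lambda>"
    "\<And>t. has_rr_integral M (\<pi> \<Otimes>\<^sub>M lborel) \<Lambda> (supOU_kernel t) (X t)"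
    using supOU no_gaussian by (auto simp: supOU_process_def)
  have b1: "1 < \<beta>" using alpha beta by simp
  interpret pi: prob_space \<pi> by (rule X)
  interpret M: prob_space M using \<Lambda>(1) by (simp add: levy_basis_def)
  interpret N: prob_space N using K by (simp add: levy_basis_def)
  interpret S: supOU_stable M a \<mu> \<pi> \<Lambda> X \<beta> cp cm
    by unfold_locales (rule X \<Lambda> measurable_process finite_variance zero_mean b1 beta coeffs tail_pos tail_neg)+
  interpret Z: stable_random_measure N "Z_control \<alpha> \<beta>" \<beta> cp cm K
    by unfold_locales (rule K b1 beta coeffs)+
  have p'm: "p' \<in> borel_measurable borel"
  proof -
    have "(\<lambda>x. indicator {0<..} x *\<^sub>R p x) \<in> borel_measurable borel"
      by (rule borel_measurable_restrict_space_iff[THEN iffD1, OF _ p_measurable]) simp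
    moreover have "p' = (\<lambda>x. indicator {0<..} x *\<^sub>R p x)" by (auto simp: p'_def indicator_def)
    ultimately show ?thesis by simp
  qed
  have pi': "\<pi> = density lborel_pos (\<lambda>x. ennreal (p' x))"
    unfolding pi_density by (rule density_cong) (use p_measurable p'm in \<open>auto simp: p'_def space_restrict_space intro!: AE_I2 measurable_restrict_space1\<close>)
  have pa': "p' \<sim>[at_right 0] (\<lambda>x. \<alpha> * l (1 / x) * x powr (\<alpha> - 1))"
  proof (rule asymp_equiv_transfer[OF p_asymp])
    show "\<forall>\<^sub>F x in at_right 0. p x = p' x" by (auto simp: p'_def eventually_at_right_field intro!: exI[of _ 1])
  qed simp
  interpret Lim: supOU_limit \<pi> \<mu> \<beta> cp cm p' l \<alpha>
  proof unfold_locales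
    show "0 \<le> p' x" for x using p_nonneg by (simp add: p'_def)
  qed (rule p'm pi' pa' slow alpha beta)+
  have int: "rr_integrable N (Z_control \<alpha> \<beta>) K (Z_kernel s)" if "0 \<le> s" for s
    by (rule Z.rr_integrable_powr) (use Z_kernel_integrable_powr[OF that beta alpha(1)] in \<open>simp_all add: Z_control_eq\<close>)
  have conv: "weak_conv_along
        (\<lambda>T::real. distr M borel (\<lambda>\<omega>. \<chi> j.
           1 / (T powr (1 - \<alpha> / \<beta>) * l T powr (1 / \<beta>)) * integrated_process X (T * t j) \<omega>))
        (distr N borel (\<lambda>\<omega>. \<chi> j. Z (t j) \<omega>)) at_top"
    if Zs: "\<forall>s\<ge>0. has_rr_integral N (Z_control \<alpha> \<beta>) K (Z_kernel s) (Z s)" for Z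
    unfolding weak_conv_along_def
  \<comment> \<open>The limit over real \<open>T\<close> is tested along sequences, as the
    continuity theorem is stated for sequences of laws.\<close>
  proof (intro allI impI tendsto_at_topI_sequentially)
    fix g :: "real^'n \<Rightarrow> real" and T :: "nat \<Rightarrow> real"
    assume g: "continuous_on UNIV g" "bounded (range g)" and T: "filterlim T at_top sequentially"
    let ?V = "\<lambda>T \<omega>. \<chi> j. 1 / (T powr (1 - \<alpha> / \<beta>) * l T powr (1 / \<beta>)) * integrated_process X (T * t j) \<omega>"
    let ?W = "\<lambda>\<omega>. \<chi> j. Z (t j) \<omega>"
    have Zm[measurable]: "Z (t j) \<in> borel_measurable N" for j using Zs times by (auto simp: has_rr_integral_def)
    have V[measurable]: "?V r \<in> borel_measurable M" for r by (rule borel_measurable_vec_lambda) simp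
    have W[measurable]: "?W \<in> borel_measurable N" by (rule borel_measurable_vec_lambda) simp
    show "(\<lambda>n. \<integral>x. g x \<partial>distr M borel (?V (T n))) \<longlonglongrightarrow> (\<integral>x. g x \<partial>distr N borel ?W)"
    proof (rule levy_continuity_cart[OF _ _ _ _ _ g])
      show "prob_space (distr M borel (?V (T n)))" for n by (rule M.prob_space_distr[OF V])
      show "prob_space (distr N borel ?W)" by (rule N.prob_space_distr[OF W])
      fix z :: "real^'n"
      have dot: "(\<lambda>x. iexp (z \<bullet> x)) \<in> borel_measurable borel" by measurable
      have W_char: "(CLINT x|distr N borel ?W. iexp (z \<bullet> x)) = exp (\<integral>q. stable_cumulant \<beta> cp cm (\<Sum>j\<in>UNIV. z $ j * Z_kernel (t j) q) \<partial>Z_control \<alpha> \<beta>)"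
      proof -
        have "(CLINT x|distr N borel ?W. iexp (z \<bullet> x)) = (CLINT \<omega>|N. iexp (\<Sum>j\<in>UNIV. z $ j * Z (t j) \<omega>))"
          by (subst integral_distr[OF W dot]) (simp add: inner_vec_def)
        also have "\<dots> = exp (\<integral>q. stable_cumulant \<beta> cp cm (\<Sum>j\<in>UNIV. z $ j * Z_kernel (t j) q) \<partial>Z_control \<alpha> \<beta>)"
          by (rule Z.joint_char_rr_integral) (use Zs times in auto)
        finally show ?thesis .
      qed
      have V_char: "(CLINT x|distr M borel (?V r). iexp (z \<bullet> x)) = exp (\<integral>q. centered_cumulant \<mu> (\<Sum>j\<in>UNIV. z $ j / Lim.norming r * S.kernel_integral (r * t j) q) \<partial>(\<pi> \<Otimes>\<^sub>M lborel))"
        if r: "0 \<le> r" for r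
      proof -
        have "(CLINT x|distr M borel (?V r). iexp (z \<bullet> x)) = (CLINT \<omega>|M. iexp (\<Sum>j\<in>UNIV. z $ j / Lim.norming r * integrated_process X (r * t j) \<omega>))"
          by (subst integral_distr[OF V dot]) (simp add: inner_vec_def Lim.norming_def)
        also have "\<dots> = exp (\<integral>q. centered_cumulant \<mu> (\<Sum>j\<in>UNIV. z $ j / Lim.norming r * S.kernel_integral (r * t j) q) \<partial>(\<pi> \<Otimes>\<^sub>M lborel))"
          by (rule S.joint_char_integrated) (use r times in auto)
        finally show ?thesis .
      qed
      have "((\<lambda>r. \<integral>q. centered_cumulant \<mu> (\<Sum>j\<in>UNIV. z $ j / Lim.norming r * S.kernel_integral (r * t j) q) \<partial>(\<pi> \<Otimes>\<^sub>M lborel)) \<longlongrightarrow> (\<integral>q. stable_cumulant \<beta> cp cm (\<Sum>j\<in>UNIV. z $ j * Z_kernel (t j) q) \<partial>Z_control \<alpha> \<beta>)) at_top"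
        by (rule Lim.cumulant_integral_tendsto) (use times in auto)
      then have "((\<lambda>r. exp (\<integral>q. centered_cumulant \<mu> (\<Sum>j\<in>UNIV. z $ j / Lim.norming r * S.kernel_integral (r * t j) q) \<partial>(\<pi> \<Otimes>\<^sub>M lborel))) \<longlongrightarrow> (CLINT x|distr N borel ?W. iexp (z \<bullet> x))) at_top"
        unfolding W_char by (rule tendsto_exp)
      then have "((\<lambda>r. CLINT x|distr M borel (?V r). iexp (z \<bullet> x)) \<longlongrightarrow> (CLINT x|distr N borel ?W. iexp (z \<bullet> x))) at_top"
        by (rule Lim_transform_eventually) (rule eventually_mono[OF eventually_ge_at_top[of 0] V_char[symmetric]])
      then show "(\<lambda>n. CLINT x|distr M borel (?V (T n)). iexp (z \<bullet> x)) \<longlonglongrightarrow> (CLINT x|distr N borel ?W. iexp (z \<bullet> x))"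
        by (rule filterlim_compose[OF _ T])
    qed simp_all
  qed
  show ?thesis using int conv by blast
qed

end
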